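(* Let $r=8$. There exists $\delta>0$ such that if $(\Omega_\tau)_{|\tau|\le1}$ is a normalized, dynamically isospectral $C^1$ one-parameter family of domains in $\mathcal S^r_\delta$, then $(\Omega_\tau)$ is a constant family, i.e. $\Omega_\tau=\Omega_0$ for all $|\tau|\le1$.
   Context: For an integer $r\ge2$, $\mathcal D^r$ denotes the set of strictly convex bounded open planar domains with $C^{r+1}$ boundary oriented counterclockwise. A closed geodesic of $\Omega$ is a closed polygon inscribed in $\partial\Omega$ such that at each vertex the two sides meeting there make equal angles with the tangent line to $\partial\Omega$; its length is its perimeter. $\mathcal L(\Omega)=\mathbb N\cdot\{\text{lengths of closed geodesics}\}\cup\mathbb N\cdot\{|\partial\Omega|\}$. A $C^1$ one-parameter family of domains in $\mathcal M\subset\mathcal D^r$ is $(\Omega_\tau)_{|\tau|\le1}\subset\mathcal M$ with a map $\gamma:[-1,1]\times\mathbb T^1\to\mathbb R^2$, continuously differentiable in $\tau$, with each $\gamma(\tau,\cdot)$ a $C^{r+1}$ diffeomorphism of $\mathbb T^1=\mathbb R/\mathbb Z$ onto $\partial\Omega_\tau$; it is dynamically isospectral if $\mathcal L(\Omega_\tau)$ is independent of $\tau$. $\mathcal S^r$ is the set of domains in $\mathcal D^r$ invariant under some reflection of the plane. A perimeter-$1$ domain with arc-length parameterization $\gamma$ is $\delta$-close to a circle if $\|\gamma-\gamma_{\mathbb D}\|_{C^{r+1}}\le\delta$ with $\gamma_{\mathbb D}$ the arc-length parameterization of a perimeter-$1$ disk tangent to $\partial\Omega$ at $s=0$; in general,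 a domain is $\delta$-close to a circle if its rescaling to perimeter $1$ is; $\mathcal S^r_\delta$ denotes those domains of $\mathcal S^r$ that are $\delta$-close to a circle. For $\Omega\in\mathcal S^r$ one fixes a symmetry axis; it meets $\partial\Omega$ in two points, one chosen as the marked point and the other as the auxiliary point; in a family these choices are made for $\Omega_0$ and continued by continuity, and the parameterization satisfies that $\gamma(\tau,0)$ is the marked point of $\Omega_\tau$. $\Omega$ is normalized if its marked point is the origin and its auxiliary point lies on the positive horizontal semi-axis; a family is normalized if every $\Omega_\tau$ is. *)

theory Defs
  imports "HOL-Analysis.Analysis"
begin

text \<open>The plane is modelled as real^2; the circle T^1 = R/Z via 1-periodic functions on R.\<close>

definition rot90 :: "real^2 \<Rightarrow> real^2" where
  "rot90 v = vector [-(v$2), v$1]"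

definition Ck :: "nat \<Rightarrow> (real \<Rightarrow> 'a::real_normed_vector) \<Rightarrow> bool" where
  "Ck k f \<longleftrightarrow> (\<exists>D. D 0 = f \<and>
      (\<forall>i<k. \<forall>t. (D i has_vector_derivative D (Suc i) t) (at t)) \<and>
      continuous_on UNIV (D k))"

text \<open>gamma is a C^k diffeomorphism of T^1 onto the boundary of Omega (regular, 1-periodic,
  injective on one period, image the boundary).\<close>
definition boundary_param :: "nat \<Rightarrow> (real^2) set \<Rightarrow> (real \<Rightarrow> real^2) \<Rightarrow> bool" where
  "boundary_param k \<Omega> \<gamma> \<longleftrightarrow>
     (\<forall>s. \<gamma> (s + 1) = \<gamma> s) \<and> Ck k \<gamma> \<and>
     (\<forall>s. vector_derivative \<gamma> (at s) \<noteq> 0) \<and>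
     inj_on \<gamma> {0..<1} \<and> \<gamma> ` {0..<1} = frontier \<Omega>"

definition strictly_convex :: "(real^2) set \<Rightarrow> bool" where
  "strictly_convex \<Omega> \<longleftrightarrow> convex \<Omega> \<and>
     (\<forall>x\<in>closure \<Omega>. \<forall>y\<in>closure \<Omega>. x \<noteq> y \<longrightarrow> open_segment x y \<subseteq> \<Omega>)"

definition domain_D :: "nat \<Rightarrow> (real^2) set \<Rightarrow> bool" where
  "domain_D r \<Omega> \<longleftrightarrow> bounded \<Omega> \<and> open \<Omega> \<and> strictly_convex \<Omega> \<and>
     (\<exists>\<gamma>. boundary_param (r + 1) \<Omega> \<gamma>)"

definition line_reflection :: "real^2 \<Rightarrow> real^2 \<Rightarrow> real^2 \<Rightarrow> real^2" where
  "line_reflection a u x = x - (2 * ((x - a) \<bullet> u)) *\<^sub>R u"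

definition domain_S :: "nat \<Rightarrow> (real^2) set \<Rightarrow> bool" where
  "domain_S r \<Omega> \<longleftrightarrow> domain_D r \<Omega> \<and>
     (\<exists>a u. norm u = 1 \<and> line_reflection a u ` \<Omega> = \<Omega>)"

definition tangent_at :: "(real^2) set \<Rightarrow> real^2 \<Rightarrow> real^2 \<Rightarrow> bool" where
  "tangent_at \<Omega> x v \<longleftrightarrow> (\<exists>\<gamma> s. boundary_param 1 \<Omega> \<gamma> \<and> \<gamma> s = x \<and>
       (\<gamma> has_vector_derivative v) (at s))"

definition closed_geodesic :: "(real^2) set \<Rightarrow> nat \<Rightarrow> (int \<Rightarrow> real^2) \<Rightarrow> bool" where
  "closed_geodesic \<Omega> q p \<longleftrightarrow> q \<ge> 2 \<and>
     (\<forall>i. p (i + int q) = p i) \<and> (\<forall>i. p i \<in> frontier \<Omega>) \<and> (\<forall>i. p (i + 1) \<noteq> p i) \<and>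
     (\<forall>i. \<exists>v. tangent_at \<Omega> (p i) v \<and>
        ((1 / norm (p i - p (i - 1))) *\<^sub>R (p i - p (i - 1))) \<bullet> v =
        ((1 / norm (p (i + 1) - p i)) *\<^sub>R (p (i + 1) - p i)) \<bullet> v)"

definition geod_length :: "nat \<Rightarrow> (int \<Rightarrow> real^2) \<Rightarrow> real" where
  "geod_length q p = (\<Sum>i\<in>{0..<int q}. dist (p i) (p (i + 1)))"

text \<open>Perimeter |\<partial>\<Omega>| (independent of the regular parameterization).\<close>
definition perimeter :: "(real^2) set \<Rightarrow> real" where
  "perimeter \<Omega> = (THE L. \<exists>\<gamma>. boundary_param 1 \<Omega> \<gamma> \<and>
      L = integral {0..1} (\<lambda>s. norm (vector_derivative \<gamma> (at s))))"

definition length_spectrum :: "(real^2) set \<Rightarrow> real set" where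
  "length_spectrum \<Omega> =
     {real n * l | n l. n \<ge> 1 \<and> (\<exists>q p. closed_geodesic \<Omega> q p \<and> l = geod_length q p)}
     \<union> {real n * perimeter \<Omega> | n. n \<ge> 1}"

definition ccw_param :: "(real^2) set \<Rightarrow> (real \<Rightarrow> real^2) \<Rightarrow> bool" where
  "ccw_param \<Omega> \<gamma> \<longleftrightarrow> (\<forall>s. \<forall>\<^sub>F e in at_right 0.
      \<gamma> s + e *\<^sub>R rot90 (vector_derivative \<gamma> (at s)) \<in> \<Omega>)"

text \<open>Arc-length parameterization of the perimeter-1 circle through x0 with unit tangent T
  at s = 0, lying to the left of T.\<close>
definition circle_param :: "real^2 \<Rightarrow> real^2 \<Rightarrow> real \<Rightarrow> real^2" where
  "circle_param x0 T s = x0 + (1 / (2 * pi)) *\<^sub>R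
      (sin (2 * pi * s) *\<^sub>R T + (1 - cos (2 * pi * s)) *\<^sub>R rot90 T)"

definition Ck_dist_le :: "nat \<Rightarrow> (real \<Rightarrow> real^2) \<Rightarrow> (real \<Rightarrow> real^2) \<Rightarrow> real \<Rightarrow> bool" where
  "Ck_dist_le k f g \<delta> \<longleftrightarrow> (\<exists>D E. D 0 = f \<and> E 0 = g \<and>
      (\<forall>i<k. \<forall>t. (D i has_vector_derivative D (Suc i) t) (at t) \<and>
                 (E i has_vector_derivative E (Suc i) t) (at t)) \<and>
      (\<forall>i\<le>k. \<forall>t. norm (D i t - E i t) \<le> \<delta>))"

definition close_to_circle :: "nat \<Rightarrow> real \<Rightarrow> (real^2) set \<Rightarrow> bool" where
  "close_to_circle r \<delta> \<Omega> \<longleftrightarrow>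
     (let \<Omega>1 = (\<lambda>x. (1 / perimeter \<Omega>) *\<^sub>R x) ` \<Omega> in
      \<exists>\<gamma>. boundary_param (r + 1) \<Omega>1 \<gamma> \<and> ccw_param \<Omega>1 \<gamma> \<and>
          (\<forall>s. norm (vector_derivative \<gamma> (at s)) = 1) \<and>
          Ck_dist_le (r + 1) \<gamma> (circle_param (\<gamma> 0) (vector_derivative \<gamma> (at 0))) \<delta>)"

definition domain_S_delta :: "nat \<Rightarrow> real \<Rightarrow> (real^2) set \<Rightarrow> bool" where
  "domain_S_delta r \<delta> \<Omega> \<longleftrightarrow> domain_S r \<Omega> \<and> close_to_circle r \<delta> \<Omega>"

definition symmetry_axis_points :: "(real^2) set \<Rightarrow> real^2 \<Rightarrow> real^2 \<Rightarrow> bool" where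
  "symmetry_axis_points \<Omega> m a \<longleftrightarrow> m \<noteq> a \<and>
     line_reflection m (rot90 ((1 / norm (a - m)) *\<^sub>R (a - m))) ` \<Omega> = \<Omega> \<and>
     frontier \<Omega> \<inter> {m + t *\<^sub>R (a - m) | t. True} = {m, a}"

definition normalized :: "(real^2) set \<Rightarrow> real^2 \<Rightarrow> real^2 \<Rightarrow> bool" where
  "normalized \<Omega> m a \<longleftrightarrow> symmetry_axis_points \<Omega> m a \<and> m = 0 \<and> a$2 = 0 \<and> a$1 > 0"

definition C1_family :: "nat \<Rightarrow> (real \<Rightarrow> (real^2) set) \<Rightarrow> (real \<Rightarrow> real \<Rightarrow> real^2) \<Rightarrow> bool" where
  "C1_family r \<Omega> \<gamma> \<longleftrightarrow>
     (\<forall>\<tau>\<in>{-1..1}. boundary_param (r + 1) (\<Omega> \<tau>) (\<gamma> \<tau>)) \<and>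
     (\<exists>\<gamma>'. (\<forall>\<tau>\<in>{-1..1}. \<forall>s. ((\<lambda>t. \<gamma> t s) has_vector_derivative \<gamma>' \<tau> s) (at \<tau> within {-1..1})) \<and>
           continuous_on ({-1..1} \<times> UNIV) (\<lambda>(\<tau>, s). \<gamma>' \<tau> s))"

definition normalized_family :: "(real \<Rightarrow> (real^2) set) \<Rightarrow> (real \<Rightarrow> real \<Rightarrow> real^2) \<Rightarrow> bool" where
  "normalized_family \<Omega> \<gamma> \<longleftrightarrow> (\<forall>\<tau>\<in>{-1..1}. \<exists>a. normalized (\<Omega> \<tau>) (\<gamma> \<tau> 0) a)"

definition dyn_isospectral :: "(real \<Rightarrow> (real^2) set) \<Rightarrow> bool" where
  "dyn_isospectral \<Omega> \<longleftrightarrow> (\<forall>\<tau>\<in>{-1..1}. length_spectrum (\<Omega> \<tau>) = length_spectrum (\<Omega> 0))"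

end

theory Submission
  imports Defs
begin

text \<open>
  Parametrise a symmetric boundary by its tangent angle and let \<open>M\<^sub>q\<close> be the largest perimeter of a symmetric
  inscribed \<open>q\<close>-gon with a vertex at the marked point. Maximal polygons are closed geodesics, \<open>M\<^sub>q\<close> is Lipschitz
  along the family, and the set of lengths of closed geodesics is negligible: a closed geodesic is determined by two
  consecutive vertices, in a Lipschitz way, and the length is stationary, so lengths of geodesics at distance \<open>d\<close>
  differ by at most a multiple of \<open>d\<^sup>2\<close>. Hence every \<open>M\<^sub>q\<close> is constant along an isospectral family.

  For two domains of the family let \<open>u\<close> be the difference of their support functions. Convexity of the norm turns
  \<open>M\<^sub>q(\<Omega>\<^sub>0) = M\<^sub>q(\<Omega>\<^sub>1)\<close> into inequalities \<open>T\<^sub>q u \<le> 0 \<le> T'\<^sub>q u\<close>, where \<open>T\<^sub>q u\<close> and \<open>T'\<^sub>q u\<close> are sums of \<open>sin \<phi>\<^sub>k u(\<theta>\<^sub>k)\<close>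
  over the maximal polygons of the two domains. With the density \<open>\<sigma> = \<rho>\<^sup>1\<^sup>/\<^sup>3\<close> (normalised, \<open>\<rho>\<close> the radius of curvature)
  and \<open>X' = \<sigma>\<close> the vertices of the maximal polygon satisfy \<open>X(\<theta>\<^sub>k) = 2\<pi>k/q + O(\<epsilon>/q\<^sup>2)\<close>; so, in terms of the coefficients
  \<open>a\<^sub>j\<close> of \<open>u/\<sigma>\<close> in the system \<open>cos(j X)\<close>, \<open>T\<^sub>q u\<close> is a positive multiple of \<open>a\<^sub>0 + \<Sum>\<^sub>n a\<^sub>n\<^sub>q\<close> up to a small error. Since
  the coefficients \<open>b\<^sub>j\<close> with respect to the second domain differ little from \<open>a\<^sub>j\<close>, the two inequalities give
  \<open>sup j\<^sup>2|a\<^sub>j| \<le> 20 \<Delta>\<close> with \<open>\<Delta> = sup j\<^sup>2|b\<^sub>j - a\<^sub>j|\<close>. Interpolation with the smoothness of \<open>u\<close> bounds \<open>\<Delta>\<close> by a power of \<open>u\<close>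
  with exponent greater than one, hence by \<open>\<Delta>/2\<close> near the circle, and so \<open>u = 0\<close>.
\<close>

section \<open>Images of functions with quadratic increments\<close>

text \<open>The symmetry makes data and unknown match: \<open>u\<close> is even, so it has one
  cosine coefficient for each \<open>q\<close>, and each \<open>q\<close> supplies one length. It
  also makes the constrained maximum a genuine geodesic, because the reflection law at a vertex on
  the axis follows from the symmetry of the polygon. The maximal lengths are never differentiated in
  the family parameter; continuity and a negligible spectrum give constancy, and afterwards two
  fixed domains are compared. The price is that the second inequality lives on the orbits of the
  other domain. The resulting phase error is multiplied by the frequency \<open>j\<close>, so it is
  not small uniformly in \<open>j\<close>. Inside one row it is balanced against the trivial bound
  of a mode. Between the two domains \<open>b j - a j\<close> is bounded twice, by the distance of
  the phases, which is good for small \<open>j\<close>, and by smoothness, which is good for large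
  \<open>j\<close>. A boundary of class C^9 has a radius of curvature with seven derivatives, and
  with these the balance gives the exponent 25/24; the same balance with six would give 20/21, less
  than one.\<close>

text \<open>Divide the square into \<open>M\<^sup>2\<close> subsquares. If all of them meet \<open>P\<close>, chaining through neighbouring subsquares shows
  that the image has diameter \<open>O(l\<^sup>2/M)\<close>; otherwise one subsquare is lost, which is the factor \<open>1 - 1/M\<^sup>2\<close>.\<close>

lemma quadratic_grid_cover:
  fixes f pa pb :: "'a \<Rightarrow> real"
  assumes C: "C \<ge> 0" and M: "M \<ge> (2::nat)"
    and quad: "\<And>x y. x \<in> P \<Longrightarrow> y \<in> P \<Longrightarrow> \<bar>f x - f y\<bar> \<le> C * (\<bar>pa x - pa y\<bar> + \<bar>pb x - pb y\<bar>)\<^sup>2"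
    and l: "l \<ge> 0"
  shows "\<exists>S. f ` {x \<in> P. pa x \<in> {a..a+l} \<and> pb x \<in> {b..b+l}} \<subseteq> S \<and> S \<in> lmeasurable \<and>
            measure lebesgue S \<le> 200 * C * l\<^sup>2 * (1 / real M + (1 - 1 / (real M)\<^sup>2) ^ k)"
  using l
proof (induction k arbitrary: a b l)
  case 0
  let ?Q = "{x \<in> P. pa x \<in> {a..a+l} \<and> pb x \<in> {b..b+l}}"
  show ?case
  proof (cases "?Q = {}")
    case True
    then show ?thesis using C 0 by (intro exI[of _ "{}"]) auto
  next
    case False
    then obtain x where x: "x \<in> ?Q" by blast
    have "f y \<in> {f x - 4 * C * l\<^sup>2 .. f x + 4 * C * l\<^sup>2}" if y: "y \<in> ?Q" for y
    proof -
      have "\<bar>f y - f x\<bar> \<le> C * (\<bar>pa y - pa x\<bar> + \<bar>pb y - pb x\<bar>)\<^sup>2" using quad x y by auto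
      also have "\<dots> \<le> C * (2 * l)\<^sup>2"
        using x y C 0 by (intro mult_left_mono power_mono) auto
      finally show ?thesis by (simp add: power2_eq_square abs_le_iff)
    qed
    then show ?thesis using C M
      by (intro exI[of _ "{f x - 4 * C * l\<^sup>2 .. f x + 4 * C * l\<^sup>2}"])
         (auto simp: field_simps intro!: add_nonneg_nonneg mult_nonneg_nonneg)
  qed
next
  case (Suc k)
  let ?Q = "{x \<in> P. pa x \<in> {a..a+l} \<and> pb x \<in> {b..b+l}}"
  define h where "h = l / real M"
  have hM: "real M * h = l" using M by (simp add: h_def)
  let ?q = "\<lambda>i j. {x \<in> P. pa x \<in> {a + real i * h .. a + real i * h + h} \<and> pb x \<in> {b + real j * h .. b + real j * h + h}}"
  let ?e = "1 / real M + (1 - 1 / (real M)\<^sup>2) ^ k"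
  have M0: "real M > 0" using M by simp
  have h0: "h \<ge> 0" using Suc.prems M0 by (simp add: h_def)
  have e0: "0 \<le> 1 - 1 / (real M)\<^sup>2" using M by (simp add: divide_le_eq_1 one_le_power)
  have idx: "\<exists>i<M. t \<in> {c + real i * h .. c + real i * h + h}" if "t \<in> {c..c+l}" for t c
  \<comment> \<open>The cells are closed, and the right end point has to go into the last one: the
    floor used for the other points would give it the index \<open>M\<close>.\<close>
  proof (cases "t = c + l")
    case True
    have "real (M - 1) * h + h = l" using M hM by (simp add: of_nat_diff algebra_simps)
    then show ?thesis using True h0 M
      by (intro exI[of _ "M - 1"]) auto
  next
    case False
    then have l0: "l > 0" and tl: "t < c + l" "t \<ge> c" using that by auto
    have h1: "h > 0" using l0 M0 by (simp add: h_def)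
    define i where "i = nat \<lfloor>(t - c) / h\<rfloor>"
    have fl: "0 \<le> (t - c) / h" using tl h1 by simp
    have i1: "real i \<le> (t - c) / h" "(t-c) / h < real i + 1" unfolding i_def using fl by linarith+
    have "real i * h \<le> t - c" using i1(1) h1 by (simp add: pos_le_divide_eq)
    moreover have "t - c < real i * h + h" using i1(2) h1 by (simp add: pos_divide_less_eq algebra_simps)
    moreover have "real i < real M"
    proof -
      have "(t - c) / h < real M" using tl h1 hM by (simp add: pos_divide_less_eq)
      then show ?thesis using i1(1) by linarith
    qed
    ultimately show ?thesis by (intro exI[of _ i]) auto
  qed
  have cover: "\<exists>i<M. \<exists>j<M. x \<in> ?q i j" if "x \<in> ?Q" for x
  proof -
    have x: "x \<in> P" "pa x \<in> {a..a+l}" "pb x \<in> {b..b+l}" using that by blast+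
    obtain i where i: "i < M" "pa x \<in> {a + real i * h .. a + real i * h + h}" using idx[OF x(2)] by blast
    obtain j where j: "j < M" "pb x \<in> {b + real j * h .. b + real j * h + h}" using idx[OF x(3)] by blast
    have "x \<in> ?q i j" using x i j by blast
    then show ?thesis using i(1) j(1) by blast
  qed
  show ?case
  proof (cases "\<forall>i<M. \<forall>j<M. ?q i j \<noteq> {}")
    case True
    define R where "R = (\<lambda>i j. SOME x. x \<in> ?q i j)"
    have R: "R i j \<in> ?q i j" if "i < M" "j < M" for i j
      unfolding R_def some_in_eq using True[rule_format, OF that] .
    \<comment> \<open>Two points in the same cell or in adjacent cells are at most
      \<open>3 * h\<close> apart in the sum of coordinate distances, \<open>2 * h\<close> in one
      direction and \<open>h\<close> in the other; hence the factor 9.\<close>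
    let ?d = "9 * C * h\<^sup>2"
    have d0: "?d \<ge> 0" using C by simp
    have stp: "\<bar>f x - f y\<bar> \<le> ?d" if "x \<in> P" "y \<in> P" "\<bar>pa x - pa y\<bar> + \<bar>pb x - pb y\<bar> \<le> 3 * h" for x y
    proof -
      have "\<bar>f x - f y\<bar> \<le> C * (\<bar>pa x - pa y\<bar> + \<bar>pb x - pb y\<bar>)\<^sup>2" using quad that by auto
      also have "\<dots> \<le> C * (3 * h)\<^sup>2" using that C by (intro mult_left_mono power_mono) auto
      finally show ?thesis by (simp only: power_mult_distrib) simp
    qed
    have c1: "\<bar>f (R i 0) - f (R 0 0)\<bar> \<le> real i * ?d" if "i < M" for i
      using that
    proof (induction i)
      case (Suc i)
      have "\<bar>f (R (Suc i) 0) - f (R i 0)\<bar> \<le> ?d"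
      proof (rule stp)
        have A: "R (Suc i) 0 \<in> ?q (Suc i) (0)" "R i 0 \<in> ?q (i) (0)" using R[of "Suc i" 0] R[of i 0] Suc.prems M by simp_all
        show "R (Suc i) 0 \<in> P" "R i 0 \<in> P" using A by blast+
        have B: "pa (R (Suc i) 0) \<in> {a + real (Suc i) * h .. a + real (Suc i) * h + h}" "pb (R (Suc i) 0) \<in> {b + real (0) * h .. b + real (0) * h + h}"
          "pa (R i 0) \<in> {a + real (i) * h .. a + real (i) * h + h}" "pb (R i 0) \<in> {b + real (0) * h .. b + real (0) * h + h}"
          using A by blast+
        show "\<bar>pa (R (Suc i) 0) - pa (R i 0)\<bar> + \<bar>pb (R (Suc i) 0) - pb (R i 0)\<bar> \<le> 3 * h"
          using B h0 unfolding of_nat_Suc distrib_right atLeastAtMost_iff by linarith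
      qed
      then show ?case using Suc by (simp add: algebra_simps)
    qed simp
    have c2: "\<bar>f (R i j) - f (R i 0)\<bar> \<le> real j * ?d" if "i < M" "j < M" for i j
      using that(2)
    proof (induction j)
      case (Suc j)
      have "\<bar>f (R i (Suc j)) - f (R i j)\<bar> \<le> ?d"
      proof (rule stp)
        have A: "R i (Suc j) \<in> ?q (i) (Suc j)" "R i j \<in> ?q (i) (j)" using R[of i "Suc j"] R[of i j] Suc.prems that(1) by simp_all
        show "R i (Suc j) \<in> P" "R i j \<in> P" using A by blast+
        have B: "pa (R i (Suc j)) \<in> {a + real (i) * h .. a + real (i) * h + h}" "pb (R i (Suc j)) \<in> {b + real (Suc j) * h .. b + real (Suc j) * h + h}"
          "pa (R i j) \<in> {a + real (i) * h .. a + real (i) * h + h}" "pb (R i j) \<in> {b + real (j) * h .. b + real (j) * h + h}"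
          using A by blast+
        show "\<bar>pa (R i (Suc j)) - pa (R i j)\<bar> + \<bar>pb (R i (Suc j)) - pb (R i j)\<bar> \<le> 3 * h"
          using B h0 unfolding of_nat_Suc distrib_right atLeastAtMost_iff by linarith
      qed
      then show ?case using Suc by (simp add: algebra_simps)
    qed simp
    \<comment> \<open>A point is reached from \<open>R 0 0\<close> by fewer than \<open>M\<close>
      steps in each of the two directions and one step inside its cell. These are
      \<open>O(M)\<close> steps of size \<open>O(h^2)\<close>, hence a total of order
      \<open>l^2 / M\<close>.\<close>
    let ?c = "f (R 0 0)" and ?w = "3 * real M * ?d"
    have "f y \<in> {?c - ?w .. ?c + ?w}" if y: "y \<in> ?Q" for y
    proof -
      obtain i j where ij: "i < M" "j < M" "y \<in> ?q i j" using cover[OF y] by blast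
      have "\<bar>f y - f (R i j)\<bar> \<le> ?d"
      proof (rule stp)
        have A: "y \<in> ?q (i) (j)" "R i j \<in> ?q (i) (j)" using R[OF ij(1,2)] ij(3) by simp_all
        show "y \<in> P" "R i j \<in> P" using A by blast+
        have B: "pa (y) \<in> {a + real (i) * h .. a + real (i) * h + h}" "pb (y) \<in> {b + real (j) * h .. b + real (j) * h + h}"
          "pa (R i j) \<in> {a + real (i) * h .. a + real (i) * h + h}" "pb (R i j) \<in> {b + real (j) * h .. b + real (j) * h + h}"
          using A by blast+
        show "\<bar>pa (y) - pa (R i j)\<bar> + \<bar>pb (y) - pb (R i j)\<bar> \<le> 3 * h"
          using B h0 unfolding of_nat_Suc distrib_right atLeastAtMost_iff by linarith
      qed
      moreover have "\<bar>f (R i j) - f (R i 0)\<bar> \<le> real j * ?d" "\<bar>f (R i 0) - f (R 0 0)\<bar> \<le> real i * ?d"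
        using c1 c2 ij by auto
      ultimately have "\<bar>f y - ?c\<bar> \<le> (1 + real i + real j) * ?d" by (simp add: algebra_simps)
      also have "\<dots> \<le> (3 * real M) * ?d" using ij M d0 by (intro mult_right_mono) auto
      finally show ?thesis by (simp only: atLeastAtMost_iff) linarith
    qed
    moreover have "2 * ?w \<le> 200 * C * l\<^sup>2 * (1 / real M + (1 - 1 / (real M)\<^sup>2) ^ Suc k)"
    proof -
      have "2 * ?w = 54 * C * l\<^sup>2 * (1 / real M)" using M0 unfolding hM[symmetric] by (simp add: power2_eq_square)
      also have "\<dots> \<le> 200 * C * l\<^sup>2 * (1 / real M)" using C M0 by (intro mult_right_mono) auto
      also have "\<dots> \<le> 200 * C * l\<^sup>2 * (1 / real M + (1 - 1 / (real M)\<^sup>2) ^ Suc k)"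
        using e0 C by (intro mult_left_mono) auto
      finally show ?thesis .
    qed
    moreover have "?w \<ge> 0" using d0 M0 by simp
    ultimately show ?thesis
      by (intro exI[of _ "{?c - ?w .. ?c + ?w}"]) auto
  next
    case False
    then obtain i0 j0 where m: "i0 < M" "j0 < M" "?q i0 j0 = {}" by blast
    let ?I = "{..<M} \<times> {..<M} - {(i0,j0)}"
    have "\<forall>ij. \<exists>S. f ` ?q (fst ij) (snd ij) \<subseteq> S \<and> S \<in> lmeasurable \<and> measure lebesgue S \<le> 200 * C * h\<^sup>2 * ?e"
      by (rule allI, rule Suc.IH[OF h0])
    from choice[OF this] obtain S where S: "\<And>ij. f ` ?q (fst ij) (snd ij) \<subseteq> S ij" "\<And>ij. S ij \<in> lmeasurable"
      "\<And>ij. measure lebesgue (S ij) \<le> 200 * C * h\<^sup>2 * ?e" by blast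
    have cardI: "real (card ?I) = (real M)\<^sup>2 - 1"
    proof -
      have "card ?I = M * M - 1" using m by (simp add: card_Diff_singleton card_cartesian_product)
      moreover have "M * M \<ge> 1" using M by (simp add: Suc_le_eq)
      ultimately show ?thesis by (simp add: power2_eq_square of_nat_diff)
    qed
    have "f ` ?Q \<subseteq> (\<Union>ij\<in>?I. S ij)"
    proof
      fix t assume "t \<in> f ` ?Q"
      then obtain x where x: "x \<in> ?Q" "t = f x" by blast
      obtain i j where ij: "i < M" "j < M" "x \<in> ?q i j" using cover[OF x(1)] by blast
      then have "(i,j) \<noteq> (i0,j0)" using m by auto
      moreover have "t \<in> S (i,j)" using S(1)[of "(i,j)"] ij x(2) by auto
      ultimately show "t \<in> (\<Union>ij\<in>?I. S ij)" using ij by auto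
    qed
    moreover have "(\<Union>ij\<in>?I. S ij) \<in> lmeasurable" using S(2) by (intro fmeasurable.finite_UN) auto
    moreover have "measure lebesgue (\<Union>ij\<in>?I. S ij) \<le> 200 * C * l\<^sup>2 * (1 / real M + (1 - 1 / (real M)\<^sup>2) ^ Suc k)"
    proof -
      have "measure lebesgue (\<Union>ij\<in>?I. S ij) \<le> (\<Sum>ij\<in>?I. measure lebesgue (S ij))"
        using S(2) by (intro measure_UNION_le) auto
      also have "\<dots> \<le> (\<Sum>ij\<in>?I. 200 * C * h\<^sup>2 * ?e)" using S(3) by (intro sum_mono)
      also have "\<dots> = ((real M)\<^sup>2 - 1) * (200 * C * h\<^sup>2 * ?e)" using cardI by simp
      \<comment> \<open>The \<open>M^2 - 1\<close> remaining cells have side \<open>l / M\<close>,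
        so their areas add up to \<open>l^2\<close> times the factor \<open>1 - 1 / M^2\<close>. The
        bound is homogeneous of degree two in the side, which is why the induction is over all
        squares at once.\<close>
      also have "\<dots> = 200 * C * l\<^sup>2 * ((1 - 1 / (real M)\<^sup>2) * ?e)"
      proof -
        have "((real M)\<^sup>2 - 1) * h\<^sup>2 = l\<^sup>2 * (1 - 1 / (real M)\<^sup>2)"
          using M0 unfolding hM[symmetric] power_mult_distrib by (simp add: right_diff_distrib left_diff_distrib)
        then have "200 * C * ?e * (((real M)\<^sup>2 - 1) * h\<^sup>2) = 200 * C * ?e * (l\<^sup>2 * (1 - 1 / (real M)\<^sup>2))"
          by (rule arg_cong)
        then show ?thesis by (simp only: ac_simps)
      qed
      also have "\<dots> \<le> 200 * C * l\<^sup>2 * (1 / real M + (1 - 1 / (real M)\<^sup>2) ^ Suc k)"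
      proof (rule mult_left_mono)
        have "(1 - 1 / (real M)\<^sup>2) * (1 / real M) \<le> 1 * (1 / real M)" using M0 by (intro mult_right_mono) auto
        then show "(1 - 1 / (real M)\<^sup>2) * ?e \<le> 1 / real M + (1 - 1 / (real M)\<^sup>2) ^ Suc k"
          by (simp add: distrib_left)
      qed (use C in simp)
      finally show ?thesis .
    qed
    ultimately show ?thesis by blast
  qed
qed

text \<open>A form of Sard's theorem in two parameters. In the covering bound \<open>M\<close> is
  chosen first, so that \<open>1 / M\<close> is small, and \<open>k\<close> afterwards, so that the
  power is small. Only increments of \<open>f\<close> enter, so \<open>P\<close> may be any set of
  configurations with two real parameters.\<close>

lemma negligible_quadratic_image:
  fixes f pa pb :: "'a \<Rightarrow> real"
  assumes quad: "\<And>x y. x \<in> P \<Longrightarrow> y \<in> P \<Longrightarrow> \<bar>f x - f y\<bar> \<le> C * (\<bar>pa x - pa y\<bar> + \<bar>pb x - pb y\<bar>)\<^sup>2"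
    and bd: "\<And>x. x \<in> P \<Longrightarrow> pa x \<in> {0..l}" "\<And>x. x \<in> P \<Longrightarrow> pb x \<in> {0..l}"
  shows "negligible (f ` P)"
proof (cases "P = {}")
  case False
  then have l: "l \<ge> 0" using bd by fastforce
  define C' where "C' = max C 0"
  have C': "C' \<ge> 0" and quad': "\<And>x y. x \<in> P \<Longrightarrow> y \<in> P \<Longrightarrow> \<bar>f x - f y\<bar> \<le> C' * (\<bar>pa x - pa y\<bar> + \<bar>pb x - pb y\<bar>)\<^sup>2"
    unfolding C'_def using quad by (auto intro!: order_trans[OF quad] mult_right_mono)
  have Q: "{x \<in> P. pa x \<in> {0..0+l} \<and> pb x \<in> {0..0+l}} = P" using bd by auto
  show ?thesis unfolding negligible_outer_le
  proof (intro allI impI)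
    fix e :: real assume e: "e > 0"
    define A where "A = 200 * C' * l\<^sup>2"
    have A: "A \<ge> 0" using C' by (simp add: A_def)
    obtain M where M: "real M > 2 * (A + 1) / e + 2" using reals_Archimedean2 by blast
    have M2: "M \<ge> 2"
    proof -
      have "2 * (A + 1) / e \<ge> 0" using A e by simp
      then show ?thesis using M by linarith
    qed
    have "0 \<le> 1 - 1 / (real M)\<^sup>2" "1 - 1 / (real M)\<^sup>2 < 1" using M2 by (auto simp: divide_le_eq_1 one_le_power)
    then have "(\<lambda>k. (1 - 1 / (real M)\<^sup>2) ^ k) \<longlonglongrightarrow> 0" by (intro LIMSEQ_realpow_zero) auto
    moreover have "0 < e / (2 * (A + 1))" using A e by simp
    ultimately have "\<forall>\<^sub>F k in sequentially. (1 - 1 / (real M)\<^sup>2) ^ k < e / (2 * (A + 1))"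
      by (rule order_tendstoD(2))
    then obtain k where k: "(1 - 1 / (real M)\<^sup>2) ^ k < e / (2 * (A + 1))"
      by (auto simp: eventually_sequentially)
    have "2 * (A + 1) / e < real M" using M by linarith
    then have m1: "1 / real M < e / (2 * (A + 1))" using A e M2 by (simp add: divide_less_eq less_divide_eq mult.commute)
    have "\<exists>S. f ` {x \<in> P. pa x \<in> {0..0+l} \<and> pb x \<in> {0..0+l}} \<subseteq> S \<and> S \<in> lmeasurable \<and>
        measure lebesgue S \<le> 200 * C' * l\<^sup>2 * (1 / real M + (1 - 1 / (real M)\<^sup>2) ^ k)"
      by (rule quadratic_grid_cover[OF C' M2 _ l]) (rule quad')
    then obtain S where S: "f ` P \<subseteq> S" "S \<in> lmeasurable" "measure lebesgue S \<le> A * (1 / real M + (1 - 1 / (real M)\<^sup>2) ^ k)"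
      unfolding Q A_def[symmetric] by blast
    have "A * (1 / real M + (1 - 1 / (real M)\<^sup>2) ^ k) \<le> A * (e / (A + 1))"
    proof (rule mult_left_mono)
      have "e / (2 * (A + 1)) + e / (2 * (A + 1)) = e / (A + 1)"
        by (metis field_sum_of_halves divide_divide_eq_left' mult.commute)
      then show "1 / real M + (1 - 1 / (real M)\<^sup>2) ^ k \<le> e / (A + 1)" using add_strict_mono[OF m1 k] by simp
    qed (use A in simp)
    also have "\<dots> \<le> e" using A e by (simp add: divide_le_eq)
    finally have "measure lebesgue S \<le> e" using S(3) by linarith
    then show "\<exists>T. f ` P \<subseteq> T \<and> T \<in> lmeasurable \<and> measure lebesgue T \<le> e" using S(1,2) by blast
  qed
qed simp

section \<open>Curves parametrised by the tangent angle\<close>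

text \<open>The angle \<open>0\<close> belongs to the marked point, which is the leftmost point of the boundary; angles increase
  counterclockwise and \<open>Nv\<close> is the outward normal.\<close>

definition Tv :: "real \<Rightarrow> real^2" where "Tv t = vector [sin t, - cos t]"
definition Nv :: "real \<Rightarrow> real^2" where "Nv t = vector [- cos t, - sin t]"
definition Rf :: "real^2 \<Rightarrow> real^2" where "Rf x = vector [x$1, - (x$2)]"

section \<open>Identities for the moving frame and the reflection\<close>

lemma Tv_nth [simp]: "Tv t $ 1 = sin t" "Tv t $ 2 = - cos t"
  and Nv_nth [simp]: "Nv t $ 1 = - cos t" "Nv t $ 2 = - sin t"
  and Rf_nth [simp]: "Rf x $ 1 = x $ 1" "Rf x $ 2 = - (x $ 2)"
  by (simp_all add: Tv_def Nv_def Rf_def)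

lemma inner_vec2: "(x::real^2) \<bullet> y = x$1 * y$1 + x$2 * y$2"
  by (simp add: inner_vec_def sum_2)

lemma vec2_eq_iff: "(x::real^2) = y \<longleftrightarrow> x$1 = y$1 \<and> x$2 = y$2"
  by (simp add: vec_eq_iff forall_2)

lemma inner_Tv_Tv: "Tv a \<bullet> Tv b = cos (a - b)"
  and inner_Tv_Nv: "Tv a \<bullet> Nv b = - sin (a - b)"
  and inner_Nv_Nv: "Nv a \<bullet> Nv b = cos (a - b)"
  by (simp_all add: inner_vec2 cos_diff sin_diff)

lemma norm_Tv [simp]: "norm (Tv a) = 1" and norm_Nv [simp]: "norm (Nv a) = 1"
  by (simp_all add: norm_eq_sqrt_inner inner_Tv_Tv inner_Nv_Nv)

lemma Tv_add: "Tv (a + b) = cos b *\<^sub>R Tv a - sin b *\<^sub>R Nv a"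
  by (simp add: vec2_eq_iff sin_add cos_add algebra_simps)

lemma frame_expand: "x = (x \<bullet> Tv a) *\<^sub>R Tv a + (x \<bullet> Nv a) *\<^sub>R Nv a"
proof -
  have "x$1 = x$1 * ((sin a)\<^sup>2 + (cos a)\<^sup>2)" "x$2 = x$2 * ((sin a)\<^sup>2 + (cos a)\<^sup>2)" by simp_all
  then have "x$1 = (x$1 * sin a - x$2 * cos a) * sin a + (- (x$1 * cos a) - x$2 * sin a) * (- cos a)"
    "x$2 = (x$1 * sin a - x$2 * cos a) * (- cos a) + (- (x$1 * cos a) - x$2 * sin a) * (- sin a)"
    by (simp_all only: power2_eq_square) algebra+
  then show ?thesis unfolding vec2_eq_iff by (simp add: inner_vec2)
qed

lemma frame_norm: "(norm x)\<^sup>2 = (x \<bullet> Tv a)\<^sup>2 + (x \<bullet> Nv a)\<^sup>2"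
proof -
  have "(norm x)\<^sup>2 = ((x \<bullet> Tv a) *\<^sub>R Tv a + (x \<bullet> Nv a) *\<^sub>R Nv a) \<bullet> ((x \<bullet> Tv a) *\<^sub>R Tv a + (x \<bullet> Nv a) *\<^sub>R Nv a)"
    unfolding frame_expand[symmetric] by (simp add: power2_norm_eq_inner)
  also have "\<dots> = (x \<bullet> Tv a)\<^sup>2 + (x \<bullet> Nv a)\<^sup>2"
    by (simp add: inner_add_left inner_add_right inner_Tv_Tv inner_Tv_Nv inner_Nv_Nv inner_commute[of "Nv a" "Tv a"] power2_eq_square)
  finally show ?thesis .
qed

lemma Rf_simps [simp]: "Rf (x - y) = Rf x - Rf y" "Rf (- x) = - Rf x" "Rf (Rf x) = x" "Rf (c *\<^sub>R x) = c *\<^sub>R Rf x" "Rf 0 = 0"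
  "norm (Rf x) = norm x" "Rf x \<bullet> Rf y = x \<bullet> y"
  by (simp_all add: vec2_eq_iff norm_eq_sqrt_inner inner_vec2)

lemma Rf_Tv: "Rf (Tv t) = - Tv (- t)" and Rf_Nv: "Rf (Nv t) = Nv (- t)"
  by (simp_all add: vec2_eq_iff)

lemma Tv_periodic [simp]: "Tv (t + 2 * pi) = Tv t" "Tv (2 * pi - t) = Tv (- t)" "Tv (2*pi) = Tv 0"
  by (simp_all add: vec2_eq_iff sin_diff cos_diff)

lemma Tv_has_vector_derivative: "(Tv has_vector_derivative - Nv t) (at t within S)"
  and Nv_has_vector_derivative: "(Nv has_vector_derivative Tv t) (at t within S)"
proof -
  have T: "Tv = (\<lambda>t. sin t *\<^sub>R axis 1 1 + (- cos t) *\<^sub>R axis 2 1)"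
    by (auto simp: fun_eq_iff vec2_eq_iff axis_def)
  have N: "Nv = (\<lambda>t. (- cos t) *\<^sub>R axis 1 1 + (- sin t) *\<^sub>R axis 2 1)"
    by (auto simp: fun_eq_iff vec2_eq_iff axis_def)
  have T': "- Nv t = cos t *\<^sub>R axis 1 1 + (sin t) *\<^sub>R axis 2 1"
    by (auto simp: vec2_eq_iff axis_def)
  show "(Tv has_vector_derivative - Nv t) (at t within S)" unfolding T T'
    by (auto intro!: derivative_eq_intros simp: has_real_derivative_iff_has_vector_derivative[symmetric])
  have N': "Tv t = sin t *\<^sub>R axis 1 1 + (- cos t) *\<^sub>R axis 2 1"
    by (auto simp: vec2_eq_iff axis_def)
  show "(Nv has_vector_derivative Tv t) (at t within S)" unfolding N N'
    by (auto intro!: derivative_eq_intros simp: has_real_derivative_iff_has_vector_derivative[symmetric])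
qed

lemma vector_derivative_inner_const:
  assumes "(f has_vector_derivative v) (at t within S)"
  shows "((\<lambda>t. f t \<bullet> c) has_real_derivative (v \<bullet> c)) (at t within S)"
  using assms unfolding has_real_derivative_iff_has_vector_derivative
  by (rule bounded_linear.has_vector_derivative[OF bounded_linear_inner_left])

text \<open>\<open>t\<close> is the tangent angle, so \<open>\<rho>\<close> is the radius of
  curvature. A positive periodic \<open>\<rho>\<close> together with the periodicity of
  \<open>z\<close> already forces the closed curve to be strictly convex.\<close>

locale curve =
  fixes z :: "real \<Rightarrow> real^2" and \<rho> :: "real \<Rightarrow> real"
  assumes z_deriv: "\<And>t. (z has_vector_derivative \<rho> t *\<^sub>R Tv t) (at t)"
    and \<rho>_pos: "\<And>t. \<rho> t > 0"
    and \<rho>_cont: "continuous_on UNIV \<rho>"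
    and \<rho>_per: "\<And>t. \<rho> (t + 2 * pi) = \<rho> t"
    and z_per: "\<And>t. z (t + 2 * pi) = z t"
begin

lemma z_shift_deriv: "((\<lambda>g. z (a + g)) has_vector_derivative \<rho> (a + g) *\<^sub>R Tv (a + g)) (at g within S)"
proof -
  have "((\<lambda>g. a + g) has_vector_derivative 0 + 1) (at g within S)"
    by (intro has_vector_derivative_add has_vector_derivative_const has_vector_derivative_id)
  from vector_diff_chain_within[OF this, of z "\<rho> (a+g) *\<^sub>R Tv (a+g)"] show ?thesis
    using z_deriv[of "a+g"] by (simp add: o_def has_vector_derivative_at_within)
qed

lemma z_cont: "continuous_on S z"
  by (rule continuous_at_imp_continuous_on) (use z_deriv in \<open>auto intro: has_vector_derivative_continuous\<close>)

lemma chord_normal_deriv: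
  "((\<lambda>g. (z (a + g) - z a) \<bullet> Nv a) has_real_derivative - \<rho> (a + g) * sin g) (at g within S)"
proof -
  have "((\<lambda>g. z (a + g) - z a) has_vector_derivative \<rho> (a + g) *\<^sub>R Tv (a + g)) (at g within S)"
    using has_vector_derivative_diff[OF z_shift_deriv has_vector_derivative_const] by simp
  from vector_derivative_inner_const[OF this, of "Nv a"] show ?thesis by (simp add: inner_Tv_Nv)
qed

text \<open>Strict convexity: the height over the tangent line at \<open>a\<close> has derivative
  \<open>- \<rho> * sin\<close>, so it falls from 0 until the tangent has turned by
  \<open>pi\<close> and then rises back to 0.\<close>

lemma chord_normal_neg:
  assumes "0 < g" "g < 2 * pi"
  shows "(z (a + g) - z a) \<bullet> Nv a < 0"
proof -
  let ?f = "\<lambda>g. (z (a + g) - z a) \<bullet> Nv a"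
  have cont: "continuous_on S ?f" for S
    by (intro continuous_intros continuous_on_compose2[OF z_cont[of UNIV]]) auto
  show ?thesis
  proof (cases "g \<le> pi")
    case True
    have "?f g < ?f 0"
    proof (rule DERIV_neg_imp_decreasing_open[OF assms(1)])
      show "\<exists>y. (?f has_real_derivative y) (at x) \<and> y < 0" if "0 < x" "x < g" for x
        using chord_normal_deriv[of a x UNIV] \<rho>_pos[of "a+x"] sin_gt_zero[of x] that True
        by (intro exI[of _ "- \<rho> (a + x) * sin x"]) auto
    qed (rule cont)
    then show ?thesis by simp
  next
    case False
    have "?f g < ?f (2 * pi)"
    proof (rule DERIV_pos_imp_increasing_open[OF assms(2)])
      show "\<exists>y. (?f has_real_derivative y) (at x) \<and> y > 0" if "g < x" "x < 2 * pi" for x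
        using chord_normal_deriv[of a x UNIV] \<rho>_pos[of "a+x"] sin_lt_zero[of x] that False
        by (intro exI[of _ "- \<rho> (a + x) * sin x"]) (auto simp: mult_pos_neg)
    qed (rule cont)
    then show ?thesis using z_per[of a] by simp
  qed
qed

lemma z_neq: assumes "a < b" "b < a + 2 * pi" shows "z b \<noteq> z a"
  using chord_normal_neg[of "b - a" a] assms by auto

text \<open>The curve lies strictly inside its tangent line at either end of the chord. Seen from
  \<open>a\<close> this puts the direction in the open half turn after the tangent at
  \<open>a\<close>; seen from \<open>b\<close>, in the half turn before the tangent at
  \<open>b\<close>.\<close>

lemma chord_angle:
  assumes "a < b" "b < a + 2 * pi"
  obtains \<alpha> where "a < \<alpha>" "\<alpha> < b" "\<alpha> - a < pi" "b - \<alpha> < pi" "sgn (z b - z a) = Tv \<alpha>"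
proof -
  let ?D = "z b - z a" let ?e = "sgn ?D"
  have D: "?D \<noteq> 0" using z_neq[OF assms] by simp
  have ne: "norm ?e = 1" using D by (simp add: norm_sgn)
  have eN: "?e \<bullet> Nv a < 0"
    using chord_normal_neg[of "b - a" a] assms D by (simp add: sgn_div_norm mult_less_0_iff)
  have fr: "(?e \<bullet> Tv a)\<^sup>2 + (?e \<bullet> Nv a)\<^sup>2 = 1" using frame_norm[of ?e a] ne by simp
  have "(?e \<bullet> Nv a)\<^sup>2 > 0" using eN by simp
  then have "(?e \<bullet> Tv a)\<^sup>2 < 1" using fr by linarith
  then have lt: "\<bar>?e \<bullet> Tv a\<bar> < 1" by (simp add: abs_square_less_1)
  define \<beta> where "\<beta> = arccos (?e \<bullet> Tv a)"
  have \<beta>: "0 < \<beta>" "\<beta> < pi" using arccos_lt_bounded[of "?e \<bullet> Tv a"] lt by (auto simp: \<beta>_def)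
  have c: "cos \<beta> = ?e \<bullet> Tv a" using lt by (simp add: \<beta>_def)
  have "(sin \<beta>)\<^sup>2 = (- (?e \<bullet> Nv a))\<^sup>2" using fr c sin_squared_eq[of \<beta>] by simp
  then have s: "sin \<beta> = - (?e \<bullet> Nv a)"
    using sin_gt_zero[OF \<beta>] eN power2_eq_imp_eq[of "sin \<beta>" "- (?e \<bullet> Nv a)"] by simp
  have e: "?e = Tv (a + \<beta>)" using frame_expand[of ?e a] by (simp add: Tv_add c s)
  \<comment> \<open>The same chord seen from \<open>b\<close>, reached by going round the
    complementary arc.\<close>
  have "(z (b + (a + 2 * pi - b)) - z b) \<bullet> Nv b < 0" using chord_normal_neg[of "a + 2 * pi - b" b] assms by simp
  then have "?D \<bullet> Nv b > 0" using z_per[of a] by (simp add: inner_diff_left)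
  then have "?e \<bullet> Nv b > 0" using D by (simp add: sgn_div_norm zero_less_mult_iff)
  then have sb: "sin (b - (a + \<beta>)) > 0" unfolding e inner_Tv_Nv by (metis minus_diff_eq sin_minus)
  have r: "b - (a + \<beta>) > 0"
  proof (rule ccontr)
    assume "\<not> ?thesis"
    moreover have "- pi < b - (a + \<beta>)" using assms \<beta> by linarith
    ultimately have "sin (- (b - (a + \<beta>))) \<ge> 0" by (intro sin_ge_zero) auto
    then show False using sb by (simp del: minus_diff_eq)
  qed
  have r2: "b - (a + \<beta>) < pi"
  proof (rule ccontr)
    assume "\<not> ?thesis"
    moreover have "b - (a + \<beta>) < 2 * pi" using assms \<beta> by linarith
    ultimately have "sin (b - (a + \<beta>)) \<le> 0" using sin_le_zero[of "b - (a + \<beta>)"] by linarith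
    then show False using sb by simp
  qed
  show thesis using that[of "a + \<beta>"] \<beta> r r2 e by simp
qed

end

section \<open>First variation of the perimeter of symmetric inscribed polygons\<close>

lemma sum_chord_by_parts:
  fixes e v :: "nat \<Rightarrow> 'a::real_inner"
  assumes "q \<ge> 1"
  shows "(\<Sum>k<q. e k \<bullet> (v (Suc k) - v k)) = e (q - 1) \<bullet> v q - e 0 \<bullet> v 0 + (\<Sum>k\<in>{1..<q}. (e (k - 1) - e k) \<bullet> v k)"
  using assms
proof (induction q rule: nat_induct_at_least)
  case base then show ?case by (simp add: inner_diff_right)
next
  case (Suc q)
  then have "{1..<Suc q} = insert q {1..<q}" by auto
  then show ?case using Suc by (simp add: inner_diff_right inner_diff_left)
qed

text \<open>A longest polygon might a priori have coinciding neighbours, where the norm is not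
  differentiable. From the right it still is, because
  \<open>norm (s *\<^sub>R V) = s * norm V\<close> for \<open>s \<ge> 0\<close>; this positive extra
  term later excludes such polygons.\<close>

lemma norm_right_derivative:
  fixes F :: "real \<Rightarrow> 'a::real_inner"
  assumes F: "(F has_vector_derivative V) (at 0)"
  shows "((\<lambda>s. norm (F s)) has_real_derivative (sgn (F 0) \<bullet> V + (if F 0 = 0 then norm V else 0))) (at 0 within {0..})"
proof (cases "F 0 = 0")
  case False
  have F': "(F has_derivative (\<lambda>h. h *\<^sub>R V)) (at 0 within {0..})"
    using F by (simp add: has_vector_derivative_def has_derivative_at_withinI)
  have "((\<lambda>s. norm (F s)) has_derivative (\<lambda>h. (h *\<^sub>R V) \<bullet> sgn (F 0))) (at 0 within {0..})"
    by (rule has_derivative_compose[OF F' has_derivative_norm[OF False]])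
  then show ?thesis using False
    by (simp add: has_field_derivative_def inner_commute mult.commute[of "sgn (F 0) \<bullet> V"] mult_commute_abs)
next
  case True
  have F': "\<forall>e>0. \<exists>d>0. \<forall>y\<in>{0..}. norm (y - 0) < d \<longrightarrow> norm (F y - F 0 - (y - 0) *\<^sub>R V) \<le> e * norm (y - 0)"
    using has_vector_derivative_at_within[OF F, of "{0..}"]
    unfolding has_vector_derivative_def has_derivative_within_alt by blast
  have "((\<lambda>s. norm (F s)) has_derivative (\<lambda>h. h * norm V)) (at 0 within {0..})"
    unfolding has_derivative_within_alt
  proof (intro conjI allI impI)
    show "bounded_linear (\<lambda>h. h * norm V)" by (rule bounded_linear_mult_left)
    fix e :: real assume "e > 0"
    then obtain d where d: "d > 0" "\<forall>y\<in>{0..}. norm (y - 0) < d \<longrightarrow> norm (F y - F 0 - (y - 0) *\<^sub>R V) \<le> e * norm (y - 0)"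
      using F' by blast
    have "norm (norm (F y) - norm (F 0) - (y - 0) * norm V) \<le> e * norm (y - 0)" if "y \<in> {0..}" "norm (y - 0) < d" for y
    proof -
      have "\<bar>norm (F y) - norm (y *\<^sub>R V)\<bar> \<le> norm (F y - y *\<^sub>R V)" by (rule norm_triangle_ineq3)
      also have "\<dots> \<le> e * norm (y - 0)" using d that True by simp
      finally show ?thesis using True that by simp
    qed
    then show "\<exists>d>0. \<forall>y\<in>{0..}. norm (y - 0) < d \<longrightarrow> norm (norm (F y) - norm (F 0) - (y - 0) * norm V) \<le> e * norm (y - 0)"
      using d(1) by blast
  qed
  then show ?thesis using True by (simp add: has_field_derivative_def mult.commute[of "norm V"] mult_commute_abs)
qed

text \<open>Weak monotonicity and the value 0 beyond \<open>q\<close> make the set compact in the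
  product topology, so a longest polygon exists; that its vertices are distinct has to be proved
  afterwards.\<close>

definition sym_polys :: "nat \<Rightarrow> (nat \<Rightarrow> real) set" where
  "sym_polys q = {\<theta>. \<theta> 0 = 0 \<and> (\<forall>k<q. \<theta> k \<le> \<theta> (Suc k)) \<and> (\<forall>k\<le>q. \<theta> (q - k) = 2 * pi - \<theta> k) \<and> (\<forall>k>q. \<theta> k = 0)}"

lemma sym_polys_mono:
  assumes "\<theta> \<in> sym_polys q" "i \<le> j" "j \<le> q" shows "\<theta> i \<le> \<theta> j"
  using assms(2,3)
proof (induction j rule: dec_induct)
  case (step n) then show ?case using assms(1) unfolding sym_polys_def by (auto intro: order_trans simp: Suc_le_eq)
qed simp

lemma sym_polys_last: "\<theta> \<in> sym_polys q \<Longrightarrow> \<theta> q = 2 * pi"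
  unfolding sym_polys_def by (metis (mono_tags, lifting) diff_zero le0 mem_Collect_eq)

lemma sym_polys_sym: "\<theta> \<in> sym_polys q \<Longrightarrow> k \<le> q \<Longrightarrow> \<theta> (q - k) = 2 * pi - \<theta> k"
  unfolding sym_polys_def by blast

lemma sym_polys_bounds: "\<theta> \<in> sym_polys q \<Longrightarrow> \<theta> k \<in> {0..2*pi}"
proof (cases "k \<le> q")
  case True
  assume A: "\<theta> \<in> sym_polys q"
  have "\<theta> 0 \<le> \<theta> k" "\<theta> k \<le> \<theta> q" using sym_polys_mono[OF A] True by auto
  moreover have "\<theta> 0 = 0" using A by (simp add: sym_polys_def)
  ultimately show ?thesis using sym_polys_last[OF A] by simp
next
  case False
  assume "\<theta> \<in> sym_polys q"
  then show ?thesis using False by (auto simp: sym_polys_def)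
qed

lemma compact_sym_polys: "compact (sym_polys q)"
proof -
  have "compact (PiE UNIV (\<lambda>k::nat. {0..2*pi::real}))"
  proof -
    have "compactin (product_topology (\<lambda>k::nat. euclidean) UNIV) (PiE UNIV (\<lambda>k. {0..2*pi::real}))"
      by (simp add: compactin_PiE)
    then show ?thesis unfolding euclidean_product_topology by simp
  qed
  moreover have "closed (sym_polys q)"
  proof -
    have e: "sym_polys q = {\<theta>. \<theta> 0 = 0} \<inter> (\<Inter>k\<in>{..<q}. {\<theta>. \<theta> k \<le> \<theta> (Suc k)}) \<inter> (\<Inter>k\<in>{..q}. {\<theta>. \<theta> (q - k) = 2 * pi - \<theta> k}) \<inter> (\<Inter>k\<in>{q<..}. {\<theta>. \<theta> k = 0})"
      by (auto simp: sym_polys_def)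
    have c: "continuous_on UNIV (\<lambda>\<theta>::nat\<Rightarrow>real. \<theta> k)" for k by (rule continuous_on_product_coordinates)
    show ?thesis unfolding e
      by (intro closed_Int closed_INT ballI closed_Collect_eq closed_Collect_le continuous_intros c)
  qed
  moreover have "sym_polys q \<subseteq> PiE UNIV (\<lambda>k::nat. {0..2*pi::real})" using sym_polys_bounds by auto
  ultimately show ?thesis by (metis compact_Int_closed inf.absorb2)
qed

text \<open>In the tangent angle the reflection law becomes additive. \<open>\<phi> k\<close> is the
  angle between a side and the tangent at vertex \<open>k\<close>, and the law is encoded by using
  one and the same \<open>\<phi> k\<close> for both sides that meet there;
  \<open>\<phi> q = \<phi> 0\<close> is the law at the marked point.\<close>

definition orbit :: "(real \<Rightarrow> real^2) \<Rightarrow> nat \<Rightarrow> (nat \<Rightarrow> real) \<Rightarrow> (nat \<Rightarrow> real) \<Rightarrow> bool" where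
  "orbit z q \<theta> \<phi> \<longleftrightarrow> \<theta> 0 = 0 \<and> \<theta> q = 2 * pi \<and> \<phi> q = \<phi> 0 \<and> (\<forall>k\<le>q. 0 < \<phi> k \<and> \<phi> k < pi) \<and>
     (\<forall>k<q. \<theta> (Suc k) = \<theta> k + \<phi> k + \<phi> (Suc k) \<and> z (\<theta> (Suc k)) \<noteq> z (\<theta> k) \<and>
        sgn (z (\<theta> (Suc k)) - z (\<theta> k)) = Tv (\<theta> k + \<phi> k))"

definition poly_length :: "(real \<Rightarrow> real^2) \<Rightarrow> nat \<Rightarrow> (nat \<Rightarrow> real) \<Rightarrow> real" where
  "poly_length z q \<theta> = (\<Sum>k<q. norm (z (\<theta> (Suc k)) - z (\<theta> k)))"

locale sym_curve = curve +
  assumes z_sym: "\<And>t. z (- t) = Rf (z t)" and \<rho>_sym: "\<And>t. \<rho> (- t) = \<rho> t" and z_0: "z 0 = 0"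
begin

lemma z_sym2: "z (2 * pi - t) = Rf (z t)" and \<rho>_sym2: "\<rho> (2 * pi - t) = \<rho> t"
  using z_per[of "- t"] z_sym[of t] \<rho>_per[of "- t"] \<rho>_sym[of t] by simp_all

lemma ex_max_poly:
  assumes "q \<ge> 2"
  obtains \<theta> where "\<theta> \<in> sym_polys q" "\<And>\<theta>'. \<theta>' \<in> sym_polys q \<Longrightarrow> poly_length z q \<theta>' \<le> poly_length z q \<theta>"
proof -
  have "(\<lambda>k. if k \<le> q then 2 * pi * real k / real q else 0) \<in> sym_polys q"
    unfolding sym_polys_def using assms by (auto simp: of_nat_diff field_simps)
  then have ne: "sym_polys q \<noteq> {}" by blast
  have "continuous_on (sym_polys q) (poly_length z q)"
    unfolding poly_length_def
    by (intro continuous_intros continuous_on_compose2[OF z_cont[of UNIV]] continuous_on_subset[OF continuous_on_product_coordinates]) auto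
  from continuous_attains_sup[OF compact_sym_polys ne this] show thesis using that by blast
qed

definition edge :: "(nat \<Rightarrow> real) \<Rightarrow> nat \<Rightarrow> real^2" where "edge \<theta> k = sgn (z (\<theta> (Suc k)) - z (\<theta> k))"

lemma edge_sym:
  assumes "\<theta> \<in> sym_polys q" "k < q"
  shows "edge \<theta> (q - Suc k) = - Rf (edge \<theta> k)"
proof -
  have "Suc (q - Suc k) = q - k" using assms by simp
  then have "z (\<theta> (Suc (q - Suc k))) - z (\<theta> (q - Suc k)) = - Rf (z (\<theta> (Suc k)) - z (\<theta> k))"
    using sym_polys_sym[OF assms(1), of k] sym_polys_sym[OF assms(1), of "Suc k"] assms(2) by (simp add: z_sym2)
  moreover have "sgn (- Rf x) = - Rf (sgn x)" for x by (simp add: sgn_div_norm)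
  ultimately show ?thesis unfolding edge_def by (simp only:)
qed

text \<open>At a maximum the right derivative of the perimeter is nonpositive in every direction
  that keeps the polygon admissible for small positive \<open>s\<close>. A degenerate side
  contributes the norm of the relative velocity of its end points.\<close>

lemma max_poly_direction:
  assumes \<theta>: "\<theta> \<in> sym_polys q" "\<And>\<theta>'. \<theta>' \<in> sym_polys q \<Longrightarrow> poly_length z q \<theta>' \<le> poly_length z q \<theta>"
    and d: "d 0 = 0" "\<And>k. k \<le> q \<Longrightarrow> d (q - k) = - d k" "\<And>k. k > q \<Longrightarrow> d k = 0"
    and feas: "\<And>k. k < q \<Longrightarrow> \<theta> k < \<theta> (Suc k) \<or> d k \<le> d (Suc k)"
    and v: "v = (\<lambda>k. (d k * \<rho> (\<theta> k)) *\<^sub>R Tv (\<theta> k))"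
  shows "(\<Sum>k<q. edge \<theta> k \<bullet> (v (Suc k) - v k) + (if z (\<theta> (Suc k)) = z (\<theta> k) then norm (v (Suc k) - v k) else 0)) \<le> 0"
    (is "?S \<le> 0")
proof (rule ccontr)
  assume "\<not> ?S \<le> 0" then have S: "?S > 0" by simp
  let ?\<theta> = "\<lambda>s k. \<theta> k + s * d k"
  have zd: "((\<lambda>s. z (\<theta> k + s * d k)) has_vector_derivative v k) (at 0)" for k
  proof -
    have "((\<lambda>s. s * d k) has_vector_derivative d k) (at 0)"
      unfolding has_real_derivative_iff_has_vector_derivative[symmetric] by (auto intro!: derivative_eq_intros)
    from vector_diff_chain_at[OF this, of "\<lambda>g. z (\<theta> k + g)" "\<rho> (\<theta> k) *\<^sub>R Tv (\<theta> k)"]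
    show ?thesis using z_shift_deriv[of "\<theta> k" 0 UNIV] by (simp add: o_def v)
  qed
  have nd: "((\<lambda>s. norm (z (?\<theta> s (Suc k)) - z (?\<theta> s k))) has_real_derivative
     edge \<theta> k \<bullet> (v (Suc k) - v k) + (if z (\<theta> (Suc k)) = z (\<theta> k) then norm (v (Suc k) - v k) else 0)) (at 0 within {0..})" for k
    using norm_right_derivative[OF has_vector_derivative_diff[OF zd[of "Suc k"] zd[of k]]] by (simp add: edge_def)
  have "((\<lambda>s. poly_length z q (?\<theta> s)) has_real_derivative ?S) (at 0 within {0..})"
    unfolding poly_length_def by (rule DERIV_sum) (rule nd)
  from has_real_derivative_pos_inc_right[OF this S]
  obtain e where e: "e > 0" "\<And>h. h > 0 \<Longrightarrow> h < e \<Longrightarrow> poly_length z q (?\<theta> 0) < poly_length z q (?\<theta> h)" by auto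
  have "\<forall>\<^sub>F s in at_right 0. \<theta> k + s * d k \<le> \<theta> (Suc k) + s * d (Suc k)" if k: "k < q" for k
  \<comment> \<open>Either the direction does not close the gap, or the gap is positive and survives
    for small \<open>s\<close>.\<close>
  proof (cases "d k \<le> d (Suc k)")
    case True
    have le: "\<theta> k \<le> \<theta> (Suc k)" using \<theta>(1) k by (simp add: sym_polys_def)
    have "\<forall>\<^sub>F s in at_right (0::real). s > 0" by (rule eventually_at_right_less)
    then show ?thesis
    proof eventually_elim
      case (elim s)
      then show ?case using True le by (intro add_mono mult_left_mono) auto
    qed
  next
    case False
    then have lt: "\<theta> k < \<theta> (Suc k)" using feas[OF k] by simp
    have "((\<lambda>s. \<theta> (Suc k) + s * d (Suc k) - (\<theta> k + s * d k)) \<longlongrightarrow> \<theta> (Suc k) + 0 * d (Suc k) - (\<theta> k + 0 * d k)) (at_right 0)"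
      by (intro tendsto_intros)
    then have "\<forall>\<^sub>F s in at_right 0. \<theta> (Suc k) + s * d (Suc k) - (\<theta> k + s * d k) > 0"
      using lt by (intro order_tendstoD(1)) auto
    then show ?thesis by eventually_elim simp
  qed
  then have "\<forall>\<^sub>F s in at_right 0. \<forall>k\<in>{..<q}. \<theta> k + s * d k \<le> \<theta> (Suc k) + s * d (Suc k)"
    by (intro eventually_ball_finite) auto
  moreover have "\<forall>\<^sub>F s in at_right 0. s < e" using e(1) eventually_at_right_field by blast
  moreover have "\<forall>\<^sub>F s in at_right (0::real). s > 0" by (rule eventually_at_right_less)
  ultimately have "\<forall>\<^sub>F s in at_right 0. (\<forall>k\<in>{..<q}. \<theta> k + s * d k \<le> \<theta> (Suc k) + s * d (Suc k)) \<and> s < e \<and> s > 0"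
    by eventually_elim auto
  then obtain s where s: "\<forall>k\<in>{..<q}. \<theta> k + s * d k \<le> \<theta> (Suc k) + s * d (Suc k)" "s < e" "s > 0"
    using eventually_happens[of _ "at_right (0::real)"] by auto
  have "?\<theta> s \<in> sym_polys q"
    using \<theta>(1) d s(1) unfolding sym_polys_def by (auto simp: algebra_simps)
  then have "poly_length z q (?\<theta> s) \<le> poly_length z q \<theta>" by (rule \<theta>(2))
  then show False using e(2)[OF s(3,2)] by simp
qed

text \<open>Vertex \<open>j\<close> and its mirror image have to move with opposite angular speeds;
  as a reflection preserves inner products, both contribute the same amount. A vertex on the axis,
  \<open>2 * j = q\<close>, cannot move at all.\<close>

lemma pair_direction_sum:
  assumes \<theta>: "\<theta> \<in> sym_polys q" and j: "1 \<le> j" "j < q" "2 * j \<noteq> q"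
    and d: "d = (\<lambda>k. if k = j then c else if k = q - j then - c else (0::real))"
    and v: "v = (\<lambda>k. (d k * \<rho> (\<theta> k)) *\<^sub>R Tv (\<theta> k))"
  shows "v (q - j) = Rf (v j)" "(\<Sum>k<q. edge \<theta> k \<bullet> (v (Suc k) - v k)) = 2 * ((edge \<theta> (j - 1) - edge \<theta> j) \<bullet> v j)"
proof -
  have jn: "q - j \<noteq> j" using j by auto
  have \<theta>j: "\<theta> (q - j) = 2 * pi - \<theta> j" using sym_polys_sym[OF \<theta>, of j] j by simp
  show vj: "v (q - j) = Rf (v j)" using jn by (simp add: v d \<theta>j \<rho>_sym2 Rf_Tv)
  have v0: "v 0 = 0" "v q = 0" using j by (auto simp: v d)
  have "(\<Sum>k<q. edge \<theta> k \<bullet> (v (Suc k) - v k)) = (\<Sum>k\<in>{1..<q}. (edge \<theta> (k - 1) - edge \<theta> k) \<bullet> v k)"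
    using sum_chord_by_parts[of q "edge \<theta>" v] j v0 by simp
  also have "\<dots> = (\<Sum>k\<in>{j, q - j}. (edge \<theta> (k - 1) - edge \<theta> k) \<bullet> v k)"
    using j by (intro sum.mono_neutral_right) (auto simp: v d)
  also have "\<dots> = (edge \<theta> (j - 1) - edge \<theta> j) \<bullet> v j + (edge \<theta> (q - j - 1) - edge \<theta> (q - j)) \<bullet> v (q - j)"
    using jn by simp
  also have "edge \<theta> (q - j - 1) - edge \<theta> (q - j) = Rf (edge \<theta> (j - 1) - edge \<theta> j)"
    using edge_sym[OF \<theta>, of j] edge_sym[OF \<theta>, of "j - 1"] j by simp
  finally show "(\<Sum>k<q. edge \<theta> k \<bullet> (v (Suc k) - v k)) = 2 * ((edge \<theta> (j - 1) - edge \<theta> j) \<bullet> v j)"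
    unfolding vj Rf_simps(7) by simp
qed

text \<open>If vertices coincide, pull the last one of the cluster away from it. The degenerate side
  grows at the full speed \<open>\<rho> (\<theta> j)\<close>, while the next side shrinks at a
  strictly smaller rate, because its direction differs from the tangent; so the perimeter would
  increase.\<close>

lemma max_poly_strict:
  assumes q: "q \<ge> 2" and \<theta>: "\<theta> \<in> sym_polys q" "\<And>\<theta>'. \<theta>' \<in> sym_polys q \<Longrightarrow> poly_length z q \<theta>' \<le> poly_length z q \<theta>"
    and k: "k < q"
  shows "\<theta> k < \<theta> (Suc k)"
proof (rule ccontr)
  assume "\<not> ?thesis"
  then have eq: "\<theta> k = \<theta> (Suc k)" using \<theta>(1) k by (simp add: sym_polys_def antisym)
  \<comment> \<open>A cluster at the end value \<open>2 * pi\<close> has no later vertex to move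
    towards; its mirror image at angle 0 has one.\<close>
  obtain i where i: "i < q" "\<theta> i = \<theta> (Suc i)" "\<theta> i \<noteq> 2 * pi"
  proof (cases "\<theta> k = 2 * pi")
    case True
    have "\<theta> (q - Suc k) = 2 * pi - \<theta> (Suc k)" "\<theta> (q - k) = 2 * pi - \<theta> k" using sym_polys_sym[OF \<theta>(1)] k by auto
    then have "\<theta> (q - Suc k) = 0" "\<theta> (Suc (q - Suc k)) = 0" using True eq k by (auto simp: Suc_diff_Suc)
    then show ?thesis using that[of "q - Suc k"] k by simp
  qed (use that k eq in blast)
  define j where "j = Max {l. l \<le> q \<and> \<theta> l = \<theta> i}"
  have jmem: "j \<in> {l. l \<le> q \<and> \<theta> l = \<theta> i}" unfolding j_def using i by (intro Max_in) (auto intro!: exI[of _ "Suc i"])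
  have jmax: "l \<le> j" if "l \<le> q" "\<theta> l = \<theta> i" for l unfolding j_def using that by (intro Max_ge) auto
  have ij: "Suc i \<le> j" using jmax[of "Suc i"] i by simp
  have jq: "j < q" using jmem i(3) sym_polys_last[OF \<theta>(1)] by (metis (mono_tags, lifting) mem_Collect_eq nat_less_le)
  have j1: "1 \<le> j" using ij by simp
  have gt: "\<theta> j < \<theta> (Suc j)"
  proof -
    have "\<theta> j \<le> \<theta> (Suc j)" using \<theta>(1) jq by (simp add: sym_polys_def)
    moreover have "\<theta> (Suc j) \<noteq> \<theta> i" using jmax[of "Suc j"] jq by auto
    ultimately show ?thesis using jmem by auto
  qed
  have eqj: "\<theta> (j - 1) = \<theta> j"
  proof -
    have "\<theta> i \<le> \<theta> (j - 1)" "\<theta> (j - 1) \<le> \<theta> j" using ij jq by (auto intro!: sym_polys_mono[OF \<theta>(1)])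
    then show ?thesis using jmem by simp
  qed
  have symj: "\<theta> (q - j) = 2 * pi - \<theta> j" "\<theta> (q - (j - 1)) = 2 * pi - \<theta> (j - 1)" "\<theta> (q - Suc j) = 2 * pi - \<theta> (Suc j)"
    using sym_polys_sym[OF \<theta>(1)] jq by auto
  have s1: "Suc (q - j) = q - (j - 1)" "Suc (q - Suc j) = q - j" using j1 jq by auto
  \<comment> \<open>At an axis vertex, coincidence with the previous vertex would by symmetry give
    coincidence with the next one, against the choice of \<open>j\<close> as the last index of the
    cluster.\<close>
  have j2: "2 * j \<noteq> q"
  proof
    assume "2 * j = q"
    then have "q - j = j" "q - (j - 1) = Suc j" using j1 by auto
    then show False using symj eqj gt by simp
  qed
  define d where "d = (\<lambda>k. if k = j then 1 else if k = q - j then - 1 else (0::real))"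
  define v where "v = (\<lambda>k. (d k * \<rho> (\<theta> k)) *\<^sub>R Tv (\<theta> k))"
  note pd = pair_direction_sum[OF \<theta>(1) j1 jq j2 d_def v_def]
  have "(\<Sum>k<q. edge \<theta> k \<bullet> (v (Suc k) - v k) + (if z (\<theta> (Suc k)) = z (\<theta> k) then norm (v (Suc k) - v k) else 0)) \<le> 0"
  proof (rule max_poly_direction[OF \<theta> _ _ _ _ v_def])
    show "d 0 = 0" using j1 jq by (simp add: d_def)
    show "d (q - k) = - d k" if "k \<le> q" for k using that j1 jq j2 unfolding d_def by (cases "k = q - j"; cases "k = j") auto
    show "d k = 0" if "k > q" for k using that jq by (simp add: d_def)
    show "\<theta> k < \<theta> (Suc k) \<or> d k \<le> d (Suc k)" if "k < q" for k
    \<comment> \<open>Only the gap after \<open>j\<close> and its mirror image can shrink, and these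
      two are positive.\<close>
    proof (cases "k = j \<or> k = q - Suc j")
      case True
      then show ?thesis using gt symj(1,3) s1(2) by auto
    next
      case False
      then have "d k \<le> 0" "Suc k \<noteq> q - j" using s1 that by (auto simp: d_def)
      moreover have "d (Suc k) \<ge> 0" using calculation by (simp add: d_def)
      ultimately show ?thesis by simp
    qed
  qed
  then have le: "2 * ((edge \<theta> (j - 1) - edge \<theta> j) \<bullet> v j) + (\<Sum>k<q. (if z (\<theta> (Suc k)) = z (\<theta> k) then norm (v (Suc k) - v k) else 0)) \<le> 0"
    unfolding sum.distrib pd(2) .
  have vj: "v j = \<rho> (\<theta> j) *\<^sub>R Tv (\<theta> j)" by (simp add: v_def d_def)
  have e0: "edge \<theta> (j - 1) = 0" using eqj j1 by (simp add: edge_def)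
  have "edge \<theta> j \<bullet> Tv (\<theta> j) < 1"
  \<comment> \<open>After a full turn the next side would be degenerate as well, and its
    \<open>edge\<close> is \<open>sgn 0 = 0\<close>.\<close>
  proof (cases "\<theta> (Suc j) < \<theta> j + 2 * pi")
    case False
    moreover have "\<theta> (Suc j) \<le> 2 * pi" "\<theta> j \<ge> 0" using sym_polys_bounds[OF \<theta>(1)] by (auto simp: atLeastAtMost_def)
    ultimately have "\<theta> (Suc j) = \<theta> j + 2 * pi" by linarith
    then show ?thesis using z_per[of "\<theta> j"] by (simp add: edge_def)
  next
    case lt2: True
    obtain \<alpha> where a: "\<theta> j < \<alpha>" "\<alpha> - \<theta> j < pi" "sgn (z (\<theta> (Suc j)) - z (\<theta> j)) = Tv \<alpha>" using chord_angle[OF gt lt2] by metis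
    have "cos (\<alpha> - \<theta> j) < cos 0" using a by (intro cos_monotone_0_pi) auto
    then show ?thesis using a(3) by (simp add: edge_def inner_Tv_Tv)
  qed
  then have "- (edge \<theta> j \<bullet> v j) > - \<rho> (\<theta> j)" using \<rho>_pos[of "\<theta> j"] by (simp add: vj)
  moreover have "(\<Sum>k<q. (if z (\<theta> (Suc k)) = z (\<theta> k) then norm (v (Suc k) - v k) else 0)) \<ge> 2 * \<rho> (\<theta> j)"
  proof -
    let ?g = "\<lambda>k. (if z (\<theta> (Suc k)) = z (\<theta> k) then norm (v (Suc k) - v k) else 0)"
    have nv: "norm (v j) = \<rho> (\<theta> j)" "norm (v (q - j)) = \<rho> (\<theta> j)" using \<rho>_pos[of "\<theta> j"] by (simp_all add: pd(1) vj)
    have z1: "z (\<theta> (Suc (j - 1))) = z (\<theta> (j - 1))" "z (\<theta> (Suc (q - j))) = z (\<theta> (q - j))"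
      using eqj symj s1 j1 by simp_all
    show ?thesis
    \<comment> \<open>If the mirror image of \<open>j\<close> is its predecessor, the two degenerate
      sides are one and the same; its end points then separate at twice the speed.\<close>
    proof (cases "q - j = j - 1")
      case False
      have "v (j - 1) = 0" "v (Suc (q - j)) = 0" using False j1 jq j2 s1 by (auto simp: v_def d_def)
      then have "?g (j - 1) + ?g (q - j) = 2 * \<rho> (\<theta> j)" using z1 nv j1 by simp
      moreover have "?g (j - 1) + ?g (q - j) = sum ?g {j - 1, q - j}" using False by simp
      moreover have "sum ?g {j - 1, q - j} \<le> sum ?g {..<q}" using jq j1 by (intro sum_mono2) auto
      ultimately show ?thesis by simp
    next
      case True
      have "\<theta> j = pi" using symj(1) eqj True by simp
      then have "Rf (v j) = - v j" unfolding vj by (simp add: vec2_eq_iff)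
      then have "v (Suc (j - 1)) - v (j - 1) = 2 *\<^sub>R v j" using pd(1) True j1 by (simp add: scaleR_2)
      then have "?g (j - 1) = 2 * \<rho> (\<theta> j)" using z1 nv by simp
      moreover have "?g (j - 1) \<le> sum ?g {..<q}" using jq j1 by (intro member_le_sum) auto
      ultimately show ?thesis by simp
    qed
  qed
  ultimately show False using le e0 by (simp add: inner_diff_left)
qed

text \<open>With distinct vertices the pair direction is admissible with either sign, so its
  derivative vanishes. The vertex opposite the marked point cannot be moved; there the two adjacent
  sides are mirror images, which is the law.\<close>

lemma max_poly_critical:
  assumes q: "q \<ge> 2" and \<theta>: "\<theta> \<in> sym_polys q" "\<And>\<theta>'. \<theta>' \<in> sym_polys q \<Longrightarrow> poly_length z q \<theta>' \<le> poly_length z q \<theta>"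
    and j: "1 \<le> j" "j < q"
  shows "edge \<theta> (j - 1) \<bullet> Tv (\<theta> j) = edge \<theta> j \<bullet> Tv (\<theta> j)"
proof (cases "2 * j = q")
  case True
  then have qj: "q - j = j" by simp
  have "\<theta> j = pi" using sym_polys_sym[OF \<theta>(1), of j] j qj by simp
  moreover have "edge \<theta> (j - 1) = - Rf (edge \<theta> j)" using edge_sym[OF \<theta>(1), of j] True j
    by (metis diff_Suc_eq_diff_pred diff_commute qj)
  ultimately show ?thesis by (simp add: inner_vec2)
next
  case False
  have strict: "\<theta> k < \<theta> (Suc k)" if "k < q" for k using max_poly_strict[OF q \<theta> that] .
  have key: "c * (\<rho> (\<theta> j) * ((edge \<theta> (j - 1) - edge \<theta> j) \<bullet> Tv (\<theta> j))) \<le> 0" for c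
  proof -
    define d where "d = (\<lambda>k. if k = j then c else if k = q - j then - c else (0::real))"
    define v where "v = (\<lambda>k. (d k * \<rho> (\<theta> k)) *\<^sub>R Tv (\<theta> k))"
    note pd = pair_direction_sum[OF \<theta>(1) j False d_def v_def]
    have "(\<Sum>k<q. edge \<theta> k \<bullet> (v (Suc k) - v k) + (if z (\<theta> (Suc k)) = z (\<theta> k) then norm (v (Suc k) - v k) else 0)) \<le> 0"
    proof (rule max_poly_direction[OF \<theta> _ _ _ _ v_def])
      show "d 0 = 0" using j by (simp add: d_def)
      show "d (q - k) = - d k" if "k \<le> q" for k using that j False unfolding d_def by (cases "k = q - j"; cases "k = j") auto
      show "d k = 0" if "k > q" for k using that j by (simp add: d_def)
      show "\<theta> k < \<theta> (Suc k) \<or> d k \<le> d (Suc k)" if "k < q" for k using strict[OF that] by simp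
    qed
    moreover have "(\<Sum>k<q. (if z (\<theta> (Suc k)) = z (\<theta> k) then norm (v (Suc k) - v k) else 0)) \<ge> 0" by (intro sum_nonneg) auto
    ultimately have "2 * ((edge \<theta> (j - 1) - edge \<theta> j) \<bullet> v j) \<le> 0" unfolding sum.distrib pd(2) by linarith
    moreover have "v j = (c * \<rho> (\<theta> j)) *\<^sub>R Tv (\<theta> j)" by (simp add: v_def d_def)
    ultimately show ?thesis by (simp add: mult.assoc)
  qed
  have "\<rho> (\<theta> j) * ((edge \<theta> (j - 1) - edge \<theta> j) \<bullet> Tv (\<theta> j)) = 0" using key[of 1] key[of "-1"] by simp
  then show ?thesis using \<rho>_pos[of "\<theta> j"] by (simp add: inner_diff_left)
qed

text \<open>Criticality only equates cosines; both angles lie in the open interval from 0 to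
  \<open>pi\<close> by \<open>chord_angle\<close>, where the cosine is injective. At the marked
  point, which is never varied, the first and the last side are mirror images.\<close>

lemma max_poly_orbit:
  assumes q: "q \<ge> 2" and \<theta>: "\<theta> \<in> sym_polys q" "\<And>\<theta>'. \<theta>' \<in> sym_polys q \<Longrightarrow> poly_length z q \<theta>' \<le> poly_length z q \<theta>"
  shows "\<exists>\<phi>. orbit z q \<theta> \<phi>"
proof -
  have strict: "\<theta> k < \<theta> (Suc k)" if "k < q" for k using max_poly_strict[OF q \<theta> that] .
  have last: "\<theta> q = 2 * pi" and first: "\<theta> 0 = 0" using \<theta>(1) sym_polys_last[OF \<theta>(1)] by (simp_all add: sym_polys_def)
  \<comment> \<open>Here \<open>q \<ge> 2\<close> enters: another side takes up part of the full
    turn.\<close>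
  have gap: "\<theta> (Suc k) < \<theta> k + 2 * pi" if "k < q" for k
  proof (cases "k = 0")
    case True
    have "\<theta> 1 < \<theta> (Suc 1)" using q by (intro strict) simp
    also have "\<dots> \<le> \<theta> q" using q by (intro sym_polys_mono[OF \<theta>(1)]) auto
    finally show ?thesis using True last first by simp
  next
    case False
    have "\<theta> 0 < \<theta> (Suc 0)" using q by (intro strict) simp
    also have "\<dots> \<le> \<theta> k" using False that by (intro sym_polys_mono[OF \<theta>(1)]) auto
    finally have "\<theta> k > 0" using first by simp
    moreover have "\<theta> (Suc k) \<le> 2 * pi" using sym_polys_bounds[OF \<theta>(1), of "Suc k"] by simp
    ultimately show ?thesis by linarith
  qed
  have "\<forall>k. \<exists>\<alpha>. k < q \<longrightarrow> \<theta> k < \<alpha> \<and> \<alpha> < \<theta> (Suc k) \<and> \<alpha> - \<theta> k < pi \<and> \<theta> (Suc k) - \<alpha> < pi \<and> edge \<theta> k = Tv \<alpha>"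
  proof
    fix k show "\<exists>\<alpha>. k < q \<longrightarrow> \<theta> k < \<alpha> \<and> \<alpha> < \<theta> (Suc k) \<and> \<alpha> - \<theta> k < pi \<and> \<theta> (Suc k) - \<alpha> < pi \<and> edge \<theta> k = Tv \<alpha>"
    proof (cases "k < q")
      case True
      show ?thesis using chord_angle[OF strict[OF True] gap[OF True]] unfolding edge_def by metis
    qed simp
  qed
  from choice[OF this] obtain \<alpha> where \<alpha>: "\<And>k. k < q \<Longrightarrow> \<theta> k < \<alpha> k" "\<And>k. k < q \<Longrightarrow> \<alpha> k < \<theta> (Suc k)"
    "\<And>k. k < q \<Longrightarrow> \<alpha> k - \<theta> k < pi" "\<And>k. k < q \<Longrightarrow> \<theta> (Suc k) - \<alpha> k < pi" "\<And>k. k < q \<Longrightarrow> edge \<theta> k = Tv (\<alpha> k)" by blast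
  define \<phi> where "\<phi> = (\<lambda>k. if k < q then \<alpha> k - \<theta> k else \<theta> q - \<alpha> (q - 1))"
  have cosinj: "x = y" if "cos x = cos y" "0 < x" "x < pi" "0 < y" "y < pi" for x y :: real
    using cos_inj_pi[of x y] that by simp
  have step: "\<theta> (Suc k) - \<alpha> k = \<phi> (Suc k)" if k: "k < q" for k
  proof (cases "Suc k < q")
    case False
    then have "Suc k = q" using k by simp
    then show ?thesis by (auto simp: \<phi>_def)
  next
    case True
    have "edge \<theta> k \<bullet> Tv (\<theta> (Suc k)) = edge \<theta> (Suc k) \<bullet> Tv (\<theta> (Suc k))"
      using max_poly_critical[OF q \<theta>, of "Suc k"] True by simp
    then have "cos (\<theta> (Suc k) - \<alpha> k) = cos (\<alpha> (Suc k) - \<theta> (Suc k))"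
      using \<alpha>(5)[OF k] \<alpha>(5)[OF True] by (simp add: inner_Tv_Tv) (metis cos_minus minus_diff_eq)
    then have "\<theta> (Suc k) - \<alpha> k = \<alpha> (Suc k) - \<theta> (Suc k)"
      by (rule cosinj) (use \<alpha>(2)[OF k] \<alpha>(4)[OF k] \<alpha>(1)[OF True] \<alpha>(3)[OF True] in auto)
    then show ?thesis using True by (simp add: \<phi>_def)
  qed
  have "\<phi> q = \<phi> 0"
  proof -
    have e: "edge \<theta> (q - 1) = - Rf (edge \<theta> 0)" using edge_sym[OF \<theta>(1), of 0] q by simp
    have "edge \<theta> (q - 1) \<bullet> Tv 0 = edge \<theta> 0 \<bullet> Tv 0" unfolding e by (simp add: inner_vec2)
    then have "Tv (\<alpha> (q - 1)) \<bullet> Tv (2 * pi) = Tv (\<alpha> 0) \<bullet> Tv 0" using \<alpha>(5)[of 0] \<alpha>(5)[of "q - 1"] q by simp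
    then have "cos (2 * pi - \<alpha> (q - 1)) = cos (\<alpha> 0)"
      unfolding inner_Tv_Tv by (metis cos_minus minus_diff_eq diff_zero)
    then have "2 * pi - \<alpha> (q - 1) = \<alpha> 0"
      by (rule cosinj) (use \<alpha>(1-4)[of 0] \<alpha>(1-4)[of "q - 1"] q last first in auto)
    then show ?thesis using q last first by (simp add: \<phi>_def)
  qed
  moreover have "0 < \<phi> k \<and> \<phi> k < pi" if "k \<le> q" for k
    using that \<alpha>(1,3)[of k] \<alpha>(2,4)[of "q - 1"] q by (auto simp: \<phi>_def)
  moreover have "\<theta> (Suc k) = \<theta> k + \<phi> k + \<phi> (Suc k) \<and> z (\<theta> (Suc k)) \<noteq> z (\<theta> k) \<and>
        sgn (z (\<theta> (Suc k)) - z (\<theta> k)) = Tv (\<theta> k + \<phi> k)" if "k < q" for k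
    using step[OF that] that \<alpha>(5)[OF that] z_neq[OF strict[OF that] gap[OF that]] by (simp add: \<phi>_def edge_def)
  ultimately show ?thesis unfolding orbit_def using last first by blast
qed

end

text \<open>By convexity of the norm each side is at least its first-order expansion at the first curve; summation by
  parts and the reflection law leave only the normal components.\<close>

lemma poly_length_compare:
  assumes q: "q \<ge> 1" and orb: "orbit z q \<theta> \<phi>" and z0: "z 0 = 0" "z (2*pi) = 0" "z' 0 = 0" "z' (2*pi) = 0"
  shows "poly_length z' q \<theta> \<ge> poly_length z q \<theta> + (\<Sum>k\<in>{1..<q}. 2 * sin (\<phi> k) * ((z' (\<theta> k) - z (\<theta> k)) \<bullet> Nv (\<theta> k)))"
proof -
  define w where "w = (\<lambda>k. z' (\<theta> k) - z (\<theta> k))"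
  define e where "e = (\<lambda>k. sgn (z (\<theta> (Suc k)) - z (\<theta> k)))"
  have o: "\<theta> 0 = 0" "\<theta> q = 2 * pi" "\<And>k. k < q \<Longrightarrow> \<theta> (Suc k) = \<theta> k + \<phi> k + \<phi> (Suc k)" "\<And>k. k < q \<Longrightarrow> e k = Tv (\<theta> k + \<phi> k)"
    using orb unfolding orbit_def e_def by auto
  have "norm (z' (\<theta> (Suc k)) - z' (\<theta> k)) \<ge> norm (z (\<theta> (Suc k)) - z (\<theta> k)) + e k \<bullet> (w (Suc k) - w k)" if "k < q" for k
  proof -
    have n1: "norm (e k) = 1" using o(4)[OF that] by simp
    have "norm (z (\<theta> (Suc k)) - z (\<theta> k)) = e k \<bullet> (z (\<theta> (Suc k)) - z (\<theta> k))"
      unfolding e_def sgn_div_norm using orb that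
      by (auto simp: power2_norm_eq_inner[symmetric] power2_eq_square orbit_def)
    then have "norm (z (\<theta> (Suc k)) - z (\<theta> k)) + e k \<bullet> (w (Suc k) - w k) = e k \<bullet> (z' (\<theta> (Suc k)) - z' (\<theta> k))"
      by (simp add: w_def inner_diff_right)
    also have "\<dots> \<le> norm (e k) * norm (z' (\<theta> (Suc k)) - z' (\<theta> k))" by (rule norm_cauchy_schwarz)
    finally show ?thesis using n1 by simp
  qed
  then have "poly_length z' q \<theta> \<ge> (\<Sum>k<q. norm (z (\<theta> (Suc k)) - z (\<theta> k)) + e k \<bullet> (w (Suc k) - w k))"
    unfolding poly_length_def by (intro sum_mono) auto
  moreover have "(\<Sum>k<q. e k \<bullet> (w (Suc k) - w k)) = (\<Sum>k\<in>{1..<q}. (e (k - 1) - e k) \<bullet> w k)"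
    using sum_chord_by_parts[OF q, of e w] o(1,2) z0 by (simp add: w_def)
  moreover have "(\<Sum>k\<in>{1..<q}. (e (k - 1) - e k) \<bullet> w k) = (\<Sum>k\<in>{1..<q}. 2 * sin (\<phi> k) * ((z' (\<theta> k) - z (\<theta> k)) \<bullet> Nv (\<theta> k)))"
  proof (rule sum.cong)
    fix k assume k: "k \<in> {1..<q}"
    have k1: "k - 1 < q" "Suc (k - 1) = k" using k by auto
    have "\<theta> k + (- \<phi> k) = \<theta> (k - 1) + \<phi> (k - 1)" using o(3)[OF k1(1)] unfolding k1(2) by simp
    then have "e (k - 1) = Tv (\<theta> k + (- \<phi> k))" using o(4)[OF k1(1)] by simp
    moreover have "e k = Tv (\<theta> k + \<phi> k)" using o(4) k by simp
    ultimately have "e (k - 1) - e k = (2 * sin (\<phi> k)) *\<^sub>R Nv (\<theta> k)"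
      unfolding Tv_add by (simp add: vec2_eq_iff)
    then show "(e (k - 1) - e k) \<bullet> w k = 2 * sin (\<phi> k) * ((z' (\<theta> k) - z (\<theta> k)) \<bullet> Nv (\<theta> k))"
      by (simp add: w_def inner_commute)
  qed simp
  ultimately show ?thesis by (simp add: sum.distrib poly_length_def)
qed

section \<open>Lengths of closed geodesics\<close>

lemma periodic_int:
  fixes f :: "real \<Rightarrow> 'a"
  assumes "\<And>t. f (t + 2 * pi) = f t"
  shows "f (t + 2 * pi * of_int m) = f t"
proof -
  have n: "f (t + 2 * pi * of_nat n) = f t" for n t
  proof (induction n)
    case (Suc n) then show ?case using assms[of "t + 2 * pi * of_nat n"] by (simp add: algebra_simps)
  qed simp
  show ?thesis
  proof (cases "m \<ge> 0")
    case True then show ?thesis using n[of t "nat m"] by simp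
  next
    case False then show ?thesis using n[of "t + 2 * pi * of_int m" "nat (-m)"] by (simp add: algebra_simps)
  qed
qed

lemma reduce_2pi:
  obtains m :: int where "a \<le> t + 2 * pi * of_int m" "t + 2 * pi * of_int m < a + 2 * pi"
proof -
  define m where "m = - \<lfloor>(t - a) / (2 * pi)\<rfloor>"
  have "of_int (- m) \<le> (t - a) / (2 * pi)" "(t - a) / (2 * pi) < of_int (- m) + 1" unfolding m_def by linarith+
  then have "of_int (- m) * (2 * pi) \<le> t - a" "t - a < (of_int (- m) + 1) * (2 * pi)"
    by (simp_all add: pos_le_divide_eq pos_divide_less_eq del: of_int_minus)
  then show thesis by (intro that[of m]) (simp_all add: algebra_simps)
qed

lemma sgn_lipschitz:
  fixes x y :: "'a::real_normed_vector"
  assumes "m > 0" "norm x \<ge> m" "y \<noteq> 0"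
  shows "norm (sgn x - sgn y) \<le> 2 / m * norm (x - y)"
proof -
  have x: "x \<noteq> 0" using assms by auto
  have "sgn x - sgn y = (1 / norm x) *\<^sub>R (x - y) + (1 / norm x - 1 / norm y) *\<^sub>R y"
    by (simp add: sgn_div_norm algebra_simps divide_inverse)
  then have "norm (sgn x - sgn y) \<le> norm ((1 / norm x) *\<^sub>R (x - y)) + norm ((1 / norm x - 1 / norm y) *\<^sub>R y)"
    by (metis norm_triangle_ineq)
  also have "norm ((1 / norm x - 1 / norm y) *\<^sub>R y) = \<bar>norm y - norm x\<bar> / norm x"
  proof -
    have "(1 / norm x - 1 / norm y) * norm y = (norm y - norm x) / norm x" using x assms(3) by (simp add: field_simps)
    then show ?thesis by (metis abs_divide abs_mult abs_norm_cancel norm_scaleR real_norm_def)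
  qed
  also have "\<dots> \<le> norm (x - y) / norm x" by (intro divide_right_mono) (auto simp: norm_minus_commute norm_triangle_ineq3 abs_minus_commute)
  finally have "norm (sgn x - sgn y) \<le> 2 * (norm (x - y) / norm x)" by simp
  also have "\<dots> \<le> 2 * (norm (x - y) / m)" using assms x by (intro mult_left_mono divide_left_mono mult_pos_pos) auto
  finally show ?thesis by simp
qed

lemma lipschitz_of_vector_derivative:
  fixes f :: "real \<Rightarrow> 'a::real_normed_vector"
  assumes "\<And>t. (f has_vector_derivative f' t) (at t)" "\<And>t. norm (f' t) \<le> B"
  shows "norm (f a - f b) \<le> B * \<bar>a - b\<bar>"
proof -
  have "norm (f a - f b) \<le> B * norm (a - b)"
  proof (rule differentiable_bound[of UNIV f "\<lambda>x h. h *\<^sub>R f' x"])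
    show "(f has_derivative (\<lambda>h. h *\<^sub>R f' x)) (at x within UNIV)" for x
      using assms(1)[of x] by (simp add: has_vector_derivative_def)
    show "onorm (\<lambda>h. h *\<^sub>R f' x) \<le> B" for x
      by (rule onorm_le) (simp add: assms(2) mult.commute[of B] mult_left_mono)
  qed auto
  then show ?thesis by simp
qed

lemma Tv_lipschitz: "norm (Tv a - Tv b) \<le> \<bar>a - b\<bar>"
  using lipschitz_of_vector_derivative[of Tv "\<lambda>t. - Nv t" 1 a b] Tv_has_vector_derivative by simp

context curve
begin

lemma z_eq_iff_ex: "z s = z t \<longleftrightarrow> (\<exists>m::int. s = t + 2 * pi * of_int m)"
proof
  assume eq: "z s = z t"
  obtain m :: int where m: "t \<le> s + 2 * pi * of_int m" "s + 2 * pi * of_int m < t + 2 * pi" using reduce_2pi[of t s] by blast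
  have "z (s + 2 * pi * of_int m) = z t" using eq periodic_int[of z, OF z_per] by simp
  then have "s + 2 * pi * of_int m = t" using z_neq[of t "s + 2 * pi * of_int m"] m by fastforce
  then show "\<exists>m::int. s = t + 2 * pi * of_int m" by (intro exI[of _ "- m"]) simp
qed (use periodic_int[of z, OF z_per] in auto)

lemma \<rho>_bounds: obtains r R where "0 < r" "\<And>t. r \<le> \<rho> t" "\<And>t. \<rho> t \<le> R" "0 < R"
proof -
  have c: "compact {0..2*pi::real}" "{0..2*pi::real} \<noteq> {}" by auto
  have co: "continuous_on {0..2*pi} \<rho>" using \<rho>_cont continuous_on_subset by blast
  obtain a where a: "a \<in> {0..2*pi}" "\<And>x. x \<in> {0..2*pi} \<Longrightarrow> \<rho> a \<le> \<rho> x" using continuous_attains_inf[OF c co] by blast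
  obtain b where b: "b \<in> {0..2*pi}" "\<And>x. x \<in> {0..2*pi} \<Longrightarrow> \<rho> x \<le> \<rho> b" using continuous_attains_sup[OF c co] by blast
  have "\<rho> a \<le> \<rho> t \<and> \<rho> t \<le> \<rho> b" for t
  proof -
    obtain m :: int where m: "0 \<le> t + 2 * pi * of_int m" "t + 2 * pi * of_int m < 0 + 2 * pi" using reduce_2pi[of 0 t] by blast
    then show ?thesis using a(2)[of "t + 2 * pi * of_int m"] b(2)[of "t + 2 * pi * of_int m"] periodic_int[of \<rho> t m, OF \<rho>_per] by auto
  qed
  then show thesis using that[of "\<rho> a" "\<rho> b"] \<rho>_pos by blast
qed

section \<open>Uniform twist of the billiard map\<close>

lemma chord_normal_lower:
  assumes "\<eta> > 0" "\<eta> \<le> pi"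
  obtains m where "m > 0" "\<And>b g. \<eta> \<le> g \<Longrightarrow> g \<le> 2 * pi - \<eta> \<Longrightarrow> (z (b + g) - z b) \<bullet> Nv b \<le> - m"
proof -
  let ?K = "{0..2*pi} \<times> {\<eta>..2*pi-\<eta>}"
  let ?f = "\<lambda>x. (z (fst x + snd x) - z (fst x)) \<bullet> Nv (fst x)"
  have Nc: "continuous_on UNIV Nv"
    by (rule continuous_at_imp_continuous_on) (auto intro: has_vector_derivative_continuous Nv_has_vector_derivative)
  have "continuous_on ?K ?f"
    by (intro continuous_intros continuous_on_compose2[OF z_cont[of UNIV]] continuous_on_compose2[OF Nc]) auto
  moreover have "compact ?K" "?K \<noteq> {}" using assms by (auto intro: compact_Times)
  ultimately obtain x where x: "x \<in> ?K" "\<And>y. y \<in> ?K \<Longrightarrow> ?f y \<le> ?f x" using continuous_attains_sup[of ?K ?f] by blast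
  have neg: "?f x < 0" using chord_normal_neg[of "snd x" "fst x"] x(1) assms by (auto simp: mem_Times_iff)
  have "(z (b + g) - z b) \<bullet> Nv b \<le> ?f x" if "\<eta> \<le> g" "g \<le> 2 * pi - \<eta>" for b g
  proof -
    obtain m :: int where m: "0 \<le> b + 2 * pi * of_int m" "b + 2 * pi * of_int m < 0 + 2 * pi" using reduce_2pi[of 0 b] by blast
    have "?f (b + 2 * pi * of_int m, g) \<le> ?f x" using m that by (intro x(2)) auto
    moreover have "z (b + 2 * pi * of_int m) = z b" "z (b + g + 2 * pi * of_int m) = z (b + g)" "Nv (b + 2 * pi * of_int m) = Nv b"
      using periodic_int[of z, OF z_per] periodic_int[of Nv b m] by (auto simp: vec2_eq_iff)
    ultimately show ?thesis by (simp add: add.assoc add.commute add.left_commute)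
  qed
  then show thesis using that[of "- ?f x"] neg by simp
qed

definition chord_dir :: "real \<Rightarrow> real \<Rightarrow> real^2" where "chord_dir b g = sgn (z (b + g) - z b)"

text \<open>The twist property of billiards: with the foot point \<open>b\<close> fixed, the cosine
  of the outgoing angle is strictly decreasing in the gap \<open>g\<close>. The derivative is minus
  \<open>\<rho>\<close> times the sines of the angles at the two ends of the chord, divided by its
  length.\<close>

lemma chord_dir_twist_deriv:
  assumes "0 < g" "g < 2 * pi"
  shows "((\<lambda>g. Tv b \<bullet> chord_dir b g) has_real_derivative
      - \<rho> (b + g) * (- (chord_dir b g \<bullet> Nv b)) * (chord_dir b g \<bullet> Nv (b + g)) / norm (z (b + g) - z b)) (at g within S)"
proof -
  let ?D = "\<lambda>g. z (b + g) - z b"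
  obtain \<alpha> where \<alpha>: "chord_dir b g = Tv \<alpha>" using chord_angle[of b "b + g"] assms unfolding chord_dir_def by auto
  have D0: "?D g \<noteq> 0" using z_neq[of b "b + g"] assms by simp
  have Dd: "(?D has_vector_derivative \<rho> (b + g) *\<^sub>R Tv (b + g)) (at g within S)"
    using has_vector_derivative_diff[OF z_shift_deriv has_vector_derivative_const] by simp
  have nd: "((\<lambda>g. norm (?D g)) has_real_derivative (\<rho> (b + g) *\<^sub>R Tv (b + g)) \<bullet> sgn (?D g)) (at g within S)"
    using has_derivative_compose[OF Dd[unfolded has_vector_derivative_def] has_derivative_norm[OF D0]]
    by (simp add: has_field_derivative_def mult_commute_abs mult.assoc mult.commute mult.left_commute)
  have "((\<lambda>g. (?D g \<bullet> Tv b) / norm (?D g)) has_real_derivative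
     (((\<rho> (b + g) *\<^sub>R Tv (b + g)) \<bullet> Tv b) * norm (?D g) - (?D g \<bullet> Tv b) * ((\<rho> (b + g) *\<^sub>R Tv (b + g)) \<bullet> sgn (?D g))) / (norm (?D g) * norm (?D g))) (at g within S)"
    using D0 by (intro DERIV_divide vector_derivative_inner_const[OF Dd] nd) simp
  moreover have "(\<lambda>g. (?D g \<bullet> Tv b) / norm (?D g)) = (\<lambda>g. Tv b \<bullet> chord_dir b g)"
    by (simp add: fun_eq_iff chord_dir_def sgn_div_norm inner_commute divide_inverse)
  moreover have "(((\<rho> (b + g) *\<^sub>R Tv (b + g)) \<bullet> Tv b) * norm (?D g) - (?D g \<bullet> Tv b) * ((\<rho> (b + g) *\<^sub>R Tv (b + g)) \<bullet> sgn (?D g))) / (norm (?D g) * norm (?D g))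
     = - \<rho> (b + g) * (- (chord_dir b g \<bullet> Nv b)) * (chord_dir b g \<bullet> Nv (b + g)) / norm (?D g)"
  proof -
    have De: "?D g = norm (?D g) *\<^sub>R Tv \<alpha>" using \<alpha> D0 unfolding chord_dir_def by (metis norm_sgn scaleR_one sgn_div_norm scaleR_scaleR right_inverse norm_eq_zero)
    have "(?D g \<bullet> Tv b) = norm (?D g) * cos (\<alpha> - b)" by (subst De) (simp add: inner_Tv_Tv)
    moreover have "sgn (?D g) = Tv \<alpha>" using \<alpha> by (simp add: chord_dir_def)
    moreover have "cos g = cos (\<alpha> - b) * cos (b + g - \<alpha>) - sin (\<alpha> - b) * sin (b + g - \<alpha>)"
      using cos_add[of "\<alpha> - b" "b + g - \<alpha>"] by simp
    moreover have "sin (b + g - \<alpha>) = - sin (\<alpha> - (b + g))" by (metis minus_diff_eq sin_minus)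
    ultimately show ?thesis using D0 by (simp add: \<alpha> inner_Tv_Tv inner_Tv_Nv field_simps)
  qed
  ultimately show ?thesis by simp
qed

text \<open>Away from degenerate gaps the twist is bounded below, so the gap is recovered from the
  outgoing cosine in a Lipschitz way. The last two bounds control the outgoing cosine at
  \<open>b\<close> and the incoming cosine of the chord that ends at \<open>b\<close>.\<close>

lemma twist_estimates:
  assumes "\<eta> > 0" "\<eta> \<le> pi"
  obtains c K where "c > 0" "K > 0"
    "\<And>b g g'. g \<in> {\<eta>..2*pi-\<eta>} \<Longrightarrow> g' \<in> {\<eta>..2*pi-\<eta>} \<Longrightarrow> c * \<bar>g - g'\<bar> \<le> \<bar>Tv b \<bullet> chord_dir b g - Tv b \<bullet> chord_dir b g'\<bar>"
    "\<And>b g b' g'. g \<in> {\<eta>..2*pi-\<eta>} \<Longrightarrow> g' \<in> {\<eta>..2*pi-\<eta>} \<Longrightarrow> \<bar>Tv b \<bullet> chord_dir b g - Tv b' \<bullet> chord_dir b' g'\<bar> \<le> K * (\<bar>b - b'\<bar> + \<bar>g - g'\<bar>)"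
    "\<And>b g b' g'. g \<in> {\<eta>..2*pi-\<eta>} \<Longrightarrow> g' \<in> {\<eta>..2*pi-\<eta>} \<Longrightarrow> \<bar>Tv b \<bullet> chord_dir (b-g) g - Tv b' \<bullet> chord_dir (b'-g') g'\<bar> \<le> K * (\<bar>b - b'\<bar> + \<bar>g - g'\<bar>)"
proof -
  obtain m where m: "m > 0" "\<And>b g. \<eta> \<le> g \<Longrightarrow> g \<le> 2 * pi - \<eta> \<Longrightarrow> (z (b + g) - z b) \<bullet> Nv b \<le> - m"
    using chord_normal_lower[OF assms] by blast
  obtain r R where r: "0 < r" "\<And>t. r \<le> \<rho> t" "\<And>t. \<rho> t \<le> R" "0 < R" using \<rho>_bounds by blast
  have zl: "norm (z a - z b) \<le> R * \<bar>a - b\<bar>" for a b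
    using lipschitz_of_vector_derivative[OF z_deriv, of R a b] r(3) \<rho>_pos by (simp add: less_imp_le abs_of_pos)
  have Dlow: "norm (z (b + g) - z b) \<ge> m" if "g \<in> {\<eta>..2*pi-\<eta>}" for b g
    using m(2)[of g b] that Cauchy_Schwarz_ineq2[of "z (b + g) - z b" "Nv b"] by simp
  have Dup: "norm (z (b + g) - z b) \<le> R * (2 * pi)" if "g \<in> {\<eta>..2*pi-\<eta>}" for b g
  proof -
    have "norm (z (b + g) - z b) \<le> R * \<bar>g\<bar>" using zl[of "b + g" b] by simp
    also have "\<dots> \<le> R * (2 * pi)" using that assms r by (intro mult_left_mono) auto
    finally show ?thesis .
  qed
  define c where "c = r * (m / (R * (2*pi))) * (m / (R * (2*pi))) / (R * (2*pi))"
  have c: "c > 0" using r m by (simp add: c_def)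
  have s1: "- (chord_dir b g \<bullet> Nv b) \<ge> m / (R * (2*pi))" if g: "g \<in> {\<eta>..2*pi-\<eta>}" for b g
  proof -
    have "- (chord_dir b g \<bullet> Nv b) = - ((z (b + g) - z b) \<bullet> Nv b) / norm (z (b + g) - z b)"
      by (simp add: chord_dir_def sgn_div_norm divide_inverse)
    also have "\<dots> \<ge> m / (R * (2*pi))"
      using m(2)[of g b] g Dup[OF g, of b] Dlow[OF g, of b] m(1) r by (intro frac_le) auto
    finally show ?thesis .
  qed
  \<comment> \<open>Reversing the chord reduces the angle at its second end to the bound at the
    first, with the complementary gap \<open>2 * pi - g\<close>.\<close>
  have s2: "chord_dir b g \<bullet> Nv (b + g) \<ge> m / (R * (2*pi))" if g: "g \<in> {\<eta>..2*pi-\<eta>}" for b g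
  proof -
    have "chord_dir (b + g) (2*pi-g) = sgn (- (z (b + g) - z b))" using z_per[of b] unfolding chord_dir_def
      by (simp add: add.commute add.left_commute)
    also have "\<dots> = - chord_dir b g" by (simp only: chord_dir_def sgn_minus)
    finally show ?thesis using s1[of "2*pi-g" "b + g"] g by simp
  qed
  have mono: "c * \<bar>g - g'\<bar> \<le> \<bar>Tv b \<bullet> chord_dir b g - Tv b \<bullet> chord_dir b g'\<bar>" if g: "g \<in> {\<eta>..2*pi-\<eta>}" "g' \<in> {\<eta>..2*pi-\<eta>}" "g < g'" for b g g'
  proof -
    let ?f' = "\<lambda>x. - \<rho> (b + x) * (- (chord_dir b x \<bullet> Nv b)) * (chord_dir b x \<bullet> Nv (b + x)) / norm (z (b + x) - z b)"
    obtain x where x: "g < x" "x < g'" "Tv b \<bullet> chord_dir b g' - Tv b \<bullet> chord_dir b g = (g' - g) * ?f' x"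
      using MVT2[OF g(3), of "\<lambda>g. Tv b \<bullet> chord_dir b g" ?f'] chord_dir_twist_deriv g assms by auto
    have xg: "x \<in> {\<eta>..2*pi-\<eta>}" using x g by auto
    have p0: "0 \<le> m / (R * (2*pi))" using m(1) r(4) by simp
    have p1: "0 \<le> - (chord_dir b x \<bullet> Nv b)" "0 \<le> chord_dir b x \<bullet> Nv (b + x)" "0 \<le> \<rho> (b + x)"
      using order_trans[OF p0 s1[OF xg, of b]] order_trans[OF p0 s2[OF xg, of b]] \<rho>_pos[of "b + x"] by simp_all
    have "c \<le> \<rho> (b + x) * (- (chord_dir b x \<bullet> Nv b)) * (chord_dir b x \<bullet> Nv (b + x)) / norm (z (b + x) - z b)"
      unfolding c_def using r(1) r(2)[of "b + x"] s1[OF xg, of b] s2[OF xg, of b] Dup[OF xg, of b] Dlow[OF xg, of b] m(1) r(4) p0 p1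
      by (intro frac_le mult_mono mult_nonneg_nonneg) auto
    then have "?f' x \<le> - c" by simp
    then have "(g' - g) * ?f' x \<le> (g' - g) * (- c)" using g by (intro mult_left_mono) auto
    then have "Tv b \<bullet> chord_dir b g' - Tv b \<bullet> chord_dir b g \<le> - (c * (g' - g))" unfolding x(3) by (simp only: mult_minus_right mult.commute)
    then show ?thesis using g(3) by (simp add: abs_real_def)
  qed
  have mono': "c * \<bar>g - g'\<bar> \<le> \<bar>Tv b \<bullet> chord_dir b g - Tv b \<bullet> chord_dir b g'\<bar>" if g: "g \<in> {\<eta>..2*pi-\<eta>}" "g' \<in> {\<eta>..2*pi-\<eta>}" for b g g'
    using mono[of g g' b] mono[of g' g b] g by (cases g g' rule: linorder_cases) (auto simp: abs_minus_commute)
  have El: "norm (chord_dir b g - chord_dir b' g') \<le> 2 / m * (R * (2 * \<bar>b - b'\<bar> + \<bar>g - g'\<bar>))" if g: "g \<in> {\<eta>..2*pi-\<eta>}" "g' \<in> {\<eta>..2*pi-\<eta>}" for b g b' g'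
  proof -
    have "norm (chord_dir b g - chord_dir b' g') \<le> 2 / m * norm ((z (b + g) - z b) - (z (b' + g') - z b'))"
      unfolding chord_dir_def using Dlow[OF g(1), of b] Dlow[OF g(2), of b'] m(1) by (intro sgn_lipschitz) auto
    also have "norm ((z (b + g) - z b) - (z (b' + g') - z b')) \<le> norm (z (b + g) - z (b' + g')) + norm (z b - z b')"
      using norm_triangle_ineq4[of "z (b + g) - z (b' + g')" "z b - z b'"] by (simp add: algebra_simps)
    also have "\<dots> \<le> R * \<bar>(b + g) - (b' + g')\<bar> + R * \<bar>b - b'\<bar>" using zl by (intro add_mono) auto
    also have "\<dots> \<le> R * (\<bar>b - b'\<bar> + \<bar>g - g'\<bar>) + R * \<bar>b - b'\<bar>" using r(4) by (intro add_mono mult_left_mono) auto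
    also have "\<dots> = R * (2 * \<bar>b - b'\<bar> + \<bar>g - g'\<bar>)" by (simp add: algebra_simps)
    finally show ?thesis using m(1) by (simp add: mult_left_mono divide_right_mono)
  qed
  define K where "K = 1 + 6 * R / m"
  have K: "K > 0" using r m by (simp add: K_def add_pos_pos)
  have ine: "\<bar>Tv b \<bullet> e - Tv b' \<bullet> e'\<bar> \<le> \<bar>b - b'\<bar> + norm (e - e')" if "norm e \<le> 1" for b b' e e'
  proof -
    have "Tv b \<bullet> e - Tv b' \<bullet> e' = (Tv b - Tv b') \<bullet> e + Tv b' \<bullet> (e - e')" by (simp add: inner_diff_left inner_diff_right)
    moreover have "\<bar>(Tv b - Tv b') \<bullet> e\<bar> \<le> \<bar>b - b'\<bar>"
      using Cauchy_Schwarz_ineq2[of "Tv b - Tv b'" e] mult_mono[OF Tv_lipschitz that, of b b'] by auto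
    moreover have "\<bar>Tv b' \<bullet> (e - e')\<bar> \<le> norm (e - e')" using Cauchy_Schwarz_ineq2[of "Tv b'" "e - e'"] by simp
    ultimately show ?thesis by linarith
  qed
  have n1: "norm (chord_dir b g) \<le> 1" for b g by (simp add: chord_dir_def norm_sgn)
  have fin: "\<bar>b - b'\<bar> + 2 / m * (R * (2 * B + G)) \<le> K * (\<bar>b - b'\<bar> + G)" if "B \<le> \<bar>b - b'\<bar> + G" "0 \<le> G" "2 * B + G \<le> 3 * (\<bar>b - b'\<bar> + G)" for b b' B G
  proof -
    have "2 / m * (R * (2 * B + G)) \<le> 2 / m * (R * (3 * (\<bar>b - b'\<bar> + G)))" using that m(1) r(4) by (intro mult_left_mono) auto
    also have "\<dots> = 6 * R / m * (\<bar>b - b'\<bar> + G)" by simp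
    finally have "\<bar>b - b'\<bar> + 2 / m * (R * (2 * B + G)) \<le> (\<bar>b - b'\<bar> + G) + 6 * R / m * (\<bar>b - b'\<bar> + G)" using that(2) by linarith
    then show ?thesis by (simp add: K_def distrib_right)
  qed
  have G: "\<bar>Tv b \<bullet> chord_dir b g - Tv b' \<bullet> chord_dir b' g'\<bar> \<le> K * (\<bar>b - b'\<bar> + \<bar>g - g'\<bar>)" if g: "g \<in> {\<eta>..2*pi-\<eta>}" "g' \<in> {\<eta>..2*pi-\<eta>}" for b g b' g'
  proof -
    have "\<bar>b - b'\<bar> + 2 / m * (R * (2 * \<bar>b - b'\<bar> + \<bar>g - g'\<bar>)) \<le> K * (\<bar>b - b'\<bar> + \<bar>g - g'\<bar>)" by (rule fin) auto
    then show ?thesis using ine[OF n1[of b g], of b b' "chord_dir b' g'"] El[OF g, of b b'] by linarith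
  qed
  have H: "\<bar>Tv b \<bullet> chord_dir (b-g) g - Tv b' \<bullet> chord_dir (b'-g') g'\<bar> \<le> K * (\<bar>b - b'\<bar> + \<bar>g - g'\<bar>)" if g: "g \<in> {\<eta>..2*pi-\<eta>}" "g' \<in> {\<eta>..2*pi-\<eta>}" for b g b' g'
  proof -
    have a: "norm (chord_dir (b-g) g - chord_dir (b'-g') g') \<le> 2 / m * (R * (2 * \<bar>b - g - (b' - g')\<bar> + \<bar>g - g'\<bar>))" using El[OF g] .
    have t: "\<bar>b - g - (b' - g')\<bar> \<le> \<bar>b - b'\<bar> + \<bar>g - g'\<bar>" using abs_triangle_ineq4[of "b - b'" "g - g'"] by (simp add: algebra_simps)
    have t3: "2 * \<bar>b - g - (b' - g')\<bar> + \<bar>g - g'\<bar> \<le> 3 * (\<bar>b - b'\<bar> + \<bar>g - g'\<bar>)"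
    proof -
      have "2 * X + Y \<le> 3 * (A + Y)" if "X \<le> A + Y" "0 \<le> A" for X Y A :: real using that by (simp add: distrib_left)
      from this[OF t] show ?thesis by simp
    qed
    have "\<bar>b - b'\<bar> + 2 / m * (R * (2 * \<bar>b - g - (b' - g')\<bar> + \<bar>g - g'\<bar>)) \<le> K * (\<bar>b - b'\<bar> + \<bar>g - g'\<bar>)"
      by (rule fin[OF t _ t3]) simp
    then show ?thesis using ine[OF n1[of "b-g" g], of b b' "chord_dir (b'-g') g'"] a by linarith
  qed
  show thesis using that[OF c K mono' G H] by blast
qed

text \<open>Lifted closed geodesics with \<open>q\<close> sides and winding number \<open>w\<close>.
  The margin \<open>\<eta>\<close> keeps all gaps where the twist is uniform, and comparing
  tangential components expresses the reflection law without naming angles.\<close>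

definition crit_configs :: "nat \<Rightarrow> int \<Rightarrow> real \<Rightarrow> (nat \<Rightarrow> real) set" where
  "crit_configs q w \<eta> = {\<theta>. \<theta> 0 \<in> {0..2*pi} \<and> (\<forall>k. \<theta> (Suc k) - \<theta> k \<in> {\<eta>..2*pi-\<eta>}) \<and> (\<forall>k. \<theta> (k + q) = \<theta> k + 2 * pi * of_int w) \<and>
     (\<forall>k. Tv (\<theta> (Suc k)) \<bullet> sgn (z (\<theta> (Suc k)) - z (\<theta> k)) = Tv (\<theta> (Suc k)) \<bullet> sgn (z (\<theta> (Suc (Suc k))) - z (\<theta> (Suc k))))}"

text \<open>The two parameters are the starting angle and the first gap; the twist propagates them
  along the configuration. On the segment joining two critical configurations each term of the
  derivative of the length is a displacement times a defect in the reflection law, and both factors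
  are of the order of the distance \<open>D\<close>.\<close>

lemma negligible_crit_configs:
  assumes \<eta>: "\<eta> > 0" "\<eta> \<le> pi"
  shows "negligible (poly_length z q ` crit_configs q w \<eta>)"
proof -
  obtain c K where c: "c > 0" and K: "K > 0" and
    mono: "\<And>b g g'. g \<in> {\<eta>..2*pi-\<eta>} \<Longrightarrow> g' \<in> {\<eta>..2*pi-\<eta>} \<Longrightarrow> c * \<bar>g - g'\<bar> \<le> \<bar>Tv b \<bullet> chord_dir b g - Tv b \<bullet> chord_dir b g'\<bar>" and
    G: "\<And>b g b' g'. g \<in> {\<eta>..2*pi-\<eta>} \<Longrightarrow> g' \<in> {\<eta>..2*pi-\<eta>} \<Longrightarrow> \<bar>Tv b \<bullet> chord_dir b g - Tv b' \<bullet> chord_dir b' g'\<bar> \<le> K * (\<bar>b - b'\<bar> + \<bar>g - g'\<bar>)" and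
    H: "\<And>b g b' g'. g \<in> {\<eta>..2*pi-\<eta>} \<Longrightarrow> g' \<in> {\<eta>..2*pi-\<eta>} \<Longrightarrow> \<bar>Tv b \<bullet> chord_dir (b-g) g - Tv b' \<bullet> chord_dir (b'-g') g'\<bar> \<le> K * (\<bar>b - b'\<bar> + \<bar>g - g'\<bar>)"
    using twist_estimates[OF \<eta>] by metis
  obtain r R where r: "0 < r" "\<And>t. r \<le> \<rho> t" "\<And>t. \<rho> t \<le> R" "0 < R" using \<rho>_bounds by blast
  \<comment> \<open>Growth rate of one step: the new gap costs \<open>3 * K / c\<close> times the
    old distance, by the twist and three Lipschitz terms, and the new angle at most the old
    distance.\<close>
  define A where "A = 2 + 3 * K / c"
  have A: "A \<ge> 2" using K c by (simp add: A_def)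
  define g where "g = (\<lambda>(\<theta>::nat\<Rightarrow>real) k. \<theta> (Suc k) - \<theta> k)"
  have edge: "sgn (z (\<theta> (Suc k)) - z (\<theta> k)) = chord_dir (\<theta> k) (g \<theta> k)" for \<theta> k by (simp add: chord_dir_def g_def)
  have edge': "chord_dir (\<theta> k) (g \<theta> k) = chord_dir (\<theta> (Suc k) - g \<theta> k) (g \<theta> k)" for \<theta> k by (simp add: g_def)
  let ?P = "crit_configs q w \<eta>"
  have gP: "g \<theta> k \<in> {\<eta>..2*pi-\<eta>}" if "\<theta> \<in> ?P" for \<theta> k using that by (simp add: crit_configs_def g_def)
  have cr: "Tv (\<theta> (Suc k)) \<bullet> chord_dir (\<theta> (Suc k) - g \<theta> k) (g \<theta> k) = Tv (\<theta> (Suc k)) \<bullet> chord_dir (\<theta> (Suc k)) (g \<theta> (Suc k))" if "\<theta> \<in> ?P" for \<theta> k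
    using that unfolding crit_configs_def edge edge'[symmetric] by blast
  have lip: "\<bar>\<theta> k - \<theta>' k\<bar> + \<bar>g \<theta> k - g \<theta>' k\<bar> \<le> A ^ k * (\<bar>\<theta> 0 - \<theta>' 0\<bar> + \<bar>g \<theta> 0 - g \<theta>' 0\<bar>)" if P: "\<theta> \<in> ?P" "\<theta>' \<in> ?P" for \<theta> \<theta>' k
  proof (induction k)
    case (Suc k)
    let ?x = "\<bar>\<theta> (Suc k) - \<theta>' (Suc k)\<bar>" and ?d = "\<bar>\<theta> k - \<theta>' k\<bar> + \<bar>g \<theta> k - g \<theta>' k\<bar>"
    have x: "?x \<le> ?d" unfolding g_def by linarith
    have "c * \<bar>g \<theta> (Suc k) - g \<theta>' (Suc k)\<bar> \<le> \<bar>Tv (\<theta> (Suc k)) \<bullet> chord_dir (\<theta> (Suc k)) (g \<theta> (Suc k)) - Tv (\<theta> (Suc k)) \<bullet> chord_dir (\<theta> (Suc k)) (g \<theta>' (Suc k))\<bar>"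
      by (rule mono[OF gP[OF P(1)] gP[OF P(2)]])
    also have "\<dots> \<le> \<bar>Tv (\<theta> (Suc k)) \<bullet> chord_dir (\<theta> (Suc k)) (g \<theta> (Suc k)) - Tv (\<theta>' (Suc k)) \<bullet> chord_dir (\<theta>' (Suc k)) (g \<theta>' (Suc k))\<bar>
        + \<bar>Tv (\<theta>' (Suc k)) \<bullet> chord_dir (\<theta>' (Suc k)) (g \<theta>' (Suc k)) - Tv (\<theta> (Suc k)) \<bullet> chord_dir (\<theta> (Suc k)) (g \<theta>' (Suc k))\<bar>" by linarith
    also have "\<dots> \<le> K * (?x + \<bar>g \<theta> k - g \<theta>' k\<bar>) + K * ?x"
      using H[OF gP[OF P(1), of k] gP[OF P(2), of k], of "\<theta> (Suc k)" "\<theta>' (Suc k)"]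
        G[OF gP[OF P(2), of "Suc k"] gP[OF P(2), of "Suc k"], of "\<theta>' (Suc k)" "\<theta> (Suc k)"]
      unfolding cr[OF P(1)] cr[OF P(2)] by (simp add: abs_minus_commute)
    also have "\<dots> \<le> K * (?d + ?d) + K * ?d" using x K by (intro add_mono mult_left_mono) auto
    finally have "\<bar>g \<theta> (Suc k) - g \<theta>' (Suc k)\<bar> \<le> (3 * K / c) * ?d" using c by (simp add: field_simps)
    then have "?x + \<bar>g \<theta> (Suc k) - g \<theta>' (Suc k)\<bar> \<le> ?d + (3 * K / c) * ?d" using x by linarith
    also have "\<dots> \<le> A * ?d" unfolding A_def distrib_right by simp
    also have "\<dots> \<le> A * (A ^ k * (\<bar>\<theta> 0 - \<theta>' 0\<bar> + \<bar>g \<theta> 0 - g \<theta>' 0\<bar>))" using Suc.IH A by (intro mult_left_mono) auto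
    finally show ?case by (simp only: power_Suc mult.assoc)
  qed simp
  define B where "B = A ^ q"
  have B: "B \<ge> 1" using A by (simp add: B_def one_le_power)
  let ?p2 = "\<lambda>\<theta>. g \<theta> 0"
  have main: "\<bar>poly_length z q \<theta> - poly_length z q \<theta>'\<bar> \<le> (real q * (B * R * (4 * K * B))) * (\<bar>\<theta> 0 - \<theta>' 0\<bar> + \<bar>g \<theta> 0 - g \<theta>' 0\<bar>)\<^sup>2"
    if P: "\<theta> \<in> ?P" "\<theta>' \<in> ?P" for \<theta> \<theta>'
  proof -
    define D where "D = \<bar>\<theta> 0 - \<theta>' 0\<bar> + \<bar>g \<theta> 0 - g \<theta>' 0\<bar>"
    have D0: "D \<ge> 0" by (simp add: D_def)
    define \<Delta> where "\<Delta> = (\<lambda>k. \<theta>' k - \<theta> k)"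
    have lipq: "\<bar>\<Delta> k\<bar> + \<bar>g \<theta> k - g \<theta>' k\<bar> \<le> B * D" if "k \<le> q" for k
    proof -
      have "A ^ k \<le> B" unfolding B_def using that A by (intro power_increasing) auto
      then have "A ^ k * D \<le> B * D" using D0 by (rule mult_right_mono)
      then show ?thesis using lip[OF P, of k] unfolding D_def \<Delta>_def by (simp add: abs_minus_commute)
    qed
    \<comment> \<open>The segment between the two angle sequences. Its intermediate configurations
      are in general not critical, but their gaps stay in the admissible interval, which is
      convex.\<close>
    define T where "T = (\<lambda>t k. \<theta> k + t * \<Delta> k)"
    have gT: "g (T t) k = g \<theta> k + t * (g \<theta>' k - g \<theta> k)" for t k by (simp add: g_def T_def \<Delta>_def algebra_simps)
    have gT': "g (T t) k \<in> {\<eta>..2*pi-\<eta>}" if "0 \<le> t" "t \<le> 1" for t k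
    proof -
      have "(1 - t) *\<^sub>R g \<theta> k + t *\<^sub>R g \<theta>' k \<in> {\<eta>..2*pi-\<eta>}"
        using gP[OF P(1)] gP[OF P(2)] that by (intro convexD) (auto simp del: atLeastAtMost_iff)
      then show ?thesis unfolding gT by (simp add: algebra_simps)
    qed
    define v where "v = (\<lambda>t k. (\<Delta> k * \<rho> (T t k)) *\<^sub>R Tv (T t k))"
    define e where "e = (\<lambda>t k. sgn (z (T t (Suc k)) - z (T t k)))"
    have zd: "((\<lambda>t. z (T t k)) has_vector_derivative v t k) (at t)" for t k
    proof -
      have "((\<lambda>t. T t k) has_vector_derivative \<Delta> k) (at t)"
        unfolding has_real_derivative_iff_has_vector_derivative[symmetric] T_def by (auto intro!: derivative_eq_intros)
      from vector_diff_chain_at[OF this z_deriv] show ?thesis by (simp add: o_def v_def)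
    qed
    define F' where "F' = (\<lambda>t. \<Sum>k<q. e t k \<bullet> (v t (Suc k) - v t k))"
    have Fd: "((\<lambda>t. poly_length z q (T t)) has_real_derivative F' t) (at t)" if t: "0 \<le> t" "t \<le> 1" for t
      unfolding poly_length_def F'_def
    proof (rule DERIV_sum)
      fix k
      have ne: "z (T t (Suc k)) - z (T t k) \<noteq> 0" using gT'[OF t, of k] z_neq[of "T t k" "T t (Suc k)"] \<eta>(1) by (auto simp: g_def)
      have vd: "((\<lambda>t. z (T t (Suc k)) - z (T t k)) has_vector_derivative v t (Suc k) - v t k) (at t)"
        by (intro has_vector_derivative_diff zd)
      show "((\<lambda>t. norm (z (T t (Suc k)) - z (T t k))) has_real_derivative e t k \<bullet> (v t (Suc k) - v t k)) (at t)"
        using has_derivative_compose[OF vd[unfolded has_vector_derivative_def] has_derivative_norm[OF ne]]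
        by (simp add: has_field_derivative_def e_def inner_commute mult_commute_abs)
    qed
    have perT: "T t (k + q) = T t k + 2 * pi * of_int w" for t k
      using P unfolding crit_configs_def T_def \<Delta>_def by (simp add: algebra_simps)
    have \<Delta>q: "\<Delta> q = \<Delta> 0"
    proof -
      have "\<theta> (0 + q) = \<theta> 0 + 2 * pi * of_int w" "\<theta>' (0 + q) = \<theta>' 0 + 2 * pi * of_int w" using P unfolding crit_configs_def by blast+
      then show ?thesis by (simp add: \<Delta>_def)
    qed
    have F'e: "F' t = (\<Sum>k<q. (e t k - e t (Suc k)) \<bullet> v t (Suc k))" for t
    proof -
      have "F' t = (\<Sum>k<q. (e t k - e t (Suc k)) \<bullet> v t (Suc k)) + (\<Sum>k<q. e t (Suc k) \<bullet> v t (Suc k) - e t k \<bullet> v t k)"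
        unfolding F'_def sum.distrib[symmetric] by (intro sum.cong) (auto simp: inner_diff_left inner_diff_right)
      also have "(\<Sum>k<q. e t (Suc k) \<bullet> v t (Suc k) - e t k \<bullet> v t k) = e t q \<bullet> v t q - e t 0 \<bullet> v t 0"
        by (rule sum_lessThan_telescope)
      also have "e t q = e t 0" unfolding e_def using perT[of t 0] perT[of t 1] periodic_int[of z, OF z_per] by simp
      also have "v t q = v t 0" unfolding v_def \<Delta>q using perT[of t 0] periodic_int[of \<rho>, OF \<rho>_per] periodic_int[of Tv] by simp
      finally show ?thesis by simp
    qed
    have F'b: "\<bar>F' t\<bar> \<le> real q * (B * R * (4 * K * B)) * D\<^sup>2" if t: "0 \<le> t" "t \<le> 1" for t
    proof -
      have "\<bar>(e t k - e t (Suc k)) \<bullet> v t (Suc k)\<bar> \<le> (B * R * (4 * K * B)) * D\<^sup>2" if k: "k < q" for k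
      proof -
        let ?b = "T t (Suc k)"
        define X where "X = (\<lambda>t. Tv (T t (Suc k)) \<bullet> chord_dir (T t (Suc k) - g (T t) k) (g (T t) k))"
        define Y where "Y = (\<lambda>t. Tv (T t (Suc k)) \<bullet> chord_dir (T t (Suc k)) (g (T t) (Suc k)))"
        have T0: "T 0 = \<theta>" by (simp add: T_def)
        \<comment> \<open>The defect \<open>X - Y\<close> of the reflection law is zero at the
          critical end \<open>t = 0\<close>, so along the segment it is bounded by the Lipschitz
          estimates.\<close>
        have XY0: "X 0 = Y 0" using cr[OF P(1), of k] by (simp add: X_def Y_def T0)
        have tm: "\<bar>t * y\<bar> \<le> \<bar>y\<bar>" for y using t by (simp add: abs_mult mult_left_le_one_le)
        have "\<bar>X t - X 0\<bar> \<le> K * (\<bar>T t (Suc k) - T 0 (Suc k)\<bar> + \<bar>g (T t) k - g (T 0) k\<bar>)"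
          unfolding X_def using gT'[OF t] gT'[of 0] by (intro H) auto
        also have "\<dots> \<le> K * (B * D + B * D)"
        proof (intro mult_left_mono add_mono)
          show "\<bar>T t (Suc k) - T 0 (Suc k)\<bar> \<le> B * D" using lipq[of "Suc k"] k tm[of "\<Delta> (Suc k)"] by (simp add: T_def)
          show "\<bar>g (T t) k - g (T 0) k\<bar> \<le> B * D" unfolding gT
            using lipq[of k] k tm[of "g \<theta>' k - g \<theta> k"] by (simp add: abs_minus_commute)
        qed (use K in simp)
        finally have x: "\<bar>X t - X 0\<bar> \<le> 2 * K * B * D" by simp
        have "\<bar>Y t - Y 0\<bar> \<le> K * (\<bar>T t (Suc k) - T 0 (Suc k)\<bar> + \<bar>g (T t) (Suc k) - g (T 0) (Suc k)\<bar>)"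
          unfolding Y_def using gT'[OF t] gT'[of 0] by (intro G) auto
        also have "\<dots> \<le> K * (B * D + B * D)"
        proof (intro mult_left_mono add_mono)
          show "\<bar>T t (Suc k) - T 0 (Suc k)\<bar> \<le> B * D" using lipq[of "Suc k"] k tm[of "\<Delta> (Suc k)"] by (simp add: T_def)
          show "\<bar>g (T t) (Suc k) - g (T 0) (Suc k)\<bar> \<le> B * D" unfolding gT
            using lipq[of "Suc k"] k tm[of "g \<theta>' (Suc k) - g \<theta> (Suc k)"] by (simp add: abs_minus_commute)
        qed (use K in simp)
        finally have y: "\<bar>Y t - Y 0\<bar> \<le> 2 * K * B * D" by simp
        have xy: "\<bar>X t - Y t\<bar> \<le> 4 * K * B * D" using x y XY0 by linarith
        have "(e t k - e t (Suc k)) \<bullet> v t (Suc k) = \<Delta> (Suc k) * \<rho> ?b * (X t - Y t)"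
          unfolding v_def e_def X_def Y_def edge edge'[symmetric] by (simp add: inner_diff_left inner_diff_right inner_commute right_diff_distrib)
        then have "\<bar>(e t k - e t (Suc k)) \<bullet> v t (Suc k)\<bar> = \<bar>\<Delta> (Suc k)\<bar> * \<rho> ?b * \<bar>X t - Y t\<bar>"
          using \<rho>_pos[of ?b] by (simp add: abs_mult)
        also have "\<dots> \<le> (B * D) * R * (4 * K * B * D)"
          using lipq[of "Suc k"] k r(3)[of ?b] \<rho>_pos[of ?b] xy B D0 r(4) by (intro mult_mono) (auto intro: less_imp_le)
        finally show ?thesis by (simp add: power2_eq_square algebra_simps)
      qed
      then have "\<bar>F' t\<bar> \<le> (\<Sum>k<q. (B * R * (4 * K * B)) * D\<^sup>2)" unfolding F'e
        by (intro order_trans[OF sum_abs] sum_mono) auto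
      then show ?thesis by simp
    qed
    obtain x where x: "0 < x" "x < 1" "poly_length z q (T 1) - poly_length z q (T 0) = (1 - 0) * F' x"
      using MVT2[of 0 1 "\<lambda>t. poly_length z q (T t)" F'] Fd by auto
    have "T 1 = \<theta>'" "T 0 = \<theta>" by (auto simp: T_def \<Delta>_def)
    then have "\<bar>poly_length z q \<theta> - poly_length z q \<theta>'\<bar> = \<bar>F' x\<bar>" using x(3) by (simp add: abs_minus_commute)
    then show ?thesis using F'b[of x] x by (simp add: D_def)
  qed
  show ?thesis
  proof (rule negligible_quadratic_image[where pa = "\<lambda>\<theta>. \<theta> 0" and pb = ?p2 and l = "2 * pi"])
    show "\<bar>poly_length z q x - poly_length z q y\<bar> \<le> (real q * (B * R * (4 * K * B))) * (\<bar>x 0 - y 0\<bar> + \<bar>g x 0 - g y 0\<bar>)\<^sup>2"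
      if "x \<in> ?P" "y \<in> ?P" for x y using main[OF that] .
    show "x 0 \<in> {0..2*pi}" if "x \<in> ?P" for x using that unfolding crit_configs_def by blast
    show "g x 0 \<in> {0..2*pi}" if "x \<in> ?P" for x using gP[OF that, of 0] \<eta>(1) by simp
  qed
qed

text \<open>Every closed geodesic lifts into one of countably many classes, indexed by the number of
  sides, the winding number and a margin \<open>1 / Suc n\<close> for its gaps, which exists because
  a period has finitely many gaps.\<close>

lemma negligible_closed_lengths:
  "negligible {l. \<exists>q p. q \<ge> 1 \<and> (\<forall>k. p k \<in> range z) \<and> (\<forall>k. p (k + q) = p k) \<and> (\<forall>k. p (Suc k) \<noteq> p k) \<and>
      (\<forall>k t. z t = p (Suc k) \<longrightarrow> Tv t \<bullet> sgn (p (Suc k) - p k) = Tv t \<bullet> sgn (p (Suc (Suc k)) - p (Suc k))) \<and>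
      l = (\<Sum>k<q. norm (p (Suc k) - p k))}" (is "negligible ?S")
proof -
  have "negligible (\<Union>(q, w, n)\<in>(UNIV :: (nat \<times> int \<times> nat) set). poly_length z q ` crit_configs q w (1 / real (Suc n)))"
  proof (rule negligible_countable_Union)
    show "countable ((\<lambda>(q, w, n). poly_length z q ` crit_configs q w (1 / real (Suc n))) ` (UNIV :: (nat \<times> int \<times> nat) set))"
      by (intro countable_image) auto
    have "1 / real (Suc n) \<le> pi" for n
    proof -
      have "1 / real (Suc n) \<le> 1" by simp
      then show ?thesis using pi_gt3 by linarith
    qed
    then show "negligible S" if "S \<in> (\<lambda>(q, w, n). poly_length z q ` crit_configs q w (1 / real (Suc n))) ` (UNIV :: (nat \<times> int \<times> nat) set)" for S
      using that by (auto intro!: negligible_crit_configs)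
  qed
  moreover have "?S \<subseteq> (\<Union>(q, w, n)\<in>(UNIV :: (nat \<times> int \<times> nat) set). poly_length z q ` crit_configs q w (1 / real (Suc n)))"
  proof
    fix l assume "l \<in> ?S"
    then obtain q p where q: "q \<ge> 1" and p: "\<And>k. p k \<in> range z" "\<And>k. p (k + q) = p k" "\<And>k. p (Suc k) \<noteq> p k"
      "\<And>k t. z t = p (Suc k) \<Longrightarrow> Tv t \<bullet> sgn (p (Suc k) - p k) = Tv t \<bullet> sgn (p (Suc (Suc k)) - p (Suc k))"
      and l: "l = (\<Sum>k<q. norm (p (Suc k) - p k))" by blast
    have lift: "\<exists>t. z t = p k \<and> a \<le> t \<and> t < a + 2 * pi" for k a
    proof -
      obtain s where s: "p k = z s" using p(1)[of k] by blast
      obtain m :: int where m: "a \<le> s + 2 * pi * of_int m" "s + 2 * pi * of_int m < a + 2 * pi" using reduce_2pi[of a s] by blast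
      then show ?thesis using s periodic_int[of z s m, OF z_per] by (intro exI[of _ "s + 2 * pi * of_int m"]) auto
    qed
    \<comment> \<open>Lift successively: each angle is the representative in the full turn that
      follows the previous one.\<close>
    have "\<exists>\<theta>. \<forall>n. (z (\<theta> n) = p n \<and> (n = 0 \<longrightarrow> \<theta> n \<in> {0..2*pi})) \<and> (\<theta> n < \<theta> (Suc n) \<and> \<theta> (Suc n) < \<theta> n + 2 * pi)"
    proof (rule dependent_nat_choice)
      show "\<exists>x. z x = p 0 \<and> (0 = 0 \<longrightarrow> x \<in> {0..2*pi})" for n :: nat using lift[of 0 0] by auto
      fix x n assume x: "z x = p n \<and> (n = 0 \<longrightarrow> x \<in> {0..2*pi})"
      obtain t where t: "z t = p (Suc n)" "x \<le> t" "t < x + 2 * pi" using lift[of "Suc n" x] by blast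
      moreover have "t \<noteq> x" using t x p(3)[of n] by auto
      ultimately show "\<exists>y. (z y = p (Suc n) \<and> (Suc n = 0 \<longrightarrow> y \<in> {0..2*pi})) \<and> x < y \<and> y < x + 2 * pi" by (intro exI[of _ t]) auto
    qed
    then obtain \<theta> where \<theta>: "\<And>n. z (\<theta> n) = p n" "\<theta> 0 \<in> {0..2*pi}" "\<And>n. \<theta> n < \<theta> (Suc n)" "\<And>n. \<theta> (Suc n) < \<theta> n + 2 * pi" by auto
    have "z (\<theta> q) = z (\<theta> 0)" using \<theta>(1) p(2)[of 0] by simp
    then obtain w :: int where w: "\<theta> q = \<theta> 0 + 2 * pi * of_int w" using z_eq_iff_ex by blast
    \<comment> \<open>The number of turns in \<open>\<theta> (k + q) - \<theta> k\<close> does not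
      depend on \<open>k\<close>: two consecutive ones are integers differing by less than one,
      since all gaps lie strictly between 0 and a full turn.\<close>
    have per: "\<theta> (k + q) = \<theta> k + 2 * pi * of_int w" for k
    proof (induction k)
      case (Suc k)
      have "z (\<theta> (Suc k + q)) = z (\<theta> (Suc k))" unfolding \<theta>(1) by (rule p(2))
      then obtain m :: int where m: "\<theta> (Suc k + q) = \<theta> (Suc k) + 2 * pi * of_int m" using z_eq_iff_ex by blast
      have "2 * pi * of_int m - 2 * pi * of_int w < 2 * pi" "2 * pi * of_int m - 2 * pi * of_int w > - (2 * pi)"
        using \<theta>(3)[of k] \<theta>(4)[of k] \<theta>(3)[of "k + q"] \<theta>(4)[of "k + q"] m Suc by auto
      then have "2 * pi * of_int (m - w) < 2 * pi * 1" "2 * pi * of_int (m - w) > 2 * pi * (- 1)" by (simp_all add: algebra_simps)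
      then have "of_int (m - w) < (1::real)" "of_int (m - w) > (- 1::real)"
        using mult_less_cancel_left_pos[of "2 * pi" "of_int (m - w)" 1] mult_less_cancel_left_pos[of "2 * pi" "- 1" "of_int (m - w)"] pi_gt_zero by simp_all
      then have "m = w" by linarith
      then show ?case using m by simp
    qed (use w in simp)
    define G where "G = (\<lambda>k. \<theta> (Suc k) - \<theta> k) ` {..<q} \<union> (\<lambda>k. \<theta> k + 2 * pi - \<theta> (Suc k)) ` {..<q}"
    have fG: "finite G" "G \<noteq> {}" "Min G > 0" using q \<theta>(3,4) by (auto simp: G_def lessThan_empty_iff)
    obtain n where n: "1 / real (Suc n) < Min G" using fG(3) nat_approx_posE by blast
    have gap0: "\<theta> (Suc k) - \<theta> k \<in> {1 / real (Suc n)..2*pi - 1 / real (Suc n)}" if "k < q" for k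
    proof -
      have "Min G \<le> \<theta> (Suc k) - \<theta> k" "Min G \<le> \<theta> k + 2 * pi - \<theta> (Suc k)" using that fG by (auto intro!: Min_le simp: G_def)
      then show ?thesis using n by auto
    qed
    have gap: "\<theta> (Suc k) - \<theta> k \<in> {1 / real (Suc n)..2*pi - 1 / real (Suc n)}" for k
    proof (induction k rule: less_induct)
      case (less k)
      show ?case
      proof (cases "k < q")
        case False
        then have "k = (k - q) + q" by simp
        then have "\<theta> k = \<theta> (k - q) + 2 * pi * of_int w" "\<theta> (Suc k) = \<theta> (Suc (k - q)) + 2 * pi * of_int w"
          using per[of "k - q"] per[of "Suc (k - q)"] by simp_all
        then show ?thesis using less[of "k - q"] False q by simp
      qed (rule gap0)
    qed
    have "\<theta> \<in> crit_configs q w (1 / real (Suc n))"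
      unfolding crit_configs_def using \<theta>(2) gap per p(4) \<theta>(1) by simp
    moreover have "l = poly_length z q \<theta>" unfolding l poly_length_def using \<theta>(1) by simp
    ultimately show "l \<in> (\<Union>(q, w, n)\<in>(UNIV :: (nat \<times> int \<times> nat) set). poly_length z q ` crit_configs q w (1 / real (Suc n)))"
      by (auto intro!: bexI[of _ "(q, w, n)"])
  qed
  ultimately show ?thesis by (rule negligible_subset)
qed

end

section \<open>Asymptotics of maximal polygons\<close>

text \<open>Integration through the mean value theorem. The factor \<open>1 / Suc n\<close> of a
  true integration is given away, so the constants derived from it are not sharp.\<close>

lemma abs_le_power_by_deriv:
  fixes f :: "real \<Rightarrow> real"
  assumes d: "\<And>x. (f has_real_derivative f' x) (at x)" and b: "\<And>x. \<bar>f' x\<bar> \<le> B * \<bar>x\<bar> ^ n" and f0: "f 0 = 0" and B: "B \<ge> 0"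
  shows "\<bar>f x\<bar> \<le> B * \<bar>x\<bar> ^ Suc n"
proof -
  have key: "\<bar>f x\<bar> \<le> B * \<bar>x\<bar> ^ Suc n" if y: "\<bar>y\<bar> \<le> \<bar>x\<bar>" "f x - f 0 = x * f' y" for y
  proof -
    have "\<bar>f x\<bar> = \<bar>x\<bar> * \<bar>f' y\<bar>" using y(2) f0 by (simp add: abs_mult)
    also have "\<dots> \<le> \<bar>x\<bar> * (B * \<bar>x\<bar> ^ n)"
      by (intro mult_left_mono abs_ge_zero order_trans[OF b mult_left_mono[OF power_mono[OF y(1) abs_ge_zero] B]])
    also have "\<dots> = B * \<bar>x\<bar> ^ Suc n" by simp
    finally show ?thesis .
  qed
  consider "x = 0" | "x > 0" | "x < 0" by linarith
  then show ?thesis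
  proof cases
    case 1 then show ?thesis using f0 by simp
  next
    case 2
    obtain y where "0 < y" "y < x" "f x - f 0 = (x - 0) * f' y" using MVT2[OF 2, of f f'] d by auto
    then show ?thesis using 2 by (intro key[of y]) auto
  next
    case 3
    obtain y where "x < y" "y < 0" "f 0 - f x = (0 - x) * f' y" using MVT2[OF 3, of f f'] d by auto
    then show ?thesis using 3 by (intro key[of y]) (auto simp: algebra_simps)
  qed
qed

lemma taylor3_bound:
  fixes f :: "real \<Rightarrow> real"
  assumes d: "\<And>x. (f has_real_derivative f1 x) (at x)" "\<And>x. (f1 has_real_derivative f2 x) (at x)" "\<And>x. (f2 has_real_derivative f3 x) (at x)"
    and b: "\<And>x. \<bar>f3 x\<bar> \<le> B"
  shows "\<bar>f1 (a + t) - f1 a - f2 a * t\<bar> \<le> B * t\<^sup>2"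
    and "\<bar>f (a + t) - f a - f1 a * t - f2 a * t\<^sup>2 / 2\<bar> \<le> B * \<bar>t\<bar> ^ 3"
proof -
  have B: "B \<ge> 0" using b[of 0] by linarith
  have sh: "((\<lambda>x. g (a + x)) has_real_derivative g' (a + x)) (at x)" if "\<And>x. (g has_real_derivative g' x) (at x)" for g g' :: "real \<Rightarrow> real" and x
    using DERIV_shift[of g "g' (a + x)" x a] that[of "a + x"] by (simp add: add.commute)
  have 1: "\<bar>f2 (a + x) - f2 a\<bar> \<le> B * \<bar>x\<bar> ^ Suc 0" for x
    by (rule abs_le_power_by_deriv[where f' = "\<lambda>x. f3 (a + x)"]) (use sh[OF d(3)] b B in \<open>auto intro!: derivative_eq_intros\<close>)
  have 2: "\<bar>f1 (a + x) - f1 a - f2 a * x\<bar> \<le> B * \<bar>x\<bar> ^ Suc (Suc 0)" for x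
    by (rule abs_le_power_by_deriv[where f' = "\<lambda>x. f2 (a + x) - f2 a"]) (use sh[OF d(2)] 1 B in \<open>auto intro!: derivative_eq_intros\<close>)
  show "\<bar>f1 (a + t) - f1 a - f2 a * t\<bar> \<le> B * t\<^sup>2" using 2[of t] by (simp add: power2_eq_square)
  have 3: "\<bar>f (a + x) - f a - f1 a * x - f2 a * x\<^sup>2 / 2\<bar> \<le> B * \<bar>x\<bar> ^ Suc (Suc (Suc 0))" for x
    by (rule abs_le_power_by_deriv[where f' = "\<lambda>x. f1 (a + x) - f1 a - f2 a * x"]) (use sh[OF d(1)] 2 B in \<open>auto intro!: derivative_eq_intros\<close>)
  show "\<bar>f (a + t) - f a - f1 a * t - f2 a * t\<^sup>2 / 2\<bar> \<le> B * \<bar>t\<bar> ^ 3" using 3[of t] by (simp add: numeral_3_eq_3)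
qed

lemma sin_ge_half: assumes "0 \<le> x" "x \<le> pi / 3" shows "x / 2 \<le> sin x"
proof -
  have "sin 0 - 0 / 2 \<le> sin x - x / 2"
  proof (rule DERIV_nonneg_imp_nondecreasing[OF assms(1)])
    fix y assume y: "0 \<le> y" "y \<le> x"
    have "cos (pi / 3) \<le> cos y" using y assms by (intro cos_monotone_0_pi_le) auto
    then show "\<exists>d. ((\<lambda>x. sin x - x / 2) has_real_derivative d) (at y) \<and> 0 \<le> d"
      by (intro exI[of _ "cos y - 1 / 2"]) (auto intro!: derivative_eq_intros simp: cos_60)
  qed
  then show ?thesis by simp
qed

lemma sin_ge_quarter: assumes "0 \<le> x" "x \<le> 2 * pi / 3" shows "x / 4 \<le> sin x"
proof -
  have "cos (pi / 3) \<le> cos (x / 2)" using assms by (intro cos_monotone_0_pi_le) auto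
  then have c: "1 / 2 \<le> cos (x / 2)" by (simp add: cos_60)
  have s: "x / 2 / 2 \<le> sin (x / 2)" using assms by (intro sin_ge_half) auto
  have "sin (x/2) * 1 \<le> sin (x/2) * (2 * cos (x/2))" using c s assms by (intro mult_left_mono) auto
  also have "\<dots> = sin x" using sin_double[of "x/2"] by simp
  finally show ?thesis using s by simp
qed

lemma sin_minus_bound: "\<bar>sin x - x\<bar> \<le> \<bar>x::real\<bar> ^ 3"
proof -
  have 1: "\<bar>1 - cos x\<bar> \<le> 1 * \<bar>x\<bar> ^ Suc 1" for x :: real
    by (rule abs_le_power_by_deriv[where f' = sin]) (auto intro!: derivative_eq_intros simp: abs_sin_x_le_abs_x)
  have "\<bar>sin x - x\<bar> \<le> 1 * \<bar>x\<bar> ^ Suc 2"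
    by (rule abs_le_power_by_deriv[where f' = "\<lambda>x. cos x - 1"]) (use 1 in \<open>auto intro!: derivative_eq_intros simp: abs_minus_commute numeral_2_eq_2\<close>)
  then show ?thesis by (simp add: numeral_3_eq_3)
qed

lemma sin_x_cos_bound: "\<bar>sin x - x * cos x - x ^ 3 / 3\<bar> \<le> \<bar>x::real\<bar> ^ 5"
proof -
  have "\<bar>sin x - x * cos x - x ^ 3 / 3\<bar> \<le> 1 * \<bar>x\<bar> ^ Suc 4"
  proof (rule abs_le_power_by_deriv[where f' = "\<lambda>x. x * (sin x - x)"])
    show "((\<lambda>x. sin x - x * cos x - x ^ 3 / 3) has_real_derivative x * (sin x - x)) (at x)" for x :: real
      by (auto intro!: derivative_eq_intros simp: algebra_simps power2_eq_square)
    show "\<bar>x * (sin x - x)\<bar> \<le> 1 * \<bar>x\<bar> ^ 4" for x :: real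
      using mult_left_mono[OF sin_minus_bound[of x] abs_ge_zero[of x]] by (simp add: abs_mult eval_nat_numeral)
  qed auto
  then show ?thesis by simp
qed

text \<open>One side with direction \<open>\<alpha>\<close> and end angles \<open>a\<close>,
  \<open>b\<close>. Its normal component vanishes, which reads \<open>h b = h (- a)\<close>, and
  Taylor expansion turns this into
  \<open>s0 * (b - a) + 2 * s1 * (a^2 - a * b + b^2) = O(M^4)\<close>. To this order the left side
  is the increment of \<open>\<sigma> * \<phi>\<close>. The terms fit because the coefficients of
  \<open>\<tau>\<close> are those of the cube of \<open>\<sigma>\<close>; this is the origin of the
  exponent 1/3. So \<open>\<sigma> * \<phi>\<close> is an adiabatic invariant, and its sum over both
  ends is the trapezoidal value for the increment of \<open>X\<close>.\<close>

lemma bounce_step: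
  fixes a b \<epsilon> :: real and \<sigma> \<tau> h X :: "real \<Rightarrow> real"
  assumes ab: "0 < a" "0 < b" "a \<le> 2 * pi / 3" "b \<le> 2 * pi / 3"
    and \<epsilon>: "0 \<le> \<epsilon>" "\<epsilon> \<le> 1 / 100000"
    and \<sigma>: "\<And>t. \<bar>\<sigma> (\<alpha> + t) - s0 - s1 * t - s2 * t\<^sup>2 / 2\<bar> \<le> \<epsilon> * \<bar>t\<bar> ^ 3"
      "\<bar>s0 - 1\<bar> \<le> \<epsilon>" "\<bar>s1\<bar> \<le> \<epsilon>" "\<bar>s2\<bar> \<le> \<epsilon>" "\<And>t. \<bar>\<sigma> (\<alpha> + t) - s0 - s1 * t\<bar> \<le> \<epsilon> * t\<^sup>2"
    and \<tau>: "\<And>t. \<bar>\<tau> (\<alpha> + t) - s0 ^ 3 - 3 * s0\<^sup>2 * s1 * t - p2 * t\<^sup>2 / 2\<bar> \<le> \<epsilon> * \<bar>t\<bar> ^ 3"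
      "\<bar>s0 ^ 3 - 1\<bar> \<le> \<epsilon>" "\<bar>3 * s0\<^sup>2 * s1\<bar> \<le> \<epsilon>" "\<bar>p2\<bar> \<le> \<epsilon>"
    and h: "\<And>x. (h has_real_derivative \<tau> (\<alpha> + x) * sin x) (at x)" "h b = h (- a)"
    and X: "\<And>x. (X has_real_derivative \<sigma> x) (at x)"
    and M: "a \<le> M" "b \<le> M" "M = a \<or> M = b"
  shows "\<bar>b - a\<bar> \<le> 2000 * \<epsilon> * M\<^sup>2"
    and "\<bar>\<sigma> (\<alpha> + b) * b - \<sigma> (\<alpha> - a) * a\<bar> \<le> 20000 * \<epsilon> * M ^ 4"
    and "\<bar>X (\<alpha> + b) - X (\<alpha> - a) - (\<sigma> (\<alpha> + b) * b + \<sigma> (\<alpha> - a) * a)\<bar> \<le> 5 * \<epsilon> * M ^ 3"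
proof -
  have M0: "M > 0" and M3: "M \<le> 3" using M ab pi_less_4 by auto
  define d where "d = \<bar>b - a\<bar>"
  have d: "0 \<le> d" "d \<le> M" using M ab by (auto simp: d_def)
  let ?S = "\<lambda>x::real. sin x - x * cos x" and ?B = "\<lambda>x::real. 2 * x * sin x + (2 - x\<^sup>2) * cos x - 2"
  define p0 where "p0 = s0 ^ 3"
  define p1 where "p1 = 3 * s0\<^sup>2 * s1"
  \<comment> \<open>Exact integral of the second-order Taylor polynomial of \<open>\<tau>\<close>
    against the sine; the third-order remainder costs \<open>\<epsilon> * M^5\<close> after
    integration.\<close>
  define E where "E = (\<lambda>x. p0 * (1 - cos x) + p1 * ?S x + p2 / 2 * ?B x)"
  have Bd: "(?B has_real_derivative x\<^sup>2 * sin x) (at x)" for x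
    by (auto intro!: derivative_eq_intros simp: algebra_simps power2_eq_square)
  have Ed: "(E has_real_derivative (p0 + p1 * x + p2 * x\<^sup>2 / 2) * sin x) (at x)" for x
    unfolding E_def by (rule derivative_eq_intros Bd refl | simp)+ (simp add: algebra_simps)
  have HE: "\<bar>(h x - h 0) - E x\<bar> \<le> \<epsilon> * \<bar>x\<bar> ^ Suc 4" for x
  proof (rule abs_le_power_by_deriv[where f' = "\<lambda>x. \<tau> (\<alpha> + x) * sin x - (p0 + p1 * x + p2 * x\<^sup>2 / 2) * sin x"])
    show "((\<lambda>x. (h x - h 0) - E x) has_real_derivative \<tau> (\<alpha> + x) * sin x - (p0 + p1 * x + p2 * x\<^sup>2 / 2) * sin x) (at x)" for x
      by (auto intro!: derivative_eq_intros h(1) Ed)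
    show "\<bar>\<tau> (\<alpha> + x) * sin x - (p0 + p1 * x + p2 * x\<^sup>2 / 2) * sin x\<bar> \<le> \<epsilon> * \<bar>x\<bar> ^ 4" for x
    proof -
      have "\<bar>\<tau> (\<alpha> + x) * sin x - (p0 + p1 * x + p2 * x\<^sup>2 / 2) * sin x\<bar> = \<bar>\<tau> (\<alpha> + x) - p0 - p1 * x - p2 * x\<^sup>2 / 2\<bar> * \<bar>sin x\<bar>"
        by (simp add: abs_mult[symmetric] algebra_simps)
      also have "\<dots> \<le> (\<epsilon> * \<bar>x\<bar> ^ 3) * \<bar>x\<bar>" using \<tau>(1)[of x] \<epsilon> by (intro mult_mono abs_sin_x_le_abs_x) (auto simp: p0_def p1_def)
      finally show ?thesis by (simp add: eval_nat_numeral mult.assoc)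
    qed
  qed (use \<epsilon> in \<open>auto simp: E_def\<close>)
  have pw: "a ^ n \<le> M ^ n" "b ^ n \<le> M ^ n" for n using ab M by (auto intro!: power_mono)
  define R where "R = E b - E (- a)"
  have R: "\<bar>R\<bar> \<le> 2 * \<epsilon> * M ^ 5"
  proof -
    have "\<bar>h b - h 0 - E b\<bar> \<le> \<epsilon> * M ^ 5" "\<bar>h (- a) - h 0 - E (- a)\<bar> \<le> \<epsilon> * M ^ 5"
      using HE[of b] HE[of "- a"] mult_left_mono[OF pw(1)[of 5] \<epsilon>(1)] mult_left_mono[OF pw(2)[of 5] \<epsilon>(1)] ab by auto
    then show ?thesis unfolding R_def using h(2) by linarith
  qed
  have Re: "R = p0 * (cos a - cos b) + p1 * (?S b + ?S a) + p2 / 2 * (?B b - ?B a)"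
    by (simp add: R_def E_def algebra_simps)
  have BB: "\<bar>?B b - ?B a\<bar> \<le> d * M ^ 3"
  proof -
    have "\<bar>?B b - ?B a\<bar> \<le> M ^ 3 * \<bar>b - a\<bar>"
    proof (rule field_differentiable_bound[of "{0..M}" ?B "\<lambda>x. x\<^sup>2 * sin x", unfolded real_norm_def])
      show "\<bar>x\<^sup>2 * sin x\<bar> \<le> M ^ 3" if "x \<in> {0..M}" for x
      proof -
        have "\<bar>x\<^sup>2 * sin x\<bar> \<le> M\<^sup>2 * M" unfolding abs_mult using that abs_sin_x_le_abs_x[of x] by (intro mult_mono) (auto intro: power_mono)
        then show ?thesis by (simp add: eval_nat_numeral)
      qed
    qed (use Bd ab M in \<open>auto intro: DERIV_subset\<close>)
    then show ?thesis by (simp add: d_def mult.commute)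
  qed
  have SS: "\<bar>?S a - a ^ 3 / 3\<bar> \<le> M ^ 5" "\<bar>?S b - b ^ 3 / 3\<bar> \<le> M ^ 5"
    using sin_x_cos_bound[of a] sin_x_cos_bound[of b] pw[of 5] ab by auto
  have p0: "1 / 2 \<le> p0" using \<tau>(2) \<epsilon> unfolding p0_def by linarith
  have p1: "\<bar>p1\<bar> \<le> \<epsilon>" using \<tau>(3) by (simp add: p1_def)
  have M5: "M ^ 5 \<le> 9 * M ^ 3" "M ^ 4 \<le> 3 * M ^ 3"
  proof -
    have "M\<^sup>2 \<le> 9" using power_mono[OF M3, of 2] M0 by simp
    then have "M\<^sup>2 * M ^ 3 \<le> 9 * M ^ 3" using M0 by (intro mult_right_mono) auto
    then show "M ^ 5 \<le> 9 * M ^ 3" by (simp add: eval_nat_numeral)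
    show "M ^ 4 \<le> 3 * M ^ 3" using mult_right_mono[OF M3, of "M ^ 3"] M0 by (simp add: eval_nat_numeral)
  qed
  have rem: "\<bar>p0 * (cos a - cos b) + p1 * (a ^ 3 + b ^ 3) / 3\<bar> \<le> 4 * \<epsilon> * M ^ 5 + \<epsilon> * (d * M ^ 3)"
  proof -
    have e: "p0 * (cos a - cos b) + p1 * (a ^ 3 + b ^ 3) / 3 = R - p1 * ((?S b - b ^ 3 / 3) + (?S a - a ^ 3 / 3)) - p2 / 2 * (?B b - ?B a)"
      unfolding Re by (simp add: algebra_simps)
    have 1: "\<bar>p1 * ((?S b - b ^ 3 / 3) + (?S a - a ^ 3 / 3))\<bar> \<le> \<epsilon> * (2 * M ^ 5)"
      unfolding abs_mult using p1 SS \<epsilon> by (intro mult_mono) auto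
    have 2: "\<bar>p2 / 2 * (?B b - ?B a)\<bar> \<le> \<epsilon> * (d * M ^ 3)"
      unfolding abs_mult using \<tau>(4) BB \<epsilon> by (intro mult_mono) auto
    have tri: "\<bar>r - A - B\<bar> \<le> x + y + w" if "\<bar>r\<bar> \<le> x" "\<bar>A\<bar> \<le> y" "\<bar>B\<bar> \<le> w" for r A B x y w :: real using that by linarith
    show ?thesis unfolding e using tri[OF R 1 2] by simp
  qed
  \<comment> \<open>Nondegeneracy in \<open>b - a\<close>: by the product formula
    \<open>cos a - cos b\<close> is at least a multiple of \<open>M * d\<close>. Both sines are
    bounded below because \<open>a\<close> and \<open>b\<close> are at most
    \<open>2 * pi / 3\<close>.\<close>
  have cosd: "M * d / 16 \<le> \<bar>cos a - cos b\<bar>"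
  proof -
    have "M \<le> 2 * pi / 3" using M ab by auto
    then have dp: "d / 2 \<le> pi / 3" using d(2) by simp
    have s1: "(a + b) / 2 / 4 \<le> sin ((a + b) / 2)" using ab by (intro sin_ge_quarter) auto
    have s2: "d / 2 / 2 \<le> sin (d / 2)" using d(1) dp by (intro sin_ge_half) auto
    have "\<bar>cos a - cos b\<bar> = 2 * sin ((a + b) / 2) * sin (d / 2)"
    proof -
      have "cos a - cos b = 2 * sin ((a + b) / 2) * sin ((b - a) / 2)" by (rule cos_diff_cos)
      moreover have "\<bar>sin ((b - a) / 2)\<bar> = sin (d / 2)"
      proof (cases "a \<le> b")
        case True then show ?thesis using s2 d by (simp add: d_def)
      next
        case False
        then have "d = a - b" by (simp add: d_def)
        then have "(b - a) / 2 = - (d / 2)" by (simp add: minus_divide_left)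
        then have "\<bar>sin ((b - a) / 2)\<bar> = \<bar>sin (d / 2)\<bar>" by (simp only: sin_minus abs_minus_cancel)
        moreover have "0 \<le> d / 2 / 2" using d by simp
        ultimately show ?thesis using s2 by simp
      qed
      moreover have "0 \<le> sin ((a + b) / 2)" using order_trans[OF _ s1] ab by simp
      ultimately show ?thesis by (simp add: abs_mult)
    qed
    also have "\<dots> \<ge> 2 * ((a + b) / 2 / 4) * (d / 2 / 2)" using s1 s2 ab d by (intro mult_mono) auto
    finally have "2 * ((a + b) / 2 / 4) * (d / 2 / 2) \<le> \<bar>cos a - cos b\<bar>" .
    moreover have "2 * ((a + b) / 2 / 4) * (d / 2 / 2) = (a + b) * d / 16" by (simp add: field_simps)
    ultimately have "(a + b) * d / 16 \<le> \<bar>cos a - cos b\<bar>" by (simp only:)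
    moreover have "M * d / 16 \<le> (a + b) * d / 16" using M ab d by (intro divide_right_mono mult_right_mono) auto
    ultimately show ?thesis by linarith
  qed
  show first: "\<bar>b - a\<bar> \<le> 2000 * \<epsilon> * M\<^sup>2"
  proof -
    have "\<bar>p1 * (a ^ 3 + b ^ 3) / 3\<bar> \<le> \<epsilon> * M ^ 3"
    proof -
      have "\<bar>p1 * (a ^ 3 + b ^ 3)\<bar> \<le> \<epsilon> * (2 * M ^ 3)" unfolding abs_mult using p1 pw[of 3] ab \<epsilon> by (intro mult_mono) auto
      then show ?thesis using \<epsilon> M0 by simp
    qed
    moreover have "4 * \<epsilon> * M ^ 5 \<le> 36 * (\<epsilon> * M ^ 3)" using mult_left_mono[OF M5(1), of "4 * \<epsilon>"] \<epsilon> by simp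
    moreover have "\<epsilon> * (d * M ^ 3) \<le> 3 * (\<epsilon> * M ^ 3)"
      using mult_left_mono[OF mult_right_mono[of d 3 "M ^ 3"] \<epsilon>(1)] d M3 M0 by simp
    ultimately have "\<bar>p0 * (cos a - cos b)\<bar> \<le> 40 * (\<epsilon> * M ^ 3)" using rem by linarith
    moreover have "1 / 2 * (M * d / 16) \<le> \<bar>p0 * (cos a - cos b)\<bar>" unfolding abs_mult using p0 cosd M0 d by (intro mult_mono) auto
    ultimately have "M * d \<le> 1280 * (\<epsilon> * M ^ 3)" by linarith
    also have "\<dots> = M * (1280 * (\<epsilon> * M\<^sup>2))" by (simp add: eval_nat_numeral)
    finally have "M * d \<le> M * (1280 * (\<epsilon> * M\<^sup>2))" .
    then have "d \<le> 1280 * (\<epsilon> * M\<^sup>2)" using M0 by simp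
    also have "\<dots> \<le> 2000 * \<epsilon> * M\<^sup>2" using \<epsilon> by simp
    finally show ?thesis by (simp add: d_def)
  qed
  then have dM: "d \<le> 2000 * \<epsilon> * M\<^sup>2" by (simp add: d_def)
  have s0: "1 - \<epsilon> \<le> s0" "s0 \<le> 1 + \<epsilon>" using \<sigma>(2) by linarith+
  have ee: "2000 * (\<epsilon> * \<epsilon>) \<le> \<epsilon> / 10" using mult_left_mono[OF \<epsilon>(2) \<epsilon>(1)] \<epsilon>(1) by simp
  show "\<bar>\<sigma> (\<alpha> + b) * b - \<sigma> (\<alpha> - a) * a\<bar> \<le> 20000 * \<epsilon> * M ^ 4"
  proof -
    have CC: "\<bar>(cos a - cos b) - (b\<^sup>2 - a\<^sup>2) / 2\<bar> \<le> d * M ^ 3"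
    proof -
      have "\<bar>(- cos b - b\<^sup>2 / 2) - (- cos a - a\<^sup>2 / 2)\<bar> \<le> M ^ 3 * \<bar>b - a\<bar>"
      proof (rule field_differentiable_bound[of "{0..M}" "\<lambda>x. - cos x - x\<^sup>2 / 2" "\<lambda>x. sin x - x", unfolded real_norm_def])
        show "\<bar>sin x - x\<bar> \<le> M ^ 3" if "x \<in> {0..M}" for x
        proof -
          have "\<bar>x\<bar> ^ 3 \<le> M ^ 3" using that by (intro power_mono) auto
          then show ?thesis using sin_minus_bound[of x] by linarith
        qed
      qed (use ab M in \<open>auto intro!: derivative_eq_intros\<close>)
      then show ?thesis by (simp add: d_def mult.commute diff_divide_distrib algebra_simps)
    qed
    have p02: "p0 \<le> 2" using \<tau>(2) \<epsilon> unfolding p0_def by linarith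
    have dM3: "d * M ^ 3 \<le> 2000 * \<epsilon> * M ^ 5" using mult_right_mono[OF dM, of "M ^ 3"] M0 by (simp add: eval_nat_numeral mult.assoc)
    have 1: "\<bar>p0 * ((cos a - cos b) - (b\<^sup>2 - a\<^sup>2) / 2)\<bar> \<le> 2 * (2000 * \<epsilon> * M ^ 5)"
      unfolding abs_mult using CC dM3 p0 p02 M0 \<epsilon> by (intro mult_mono) auto
    have 2: "\<epsilon> * (d * M ^ 3) \<le> \<epsilon> * M ^ 5"
    proof -
      have "\<epsilon> * (d * M ^ 3) \<le> \<epsilon> * (2000 * \<epsilon> * M ^ 5)" using dM3 \<epsilon>(1) by (rule mult_left_mono)
      also have "\<dots> = 2000 * (\<epsilon> * \<epsilon>) * M ^ 5" by simp
      also have "\<dots> \<le> \<epsilon> * M ^ 5" using ee \<epsilon>(1) M0 by (intro mult_right_mono) auto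
      finally show ?thesis .
    qed
    have e3: "p0 * (b\<^sup>2 - a\<^sup>2) / 2 + p1 * (a ^ 3 + b ^ 3) / 3 = (p0 * (cos a - cos b) + p1 * (a ^ 3 + b ^ 3) / 3) - p0 * ((cos a - cos b) - (b\<^sup>2 - a\<^sup>2) / 2)"
      by (simp add: algebra_simps)
    have 3: "\<bar>p0 * (b\<^sup>2 - a\<^sup>2) / 2 + p1 * (a ^ 3 + b ^ 3) / 3\<bar> \<le> 4010 * (\<epsilon> * M ^ 5)"
    proof -
      have tri: "\<bar>A - B\<bar> \<le> x + y" if "\<bar>A\<bar> \<le> x" "\<bar>B\<bar> \<le> y" for A B x y :: real using that by linarith
      have "4 * \<epsilon> * M ^ 5 + \<epsilon> * (d * M ^ 3) + 2 * (2000 * \<epsilon> * M ^ 5) \<le> 4010 * (\<epsilon> * M ^ 5)"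
        using 2 mult_nonneg_nonneg[OF \<epsilon>(1) zero_le_power[of M 5]] M0 by simp
      then show ?thesis unfolding e3 using tri[OF rem 1] by linarith
    qed
    \<comment> \<open>What the expanded equation bounds after division by
      \<open>(a + b) * s0^2 / 2\<close>; it differs from the increment of
      \<open>\<sigma> * \<phi>\<close> only by terms of order
      \<open>\<epsilon> * M^4\<close>.\<close>
    define Q where "Q = s0 * (b - a) + 2 * s1 * (a\<^sup>2 - a * b + b\<^sup>2)"
    have 4: "p0 * (b\<^sup>2 - a\<^sup>2) / 2 + p1 * (a ^ 3 + b ^ 3) / 3 = (a + b) * s0\<^sup>2 / 2 * Q"
      unfolding p0_def p1_def Q_def by (simp add: field_simps) (simp add: eval_nat_numeral algebra_simps)
    have s02: "1 / 2 \<le> s0\<^sup>2"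
    proof -
      have "(9/10)\<^sup>2 \<le> s0\<^sup>2" using s0 \<epsilon> by (intro power_mono) auto
      then show ?thesis by (simp add: power2_eq_square)
    qed
    have "M * (1 / 2) / 2 * \<bar>Q\<bar> \<le> (a + b) * s0\<^sup>2 / 2 * \<bar>Q\<bar>"
      using s02 M ab by (intro mult_right_mono divide_right_mono mult_mono) auto
    also have "\<dots> = \<bar>(a + b) * s0\<^sup>2 / 2 * Q\<bar>" using ab by (simp add: abs_mult)
    also have "\<dots> \<le> 4010 * (\<epsilon> * M ^ 5)" using 3 unfolding 4 .
    also have "\<dots> = M / 4 * (16040 * (\<epsilon> * M ^ 4))" by (simp add: eval_nat_numeral)
    finally have "M / 4 * \<bar>Q\<bar> \<le> M / 4 * (16040 * (\<epsilon> * M ^ 4))" by simp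
    then have Q: "\<bar>Q\<bar> \<le> 16040 * (\<epsilon> * M ^ 4)" using M0 by simp
    define r1 where "r1 = \<sigma> (\<alpha> + b) - s0 - s1 * b - s2 * b\<^sup>2 / 2"
    define r2 where "r2 = \<sigma> (\<alpha> - a) - s0 + s1 * a - s2 * a\<^sup>2 / 2"
    have r: "\<bar>r1 * b\<bar> \<le> \<epsilon> * M ^ 4" "\<bar>r2 * a\<bar> \<le> \<epsilon> * M ^ 4"
    proof -
      have r0: "\<bar>r1\<bar> \<le> \<epsilon> * M ^ 3" "\<bar>r2\<bar> \<le> \<epsilon> * M ^ 3"
        using \<sigma>(1)[of b] \<sigma>(1)[of "- a"] mult_left_mono[OF pw(1)[of 3] \<epsilon>(1)] mult_left_mono[OF pw(2)[of 3] \<epsilon>(1)] ab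
        by (auto simp: r1_def r2_def)
      have "\<bar>r1\<bar> * \<bar>b\<bar> \<le> \<epsilon> * M ^ 3 * M" "\<bar>r2\<bar> * \<bar>a\<bar> \<le> \<epsilon> * M ^ 3 * M" using r0 M ab \<epsilon> M0 by (auto intro!: mult_mono)
      then show "\<bar>r1 * b\<bar> \<le> \<epsilon> * M ^ 4" "\<bar>r2 * a\<bar> \<le> \<epsilon> * M ^ 4" by (simp_all add: abs_mult eval_nat_numeral mult.assoc)
    qed
    have eq: "\<sigma> (\<alpha> + b) * b - \<sigma> (\<alpha> - a) * a = Q - s1 * (b - a)\<^sup>2 + s2 / 2 * (b ^ 3 - a ^ 3) + r1 * b - r2 * a"
      unfolding Q_def r1_def r2_def by (simp add: field_simps) (simp add: eval_nat_numeral algebra_simps)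
    have d2: "d * d \<le> M ^ 4"
    proof -
      have "2000 * \<epsilon> * M\<^sup>2 \<le> 1 * M\<^sup>2" using \<epsilon> by (intro mult_right_mono) auto
      then have "d \<le> M\<^sup>2" using dM by simp
      then have "d * d \<le> M\<^sup>2 * M\<^sup>2" using d by (intro mult_mono) auto
      then show ?thesis by (simp add: eval_nat_numeral mult.assoc)
    qed
    have t1: "\<bar>s1 * (b - a)\<^sup>2\<bar> \<le> \<epsilon> * M ^ 4"
    proof -
      have "(b - a)\<^sup>2 = d * d" by (simp add: d_def power2_eq_square)
      then show ?thesis unfolding abs_mult using \<sigma>(3) d2 d \<epsilon> by (intro mult_mono) auto
    qed
    have t2: "\<bar>s2 / 2 * (b ^ 3 - a ^ 3)\<bar> \<le> \<epsilon> * M ^ 4"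
    proof -
      have "b ^ 3 - a ^ 3 = (b - a) * (a\<^sup>2 + a * b + b\<^sup>2)" by (simp add: eval_nat_numeral algebra_simps)
      then have "\<bar>b ^ 3 - a ^ 3\<bar> = d * (a\<^sup>2 + a * b + b\<^sup>2)" using ab by (simp add: abs_mult d_def)
      also have "\<dots> \<le> d * (3 * M\<^sup>2)"
        using pw[of 2] mult_mono[OF M(1,2)] ab d by (intro mult_left_mono) (auto simp: power2_eq_square)
      also have "\<dots> \<le> (2000 * \<epsilon> * M\<^sup>2) * (3 * M\<^sup>2)" using dM by (intro mult_right_mono) auto
      also have "\<dots> \<le> 2 * M ^ 4"
      proof -
        have "6000 * \<epsilon> * M ^ 4 \<le> 2 * M ^ 4" using \<epsilon> by (intro mult_right_mono) auto
        then show ?thesis by (simp add: eval_nat_numeral mult.assoc)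
      qed
      finally have "\<bar>b ^ 3 - a ^ 3\<bar> \<le> 2 * M ^ 4" .
      then have "\<bar>s2 / 2\<bar> * \<bar>b ^ 3 - a ^ 3\<bar> \<le> (\<epsilon> / 2) * (2 * M ^ 4)" using \<sigma>(4) \<epsilon> by (intro mult_mono) auto
      then show ?thesis by (simp add: abs_mult)
    qed
    have "0 \<le> \<epsilon> * M ^ 4" using \<epsilon> M0 by simp
    then have "\<bar>\<sigma> (\<alpha> + b) * b - \<sigma> (\<alpha> - a) * a\<bar> \<le> 20000 * (\<epsilon> * M ^ 4)" unfolding eq using Q t1 t2 r by linarith
    then show ?thesis by simp
  qed
  show "\<bar>X (\<alpha> + b) - X (\<alpha> - a) - (\<sigma> (\<alpha> + b) * b + \<sigma> (\<alpha> - a) * a)\<bar> \<le> 5 * \<epsilon> * M ^ 3"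
  proof -
    have Xb: "\<bar>X (\<alpha> + x) - X \<alpha> - s0 * x - s1 * x\<^sup>2 / 2\<bar> \<le> \<epsilon> * \<bar>x\<bar> ^ Suc 2" for x
    proof (rule abs_le_power_by_deriv[where f' = "\<lambda>x. \<sigma> (\<alpha> + x) - s0 - s1 * x"])
      have "((\<lambda>x. X (\<alpha> + x)) has_real_derivative \<sigma> (\<alpha> + x)) (at x)" for x
        using DERIV_shift[of X "\<sigma> (\<alpha> + x)" x \<alpha>] X[of "\<alpha> + x"] by (simp add: add.commute)
      then show "((\<lambda>x. X (\<alpha> + x) - X \<alpha> - s0 * x - s1 * x\<^sup>2 / 2) has_real_derivative \<sigma> (\<alpha> + x) - s0 - s1 * x) (at x)" for x
        by (auto intro!: derivative_eq_intros)
    qed (use \<sigma>(5) \<epsilon> in auto)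
    define x1 where "x1 = X (\<alpha> + b) - X \<alpha> - s0 * b - s1 * b\<^sup>2 / 2"
    define x2 where "x2 = X (\<alpha> - a) - X \<alpha> + s0 * a - s1 * a\<^sup>2 / 2"
    define y1 where "y1 = \<sigma> (\<alpha> + b) - s0 - s1 * b"
    define y2 where "y2 = \<sigma> (\<alpha> - a) - s0 + s1 * a"
    have x: "\<bar>x1\<bar> \<le> \<epsilon> * M ^ 3" "\<bar>x2\<bar> \<le> \<epsilon> * M ^ 3"
      using Xb[of b] Xb[of "- a"] mult_left_mono[OF pw(1)[of 3] \<epsilon>(1)] mult_left_mono[OF pw(2)[of 3] \<epsilon>(1)] ab
      by (auto simp: x1_def x2_def numeral_3_eq_3 numeral_2_eq_2)
    have y: "\<bar>y1 * b\<bar> \<le> \<epsilon> * M ^ 3" "\<bar>y2 * a\<bar> \<le> \<epsilon> * M ^ 3"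
    proof -
      have r0: "\<bar>y1\<bar> \<le> \<epsilon> * M\<^sup>2" "\<bar>y2\<bar> \<le> \<epsilon> * M\<^sup>2"
        using \<sigma>(5)[of b] \<sigma>(5)[of "- a"] mult_left_mono[OF pw(1)[of 2] \<epsilon>(1)] mult_left_mono[OF pw(2)[of 2] \<epsilon>(1)] ab
        by (auto simp: y1_def y2_def)
      have "\<bar>y1\<bar> * \<bar>b\<bar> \<le> \<epsilon> * M\<^sup>2 * M" "\<bar>y2\<bar> * \<bar>a\<bar> \<le> \<epsilon> * M\<^sup>2 * M" using r0 M ab \<epsilon> M0 by (auto intro!: mult_mono)
      then show "\<bar>y1 * b\<bar> \<le> \<epsilon> * M ^ 3" "\<bar>y2 * a\<bar> \<le> \<epsilon> * M ^ 3" by (simp_all add: abs_mult eval_nat_numeral mult.assoc)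
    qed
    have eq: "X (\<alpha> + b) - X (\<alpha> - a) - (\<sigma> (\<alpha> + b) * b + \<sigma> (\<alpha> - a) * a) = x1 - x2 - y1 * b - y2 * a - s1 * (b\<^sup>2 - a\<^sup>2) / 2"
      unfolding x1_def x2_def y1_def y2_def by (simp add: field_simps power2_eq_square)
    have "\<bar>s1 * (b\<^sup>2 - a\<^sup>2) / 2\<bar> \<le> \<epsilon> * M ^ 3"
    proof -
      have "b\<^sup>2 - a\<^sup>2 = (b - a) * (a + b)" by (simp add: power2_eq_square algebra_simps)
      then have "\<bar>b\<^sup>2 - a\<^sup>2\<bar> = d * (a + b)" using ab by (simp add: abs_mult d_def)
      also have "\<dots> \<le> M\<^sup>2 * (2 * M)"
      proof (rule mult_mono)
        have "2000 * \<epsilon> * M\<^sup>2 \<le> 1 * M\<^sup>2" using \<epsilon> by (intro mult_right_mono) auto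
        then show "d \<le> M\<^sup>2" using dM by simp
      qed (use M ab in auto)
      finally have "\<bar>s1\<bar> * \<bar>b\<^sup>2 - a\<^sup>2\<bar> \<le> \<epsilon> * (M\<^sup>2 * (2 * M))" using \<sigma>(3) \<epsilon> by (intro mult_mono) auto
      then show ?thesis by (simp add: abs_mult eval_nat_numeral)
    qed
    then have "\<bar>X (\<alpha> + b) - X (\<alpha> - a) - (\<sigma> (\<alpha> + b) * b + \<sigma> (\<alpha> - a) * a)\<bar> \<le> 5 * (\<epsilon> * M ^ 3)" unfolding eq using x y by linarith
    then show ?thesis by simp
  qed
qed

lemma sinc_lipschitz:
  fixes x y m :: real
  assumes "0 < x" "x \<le> m" "0 < y" "y \<le> m"
  shows "\<bar>sin x / x - sin y / y\<bar> \<le> m * \<bar>x - y\<bar>"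
proof (rule field_differentiable_bound[of "{0<..m}" "\<lambda>x. sin x / x" "\<lambda>x. (cos x * x - sin x * 1) / (x * x)", unfolded real_norm_def])
  show "((\<lambda>x. sin x / x) has_field_derivative (cos x * x - sin x * 1) / (x * x)) (at x within {0<..m})" if "x \<in> {0<..m}" for x
    using that by (intro DERIV_divide DERIV_ident has_field_derivative_at_within[OF DERIV_sin]) auto
  show "\<bar>(cos x * x - sin x * 1) / (x * x)\<bar> \<le> m" if x: "x \<in> {0<..m}" for x
  proof -
    have "\<bar>sin x - x * cos x\<bar> \<le> 1 * \<bar>x\<bar> ^ Suc 2"
    proof (rule abs_le_power_by_deriv[where f' = "\<lambda>x. x * sin x"])
      show "((\<lambda>x. sin x - x * cos x) has_real_derivative x * sin x) (at x)" for x :: real by (auto intro!: derivative_eq_intros)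
      show "\<bar>x * sin x\<bar> \<le> 1 * \<bar>x\<bar>\<^sup>2" for x :: real
        using mult_left_mono[OF abs_sin_x_le_abs_x[of x] abs_ge_zero[of x]] by (simp add: abs_mult power2_eq_square)
    qed auto
    then have "\<bar>cos x * x - sin x * 1\<bar> \<le> x * (x * x)" using x by (simp add: mult.commute abs_minus_commute eval_nat_numeral)
    then have "\<bar>cos x * x - sin x * 1\<bar> / (x * x) \<le> x" using x by (simp add: pos_divide_le_eq)
    then show ?thesis using x by (simp add: abs_mult)
  qed
qed (use assms in auto)

text \<open>The invariant \<open>J = \<sigma> * \<phi>\<close> changes by
  \<open>O(\<epsilon> / q^4)\<close> per side, hence by \<open>O(\<epsilon> / q^3)\<close>
  altogether, and the total \<open>X\<close>-length \<open>2 * pi\<close> fixes its value near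
  \<open>pi / q\<close>. Before that the angles must be shown to be of size \<open>1 / q\<close>, by
  a crude bound and then by a logarithmic comparison. The constant \<open>10^11\<close> is not
  optimised.\<close>

lemma orbit_asymptotics:
  fixes \<sigma> \<tau> X :: "real \<Rightarrow> real"
  assumes "curve z \<rho>" and \<rho>: "\<And>t. \<rho> t = c * \<tau> t" and c: "c > 0" and \<tau>\<sigma>: "\<And>t. \<tau> t = \<sigma> t ^ 3"
    and \<epsilon>: "0 \<le> \<epsilon>" "\<epsilon> \<le> 1 / 100000"
    and \<sigma>: "\<And>x. (\<sigma> has_real_derivative \<sigma>1 x) (at x)" "\<And>x. (\<sigma>1 has_real_derivative \<sigma>2 x) (at x)" "\<And>x. (\<sigma>2 has_real_derivative \<sigma>3 x) (at x)"
      "\<And>x. \<bar>\<sigma> x - 1\<bar> \<le> \<epsilon>" "\<And>x. \<bar>\<sigma>1 x\<bar> \<le> \<epsilon>" "\<And>x. \<bar>\<sigma>2 x\<bar> \<le> \<epsilon>" "\<And>x. \<bar>\<sigma>3 x\<bar> \<le> \<epsilon>"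
    and \<tau>: "\<And>x. (\<tau> has_real_derivative \<tau>1 x) (at x)" "\<And>x. (\<tau>1 has_real_derivative \<tau>2 x) (at x)" "\<And>x. (\<tau>2 has_real_derivative \<tau>3 x) (at x)"
      "\<And>x. \<bar>\<tau> x - 1\<bar> \<le> \<epsilon>" "\<And>x. \<bar>\<tau>1 x\<bar> \<le> \<epsilon>" "\<And>x. \<bar>\<tau>2 x\<bar> \<le> \<epsilon>" "\<And>x. \<bar>\<tau>3 x\<bar> \<le> \<epsilon>"
    and X: "\<And>x. (X has_real_derivative \<sigma> x) (at x)" "X 0 = 0" "X (2 * pi) = 2 * pi"
    and q: "q \<ge> 2" and orb: "orbit z q \<theta> \<phi>"
  defines "x \<equiv> \<lambda>k. X (\<theta> k)" and "w \<equiv> \<lambda>k. sin (\<phi> k) * \<sigma> (\<theta> k)" and "C \<equiv> 10 ^ 11"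
  shows "\<And>k. k < q \<Longrightarrow> \<bar>x (Suc k) - x k - 2 * pi / q\<bar> \<le> C * \<epsilon> / q ^ 3"
    and "\<And>k. k \<le> q \<Longrightarrow> \<bar>x k - 2 * pi * k / q\<bar> \<le> C * \<epsilon> / q ^ 2"
    and "\<And>k. k < q \<Longrightarrow> \<bar>w (Suc k) - w k\<bar> \<le> C * \<epsilon> / q ^ 4"
    and "\<And>k. k \<le> q \<Longrightarrow> \<bar>w k - sin (pi / q)\<bar> \<le> C * \<epsilon> / q ^ 3"
proof -
  interpret curve z \<rho> by fact
  have th: "\<theta> 0 = 0" "\<theta> q = 2 * pi" "\<phi> q = \<phi> 0" and ph: "\<And>k. k \<le> q \<Longrightarrow> 0 < \<phi> k" "\<And>k. k \<le> q \<Longrightarrow> \<phi> k < pi"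
    and st: "\<And>k. k < q \<Longrightarrow> \<theta> (Suc k) = \<theta> k + \<phi> k + \<phi> (Suc k)"
    and ch: "\<And>k. k < q \<Longrightarrow> sgn (z (\<theta> (Suc k)) - z (\<theta> k)) = Tv (\<theta> k + \<phi> k)"
    using orb unfolding orbit_def by auto
  define n where "n = real q"
  have n: "n \<ge> 2" using q by (simp add: n_def)
  have sum\<phi>: "(\<Sum>k<q. \<phi> k + \<phi> (Suc k)) = 2 * pi"
  proof -
    have "(\<Sum>k<q. \<phi> k + \<phi> (Suc k)) = (\<Sum>k<q. \<theta> (Suc k) - \<theta> k)" using st by (intro sum.cong) auto
    also have "\<dots> = \<theta> q - \<theta> 0" by (rule sum_lessThan_telescope)
    finally show ?thesis using th by simp
  qed
  have sum\<phi>': "(\<Sum>k<q. \<phi> k) = pi"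
  proof -
    have "(\<Sum>k<q. \<phi> (Suc k)) = (\<Sum>k<q. \<phi> k) + \<phi> q - \<phi> 0"
      using sum.lessThan_Suc_shift[of \<phi> q] sum.lessThan_Suc[of \<phi> q] by simp
    then show ?thesis using sum\<phi> th(3) unfolding sum.distrib by simp
  qed
  define h where "h = (\<lambda>k s. - ((z (\<theta> k + \<phi> k + s) - z (\<theta> k + \<phi> k)) \<bullet> Nv (\<theta> k + \<phi> k)) / c)"
  have hd: "(h k has_real_derivative \<tau> (\<theta> k + \<phi> k + s) * sin s) (at s)" for k s
    using DERIV_cdivide[OF DERIV_minus[OF chord_normal_deriv[of "\<theta> k + \<phi> k" s UNIV]], of c] c unfolding h_def \<rho> by simp
  have heq: "h k (\<phi> (Suc k)) = h k (- \<phi> k)" if "k < q" for k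
  proof -
    have "(z (\<theta> (Suc k)) - z (\<theta> k)) \<bullet> Nv (\<theta> k + \<phi> k) = 0"
    proof -
      have "z (\<theta> (Suc k)) - z (\<theta> k) = norm (z (\<theta> (Suc k)) - z (\<theta> k)) *\<^sub>R sgn (z (\<theta> (Suc k)) - z (\<theta> k))"
        by (cases "z (\<theta> (Suc k)) - z (\<theta> k) = 0") (simp_all add: sgn_div_norm)
      then show ?thesis unfolding ch[OF that] by (metis inner_Tv_Nv diff_self sin_zero neg_equal_0_iff_equal inner_scaleR_left mult_zero_right)
    qed
    then show ?thesis unfolding h_def st[OF that] by (simp add: inner_diff_left)
  qed
  \<comment> \<open>The local estimate needs both angles at most \<open>2 * pi / 3\<close>. All
    \<open>\<phi> k\<close> add up to \<open>pi\<close>, so a larger one forces its successor below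
    \<open>pi / 3\<close>; but on an almost circular curve the vanishing normal component makes
    neighbouring angles almost equal.\<close>
  have \<phi>3: "\<phi> k \<le> 2 * pi / 3" if k: "k \<le> q" for k
  proof -
    have main: False if i: "i < q" and gt: "\<phi> i > 2 * pi / 3" for i
    proof -
      have b: "\<phi> (Suc i) \<le> pi / 3"
      proof -
        \<comment> \<open>The cyclic successor, since \<open>\<phi> q = \<phi> 0\<close>; it differs
          from \<open>i\<close> because \<open>q \<ge> 2\<close>.\<close>
        define j where "j = (if Suc i < q then Suc i else 0)"
        have j: "j < q" "j \<noteq> i" "\<phi> (Suc i) = \<phi> j" using i q th(3) by (auto simp: j_def) (metis Suc_lessI)
        have "sum \<phi> {i, j} \<le> sum \<phi> {..<q}" using i j ph(1) by (intro sum_mono2) (auto intro: less_imp_le)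
        then show ?thesis using j gt unfolding sum\<phi>' by simp
      qed
      let ?h = "h i" and ?\<alpha> = "\<theta> i + \<phi> i"
      have b0: "0 \<le> \<phi> (Suc i)" "0 \<le> \<phi> i" "\<phi> i \<le> pi" using ph[of i] ph[of "Suc i"] i by auto
      have up: "?h (\<phi> (Suc i)) - ?h 0 \<le> (1 + \<epsilon>) * (1 - cos (\<phi> (Suc i)))"
      proof -
        have "(1 + \<epsilon>) * (1 - cos 0) - (?h 0 - ?h 0) \<le> (1 + \<epsilon>) * (1 - cos (\<phi> (Suc i))) - (?h (\<phi> (Suc i)) - ?h 0)"
        proof (rule DERIV_nonneg_imp_nondecreasing[OF b0(1)])
          fix y assume y: "0 \<le> y" "y \<le> \<phi> (Suc i)"
          have "sin y \<ge> 0" using y b pi_gt_zero by (intro sin_ge_zero) auto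
          moreover have "\<tau> (?\<alpha> + y) \<le> 1 + \<epsilon>" using \<tau>(4)[of "?\<alpha> + y"] by linarith
          ultimately have "0 \<le> (1 + \<epsilon> - \<tau> (?\<alpha> + y)) * sin y" by (intro mult_nonneg_nonneg) auto
          moreover have "((\<lambda>y. (1 + \<epsilon>) * (1 - cos y) - (?h y - ?h 0)) has_real_derivative (1 + \<epsilon> - \<tau> (?\<alpha> + y)) * sin y) (at y)"
            by (auto intro!: derivative_eq_intros hd simp: algebra_simps)
          ultimately show "\<exists>d. ((\<lambda>y. (1 + \<epsilon>) * (1 - cos y) - (?h y - ?h 0)) has_real_derivative d) (at y) \<and> 0 \<le> d" by blast
        qed
        then show ?thesis by simp
      qed
      have lo: "(1 - \<epsilon>) * (1 - cos (\<phi> i)) \<le> ?h (- \<phi> i) - ?h 0"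
      proof -
        have "(?h (- 0) - ?h 0) - (1 - \<epsilon>) * (1 - cos 0) \<le> (?h (- \<phi> i) - ?h 0) - (1 - \<epsilon>) * (1 - cos (\<phi> i))"
        proof (rule DERIV_nonneg_imp_nondecreasing[OF b0(2)])
          fix y assume y: "0 \<le> y" "y \<le> \<phi> i"
          have "sin y \<ge> 0" using y b0 by (intro sin_ge_zero) auto
          moreover have "\<tau> (?\<alpha> - y) \<ge> 1 - \<epsilon>" using \<tau>(4)[of "?\<alpha> - y"] by linarith
          ultimately have "0 \<le> (\<tau> (?\<alpha> - y) - (1 - \<epsilon>)) * sin y" by (intro mult_nonneg_nonneg) auto
          moreover have "((\<lambda>y. (?h (- y) - ?h 0) - (1 - \<epsilon>) * (1 - cos y)) has_real_derivative (\<tau> (?\<alpha> - y) - (1 - \<epsilon>)) * sin y) (at y)"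
          proof -
            have "((\<lambda>y. ?h (- y)) has_real_derivative (\<tau> (?\<alpha> + - y) * sin (- y)) * (- 1)) (at y)"
              using DERIV_mirror[of ?h "\<tau> (?\<alpha> + - y) * sin (- y)" y] hd[of i "- y"] by simp
            then show ?thesis by (auto intro!: derivative_eq_intros simp: algebra_simps)
          qed
          ultimately show "\<exists>d. ((\<lambda>y. (?h (- y) - ?h 0) - (1 - \<epsilon>) * (1 - cos y)) has_real_derivative d) (at y) \<and> 0 \<le> d" by blast
        qed
        then show ?thesis by simp
      qed
      have c1: "1 - cos (\<phi> (Suc i)) \<le> 1 / 2"
        using cos_monotone_0_pi_le[of "\<phi> (Suc i)" "pi / 3"] b b0 by (simp add: cos_60)
      have c2: "3 / 2 \<le> 1 - cos (\<phi> i)"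
        using cos_monotone_0_pi_le[of "2 * pi / 3" "\<phi> i"] gt b0 by (simp add: cos_120)
      have "(1 - \<epsilon>) * (3 / 2) \<le> (1 - \<epsilon>) * (1 - cos (\<phi> i))" using c2 \<epsilon> by (intro mult_left_mono) auto
      moreover have "(1 + \<epsilon>) * (1 - cos (\<phi> (Suc i))) \<le> (1 + \<epsilon>) * (1 / 2)" using c1 \<epsilon> by (intro mult_left_mono) auto
      ultimately have "(1 - \<epsilon>) * (3 / 2) \<le> (1 + \<epsilon>) * (1 / 2)" using up lo heq[OF i] by linarith
      then show False using \<epsilon> by (simp add: algebra_simps)
    qed
    show ?thesis
    proof (rule ccontr)
      assume "\<not> ?thesis"
      then show False using main[of k] main[of 0] k q th(3) by (cases "k = q") auto
    qed
  qed
  define J where "J = (\<lambda>k. \<sigma> (\<theta> k) * \<phi> k)"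
  define M where "M = (\<lambda>k. max (\<phi> k) (\<phi> (Suc k)))"
  have \<tau>1: "\<tau>1 t = 3 * (\<sigma> t)\<^sup>2 * \<sigma>1 t" for t
  proof -
    have "((\<lambda>t. \<sigma> t ^ 3) has_real_derivative 3 * (\<sigma> t)\<^sup>2 * \<sigma>1 t) (at t)" by (auto intro!: derivative_eq_intros \<sigma>(1) simp: numeral_2_eq_2)
    moreover have "\<tau> = (\<lambda>t. \<sigma> t ^ 3)" using \<tau>\<sigma> by auto
    ultimately show ?thesis using DERIV_unique \<tau>(1) by metis
  qed
  have step: "\<bar>\<phi> (Suc k) - \<phi> k\<bar> \<le> 2000 * \<epsilon> * (M k)\<^sup>2" "\<bar>J (Suc k) - J k\<bar> \<le> 20000 * \<epsilon> * M k ^ 4"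
    "\<bar>x (Suc k) - x k - (J (Suc k) + J k)\<bar> \<le> 5 * \<epsilon> * M k ^ 3" if k: "k < q" for k
  proof -
    let ?\<alpha> = "\<theta> k + \<phi> k"
    have k': "k \<le> q" "Suc k \<le> q" using k by auto
    have p: "\<bar>\<sigma> ?\<alpha> ^ 3 - 1\<bar> \<le> \<epsilon>" "\<bar>3 * (\<sigma> ?\<alpha>)\<^sup>2 * \<sigma>1 ?\<alpha>\<bar> \<le> \<epsilon>" using \<tau>(4)[of ?\<alpha>] \<tau>(5)[of ?\<alpha>] unfolding \<tau>\<sigma> \<tau>1 by auto
    have ta: "\<bar>\<tau> (?\<alpha> + t) - \<sigma> ?\<alpha> ^ 3 - 3 * (\<sigma> ?\<alpha>)\<^sup>2 * \<sigma>1 ?\<alpha> * t - \<tau>2 ?\<alpha> * t\<^sup>2 / 2\<bar> \<le> \<epsilon> * \<bar>t\<bar> ^ 3" for t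
      using taylor3_bound(2)[OF \<tau>(1-3,7), of ?\<alpha> t] unfolding \<tau>1 \<tau>\<sigma>[of ?\<alpha>] .
    have t2: "\<bar>\<sigma> (?\<alpha> + t) - \<sigma> ?\<alpha> - \<sigma>1 ?\<alpha> * t\<bar> \<le> \<epsilon> * t\<^sup>2" for t
    proof -
      define S where "S = (\<lambda>x. \<sigma> x)"
      have "\<exists>S. \<forall>x. (S has_real_derivative \<sigma> x) (at x)" using X(1) by blast
      then show ?thesis using taylor3_bound(1)[OF X(1) \<sigma>(1,2,6), of ?\<alpha> t] by simp
    qed
    note bs = bounce_step[where \<sigma>=\<sigma> and \<tau>=\<tau> and h="h k" and X=X and \<alpha>="?\<alpha>" and a="\<phi> k" and b="\<phi> (Suc k)" and M="M k",
        OF ph(1)[OF k'(1)] ph(1)[OF k'(2)] \<phi>3[OF k'(1)] \<phi>3[OF k'(2)] \<epsilon> taylor3_bound(2)[OF \<sigma>(1-3,7)] \<sigma>(4) \<sigma>(5) \<sigma>(6) t2 ta p \<tau>(6) hd heq[OF k] X(1)]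
    have e: "?\<alpha> + \<phi> (Suc k) = \<theta> (Suc k)" "?\<alpha> - \<phi> k = \<theta> k" using st[OF k] by auto
    have MM: "\<phi> k \<le> M k" "\<phi> (Suc k) \<le> M k" "M k = \<phi> k \<or> M k = \<phi> (Suc k)" by (auto simp: M_def)
    show "\<bar>\<phi> (Suc k) - \<phi> k\<bar> \<le> 2000 * \<epsilon> * (M k)\<^sup>2" "\<bar>J (Suc k) - J k\<bar> \<le> 20000 * \<epsilon> * M k ^ 4"
      "\<bar>x (Suc k) - x k - (J (Suc k) + J k)\<bar> \<le> 5 * \<epsilon> * M k ^ 3"
      using bs[OF MM] unfolding e J_def x_def by auto
  qed
  \<comment> \<open>The relative change of \<open>\<phi>\<close> is at most a multiple of the angle
    covered by the side, so the logarithms accumulate at most a multiple of the total angle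
    \<open>2 * pi\<close>, whatever the number of sides.\<close>
  have logstep: "\<bar>ln (\<phi> (Suc k)) - ln (\<phi> k)\<bar> \<le> 4000 * \<epsilon> * (\<phi> k + \<phi> (Suc k))" if k: "k < q" for k
  proof -
    have k': "k \<le> q" "Suc k \<le> q" using k by auto
    define m where "m = min (\<phi> k) (\<phi> (Suc k))"
    have m0: "m > 0" using ph(1) k' by (simp add: m_def)
    have M3: "M k \<le> 3" "M k > 0" using \<phi>3[OF k'(1)] \<phi>3[OF k'(2)] ph(1)[OF k'(1)] pi_less_4 by (auto simp: M_def)
    have dM: "M k - m = \<bar>\<phi> (Suc k) - \<phi> k\<bar>" by (auto simp: M_def m_def)
    have d1: "M k - m \<le> 2000 * \<epsilon> * (M k)\<^sup>2" using step(1)[OF k] dM by simp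
    also have "\<dots> \<le> 1 / 50 * (M k * 3)"
      unfolding power2_eq_square using M3 \<epsilon> by (intro mult_mono) auto
    finally have mM: "M k / 2 \<le> m" using M3 by simp
    have "ln (M k) - ln m = ln (M k / m)" using M3 m0 by (simp add: ln_div)
    also have "\<dots> \<le> M k / m - 1" using M3 m0 by (intro ln_le_minus_one) auto
    also have "\<dots> = (M k - m) / m" using m0 by (simp add: diff_divide_distrib)
    also have "\<dots> \<le> (2000 * \<epsilon> * (M k)\<^sup>2) / (M k / 2)" using d1 mM M3 dM by (intro frac_le) auto
    also have "\<dots> = 4000 * \<epsilon> * M k" using M3 by (simp add: power2_eq_square)
    also have "\<dots> \<le> 4000 * \<epsilon> * (\<phi> k + \<phi> (Suc k))" using ph(1)[OF k'(1)] ph(1)[OF k'(2)] \<epsilon> by (intro mult_left_mono) (auto simp: M_def)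
    finally have l: "ln (M k) - ln m \<le> 4000 * \<epsilon> * (\<phi> k + \<phi> (Suc k))" .
    have "0 \<le> ln (M k) - ln m" using m0 by (auto simp: M_def m_def)
    then have "\<bar>ln (\<phi> (Suc k)) - ln (\<phi> k)\<bar> = ln (M k) - ln m" by (cases "\<phi> k \<le> \<phi> (Suc k)") (auto simp: M_def m_def max_def min_def)
    then show ?thesis using l by simp
  qed
  have log0: "\<bar>ln (\<phi> k) - ln (\<phi> 0)\<bar> \<le> 32 / 100" if "k \<le> q" for k
  proof -
    have "\<bar>ln (\<phi> k) - ln (\<phi> 0)\<bar> = \<bar>\<Sum>i<k. ln (\<phi> (Suc i)) - ln (\<phi> i)\<bar>"
      unfolding sum_lessThan_telescope[of "\<lambda>i. ln (\<phi> i)"] ..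
    also have "\<dots> \<le> (\<Sum>i<k. 4000 * \<epsilon> * (\<phi> i + \<phi> (Suc i)))" using that logstep by (intro order_trans[OF sum_abs] sum_mono) auto
    also have "\<dots> \<le> (\<Sum>i<q. 4000 * \<epsilon> * (\<phi> i + \<phi> (Suc i)))"
    proof (rule sum_mono2)
      show "0 \<le> 4000 * \<epsilon> * (\<phi> b + \<phi> (Suc b))" if "b \<in> {..<q} - {..<k}" for b
        using ph(1)[of b] ph(1)[of "Suc b"] that \<epsilon>(1) by (intro mult_nonneg_nonneg) auto
    qed (use that in auto)
    also have "\<dots> = 4000 * \<epsilon> * (2 * pi)" unfolding sum_distrib_left[symmetric] sum\<phi> ..
    also have "\<dots> \<le> 4 / 100 * 8" using \<epsilon> pi_less_4 by (intro mult_mono) auto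
    finally show ?thesis by simp
  qed
  \<comment> \<open>Two deviations of \<open>32/100\<close> add up to less than 2/3, a lower bound
    for \<open>ln 2\<close>.\<close>
  have comp: "\<phi> i \<le> 2 * \<phi> j" if "i \<le> q" "j \<le> q" for i j
  proof -
    have "ln (\<phi> i) \<le> ln 2 + ln (\<phi> j)" using log0[OF that(1)] log0[OF that(2)] ln2_ge_two_thirds by linarith
    also have "\<dots> = ln (2 * \<phi> j)" using ph(1)[OF that(2)] by (simp add: ln_mult)
    finally show ?thesis using ph(1)[OF that(1)] ph(1)[OF that(2)] by simp
  qed
  have \<phi>n: "\<phi> k \<le> 8 / n" if "k \<le> q" for k
  proof -
    have "(\<Sum>i<q. \<phi> k / 2) \<le> (\<Sum>i<q. \<phi> i)" using comp[OF that] by (intro sum_mono) (auto simp: field_simps)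
    then have "n * (\<phi> k / 2) \<le> pi" unfolding sum\<phi>' by (simp add: n_def)
    then have "n * \<phi> k \<le> 8" using pi_less_4 by simp
    then show ?thesis using n by (simp add: pos_le_divide_eq mult.commute)
  qed
  \<comment> \<open>Absorbs the largest constant of the local estimates,
    \<open>20000 * 8^4\<close>.\<close>
  define E where "E = 10 ^ 8 * \<epsilon>"
  have E0: "E \<ge> 0" using \<epsilon> by (simp add: E_def)
  have n0: "n > 0" using n by simp
  have Mn: "M k \<le> 8 / n" "0 \<le> M k" if "k < q" for k using \<phi>n[of k] \<phi>n[of "Suc k"] ph(1)[of k] that by (auto simp: M_def)
  have d\<phi>: "\<bar>\<phi> (Suc k) - \<phi> k\<bar> \<le> 128000 * \<epsilon> / n ^ 2" if k: "k < q" for k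
  proof -
    have "2000 * \<epsilon> * (M k)\<^sup>2 \<le> 2000 * \<epsilon> * (8 / n)\<^sup>2" using Mn[OF k] \<epsilon> by (intro mult_left_mono power_mono) auto
    then show ?thesis using step(1)[OF k] by (simp add: power_divide)
  qed
  have dJ: "\<bar>J (Suc k) - J k\<bar> \<le> E / n ^ 4" if k: "k < q" for k
  proof -
    have "20000 * \<epsilon> * M k ^ 4 \<le> 20000 * \<epsilon> * (8 / n) ^ 4" using Mn[OF k] \<epsilon> by (intro mult_left_mono power_mono) auto
    also have "\<dots> = 81920000 * \<epsilon> / n ^ 4" by (simp add: power_divide)
    also have "\<dots> \<le> E / n ^ 4" unfolding E_def using \<epsilon> n0 by (intro divide_right_mono mult_right_mono) auto
    finally show ?thesis using step(2)[OF k] by linarith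
  qed
  have dx: "\<bar>x (Suc k) - x k - (J (Suc k) + J k)\<bar> \<le> E / n ^ 3" if k: "k < q" for k
  proof -
    have "5 * \<epsilon> * M k ^ 3 \<le> 5 * \<epsilon> * (8 / n) ^ 3" using Mn[OF k] \<epsilon> by (intro mult_left_mono power_mono) auto
    also have "\<dots> = 2560 * \<epsilon> / n ^ 3" by (simp add: power_divide)
    also have "\<dots> \<le> E / n ^ 3" unfolding E_def using \<epsilon> n0 by (intro divide_right_mono mult_right_mono) auto
    finally show ?thesis using step(3)[OF k] by linarith
  qed
  have accum: "\<bar>f k - f 0 - real k * s\<bar> \<le> n * B" if "k \<le> q" "\<And>i. i < q \<Longrightarrow> \<bar>f (Suc i) - f i - s\<bar> \<le> B" "0 \<le> B" for f :: "nat \<Rightarrow> real" and k s B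
  proof -
    have "f k - f 0 - real k * s = (\<Sum>i<k. f (Suc i) - f i - s)"
      unfolding sum_subtractf[of "\<lambda>i. f (Suc i) - f i"] sum_lessThan_telescope by simp
    also have "\<bar>\<dots>\<bar> \<le> (\<Sum>i<k. B)" using that by (intro order_trans[OF sum_abs] sum_mono) auto
    also have "\<dots> \<le> n * B" using that by (simp add: n_def mult_right_mono)
    finally show ?thesis .
  qed
  have nE: "n * (E / n ^ 4) = E / n ^ 3" "n * (E / n ^ 3) = E / n ^ 2" "n * (7 * E / n ^ 3) = 7 * E / n ^ 2" using n0 by (simp_all add: eval_nat_numeral)
  have J0: "\<bar>J k - J 0\<bar> \<le> E / n ^ 3" if "k \<le> q" for k
    using accum[OF that, of J 0 "E / n ^ 4"] dJ E0 n0 unfolding nE by simp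
  \<comment> \<open>All increments of \<open>x\<close> are \<open>2 * J 0\<close> up to a small
    error and add up to \<open>2 * pi\<close>, since \<open>X\<close> maps a full turn to a full
    turn.\<close>
  have Jp: "\<bar>J 0 - pi / n\<bar> \<le> 2 * E / n ^ 3"
  proof -
    have "\<bar>x (Suc i) - x i - 2 * J 0\<bar> \<le> 3 * E / n ^ 3" if "i < q" for i
    proof -
      have "\<bar>x (Suc i) - x i - (J (Suc i) + J i)\<bar> + \<bar>J (Suc i) - J 0\<bar> + \<bar>J i - J 0\<bar> \<le> E / n ^ 3 + E / n ^ 3 + E / n ^ 3"
        using dx[OF that] J0[of "Suc i"] J0[of i] that by (intro add_mono) auto
      moreover have "3 * E / n ^ 3 = E / n ^ 3 + E / n ^ 3 + E / n ^ 3" by simp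
      ultimately show ?thesis by linarith
    qed
    then have "\<bar>x q - x 0 - n * (2 * J 0)\<bar> \<le> n * (3 * E / n ^ 3)"
      using accum[of q x "2 * J 0" "3 * E / n ^ 3"] E0 n0 by (simp add: n_def)
    moreover have "x q - x 0 = 2 * pi" by (simp add: x_def th X)
    ultimately have 1: "\<bar>2 * pi - n * (2 * J 0)\<bar> \<le> n * (3 * E / n ^ 3)" by simp
    have "2 * pi - n * (2 * J 0) = (2 * n) * (pi / n - J 0)" using n0 by (simp add: algebra_simps)
    then have e1: "\<bar>2 * pi - n * (2 * J 0)\<bar> = (2 * n) * \<bar>J 0 - pi / n\<bar>" using n0 by (simp add: abs_mult abs_minus_commute)
    have e2: "(2 * n) * (3 / 2 * E / n ^ 3) = n * (3 * E / n ^ 3)" by simp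
    have "(2 * n) * \<bar>J 0 - pi / n\<bar> \<le> (2 * n) * (3 / 2 * E / n ^ 3)" unfolding e2 using 1 unfolding e1 .
    then have "\<bar>J 0 - pi / n\<bar> \<le> 3 / 2 * E / n ^ 3" by (rule mult_left_le_imp_le) (use n0 in simp)
    also have "\<dots> \<le> 2 * E / n ^ 3" using E0 n0 by (intro divide_right_mono mult_right_mono) auto
    finally show ?thesis .
  qed
  have Jk: "\<bar>J k - pi / n\<bar> \<le> 3 * E / n ^ 3" if "k \<le> q" for k using J0[OF that] Jp by simp
  have CE: "7 * E \<le> C * \<epsilon>" "2 * E \<le> C * \<epsilon>" "131 * E \<le> C * \<epsilon>" using \<epsilon> by (auto simp: C_def E_def)
  have inc: "\<bar>x (Suc k) - x k - 2 * pi / n\<bar> \<le> 7 * E / n ^ 3" if "k < q" for k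
  proof -
    have "\<bar>x (Suc k) - x k - (J (Suc k) + J k)\<bar> + \<bar>J (Suc k) - pi / n\<bar> + \<bar>J k - pi / n\<bar> \<le> E / n ^ 3 + 3 * E / n ^ 3 + 3 * E / n ^ 3"
      using dx[OF that] Jk[of "Suc k"] Jk[of k] that by (intro add_mono) auto
    moreover have "7 * E / n ^ 3 = E / n ^ 3 + 3 * E / n ^ 3 + 3 * E / n ^ 3" by simp
    moreover have "2 * pi / n = pi / n + pi / n" by simp
    ultimately show ?thesis by linarith
  qed
  show "\<bar>x (Suc k) - x k - 2 * pi / q\<bar> \<le> C * \<epsilon> / q ^ 3" if "k < q" for k
    using inc[OF that] divide_right_mono[OF CE(1), of "n ^ 3"] n0 by (simp add: n_def)
  show "\<bar>x k - 2 * pi * k / q\<bar> \<le> C * \<epsilon> / q ^ 2" if "k \<le> q" for k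
  proof -
    have "\<bar>x k - x 0 - real k * (2 * pi / n)\<bar> \<le> n * (7 * E / n ^ 3)"
      using inc E0 n0 by (intro accum[OF that]) auto
    then have "\<bar>x k - 2 * pi * k / q\<bar> \<le> 7 * E / n ^ 2" unfolding nE by (simp add: x_def th X n_def mult.commute)
    then show ?thesis using divide_right_mono[OF CE(1), of "n ^ 2"] n0 by (simp add: n_def)
  qed
  \<comment> \<open>The function \<open>sin y / y\<close> has a Lipschitz constant of order
    \<open>1 / q\<close> on the range of the angles, which makes the increments of the weight as
    small as those of \<open>J\<close>.\<close>
  have weq: "w k = J k * (sin (\<phi> k) / \<phi> k)" if "k \<le> q" for k using ph(1)[OF that] by (simp add: w_def J_def)
  have sc: "\<bar>sin y / y\<bar> \<le> 1" for y :: real using abs_sin_x_le_abs_x[of y] by (cases "y = 0") (auto simp: abs_divide divide_le_eq_1)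
  have s\<theta>: "\<bar>\<sigma> t\<bar> \<le> 2" for t using \<sigma>(4)[of t] \<epsilon> by linarith
  have Jb: "\<bar>J k\<bar> \<le> 16 / n" if "k \<le> q" for k
  proof -
    have "\<bar>J k\<bar> \<le> 2 * (8 / n)" unfolding J_def abs_mult using s\<theta>[of "\<theta> k"] \<phi>n[OF that] ph(1)[OF that] by (intro mult_mono) auto
    then show ?thesis by simp
  qed
  show "\<bar>w (Suc k) - w k\<bar> \<le> C * \<epsilon> / q ^ 4" if k: "k < q" for k
  proof -
    have k': "k \<le> q" "Suc k \<le> q" using k by auto
    define s where "s = (\<lambda>k. sin (\<phi> k) / \<phi> k)"
    have "w k = J k * s k" "w (Suc k) = J (Suc k) * s (Suc k)" using weq[OF k'(1)] weq[OF k'(2)] by (simp_all only: s_def)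
    then have "w (Suc k) - w k = (J (Suc k) - J k) * s (Suc k) + J k * (s (Suc k) - s k)" by (simp add: algebra_simps)
    moreover have "\<bar>(J (Suc k) - J k) * s (Suc k)\<bar> \<le> E / n ^ 4 * 1"
      unfolding abs_mult using dJ[OF k] sc[of "\<phi> (Suc k)"] E0 n0 by (intro mult_mono) (auto simp: s_def)
    moreover have "\<bar>J k * (s (Suc k) - s k)\<bar> \<le> 16 / n * (8 / n * (128000 * \<epsilon> / n ^ 2))"
      unfolding abs_mult
    proof (rule mult_mono[OF Jb[OF k'(1)]])
      have "\<bar>s (Suc k) - s k\<bar> \<le> 8 / n * \<bar>\<phi> (Suc k) - \<phi> k\<bar>" unfolding s_def
        using ph(1)[OF k'(1)] ph(1)[OF k'(2)] \<phi>n[OF k'(1)] \<phi>n[OF k'(2)] by (intro sinc_lipschitz)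
      also have "\<dots> \<le> 8 / n * (128000 * \<epsilon> / n ^ 2)" using d\<phi>[OF k] n0 by (intro mult_left_mono) auto
      finally show "\<bar>s (Suc k) - s k\<bar> \<le> 8 / n * (128000 * \<epsilon> / n ^ 2)" .
    qed (use n0 in auto)
    moreover have "16 / n * (8 / n * (128000 * \<epsilon> / n ^ 2)) \<le> E / n ^ 4"
    proof -
      have "16 / n * (8 / n * (128000 * \<epsilon> / n ^ 2)) = 16384000 * \<epsilon> / n ^ 4" by (simp add: eval_nat_numeral)
      also have "\<dots> \<le> E / n ^ 4" unfolding E_def using \<epsilon> n0 by (intro divide_right_mono mult_right_mono) auto
      finally show ?thesis .
    qed
    ultimately have "\<bar>w (Suc k) - w k\<bar> \<le> E / n ^ 4 + E / n ^ 4" by linarith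
    then have "\<bar>w (Suc k) - w k\<bar> \<le> 2 * E / n ^ 4" by simp
    then show ?thesis using divide_right_mono[OF CE(2), of "n ^ 4"] n0 by (simp add: n_def)
  qed
  show "\<bar>w k - sin (pi / q)\<bar> \<le> C * \<epsilon> / q ^ 3" if k: "k \<le> q" for k
  proof -
    have pn: "0 < pi / n" "pi / n \<le> 8 / n" "pi / n \<le> 4 / n" using n0 pi_less_4 by (auto intro!: divide_right_mono)
    have "\<bar>\<phi> k - J k\<bar> \<le> \<epsilon> * (8 / n)"
    proof -
      have "\<phi> k - J k = (1 - \<sigma> (\<theta> k)) * \<phi> k" by (simp add: J_def algebra_simps)
      moreover have "\<bar>1 - \<sigma> (\<theta> k)\<bar> * \<bar>\<phi> k\<bar> \<le> \<epsilon> * (8 / n)" using \<sigma>(4)[of "\<theta> k"] \<phi>n[OF k] ph(1)[OF k] \<epsilon>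
        by (intro mult_mono) auto
      ultimately show ?thesis by (simp only: abs_mult)
    qed
    moreover have "\<epsilon> * (8 / n) \<le> E / n" unfolding E_def using \<epsilon> n0 by (simp add: divide_right_mono)
    moreover have "3 * E / n ^ 3 \<le> 3 * E / n"
    proof -
      have "n ^ 1 \<le> n ^ 3" using n by (intro power_increasing) auto
      then show ?thesis using E0 n0 by (intro divide_left_mono mult_pos_pos) auto
    qed
    ultimately have "\<bar>\<phi> k - pi / n\<bar> \<le> E / n + 3 * E / n" using Jk[OF k] by linarith
    then have p: "\<bar>\<phi> k - pi / n\<bar> \<le> 4 * E / n" by simp
    define s where "s = (\<lambda>y::real. sin y / y)"
    have "sin (pi / n) = pi / n * s (pi / n)" using pn by (simp add: s_def)
    moreover have "w k = J k * s (\<phi> k)" using weq[OF k] by (simp only: s_def)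
    ultimately have "w k - sin (pi / n) = (J k - pi / n) * s (\<phi> k) + pi / n * (s (\<phi> k) - s (pi / n))"
    proof -
      have "A * x - p * y = (A - p) * x + p * (x - y)" for A x p y :: real by (simp add: algebra_simps)
      then show ?thesis using \<open>sin (pi / n) = pi / n * s (pi / n)\<close> \<open>w k = J k * s (\<phi> k)\<close> by metis
    qed
    moreover have "\<bar>(J k - pi / n) * s (\<phi> k)\<bar> \<le> 3 * E / n ^ 3 * 1"
      unfolding abs_mult using Jk[OF k] sc[of "\<phi> k"] E0 n0 by (intro mult_mono) (auto simp: s_def)
    moreover have "\<bar>pi / n * (s (\<phi> k) - s (pi / n))\<bar> \<le> 4 / n * (8 / n * (4 * E / n))"
      unfolding abs_mult
    proof (rule mult_mono)
      have "\<bar>s (\<phi> k) - s (pi / n)\<bar> \<le> 8 / n * \<bar>\<phi> k - pi / n\<bar>" unfolding s_def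
        using ph(1)[OF k] \<phi>n[OF k] pn by (intro sinc_lipschitz)
      also have "\<dots> \<le> 8 / n * (4 * E / n)" using p n0 by (intro mult_left_mono) auto
      finally show "\<bar>s (\<phi> k) - s (pi / n)\<bar> \<le> 8 / n * (4 * E / n)" .
    qed (use n0 pn in auto)
    moreover have "4 / n * (8 / n * (4 * E / n)) = 128 * E / n ^ 3" by (simp add: eval_nat_numeral)
    moreover have "131 * E / n ^ 3 = 3 * E / n ^ 3 * 1 + 128 * E / n ^ 3" by simp
    ultimately have "\<bar>w k - sin (pi / n)\<bar> \<le> 131 * E / n ^ 3" by linarith
    then show ?thesis using divide_right_mono[OF CE(3), of "n ^ 3"] n0 by (simp add: n_def)
  qed
qed

section \<open>Functions with bounded derivatives\<close>

text \<open>The C^m norm, taken as the maximum over the orders and not as a sum, so that the same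
  constant is passed on when a derivative is stripped off.\<close>

primrec bC :: "nat \<Rightarrow> real \<Rightarrow> (real \<Rightarrow> real) \<Rightarrow> bool" where
  "bC 0 B f \<longleftrightarrow> (\<forall>x. \<bar>f x\<bar> \<le> B)"
| "bC (Suc m) B f \<longleftrightarrow> (\<forall>x. \<bar>f x\<bar> \<le> B) \<and> (\<exists>f'. (\<forall>x. (f has_real_derivative f' x) (at x)) \<and> bC m B f')"

lemma bC_abs: "bC m B f \<Longrightarrow> \<bar>f x\<bar> \<le> B"
  by (cases m) auto

lemma bC_nonneg: "bC m B f \<Longrightarrow> 0 \<le> B"
  using bC_abs[of m B f 0] by simp

lemma bC_SucI:
  assumes "\<And>x. \<bar>f x\<bar> \<le> B" "\<And>x. (f has_real_derivative f' x) (at x)" "bC m B f'"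
  shows "bC (Suc m) B f"
  using assms by auto

lemma bC_SucE:
  assumes "bC (Suc m) B f"
  obtains f' where "\<And>x. (f has_real_derivative f' x) (at x)" "bC m B f'"
  using assms by auto

lemma bC_deriv: "bC (Suc m) B f \<Longrightarrow> (\<And>x. (f has_real_derivative f' x) (at x)) \<Longrightarrow> bC m B f'"
  by (metis DERIV_unique bC_SucE ext)

lemma bC_mono: "bC m A f \<Longrightarrow> A \<le> B \<Longrightarrow> bC m B f"
proof (induction m arbitrary: f)
  case (Suc m)
  obtain f' where f': "\<And>x. (f has_real_derivative f' x) (at x)" "bC m A f'" using bC_SucE[OF Suc.prems(1)] by blast
  show ?case using bC_abs[OF Suc.prems(1)] Suc.prems(2) f'(1) Suc.IH[OF f'(2) Suc.prems(2)]
    by (intro bC_SucI[of f B f']) (auto intro: order_trans)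
qed (auto intro: order_trans)

lemma bC_Suc_imp: "bC (Suc m) B f \<Longrightarrow> bC m B f"
proof (induction m arbitrary: f)
  case (Suc m)
  obtain f' where f': "\<And>x. (f has_real_derivative f' x) (at x)" "bC (Suc m) B f'" using bC_SucE[OF Suc.prems] by blast
  show ?case using bC_abs[OF Suc.prems] f'(1) Suc.IH[OF f'(2)] by (intro bC_SucI[of f B f']) auto
qed auto

lemma bC_le: "bC m B f \<Longrightarrow> k \<le> m \<Longrightarrow> bC k B f"
  by (induction m) (auto simp: le_Suc_eq simp del: bC.simps dest: bC_Suc_imp)

lemma bC_const: "bC m \<bar>c\<bar> (\<lambda>_. c)"
proof (induction m arbitrary: c)
  case (Suc m)
  have "bC m \<bar>c\<bar> (\<lambda>_. 0)" using Suc[of 0] by (rule bC_mono) auto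
  then show ?case by (intro bC_SucI[of _ _ "\<lambda>_. 0"]) auto
qed auto

lemma bC_add: "bC m A f \<Longrightarrow> bC m B g \<Longrightarrow> bC m (A + B) (\<lambda>x. f x + g x)"
proof (induction m arbitrary: f g)
  case 0 then show ?case by (auto intro: order_trans[OF abs_triangle_ineq add_mono])
next
  case (Suc m)
  obtain f' where f': "\<And>x. (f has_real_derivative f' x) (at x)" "bC m A f'" using bC_SucE[OF Suc.prems(1)] by blast
  obtain g' where g': "\<And>x. (g has_real_derivative g' x) (at x)" "bC m B g'" using bC_SucE[OF Suc.prems(2)] by blast
  show ?case
  proof (rule bC_SucI)
    show "\<bar>f x + g x\<bar> \<le> A + B" for x using bC_abs[OF Suc.prems(1), of x] bC_abs[OF Suc.prems(2), of x] by linarith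
    show "((\<lambda>x. f x + g x) has_real_derivative f' x + g' x) (at x)" for x by (intro DERIV_add f'(1) g'(1))
  qed (rule Suc.IH[OF f'(2) g'(2)])
qed

lemma bC_cmult: "bC m B f \<Longrightarrow> bC m (\<bar>c\<bar> * B) (\<lambda>x. c * f x)"
proof (induction m arbitrary: f)
  case 0 then show ?case by (auto simp: abs_mult intro: mult_left_mono)
next
  case (Suc m)
  obtain f' where f': "\<And>x. (f has_real_derivative f' x) (at x)" "bC m B f'" using bC_SucE[OF Suc.prems(1)] by blast
  show ?case
  proof (rule bC_SucI)
    show "\<bar>c * f x\<bar> \<le> \<bar>c\<bar> * B" for x using bC_abs[OF Suc.prems(1), of x] by (auto simp: abs_mult intro: mult_left_mono)
    show "((\<lambda>x. c * f x) has_real_derivative c * f' x) (at x)" for x by (intro DERIV_cmult f'(1))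
  qed (rule Suc.IH[OF f'(2)])
qed

lemma bC_diff: "bC m A f \<Longrightarrow> bC m B g \<Longrightarrow> bC m (A + B) (\<lambda>x. f x - g x)"
  using bC_add[of m A f B "\<lambda>x. (-1) * g x"] bC_cmult[of m B g "-1"] by simp

lemma bC_mult: "bC m A f \<Longrightarrow> bC m B g \<Longrightarrow> bC m (2 ^ m * A * B) (\<lambda>x. f x * g x)"
proof (induction m arbitrary: f g)
  case 0 then show ?case by (auto simp: abs_mult intro!: mult_mono intro: order_trans[OF abs_ge_zero])
next
  case (Suc m)
  have AB: "0 \<le> A" "0 \<le> B" using bC_nonneg[OF Suc.prems(1)] bC_nonneg[OF Suc.prems(2)] by auto
  obtain f' where f': "\<And>x. (f has_real_derivative f' x) (at x)" "bC m A f'" using bC_SucE[OF Suc.prems(1)] by blast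
  obtain g' where g': "\<And>x. (g has_real_derivative g' x) (at x)" "bC m B g'" using bC_SucE[OF Suc.prems(2)] by blast
  show ?case
  proof (rule bC_SucI)
    have "\<bar>f x * g x\<bar> \<le> A * B" for x unfolding abs_mult using AB bC_abs[OF Suc.prems(1)] bC_abs[OF Suc.prems(2)] by (intro mult_mono) auto
    moreover have "1 * (A * B) \<le> 2 ^ Suc m * (A * B)" using AB by (intro mult_right_mono one_le_power mult_nonneg_nonneg) auto
    ultimately show "\<bar>f x * g x\<bar> \<le> 2 ^ Suc m * A * B" for x by (auto intro: order_trans simp: mult.assoc)
    show "((\<lambda>x. f x * g x) has_real_derivative f x * g' x + f' x * g x) (at x)" for x by (intro DERIV_mult' f'(1) g'(1))
    have "bC m (2 ^ m * A * B + 2 ^ m * A * B) (\<lambda>x. f x * g' x + f' x * g x)"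
      by (intro bC_add Suc.IH f'(2) g'(2) bC_Suc_imp[OF Suc.prems(1)] bC_Suc_imp[OF Suc.prems(2)])
    then show "bC m (2 ^ Suc m * A * B) (\<lambda>x. f x * g' x + f' x * g x)" by (simp add: algebra_simps)
  qed
qed

text \<open>The induction runs over all exponents at once, because differentiation lowers the
  exponent by one.\<close>

lemma bC_powr_aux:
  "\<exists>C. \<forall>f. bC m (1/2) (\<lambda>x. f x - 1) \<longrightarrow> bC m C (\<lambda>x. f x powr p)"
proof (induction m arbitrary: p)
  case 0
  have "\<bar>f x powr p\<bar> \<le> (3/2) powr p + (1/2) powr p" if "\<forall>x. \<bar>f x - 1\<bar> \<le> 1/2" for f :: "real \<Rightarrow> real" and x
  proof -
    have fx: "1/2 \<le> f x" "f x \<le> 3/2" using that[rule_format, of x] by linarith+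
    show ?thesis
    proof (cases "p \<ge> 0")
      case True then have "f x powr p \<le> (3/2) powr p" using fx by (intro powr_mono2) auto
      then show ?thesis by (simp add: add_increasing2)
    next
      case False then have "f x powr p \<le> (1/2) powr p" using fx by (intro powr_mono2') auto
      then show ?thesis by (simp add: add_increasing)
    qed
  qed
  then show ?case by (intro exI[of _ "(3/2) powr p + (1/2) powr p"]) auto
next
  case (Suc m)
  obtain C0 where C0: "\<And>f. bC m (1/2) (\<lambda>x. f x - 1) \<Longrightarrow> bC m C0 (\<lambda>x. f x powr p)" using Suc.IH[of p] by blast
  obtain C1 where C1: "\<And>f. bC m (1/2) (\<lambda>x. f x - 1) \<Longrightarrow> bC m C1 (\<lambda>x. f x powr (p - 1))" using Suc.IH[of "p - 1"] by blast
  define C where "C = max C0 (\<bar>p\<bar> * (2 ^ m * C1 * (1/2)))"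
  have "bC (Suc m) C (\<lambda>x. f x powr p)" if f: "bC (Suc m) (1/2) (\<lambda>x. f x - 1)" for f
  proof -
    obtain f' where f': "\<And>x. ((\<lambda>x. f x - 1) has_real_derivative f' x) (at x)" "bC m (1/2) f'" using bC_SucE[OF f] by blast
    have fd: "(f has_real_derivative f' x) (at x)" for x using DERIV_add[OF f'(1)[of x] DERIV_const[of 1]] by simp
    have fm: "bC m (1/2) (\<lambda>x. f x - 1)" using f by (rule bC_Suc_imp)
    have fx: "f x > 0" for x using bC_abs[OF f, of x] by linarith
    show ?thesis
    proof (rule bC_SucI)
      show "\<bar>f x powr p\<bar> \<le> C" for x using bC_abs[OF C0[OF fm], of x] by (simp add: C_def)
      show "((\<lambda>x. f x powr p) has_real_derivative p * (f x powr (p - 1) * f' x)) (at x)" for x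
        using DERIV_fun_powr[OF fd[of x] fx[of x], of p] by (simp add: mult.assoc)
      show "bC m C (\<lambda>x. p * (f x powr (p - 1) * f' x))"
        by (rule bC_mono[OF bC_cmult[OF bC_mult[OF C1[OF fm] f'(2)]]]) (simp add: C_def)
    qed
  qed
  then show ?case by blast
qed

text \<open>The bound has to be linear in \<open>\<epsilon>\<close>. Order zero comes from the mean
  value theorem; in higher orders the factor \<open>f'\<close> carries the \<open>\<epsilon>\<close>
  and the power only a fixed constant.\<close>

lemma bC_powr:
  "\<exists>C\<ge>0. \<forall>f \<epsilon>. \<epsilon> \<le> 1/2 \<longrightarrow> bC m \<epsilon> (\<lambda>x. f x - 1) \<longrightarrow> bC m (C * \<epsilon>) (\<lambda>x. f x powr p - 1)"
proof -
  obtain D where D: "\<And>f. bC m (1/2) (\<lambda>x. f x - 1) \<Longrightarrow> bC m D (\<lambda>x. f x powr (p - 1))" using bC_powr_aux by blast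
  define K where "K = \<bar>p\<bar> * ((3/2) powr (p-1) + (1/2) powr (p-1))"
  have K0: "K \<ge> 0" by (simp add: K_def)
  have lip: "\<bar>x powr p - 1\<bar> \<le> K * \<bar>x - 1\<bar>" if x: "1/2 \<le> x" "x \<le> 3/2" for x :: real
  proof -
    have "\<bar>x powr p - 1 powr p\<bar> \<le> K * \<bar>x - 1\<bar>"
    proof (rule field_differentiable_bound[of "{1/2..3/2}" "\<lambda>x. x powr p" "\<lambda>x. p * x powr (p - 1)", unfolded real_norm_def])
      show "((\<lambda>x. x powr p) has_field_derivative p * x powr (p - 1)) (at x within {1/2..3/2})" if "x \<in> {1/2..3/2}" for x :: real
        using that by (intro has_field_derivative_at_within[OF has_real_derivative_powr]) auto
      show "\<bar>p * x powr (p - 1)\<bar> \<le> K" if "x \<in> {1/2..3/2}" for x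
      proof -
        have "x powr (p - 1) \<le> (3/2) powr (p-1) + (1/2) powr (p-1)"
        proof (cases "p - 1 \<ge> 0")
          case True then have "x powr (p-1) \<le> (3/2) powr (p-1)" using that by (intro powr_mono2) auto
          then show ?thesis by (simp add: add_increasing2)
        next
          case False then have "x powr (p-1) \<le> (1/2) powr (p-1)" using that by (intro powr_mono2') auto
          then show ?thesis by (simp add: add_increasing)
        qed
        then show ?thesis unfolding K_def abs_mult by (intro mult_left_mono) auto
      qed
    qed (use x in auto)
    then show ?thesis by simp
  qed
  define C where "C = max K (\<bar>p\<bar> * (2 ^ m * \<bar>D\<bar>))"
  have "bC m (C * \<epsilon>) (\<lambda>x. f x powr p - 1)" if e: "\<epsilon> \<le> 1/2" and f: "bC m \<epsilon> (\<lambda>x. f x - 1)" for f \<epsilon>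
  proof -
    have e0: "0 \<le> \<epsilon>" using bC_nonneg[OF f] .
    have fx: "1/2 \<le> f x" "f x \<le> 3/2" for x using bC_abs[OF f, of x] e by linarith+
    have b0: "\<bar>f x powr p - 1\<bar> \<le> C * \<epsilon>" for x
    proof -
      have "\<bar>f x powr p - 1\<bar> \<le> K * \<bar>f x - 1\<bar>" using fx by (rule lip)
      also have "\<dots> \<le> C * \<epsilon>" using bC_abs[OF f, of x] e0 K0 by (intro mult_mono) (auto simp: C_def)
      finally show ?thesis .
    qed
    show ?thesis
    proof (cases m)
      case 0 then show ?thesis using b0 by simp
    next
      case (Suc k)
      obtain f' where f': "\<And>x. ((\<lambda>x. f x - 1) has_real_derivative f' x) (at x)" "bC k \<epsilon> f'" using bC_SucE[OF f[unfolded Suc]] by blast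
      have fd: "(f has_real_derivative f' x) (at x)" for x using DERIV_add[OF f'(1)[of x] DERIV_const[of 1]] by simp
      have fp: "f x > 0" for x using fx(1)[of x] by linarith
      have Dk: "bC k D (\<lambda>x. f x powr (p - 1))" using D[OF bC_mono[OF f e]] unfolding Suc by (rule bC_Suc_imp)
      show ?thesis unfolding Suc
      proof (rule bC_SucI)
        show "((\<lambda>x. f x powr p - 1) has_real_derivative p * (f x powr (p - 1) * f' x)) (at x)" for x
          using DERIV_diff[OF DERIV_fun_powr[OF fd[of x] fp[of x], of p] DERIV_const[of 1]] by (simp add: mult.assoc)
        have "\<bar>p\<bar> * (2 ^ k * D * \<epsilon>) \<le> C * \<epsilon>"
        proof -
          have "\<bar>p\<bar> * (2 ^ k * D) \<le> \<bar>p\<bar> * (2 ^ m * \<bar>D\<bar>)"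
          proof (intro mult_left_mono)
            have "2 ^ k * D \<le> 2 ^ k * \<bar>D\<bar>" by (intro mult_left_mono) auto
            also have "\<dots> \<le> 2 ^ m * \<bar>D\<bar>" unfolding Suc by (intro mult_right_mono power_increasing) auto
            finally show "2 ^ k * D \<le> 2 ^ m * \<bar>D\<bar>" .
          qed auto
          also have "\<dots> \<le> C" by (simp add: C_def)
          finally have "\<bar>p\<bar> * (2 ^ k * D) * \<epsilon> \<le> C * \<epsilon>" using e0 by (rule mult_right_mono)
          then show ?thesis by (simp add: mult.assoc)
        qed
        then show "bC k (C * \<epsilon>) (\<lambda>x. p * (f x powr (p - 1) * f' x))"
          by (rule bC_mono[OF bC_cmult[OF bC_mult[OF Dk f'(2)]]])
      qed (rule b0)
    qed
  qed
  moreover have "C \<ge> 0" using K0 by (simp add: C_def)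
  ultimately show ?thesis by blast
qed

text \<open>Since \<open>s\<close> solves the autonomous equation \<open>s' = g (s)\<close>, the
  derivative of \<open>f (s x)\<close> is the product \<open>f' * g\<close> taken at
  \<open>s x\<close>, again of the same form. So no chain rule of higher order appears, and the
  constant is independent of \<open>s\<close>.\<close>

lemma bC_reparam:
  "\<exists>C\<ge>0. \<forall>f g s B. bC m B f \<longrightarrow> bC m 2 g \<longrightarrow> (\<forall>x. (s has_real_derivative g (s x)) (at x)) \<longrightarrow> bC m (C * B) (\<lambda>x. f (s x))"
proof (induction m)
  case 0 then show ?case by (intro exI[of _ 1]) auto
next
  case (Suc m)
  then obtain C where C: "C \<ge> 0" "\<And>f g s B. bC m B f \<Longrightarrow> bC m 2 g \<Longrightarrow> (\<And>x. (s has_real_derivative g (s x)) (at x)) \<Longrightarrow> bC m (C * B) (\<lambda>x. f (s x))" by blast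
  define C' where "C' = max 1 (C * (2 ^ m * 2))"
  have "bC (Suc m) (C' * B) (\<lambda>x. f (s x))"
    if f: "bC (Suc m) B f" and g: "bC (Suc m) 2 g" and s: "\<And>x. (s has_real_derivative g (s x)) (at x)" for f g s B
  proof -
    have B: "0 \<le> B" using bC_nonneg[OF f] .
    obtain f' where f': "\<And>x. (f has_real_derivative f' x) (at x)" "bC m B f'" using bC_SucE[OF f] by blast
    have gm: "bC m 2 g" using g by (rule bC_Suc_imp)
    show ?thesis
    proof (rule bC_SucI)
      have "1 * B \<le> C' * B" using B by (intro mult_right_mono) (auto simp: C'_def)
      then show "\<bar>f (s x)\<bar> \<le> C' * B" for x using bC_abs[OF f, of "s x"] by linarith
      show "((\<lambda>x. f (s x)) has_real_derivative f' (s x) * g (s x)) (at x)" for x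
        by (rule DERIV_chain2[where f = f and g = s, OF f'(1) s])
      have "C * (2 ^ m * B * 2) = (C * (2 ^ m * 2)) * B" by simp
      also have "\<dots> \<le> C' * B" using B by (intro mult_right_mono) (auto simp: C'_def)
      finally show "bC m (C' * B) (\<lambda>x. f' (s x) * g (s x))"
        using bC_mono[OF C(2)[OF bC_mult[OF f'(2) gm] gm s]] by simp
    qed
  qed
  then show ?case by (intro exI[of _ C']) (auto simp: C'_def simp del: bC.simps)
qed

section \<open>Decay of oscillatory integrals\<close>

lemma periodic_deriv:
  fixes f :: "real \<Rightarrow> real"
  assumes "\<And>x. (f has_real_derivative f' x) (at x)" "\<And>x. f (x + c) = f x"
  shows "f' (x + c) = f' x"
proof -
  have "((\<lambda>x. f (x + c)) has_real_derivative f' (x + c)) (at x)" using assms(1)[of "x + c"] by (simp add: DERIV_shift)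
  then show ?thesis using assms DERIV_unique by (metis (no_types, lifting) DERIV_cong_ev ext)
qed

lemma abs_integral_le:
  fixes f :: "real \<Rightarrow> real"
  assumes "\<And>x. x \<in> {a..b} \<Longrightarrow> \<bar>f x\<bar> \<le> B" "a \<le> b" "0 \<le> B"
  shows "\<bar>integral {a..b} f\<bar> \<le> B * (b - a)"
proof (cases "f integrable_on {a..b}")
  case True then show ?thesis using integral_norm_bound_integral[of f "{a..b}" "\<lambda>_. B"] assms by (simp add: integrable_const_ivl mult.commute)
next
  \<comment> \<open>A function that is not integrable has \<open>integral\<close> 0 by
    convention.\<close>
  case False then show ?thesis using assms by (simp add: not_integrable_integral)
qed

text \<open>\<open>g\<close> is the reciprocal of \<open>\<sigma>\<close>, named separately because
  each integration by parts multiplies by it.\<close>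

definition phase :: "(real \<Rightarrow> real) \<Rightarrow> (real \<Rightarrow> real) \<Rightarrow> (real \<Rightarrow> real) \<Rightarrow> bool" where
  "phase \<sigma> g X \<longleftrightarrow> (\<forall>x. g (x + 2 * pi) = g x) \<and> (\<forall>x. \<sigma> x * g x = 1) \<and> (\<forall>x. (X has_real_derivative \<sigma> x) (at x)) \<and> X 0 = 0 \<and> X (2 * pi) = 2 * pi"

text \<open>Each integration by parts moves a derivative onto \<open>f * g\<close> and gains
  \<open>1 / j\<close>; the boundary terms vanish or cancel by periodicity. Sine and cosine
  alternate, so both are carried through the induction.\<close>

lemma oscillatory_decay:
  "\<exists>C\<ge>0. \<forall>f g \<sigma> X B j. bC m B f \<longrightarrow> (\<forall>x. f (x + 2 * pi) = f x) \<longrightarrow> bC m 2 g \<longrightarrow> phase \<sigma> g X \<longrightarrow> 1 \<le> j \<longrightarrow>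
     \<bar>integral {0..2*pi} (\<lambda>x. f x * cos (real j * X x))\<bar> \<le> C * B / real j ^ m \<and> \<bar>integral {0..2*pi} (\<lambda>x. f x * sin (real j * X x))\<bar> \<le> C * B / real j ^ m"
proof (induction m)
  case 0
  have "\<bar>integral {0..2*pi} (\<lambda>x. f x * c x)\<bar> \<le> 2 * pi * B" if "\<forall>x. \<bar>f x\<bar> \<le> B" "\<forall>x. \<bar>c x\<bar> \<le> 1" for f c :: "real \<Rightarrow> real" and B
  proof -
    have B: "0 \<le> B" using that(1)[rule_format, of 0] by linarith
    have "\<bar>f x * c x\<bar> \<le> B * 1" for x unfolding abs_mult using that B by (intro mult_mono) auto
    then show ?thesis using abs_integral_le[of 0 "2*pi" "\<lambda>x. f x * c x" B] B by (simp add: mult.commute)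
  qed
  then show ?case by (intro exI[of _ "2 * pi"]) auto
next
  case (Suc m)
  then obtain C where C: "C \<ge> 0" and IH: "\<And>f g \<sigma> X B j. bC m B f \<Longrightarrow> (\<forall>x. f (x + 2 * pi) = f x) \<Longrightarrow> bC m 2 g \<Longrightarrow> phase \<sigma> g X \<Longrightarrow> 1 \<le> j \<Longrightarrow>
     \<bar>integral {0..2*pi} (\<lambda>x. f x * cos (real j * X x))\<bar> \<le> C * B / real j ^ m \<and> \<bar>integral {0..2*pi} (\<lambda>x. f x * sin (real j * X x))\<bar> \<le> C * B / real j ^ m" by blast
  define C' where "C' = C * (2 ^ Suc m * 2)"
  have "\<bar>integral {0..2*pi} (\<lambda>x. f x * cos (real j * X x))\<bar> \<le> C' * B / real j ^ Suc m \<and> \<bar>integral {0..2*pi} (\<lambda>x. f x * sin (real j * X x))\<bar> \<le> C' * B / real j ^ Suc m"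
    if f: "bC (Suc m) B f" "\<forall>x. f (x + 2 * pi) = f x" and g: "bC (Suc m) 2 g" and ph: "phase \<sigma> g X" and j: "1 \<le> j"
    for f g \<sigma> X B and j :: nat
  proof -
    have g2: "\<forall>x. g (x + 2 * pi) = g x" and \<sigma>: "\<forall>x. \<sigma> x * g x = 1" and X: "\<forall>x. (X has_real_derivative \<sigma> x) (at x)" "X 0 = 0" "X (2 * pi) = 2 * pi"
      using ph unfolding phase_def by auto
    obtain F' where F': "\<And>x. ((\<lambda>x. f x * g x) has_real_derivative F' x) (at x)" "bC m (2 ^ Suc m * B * 2) F'"
      using bC_SucE[OF bC_mult[OF f(1) g]] by blast
    have per: "\<forall>x. F' (x + 2 * pi) = F' x" using periodic_deriv[OF F'(1), of "2 * pi"] f(2) g2 by simp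
    have fg: "f x * g x * \<sigma> x = f x" for x using \<sigma>[rule_format, of x] by (metis mult.assoc mult.commute mult.right_neutral)
    have Xd: "(X has_real_derivative \<sigma> x) (at x)" for x using X(1) by blast
    have fd: "f differentiable at x" for x using f(1) by (auto simp: real_differentiable_def)
    have fc: "continuous_on S f" for S using fd by (meson continuous_at_imp_continuous_on differentiable_imp_continuous_within)
    have Xc: "continuous_on S X" for S using Xd by (meson DERIV_isCont continuous_at_imp_continuous_on)
    have j0: "real j > 0" using j by simp
    have 1: "((\<lambda>x. F' x * sin (real j * X x) / real j + f x * cos (real j * X x)) has_integral 0) {0..2*pi}"
    proof -
      have "((\<lambda>x. f x * g x * (sin (real j * X x) / real j)) has_real_derivative F' x * sin (real j * X x) / real j + f x * cos (real j * X x)) (at x)" for x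
      proof -
        have "((\<lambda>x. sin (real j * X x) / real j) has_real_derivative cos (real j * X x) * \<sigma> x) (at x)"
          using j0 by (auto intro!: derivative_eq_intros Xd)
        from DERIV_mult'[OF F'(1)[of x] this] show ?thesis
          by (rule DERIV_cong) (use fg[of x] in \<open>auto simp: mult.assoc mult.commute mult.left_commute\<close>)
      qed
      then have "((\<lambda>x. F' x * sin (real j * X x) / real j + f x * cos (real j * X x)) has_integral
        f (2*pi) * g (2*pi) * (sin (real j * X (2*pi)) / real j) - f 0 * g 0 * (sin (real j * X 0) / real j)) {0..2*pi}"
        by (intro fundamental_theorem_of_calculus) (auto simp: has_real_derivative_iff_has_vector_derivative[symmetric] intro: DERIV_subset)
      moreover have "sin (real j * (2 * pi)) = 0" using sin_int_2pin[of "int j"] by (simp add: mult.commute mult.left_commute)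
      ultimately show ?thesis using X by simp
    qed
    have 2: "((\<lambda>x. F' x * cos (real j * X x) / real j - f x * sin (real j * X x)) has_integral 0) {0..2*pi}"
    proof -
      have "((\<lambda>x. f x * g x * (cos (real j * X x) / real j)) has_real_derivative F' x * cos (real j * X x) / real j - f x * sin (real j * X x)) (at x)" for x
      proof -
        have "((\<lambda>x. cos (real j * X x) / real j) has_real_derivative - sin (real j * X x) * \<sigma> x) (at x)"
          using j0 by (auto intro!: derivative_eq_intros Xd)
        from DERIV_mult'[OF F'(1)[of x] this] show ?thesis
          by (rule DERIV_cong) (use fg[of x] in \<open>auto simp: mult.assoc mult.commute mult.left_commute\<close>)
      qed
      then have "((\<lambda>x. F' x * cos (real j * X x) / real j - f x * sin (real j * X x)) has_integral
        f (2*pi) * g (2*pi) * (cos (real j * X (2*pi)) / real j) - f 0 * g 0 * (cos (real j * X 0) / real j)) {0..2*pi}"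
        by (intro fundamental_theorem_of_calculus) (auto simp: has_real_derivative_iff_has_vector_derivative[symmetric] intro: DERIV_subset)
      moreover have "cos (real j * (2 * pi)) = 1" using cos_int_2pin[of "int j"] by (simp add: mult.commute mult.left_commute)
      moreover have "f (2 * pi) = f 0" "g (2 * pi) = g 0" using f(2)[rule_format, of 0] g2[rule_format, of 0] by auto
      ultimately show ?thesis using X by simp
    qed
    have i1: "(\<lambda>x. f x * cos (real j * X x)) integrable_on {0..2*pi}" "(\<lambda>x. f x * sin (real j * X x)) integrable_on {0..2*pi}"
      by (auto intro!: integrable_continuous_interval continuous_intros fc Xc)
    have "((\<lambda>x. F' x * sin (real j * X x) / real j) has_integral - integral {0..2*pi} (\<lambda>x. f x * cos (real j * X x))) {0..2*pi}"
      using has_integral_diff[OF 1 integrable_integral[OF i1(1)]] by simp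
    then have "integral {0..2*pi} (\<lambda>x. F' x * sin (real j * X x) / real j) = - integral {0..2*pi} (\<lambda>x. f x * cos (real j * X x))" by (rule integral_unique)
    then have a: "integral {0..2*pi} (\<lambda>x. f x * cos (real j * X x)) = - (integral {0..2*pi} (\<lambda>x. F' x * sin (real j * X x)) / real j)"
      by (simp add: integral_divide)
    have "((\<lambda>x. F' x * cos (real j * X x) / real j) has_integral integral {0..2*pi} (\<lambda>x. f x * sin (real j * X x))) {0..2*pi}"
      using has_integral_add[OF 2 integrable_integral[OF i1(2)]] by simp
    then have "integral {0..2*pi} (\<lambda>x. F' x * cos (real j * X x) / real j) = integral {0..2*pi} (\<lambda>x. f x * sin (real j * X x))" by (rule integral_unique)
    then have b: "integral {0..2*pi} (\<lambda>x. f x * sin (real j * X x)) = integral {0..2*pi} (\<lambda>x. F' x * cos (real j * X x)) / real j"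
      by (simp add: integral_divide)
    have ih: "\<bar>integral {0..2*pi} (\<lambda>x. F' x * cos (real j * X x))\<bar> \<le> C * (2 ^ Suc m * B * 2) / real j ^ m" "\<bar>integral {0..2*pi} (\<lambda>x. F' x * sin (real j * X x))\<bar> \<le> C * (2 ^ Suc m * B * 2) / real j ^ m"
      using IH[OF F'(2) per bC_Suc_imp[OF g] ph j] by auto
    have c: "C * (2 ^ Suc m * B * 2) / real j ^ m / real j = C' * B / real j ^ Suc m" by (simp add: C'_def mult.commute mult.left_commute)
    show ?thesis unfolding a b using divide_right_mono[OF ih(1), of "real j"] divide_right_mono[OF ih(2), of "real j"] j0 unfolding c
      by (simp add: abs_divide)
  qed
  then show ?case using C by (intro exI[of _ C']) (auto simp: C'_def simp del: bC.simps)
qed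

section \<open>Fourier series in a circle coordinate\<close>

locale circle_phase =
  fixes \<sigma> X :: "real \<Rightarrow> real"
  assumes \<sigma>_cont: "continuous_on UNIV \<sigma>" and \<sigma>_pos: "\<And>t. \<sigma> t > 0"
    and X_deriv: "\<And>t. (X has_real_derivative \<sigma> t) (at t)" and X_0: "X 0 = 0" and X_2pi: "X (2 * pi) = 2 * pi"
    and X_sym: "\<And>t. X (2 * pi - t) = 2 * pi - X t"
begin

lemma X_cont: "continuous_on S X"
  using X_deriv by (meson DERIV_isCont continuous_at_imp_continuous_on)

lemma \<sigma>_cont': "continuous_on S \<sigma>" using \<sigma>_cont continuous_on_subset by blast

lemma X_less: "s < t \<Longrightarrow> X s < X t"
  using DERIV_pos_imp_increasing[of s t X] X_deriv \<sigma>_pos by blast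

lemma cos_has_integral:
  "((\<lambda>t. cos (of_int n * X t) * \<sigma> t) has_integral (if n = 0 then 2 * pi else 0)) {0..2*pi}"
proof (cases "n = 0")
  case True
  have "(\<sigma> has_integral (X (2*pi) - X 0)) {0..2*pi}"
    using X_deriv by (intro fundamental_theorem_of_calculus)
      (auto simp: has_real_derivative_iff_has_vector_derivative[symmetric] intro: DERIV_subset)
  then show ?thesis using True X_0 X_2pi by simp
next
  case False
  have "((\<lambda>t. sin (of_int n * X t) / of_int n) has_real_derivative cos (of_int n * X t) * \<sigma> t) (at t)" for t
    using False by (auto intro!: derivative_eq_intros X_deriv)
  then have "((\<lambda>t. cos (of_int n * X t) * \<sigma> t) has_integral (sin (of_int n * X (2*pi)) / of_int n - sin (of_int n * X 0) / of_int n)) {0..2*pi}"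
    by (intro fundamental_theorem_of_calculus)
      (auto simp: has_real_derivative_iff_has_vector_derivative[symmetric] intro: DERIV_subset)
  moreover have "sin (of_int n * (2 * pi)) = 0" using sin_int_2pin[of n] by (simp add: mult.commute mult.left_commute)
  ultimately show ?thesis using False X_0 X_2pi by simp
qed

definition nrm :: "nat \<Rightarrow> real" where "nrm j = (if j = 0 then 2 * pi else pi)"

text \<open>As \<open>dX = \<sigma> dt\<close>, this is the cosine coefficient of
  \<open>u / \<sigma>\<close> in the coordinate \<open>X\<close>. Written against \<open>dt\<close>,
  it depends on the domain only through \<open>X\<close>, and for \<open>j = 0\<close> not at
  all.\<close>

definition coef :: "(real \<Rightarrow> real) \<Rightarrow> nat \<Rightarrow> real" where
  "coef u j = integral {0..2*pi} (\<lambda>t. u t * cos (real j * X t)) / nrm j"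

lemma nrm_pos: "nrm j > 0" by (simp add: nrm_def)

lemma cos_cos_has_integral:
  "((\<lambda>t. cos (real j * X t) * (cos (real k * X t) * \<sigma> t)) has_integral (if j = k then nrm k else 0)) {0..2*pi}"
proof -
  have e: "cos (real j * X t) * (cos (real k * X t) * \<sigma> t) =
     1/2 * (cos (of_int (int j - int k) * X t) * \<sigma> t + cos (of_int (int j + int k) * X t) * \<sigma> t)" for t
    by (simp add: left_diff_distrib distrib_right cos_add cos_diff algebra_simps)
  have "((\<lambda>t. cos (real j * X t) * (cos (real k * X t) * \<sigma> t)) has_integral
     (1/2 * ((if int j - int k = 0 then 2 * pi else 0) + (if int j + int k = 0 then 2 * pi else 0)))) {0..2*pi}"
    unfolding e by (intro has_integral_mult_right has_integral_add cos_has_integral)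
  moreover have "(1/2 * ((if int j - int k = 0 then 2 * pi else 0) + (if int j + int k = 0 then 2 * pi else 0))) = (if j = k then nrm k else 0)"
    by (auto simp: nrm_def)
  ultimately show ?thesis by simp
qed

lemma \<sigma>_bdd: obtains B where "B > 0" "\<And>t. t \<in> {0..2*pi} \<Longrightarrow> \<sigma> t \<le> B"
proof -
  have "\<exists>x\<in>{0..2*pi}. \<forall>y\<in>{0..2*pi}. \<sigma> y \<le> \<sigma> x"
    by (rule continuous_attains_sup) (auto intro: \<sigma>_cont')
  then obtain a where "\<And>t. t \<in> {0..2*pi} \<Longrightarrow> \<sigma> t \<le> \<sigma> a" by blast
  then show thesis using that[of "\<sigma> a"] \<sigma>_pos by blast
qed

text \<open>Absolutely summable coefficients give a continuous limit \<open>S\<close>, and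
  \<open>u / \<sigma> - S\<close> is orthogonal to every \<open>cos (k * X)\<close>. These functions
  span the polynomials in \<open>cos X\<close>, which by Stone-Weierstrass are dense in the
  continuous functions on the half circle, where \<open>cos X\<close> is injective; the symmetry
  carries the approximation to the other half.\<close>

lemma fourier_repr:
  assumes u: "continuous_on UNIV u" and usym: "\<And>t. u (2 * pi - t) = u t" and \<sigma>sym: "\<And>t. \<sigma> (2 * pi - t) = \<sigma> t"
    and sm: "summable (\<lambda>j. \<bar>coef u j\<bar>)" and t: "t \<in> {0..2*pi}"
  shows "(\<lambda>j. coef u j * cos (real j * X t)) sums (u t / \<sigma> t)"
proof -
  let ?I = "{0..2*pi::real}"
  define S where "S = (\<lambda>t. suminf (\<lambda>j. coef u j * cos (real j * X t)))"
  have sumt: "summable (\<lambda>j. coef u j * cos (real j * X t))" for t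
    by (rule summable_comparison_test[OF _ sm]) (auto simp: abs_mult intro!: exI[of _ 0] mult_left_le)
  have ul: "uniform_limit UNIV (\<lambda>n t. \<Sum>i<n. coef u i * cos (real i * X t)) S sequentially"
    unfolding S_def by (rule Weierstrass_m_test[OF _ sm]) (auto simp: abs_mult intro!: mult_left_le)
  have Sc: "continuous_on UNIV S"
    by (rule uniform_limit_theorem[OF _ ul]) (auto intro!: always_eventually continuous_intros X_cont)
  define g where "g = (\<lambda>t. u t / \<sigma> t - S t)"
  have gc: "continuous_on A g" for A
    unfolding g_def using \<sigma>_pos by (intro continuous_intros continuous_on_subset[OF Sc] continuous_on_subset[OF u] \<sigma>_cont') (auto simp: less_imp_neq[symmetric] intro: less_imp_neq[THEN not_sym])
  obtain B where B: "B > 0" "\<And>t. t \<in> ?I \<Longrightarrow> \<sigma> t \<le> B" using \<sigma>_bdd by blast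
  have gn: "((\<lambda>t. g t * (cos (real k * X t) * \<sigma> t)) has_integral 0) ?I" for k
  proof -
    let ?f = "\<lambda>j t. coef u j * cos (real j * X t) * (cos (real k * X t) * \<sigma> t)"
    have u1: "uniform_limit ?I (\<lambda>n t. \<Sum>i<n. ?f i t) (\<lambda>t. suminf (\<lambda>j. ?f j t)) sequentially"
    proof (rule Weierstrass_m_test)
      show "summable (\<lambda>j. \<bar>coef u j\<bar> * B)" using sm by (rule summable_mult2)
      show "norm (?f n x) \<le> \<bar>coef u n\<bar> * B" if "x \<in> ?I" for n x
      proof -
        have "\<bar>cos (real n * X x) * (cos (real k * X x) * \<sigma> x)\<bar> \<le> 1 * (1 * B)"
          unfolding abs_mult using B that \<sigma>_pos[of x] by (intro mult_mono) auto
        then have "\<bar>coef u n\<bar> * \<bar>cos (real n * X x) * (cos (real k * X x) * \<sigma> x)\<bar> \<le> \<bar>coef u n\<bar> * B" by (intro mult_left_mono) auto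
        then show ?thesis by (simp add: abs_mult mult.assoc)
      qed
    qed
    have u2: "continuous_on ?I (\<lambda>t. \<Sum>i<n. ?f i t)" for n by (intro continuous_intros X_cont \<sigma>_cont')
    obtain I J where IJ: "\<And>n. ((\<lambda>t. \<Sum>i<n. ?f i t) has_integral I n) ?I" "((\<lambda>t. suminf (\<lambda>j. ?f j t)) has_integral J) ?I" "I \<longlonglongrightarrow> J"
    proof (rule uniform_limit_integral[OF u1 u2 trivial_limit_sequentially])
      fix I J assume a: "\<And>n. ((\<lambda>t. \<Sum>i<n. ?f i t) has_integral I n) ?I" "((\<lambda>t. suminf (\<lambda>j. ?f j t)) has_integral J) ?I" "I \<longlonglongrightarrow> J"
      show thesis by (rule that[OF a])
    qed
    have In: "I n = coef u k * nrm k" if "n > k" for n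
    proof -
      have "((\<lambda>t. \<Sum>i<n. coef u i * (cos (real i * X t) * (cos (real k * X t) * \<sigma> t))) has_integral (\<Sum>i<n. coef u i * (if i = k then nrm k else 0))) ?I"
        by (intro has_integral_sum has_integral_mult_right cos_cos_has_integral) auto
      moreover have "(\<Sum>i<n. coef u i * (if i = k then nrm k else 0)) = coef u k * nrm k" using that by (simp add: if_distrib cong: if_cong)
      ultimately show ?thesis using IJ(1)[of n] by (simp add: mult.assoc has_integral_unique)
    qed
    have "J = coef u k * nrm k"
      by (rule LIMSEQ_unique[OF IJ(3) tendsto_eventually]) (use In in \<open>auto simp: eventually_sequentially intro!: exI[of _ "Suc k"]\<close>)
    moreover have "suminf (\<lambda>j. ?f j t) = S t * (cos (real k * X t) * \<sigma> t)" for t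
      unfolding S_def using suminf_mult2[OF sumt, of t "cos (real k * X t) * \<sigma> t"] by simp
    ultimately have 1: "((\<lambda>t. S t * (cos (real k * X t) * \<sigma> t)) has_integral coef u k * nrm k) ?I" using IJ(2) by simp
    have "(\<lambda>t. u t * cos (real k * X t)) integrable_on ?I"
      by (intro integrable_continuous_interval continuous_intros continuous_on_subset[OF u] X_cont) auto
    then have 2: "((\<lambda>t. u t * cos (real k * X t)) has_integral coef u k * nrm k) ?I"
      using nrm_pos[of k] by (simp add: coef_def has_integral_integral)
    have "g t * (cos (real k * X t) * \<sigma> t) = u t * cos (real k * X t) - S t * (cos (real k * X t) * \<sigma> t)" for t
      using \<sigma>_pos[of t] by (simp add: g_def field_simps)
    then show ?thesis using has_integral_diff[OF 2 1] by simp
  qed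
  have gi: "((\<lambda>t. g t * (cos (of_int k * X t) * \<sigma> t)) has_integral 0) ?I" for k :: int
  proof (cases "k \<ge> 0")
    case True then show ?thesis using gn[of "nat k"] by simp
  next
    case False
    have "cos (of_int k * X t) = cos (real (nat (- k)) * X t)" for t using False cos_minus[of "of_int k * X t"] by simp
    then show ?thesis using gn[of "nat (- k)"] by simp
  qed
  \<comment> \<open>Generalised to a power times one cosine, so that the product formula turns
    \<open>cos (X t) ^ Suc n\<close> into two instances of the induction hypothesis.\<close>
  have gp: "((\<lambda>t. g t * (cos (X t) ^ n * cos (of_int k * X t) * \<sigma> t)) has_integral 0) ?I" for n and k :: int
  proof (induction n arbitrary: k)
    case 0 then show ?case using gi[of k] by (simp add: mult.assoc)
  next
    case (Suc n)
    have eq: "g t * (cos (X t) ^ Suc n * cos (of_int k * X t) * \<sigma> t) = 1/2 * (g t * (cos (X t) ^ n * cos (of_int (k + 1) * X t) * \<sigma> t) + g t * (cos (X t) ^ n * cos (of_int (k - 1) * X t) * \<sigma> t))" for t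
    proof -
      have s: "cos (of_int (k + 1) * X t) + cos (of_int (k - 1) * X t) = 2 * (cos (X t) * cos (of_int k * X t))"
        by (simp add: distrib_right left_diff_distrib cos_add cos_diff)
      have "1/2 * (g t * (cos (X t) ^ n * a * \<sigma> t) + g t * (cos (X t) ^ n * b * \<sigma> t)) = g t * cos (X t) ^ n * \<sigma> t * ((a + b) / 2)" for a b
        by (simp add: field_simps)
      then have "1/2 * (g t * (cos (X t) ^ n * cos (of_int (k + 1) * X t) * \<sigma> t) + g t * (cos (X t) ^ n * cos (of_int (k - 1) * X t) * \<sigma> t))
        = g t * cos (X t) ^ n * \<sigma> t * (2 * (cos (X t) * cos (of_int k * X t)) / 2)" by (simp only: s)
      also have "\<dots> = g t * (cos (X t) ^ Suc n * cos (of_int k * X t) * \<sigma> t)" by (simp add: mult.commute mult.left_commute)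
      finally show ?thesis ..
    qed
    have J: "((\<lambda>t. 1/2 * (g t * (cos (X t) ^ n * cos (of_int (k + 1) * X t) * \<sigma> t) + g t * (cos (X t) ^ n * cos (of_int (k - 1) * X t) * \<sigma> t))) has_integral (1/2 * (0 + 0))) ?I"
      by (intro has_integral_mult_right has_integral_add Suc)
    have "((\<lambda>t. g t * (cos (X t) ^ Suc n * cos (of_int k * X t) * \<sigma> t)) has_integral (1/2 * (0 + 0))) ?I"
      by (rule has_integral_eq[OF _ J]) (simp only: eq)
    then show ?case by (simp only: add_0 mult_zero_right)
  qed
  have gpoly: "((\<lambda>t. g t * (p (cos (X t)) * \<sigma> t)) has_integral 0) ?I" if p: "real_polynomial_function p" for p
  proof -
    obtain a n where an: "p = (\<lambda>x. \<Sum>i\<le>n. a i * x ^ i)" using p unfolding real_polynomial_function_iff_sum by blast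
    have "((\<lambda>t. \<Sum>i\<le>n. a i * (g t * (cos (X t) ^ i * cos (of_int 0 * X t) * \<sigma> t))) has_integral (\<Sum>i\<le>n. a i * 0)) ?I"
      by (intro has_integral_sum has_integral_mult_right gp) auto
    moreover have "(\<Sum>i\<le>n. a i * (g t * (cos (X t) ^ i * cos (of_int 0 * X t) * \<sigma> t))) = g t * (p (cos (X t)) * \<sigma> t)" for t
      by (simp add: an sum_distrib_left sum_distrib_right mult.commute mult.left_commute)
    ultimately show ?thesis by simp
  qed
  have Xpi: "X pi = pi" using X_sym[of pi] by simp
  have inj: "cos (X s) \<noteq> cos (X t)" if "s \<in> {0..pi}" "t \<in> {0..pi}" "s \<noteq> t" for s t
  proof -
    have "X s \<in> {0..pi}" "X t \<in> {0..pi}" using X_less[of 0 s] X_less[of s pi] X_less[of 0 t] X_less[of t pi] that X_0 Xpi by (auto simp: less_eq_real_def)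
    moreover have "X s \<noteq> X t" using X_less[of s t] X_less[of t s] that by (metis linorder_neqE_linordered_idom less_irrefl)
    ultimately show ?thesis using cos_inj_pi[of "X s" "X t"] by auto
  qed
  have approx: "\<exists>p. real_polynomial_function p \<and> (\<forall>t\<in>?I. \<bar>g t - p (cos (X t))\<bar> < e)" if e: "e > 0" for e
  proof -
    let ?P = "\<lambda>f. \<exists>p. real_polynomial_function p \<and> f = (\<lambda>t. p (cos (X t)))"
    have "\<exists>f. ?P f \<and> (\<forall>t\<in>{0..pi}. \<bar>g t - f t\<bar> < e)"
    proof (rule Stone_Weierstrass_HOL[where P = ?P])
      show "?P (\<lambda>x. c)" for c by (rule exI[of _ "\<lambda>_. c"]) (auto intro: real_polynomial_function.intros)
      show "continuous_on {0..pi} f" if "?P f" for f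
      proof -
        define p where "p = (SOME p. real_polynomial_function p \<and> f = (\<lambda>t. p (cos (X t))))"
        have "real_polynomial_function p \<and> f = (\<lambda>t. p (cos (X t)))" unfolding p_def using that by (rule someI_ex)
        then have p: "real_polynomial_function p" "f = (\<lambda>t. p (cos (X t)))" by simp_all
        have "continuous_on UNIV p" by (intro continuous_at_imp_continuous_on ballI continuous_real_polymonial_function p(1))
        then show ?thesis unfolding p(2) by (rule continuous_on_compose2) (auto intro!: continuous_intros X_cont)
      qed
      show "?P (\<lambda>x. f x + h x)" if "?P f \<and> ?P h" for f h
      proof -
        define p where "p = (SOME p. real_polynomial_function p \<and> f = (\<lambda>t. p (cos (X t))))"
        define p' where "p' = (SOME p. real_polynomial_function p \<and> h = (\<lambda>t. p (cos (X t))))"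
        have "real_polynomial_function p \<and> f = (\<lambda>t. p (cos (X t)))" unfolding p_def using conjunct1[OF that] by (rule someI_ex)
        moreover have "real_polynomial_function p' \<and> h = (\<lambda>t. p' (cos (X t)))" unfolding p'_def using conjunct2[OF that] by (rule someI_ex)
        ultimately have p: "real_polynomial_function p" "f = (\<lambda>t. p (cos (X t)))" "real_polynomial_function p'" "h = (\<lambda>t. p' (cos (X t)))" by simp_all
        show ?thesis unfolding p(2,4) using real_polynomial_function.intros(3)[OF p(1,3)] by (intro exI[of _ "\<lambda>x. p x + p' x"]) simp
      qed
      show "?P (\<lambda>x. f x * h x)" if "?P f \<and> ?P h" for f h
      proof -
        define p where "p = (SOME p. real_polynomial_function p \<and> f = (\<lambda>t. p (cos (X t))))"
        define p' where "p' = (SOME p. real_polynomial_function p \<and> h = (\<lambda>t. p (cos (X t))))"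
        have "real_polynomial_function p \<and> f = (\<lambda>t. p (cos (X t)))" unfolding p_def using conjunct1[OF that] by (rule someI_ex)
        moreover have "real_polynomial_function p' \<and> h = (\<lambda>t. p' (cos (X t)))" unfolding p'_def using conjunct2[OF that] by (rule someI_ex)
        ultimately have p: "real_polynomial_function p" "f = (\<lambda>t. p (cos (X t)))" "real_polynomial_function p'" "h = (\<lambda>t. p' (cos (X t)))" by simp_all
        show ?thesis unfolding p(2,4) using real_polynomial_function.intros(4)[OF p(1,3)] by (intro exI[of _ "\<lambda>x. p x * p' x"]) simp
      qed
      show "\<exists>f. ?P f \<and> f x \<noteq> f y" if "x \<in> {0..pi} \<and> y \<in> {0..pi} \<and> x \<noteq> y" for x y
      proof (rule exI[of _ "\<lambda>t. cos (X t)"], intro conjI exI[of _ "\<lambda>x. x"])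
        show "real_polynomial_function (\<lambda>x. x)" by (rule real_polynomial_function.intros(1)[OF bounded_linear_ident])
        show "cos (X x) \<noteq> cos (X y)" using that inj[of x y] by blast
      qed simp
    qed (use gc e in auto)
    then have "\<exists>p. real_polynomial_function p \<and> (\<forall>t\<in>{0..pi}. \<bar>g t - p (cos (X t))\<bar> < e)" by (elim exE conjE) (auto intro!: exI)
    then obtain p where "real_polynomial_function p" "\<forall>t\<in>{0..pi}. \<bar>g t - p (cos (X t))\<bar> < e" by blast
    then have p: "real_polynomial_function p" "\<And>t. t \<in> {0..pi} \<Longrightarrow> \<bar>g t - p (cos (X t))\<bar> < e" by simp_all
    have "\<bar>g t - p (cos (X t))\<bar> < e" if "t \<in> ?I" for t
    proof (cases "t \<le> pi")
      case True then show ?thesis using p(2)[of t] that by simp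
    next
      case False
      have c: "cos (real j * X (2 * pi - t)) = cos (real j * X t)" for j t
      proof -
        have "cos (real j * X (2 * pi - t)) = cos (2 * pi * real j - real j * X t)" unfolding X_sym by (simp add: algebra_simps)
        moreover have "cos (2 * pi * real j) = 1" "sin (2 * pi * real j) = 0"
          using cos_2npi[of j] sin_2npi[of j] by (simp_all add: mult.commute mult.left_commute)
        ultimately show ?thesis unfolding cos_diff by simp
      qed
      have "g (2 * pi - t) = g t" unfolding g_def S_def usym \<sigma>sym c ..
      moreover have "cos (X (2 * pi - t)) = cos (X t)" using c[of 1 t] by simp
      ultimately show ?thesis using p(2)[of "2 * pi - t"] that False by simp
    qed
    then show ?thesis using p(1) by blast
  qed
  have sq: "(\<lambda>t. (g t)\<^sup>2 * \<sigma> t) integrable_on ?I" by (intro integrable_continuous_interval continuous_intros gc \<sigma>_cont')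
  have ab: "(\<lambda>t. \<bar>g t\<bar> * \<sigma> t) integrable_on ?I" by (intro integrable_continuous_interval continuous_intros gc \<sigma>_cont')
  define D where "D = integral ?I (\<lambda>t. \<bar>g t\<bar> * \<sigma> t)"
  have D0: "D \<ge> 0" unfolding D_def by (intro integral_nonneg ab mult_nonneg_nonneg less_imp_le[OF \<sigma>_pos]) auto
  \<comment> \<open>Since \<open>g\<close> is orthogonal to the approximating polynomial
    \<open>p\<close>, the integrand \<open>g^2\<close> may be replaced by
    \<open>g * (g - p)\<close>, which is small.\<close>
  have le: "integral ?I (\<lambda>t. (g t)\<^sup>2 * \<sigma> t) \<le> e * D" if e: "e > 0" for e
  proof -
    obtain p where p: "real_polynomial_function p" "\<And>t. t \<in> ?I \<Longrightarrow> \<bar>g t - p (cos (X t))\<bar> < e" using approx[OF e] by blast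
    have A: "((\<lambda>t. (g t)\<^sup>2 * \<sigma> t - g t * (p (cos (X t)) * \<sigma> t)) has_integral integral ?I (\<lambda>t. (g t)\<^sup>2 * \<sigma> t) - 0) ?I"
      by (intro has_integral_diff gpoly p(1) integrable_integral sq)
    have B: "((\<lambda>t. e * (\<bar>g t\<bar> * \<sigma> t)) has_integral e * D) ?I" unfolding D_def by (intro has_integral_mult_right integrable_integral ab)
    have le: "(g t)\<^sup>2 * \<sigma> t - g t * (p (cos (X t)) * \<sigma> t) \<le> e * (\<bar>g t\<bar> * \<sigma> t)" if "t \<in> ?I" for t
    proof -
      have "(g t)\<^sup>2 * \<sigma> t - g t * (p (cos (X t)) * \<sigma> t) = g t * (g t - p (cos (X t))) * \<sigma> t" by (simp add: algebra_simps power2_eq_square)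
      also have "\<dots> \<le> \<bar>g t * (g t - p (cos (X t)))\<bar> * \<sigma> t" using \<sigma>_pos[of t] by (intro mult_right_mono) auto
      also have "\<dots> \<le> (\<bar>g t\<bar> * e) * \<sigma> t" unfolding abs_mult using p(2)[OF that] \<sigma>_pos[of t] by (intro mult_right_mono mult_left_mono) auto
      finally show ?thesis by (simp add: mult.commute mult.left_commute)
    qed
    show ?thesis using has_integral_le[OF A B le] by simp
  qed
  have "integral ?I (\<lambda>t. (g t)\<^sup>2 * \<sigma> t) \<le> 0"
  proof (rule field_le_epsilon)
    fix e :: real assume "e > 0"
    then have "integral ?I (\<lambda>t. (g t)\<^sup>2 * \<sigma> t) \<le> e / (D + 1) * D" using D0 by (intro le) auto
    also have "\<dots> \<le> e" using D0 \<open>e > 0\<close> by (simp add: divide_le_eq)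
    finally show "integral ?I (\<lambda>t. (g t)\<^sup>2 * \<sigma> t) \<le> 0 + e" by simp
  qed
  moreover have "integral ?I (\<lambda>t. (g t)\<^sup>2 * \<sigma> t) \<ge> 0" by (intro integral_nonneg sq mult_nonneg_nonneg less_imp_le[OF \<sigma>_pos]) auto
  ultimately have "integral ?I (\<lambda>t. (g t)\<^sup>2 * \<sigma> t) = 0" by simp
  moreover have "continuous_on ?I (\<lambda>t. (g t)\<^sup>2 * \<sigma> t)" by (intro continuous_intros gc \<sigma>_cont')
  ultimately have "\<forall>x\<in>?I. (g x)\<^sup>2 * \<sigma> x = 0"
    by (subst (asm) integral_eq_0_iff) (auto intro!: mult_nonneg_nonneg less_imp_le[OF \<sigma>_pos])
  then have "g t = 0" using t \<sigma>_pos[of t] by force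
  then have "u t / \<sigma> t = S t" by (simp add: g_def)
  then show ?thesis using sumt[of t] by (simp add: S_def summable_sums)
qed

end

section \<open>Sums over almost equidistributed points\<close>

text \<open>Distance from \<open>j\<close> to the nearest multiple of \<open>q\<close>; on the
  multiples themselves it is set to 1, because it serves as a denominator.\<close>

definition rdist :: "nat \<Rightarrow> nat \<Rightarrow> real" where
  "rdist q j = (if q dvd j then 1 else real (min (j mod q) (q - j mod q)))"

lemma rdist_ge_1: "q \<ge> 2 \<Longrightarrow> rdist q j \<ge> 1"
  unfolding rdist_def by (auto simp: dvd_eq_mod_eq_0 Suc_le_eq min_def)

lemma sum_inverse_squares: "(\<Sum>i<n. 1 / (real i)\<^sup>2) \<le> 2"
proof -
  \<comment> \<open>Telescoping; the term \<open>i = 0\<close> is zero because division by zero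
    gives zero.\<close>
  have "(\<Sum>i<Suc (Suc n). 1 / (real i)\<^sup>2) \<le> 2 - 1 / real (Suc n)" for n
  proof (induction n)
    case (Suc n)
    have "1 / (real (Suc (Suc n)))\<^sup>2 \<le> 1 / real (Suc n) - 1 / real (Suc (Suc n))"
    proof -
      have "1 / real (Suc n) - 1 / real (Suc (Suc n)) = 1 / (real (Suc n) * real (Suc (Suc n)))" by (simp add: field_simps)
      moreover have "1 / (real (Suc (Suc n)))\<^sup>2 \<le> 1 / (real (Suc n) * real (Suc (Suc n)))"
        unfolding power2_eq_square by (intro divide_left_mono mult_right_mono) auto
      ultimately show ?thesis by (simp only:)
    qed
    then show ?case using Suc by simp
  qed (simp add: numeral_2_eq_2)
  then have "(\<Sum>i<Suc (Suc n). 1 / (real i)\<^sup>2) \<le> 2" by (metis diff_le_eq le_add_same_cancel1 of_nat_0_le_iff order_trans zero_le_divide_1_iff)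
  moreover have "(\<Sum>i<n. 1 / (real i)\<^sup>2) \<le> (\<Sum>i<Suc (Suc n). 1 / (real i)\<^sup>2)" by (intro sum_mono2) auto
  ultimately show ?thesis by linarith
qed

lemma sum_inverse_sqrt: "(\<Sum>i<n. 1 / sqrt (real i)) \<le> 2 * sqrt (real n)"
proof -
  have "(\<Sum>i<Suc n. 1 / sqrt (real i)) \<le> 2 * sqrt (real n)" for n
  proof (induction n)
    case (Suc n)
    define a b where "a = sqrt (real n)" and "b = sqrt (real (Suc n))"
    have b0: "b > 0" and ab: "b * b = a * a + 1" by (auto simp: a_def b_def)
    have "2 * (a * b) \<le> a * a + b * b" using zero_le_square[of "a - b"] by (simp add: algebra_simps)
    then have "(2 * a + 1 / b) * b \<le> (2 * b) * b" using ab b0 by (simp add: distrib_right)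
    then have "2 * a + 1 / b \<le> 2 * b" using b0 by (rule mult_right_le_imp_le)
    then show ?case using Suc by (simp add: a_def b_def)
  qed simp
  moreover have "(\<Sum>i<n. 1 / sqrt (real i)) \<le> (\<Sum>i<Suc n. 1 / sqrt (real i))" by simp
  ultimately show ?thesis using order_trans by blast
qed

text \<open>The error of mode \<open>j\<close> caused by the phase deviation grows like
  \<open>E * j / (q^2 * rdist q j)\<close>, which is useless for large \<open>j\<close>, where only
  the trivial bound 3 holds. The geometric mean of the two costs the square root of
  \<open>E\<close>, but summed against \<open>1 / j^2\<close> it converges and keeps the factor
  \<open>1 / q^2\<close>.\<close>

lemma row_sum_bound:
  "\<exists>Z>0. \<forall>E q b. 0 \<le> E \<longrightarrow> E \<le> 1 \<longrightarrow> q \<ge> 2 \<longrightarrow> (\<forall>j\<ge>1. 0 \<le> b j \<and> b j \<le> 3 \<and> b j \<le> E * real j / ((real q)\<^sup>2 * rdist q j)) \<longrightarrow>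
     summable (\<lambda>j. b j / (real j)\<^sup>2) \<and> (\<Sum>j. b j / (real j)\<^sup>2) \<le> Z * sqrt E / (real q)\<^sup>2"
proof -
  define Z1 where "Z1 = (\<Sum>m. real m powr (-3/2))"
  have sm: "summable (\<lambda>m. real m powr (-3/2))" by (subst summable_real_powr_iff) auto
  have Z1: "(\<Sum>m<n. real m powr (-3/2)) \<le> Z1" for n unfolding Z1_def by (rule sum_le_suminf[OF sm]) auto
  have Z10: "Z1 \<ge> 0" using Z1[of 0] by simp
  define Z where "Z = 4 + 12 * Z1"
  have "summable (\<lambda>j. b j / (real j)\<^sup>2) \<and> (\<Sum>j. b j / (real j)\<^sup>2) \<le> Z * sqrt E / (real q)\<^sup>2"
    if E: "0 \<le> E" "E \<le> 1" and q: "q \<ge> 2" and b: "\<forall>j\<ge>1. 0 \<le> b j \<and> b j \<le> 3 \<and> b j \<le> E * real j / ((real q)\<^sup>2 * rdist q j)"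
    for E q and b :: "nat \<Rightarrow> real"
  proof -
    define f where "f = (\<lambda>j. b j / (real j)\<^sup>2)"
    have f0: "f j \<ge> 0" for j using b by (cases "j = 0") (auto simp: f_def Suc_le_eq)
    have q0: "real q > 0" using q by simp
    have EsE: "E \<le> sqrt E" using E by (simp add: real_le_rsqrt power2_eq_square mult_left_le)
    \<comment> \<open>For \<open>j < q\<close> the linear bound is good enough as it stands, because
      \<open>1 / (i * (q - i))\<close> is at most \<open>2 / q\<close>.\<close>
    have b0: "sum f {0..<q} \<le> 4 * sqrt E / (real q)\<^sup>2"
    proof -
      have fi: "f i \<le> E / (real q)\<^sup>2 * (1 / (real i)\<^sup>2 + 2 / real q)" if i: "i \<in> {0..<q}" for i
      proof (cases "i = 0")
        case True then show ?thesis using E by (simp add: f_def)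
      next
        case False
        then have i1: "i \<ge> 1" "i < q" using i by auto
        have nd: "\<not> q dvd i" using i1 by (auto dest: dvd_imp_le)
        have dd: "rdist q i = real (min i (q - i))" using nd i1 by (simp add: rdist_def)
        have ge: "real i * real (q - i) \<ge> real q / 2"
        proof -
          have "i * (q - i) \<ge> q - 1"
          proof (cases "q - i = 0")
            case False
            then obtain a c where ac: "i = Suc a" "q - i = Suc c" using i1 by (metis Suc_le_D One_nat_def not0_implies_Suc)
            then have "q = Suc a + Suc c" using i1 by simp
            then show ?thesis using ac by simp
          qed (use i1 in simp)
          then have "real (i * (q - i)) \<ge> real (q - 1)" by (simp only: of_nat_le_iff)
          moreover have "real (q - 1) = real q - 1" "real q \<ge> 2" using q by (simp_all add: of_nat_diff)
          ultimately show ?thesis unfolding of_nat_mult by linarith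
        qed
        have "1 / (real i * real (q - i)) \<le> 1 / (real q / 2)" using q0 i1 by (intro divide_left_mono[OF ge] mult_pos_pos) auto
        then have e2: "1 / (real i * real (q - i)) \<le> 2 / real q" by simp
        have "1 / rdist q i \<le> 1 / real i + 1 / real (q - i)" unfolding dd by (auto simp: min_def)
        then have "1 / real i * (1 / rdist q i) \<le> 1 / real i * (1 / real i + 1 / real (q - i))" by (intro mult_left_mono) auto
        then have e1: "1 / (real i * rdist q i) \<le> 1 / (real i)\<^sup>2 + 1 / (real i * real (q - i))" by (simp add: distrib_left power2_eq_square)
        have "f i \<le> E * real i / ((real q)\<^sup>2 * rdist q i) / (real i)\<^sup>2"
          unfolding f_def using b i1 by (intro divide_right_mono) auto
        also have "\<dots> = E / (real q)\<^sup>2 * (1 / (real i * rdist q i))" using i1 by (simp add: power2_eq_square)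
        also have "\<dots> \<le> E / (real q)\<^sup>2 * (1 / (real i)\<^sup>2 + 2 / real q)" using e1 e2 E by (intro mult_left_mono) auto
        finally show ?thesis .
      qed
      have "sum f {0..<q} \<le> (\<Sum>i\<in>{0..<q}. E / (real q)\<^sup>2 * (1 / (real i)\<^sup>2 + 2 / real q))" by (intro sum_mono fi)
      also have "\<dots> = E / (real q)\<^sup>2 * ((\<Sum>i<q. 1 / (real i)\<^sup>2) + 2)"
        unfolding sum_distrib_left[symmetric] sum.distrib atLeast0LessThan using q0 by simp
      also have "\<dots> \<le> E / (real q)\<^sup>2 * (2 + 2)" using sum_inverse_squares[of q] E by (intro mult_left_mono) auto
      also have "\<dots> \<le> 4 * sqrt E / (real q)\<^sup>2" using EsE q0 by (simp add: divide_right_mono)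
      finally show ?thesis .
    qed
    \<comment> \<open>In the block that starts at \<open>m * q\<close> the inverse square roots of
      the distances to both ends add up to at most \<open>6 * sqrt q\<close>, while \<open>j\<close>
      is replaced by its least value \<open>m * q\<close>. The result is summable over
      \<open>m\<close> like \<open>m powr (-3/2)\<close>.\<close>
    have bm: "sum f {m * q..<m * q + q} \<le> 12 * sqrt E / (real q)\<^sup>2 * (real m powr (-3/2))" if m: "m \<ge> 1" for m
    proof -
      define c where "c = 2 * sqrt E / real q * (real (m * q) powr (-3/2))"
      have c0: "c \<ge> 0" using E by (simp add: c_def)
      have fi: "f (m * q + i) \<le> c * (of_bool (i = 0) + 1 / sqrt (real i) + 1 / sqrt (real (q - i)))" if i: "i < q" for i
      proof -
        let ?j = "m * q + i"
        have "1 \<le> m * q" using m q by simp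
        then have j1: "?j \<ge> 1" by (rule trans_le_add1)
        then have j0: "real ?j > 0" by (simp only: of_nat_0_less_iff)
        have d1: "rdist q ?j \<ge> 1" using rdist_ge_1[OF q] .
        define y where "y = E * real ?j / ((real q)\<^sup>2 * rdist q ?j)"
        have y0: "y \<ge> 0" using E d1 by (simp add: y_def)
        have "b ?j \<le> 2 * sqrt y"
        proof -
          have bb: "0 \<le> b ?j" "b ?j \<le> 3" "b ?j \<le> y" using b[rule_format, OF j1] unfolding y_def by blast+
          have "(b ?j)\<^sup>2 \<le> 3 * y" unfolding power2_eq_square using bb by (intro mult_mono) auto
          also have "\<dots> \<le> (2 * sqrt y)\<^sup>2" using y0 by (simp add: power_mult_distrib)
          finally show ?thesis using y0 by (intro power2_le_imp_le[of "b ?j" "2 * sqrt y"]) auto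
        qed
        then have "f ?j \<le> 2 * sqrt y / (real ?j)\<^sup>2" unfolding f_def by (intro divide_right_mono) auto
        also have "sqrt y = sqrt E * sqrt (real ?j) / (real q * sqrt (rdist q ?j))"
          unfolding y_def using q0 by (simp add: real_sqrt_divide real_sqrt_mult)
        also have "2 * (sqrt E * sqrt (real ?j) / (real q * sqrt (rdist q ?j))) / (real ?j)\<^sup>2 = 2 * sqrt E / real q * (sqrt (real ?j) / (real ?j)\<^sup>2) * (1 / sqrt (rdist q ?j))"
          by (simp only: times_divide_eq_right times_divide_eq_left divide_divide_eq_left mult.assoc mult.commute mult.left_commute mult_1_right)
        also have "sqrt (real ?j) / (real ?j)\<^sup>2 = real ?j powr (-3/2)"
        proof -
          have "real ?j powr (-3/2) = real ?j powr (1/2 - 2)" by simp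
          also have "\<dots> = real ?j powr (1/2) / real ?j powr 2" by (rule powr_diff)
          also have "\<dots> = sqrt (real ?j) / (real ?j)\<^sup>2" using j0 by (simp add: powr_half_sqrt)
          finally show ?thesis ..
        qed
        also have "2 * sqrt E / real q * (real ?j powr (-3/2)) * (1 / sqrt (rdist q ?j)) \<le> c * (1 / sqrt (rdist q ?j))"
        proof (rule mult_right_mono)
          have "real ?j powr (-3/2) \<le> real (m * q) powr (-3/2)" using m q by (intro powr_mono2') auto
          then show "2 * sqrt E / real q * (real ?j powr (-3/2)) \<le> c" unfolding c_def using E q0 by (intro mult_left_mono) auto
        qed (use d1 in simp)
        also have "\<dots> \<le> c * (of_bool (i = 0) + 1 / sqrt (real i) + 1 / sqrt (real (q - i)))"
        proof (rule mult_left_mono[OF _ c0])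
          show "1 / sqrt (rdist q ?j) \<le> of_bool (i = 0) + 1 / sqrt (real i) + 1 / sqrt (real (q - i))"
            using i by (auto simp: rdist_def min_def dvd_eq_mod_eq_0)
        qed
        finally show ?thesis .
      qed
      have "sum f {m * q..<m * q + q} = (\<Sum>i<q. f (m * q + i))"
        using sum.shift_bounds_nat_ivl[of f 0 "m * q" q] by (simp add: atLeast0LessThan add.commute)
      also have "\<dots> \<le> (\<Sum>i<q. c * (of_bool (i = 0) + 1 / sqrt (real i) + 1 / sqrt (real (q - i))))" using fi by (intro sum_mono) auto
      also have "\<dots> = c * ((\<Sum>i<q. of_bool (i = 0)) + (\<Sum>i<q. 1 / sqrt (real i)) + (\<Sum>i<q. 1 / sqrt (real (q - i))))"
        by (simp only: sum_distrib_left[symmetric] sum.distrib)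
      also have "\<dots> \<le> c * (6 * sqrt (real q))"
      proof (rule mult_left_mono[OF _ c0])
        have "(\<Sum>i<q. of_bool (i = 0)) = (1::real)" using q by (simp add: of_bool_def sum.delta')
        moreover have "(\<Sum>i<q. 1 / sqrt (real (q - i))) = (\<Sum>i<Suc q. 1 / sqrt (real i))"
        proof -
          have "(\<Sum>i<q. 1 / sqrt (real (q - i))) = (\<Sum>i<q. 1 / sqrt (real (Suc i)))"
            using sum.nat_diff_reindex[of "\<lambda>i. 1 / sqrt (real (Suc i))" q] by (simp add: Suc_diff_Suc)
          then show ?thesis using sum.lessThan_Suc_shift[of "\<lambda>i. 1 / sqrt (real i)" q] by simp
        qed
        moreover have "(\<Sum>i<Suc q. 1 / sqrt (real i)) \<le> 2 * sqrt (real q) + 1"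
        proof -
          have "1 / sqrt (real q) \<le> 1" using q by simp
          then show ?thesis unfolding sum.lessThan_Suc using sum_inverse_sqrt[of q] by linarith
        qed
        moreover have "1 \<le> sqrt (real q)" using q by simp
        ultimately show "(\<Sum>i<q. of_bool (i = 0)) + (\<Sum>i<q. 1 / sqrt (real i)) + (\<Sum>i<q. 1 / sqrt (real (q - i))) \<le> 6 * sqrt (real q)"
          using sum_inverse_sqrt[of q] by linarith
      qed
      also have "\<dots> = 12 * sqrt E / (real q)\<^sup>2 * (real m powr (-3/2))"
      proof -
        have "real (m * q) powr (-3/2) * sqrt (real q) = real m powr (-3/2) * (real q powr (-3/2) * real q powr (1/2))"
          using q0 by (simp add: powr_mult powr_half_sqrt)
        also have "real q powr (-3/2) * real q powr (1/2) = real q powr (-3/2 + 1/2)" by (rule powr_add[symmetric])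
        also have "\<dots> = 1 / real q" using q0 by (simp add: powr_minus_divide)
        finally show ?thesis by (simp add: c_def power2_eq_square)
      qed
      finally show ?thesis .
    qed
    have part: "sum f {..<n} \<le> Z * sqrt E / (real q)\<^sup>2" for n
    proof -
      have "n * 1 \<le> Suc n * q" using q by (intro mult_le_mono) auto
      then have "n \<le> Suc n * q" by simp
      then have "sum f {..<n} \<le> sum f {..<Suc n * q}" using f0 by (intro sum_mono2) auto
      also have "\<dots> = (\<Sum>m<Suc n. sum f {m * q..<m * q + q})" by (rule sum.nat_group[symmetric])
      also have "\<dots> = sum f {0..<q} + (\<Sum>m<n. sum f {Suc m * q..<Suc m * q + q})" unfolding sum.lessThan_Suc_shift by simp
      also have "\<dots> \<le> 4 * sqrt E / (real q)\<^sup>2 + (\<Sum>m<n. 12 * sqrt E / (real q)\<^sup>2 * (real (Suc m) powr (-3/2)))"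
        by (intro add_mono sum_mono b0 bm) simp
      also have "(\<Sum>m<n. 12 * sqrt E / (real q)\<^sup>2 * (real (Suc m) powr (-3/2))) \<le> 12 * sqrt E / (real q)\<^sup>2 * Z1"
      proof -
        have "(\<Sum>m<n. real (Suc m) powr (-3/2)) \<le> Z1" using Z1[of "Suc n"] unfolding sum.lessThan_Suc_shift by simp
        then show ?thesis unfolding sum_distrib_left[symmetric] using E by (intro mult_left_mono) auto
      qed
      also have "4 * sqrt E / (real q)\<^sup>2 + 12 * sqrt E / (real q)\<^sup>2 * Z1 = Z * sqrt E / (real q)\<^sup>2"
        unfolding Z_def distrib_right add_divide_distrib by simp
      finally show ?thesis by simp
    qed
    have "summable f" by (rule summableI_nonneg_bounded[OF f0 part])
    moreover have "suminf f \<le> Z * sqrt E / (real q)\<^sup>2" by (rule suminf_le_const[OF calculation part])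
    ultimately show ?thesis by (simp add: f_def)
  qed
  moreover have "Z > 0" using Z10 by (simp add: Z_def)
  ultimately show ?thesis by blast
qed

text \<open>Abel summation over a full period of \<open>z ^ k\<close>. The boundary term is
  \<open>G q - G 0\<close>, itself a sum of increments, so the size of \<open>G\<close> does not
  enter.\<close>

lemma abel_unit_circle:
  fixes G :: "nat \<Rightarrow> complex"
  assumes z: "norm z = 1" "z ^ q = 1" "z \<noteq> 1"
  shows "norm (\<Sum>k<q. z ^ k * G k) \<le> 2 * (\<Sum>k<q. norm (G (Suc k) - G k)) / norm (z - 1)"
proof -
  have "(\<Sum>k<q. z ^ Suc k * G (Suc k) - z ^ k * G k) = z ^ q * G q - z ^ 0 * G 0" by (rule sum_lessThan_telescope)
  also have "\<dots> = (\<Sum>k<q. G (Suc k) - G k)" unfolding sum_lessThan_telescope using z by simp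
  finally have 1: "(\<Sum>k<q. z ^ Suc k * G (Suc k) - z ^ k * G k) = (\<Sum>k<q. G (Suc k) - G k)" .
  have 2: "(\<Sum>k<q. z ^ Suc k * G (Suc k) - z ^ k * G k) = (z - 1) * (\<Sum>k<q. z ^ k * G k) + (\<Sum>k<q. z ^ Suc k * (G (Suc k) - G k))"
    unfolding sum_distrib_left sum.distrib[symmetric] by (intro sum.cong) (auto simp: algebra_simps)
  have 3: "(z - 1) * (\<Sum>k<q. z ^ k * G k) = (\<Sum>k<q. G (Suc k) - G k) - (\<Sum>k<q. z ^ Suc k * (G (Suc k) - G k))"
    unfolding eq_diff_eq 2[symmetric] by (rule 1)
  have "norm (z - 1) * norm (\<Sum>k<q. z ^ k * G k) \<le> norm (\<Sum>k<q. G (Suc k) - G k) + norm (\<Sum>k<q. z ^ Suc k * (G (Suc k) - G k))"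
    unfolding norm_mult[symmetric] 3 by (rule norm_triangle_ineq4)
  also have "\<dots> \<le> (\<Sum>k<q. norm (G (Suc k) - G k)) + (\<Sum>k<q. norm (G (Suc k) - G k))"
    using z by (intro add_mono sum_norm_le) (auto simp: norm_mult norm_power)
  finally have "norm (\<Sum>k<q. z ^ k * G k) * norm (z - 1) \<le> 2 * (\<Sum>k<q. norm (G (Suc k) - G k))" by (simp add: mult.commute)
  then show ?thesis using z by (simp add: pos_le_divide_eq)
qed

lemma abs_sin_diff_le: "\<bar>sin a - sin b\<bar> \<le> \<bar>a - b :: real\<bar>" and abs_cos_diff_le: "\<bar>cos a - cos b\<bar> \<le> \<bar>a - b :: real\<bar>"
proof -
  have s: "\<bar>2 * x * sin ((a - b) / 2)\<bar> \<le> \<bar>a - b\<bar>" if "\<bar>x\<bar> \<le> 1" for x :: real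
  proof -
    have "\<bar>x\<bar> * \<bar>sin ((a - b) / 2)\<bar> \<le> 1 * \<bar>(a - b) / 2\<bar>" using that abs_sin_x_le_abs_x[of "(a - b) / 2"] by (intro mult_mono) auto
    then show ?thesis by (simp add: abs_mult)
  qed
  show "\<bar>sin a - sin b\<bar> \<le> \<bar>a - b\<bar>" using s[of "cos ((a + b) / 2)"] unfolding sin_diff_sin by (simp add: mult.commute mult.left_commute)
  have e: "(b - a) / 2 = - ((a - b) / 2)" by (simp add: minus_divide_left)
  have "cos a - cos b = - (2 * sin ((a + b) / 2) * sin ((a - b) / 2))" unfolding cos_diff_cos e sin_minus by simp
  then show "\<bar>cos a - cos b\<bar> \<le> \<bar>a - b\<bar>" using s[of "sin ((a + b) / 2)"] by simp
qed

lemma norm_cis_diff_le: "norm (cis a - cis b) \<le> 2 * \<bar>a - b\<bar>"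
  using cmod_le[of "cis a - cis b"] abs_sin_diff_le[of a b] abs_cos_diff_le[of a b] by simp

text \<open>For exactly equidistributed \<open>x\<close> the sum vanishes unless \<open>q\<close> divides \<open>j\<close>; the deviation is controlled by
  summation by parts against the geometric sums, whose size is governed by the distance of \<open>j\<close> to the multiples of \<open>q\<close>.\<close>

lemma mode_bound:
  fixes g x :: "nat \<Rightarrow> real" and A :: real
  assumes q: "q \<ge> 2" and A: "0 \<le> A" "A \<le> 1" and j: "j \<ge> 1"
    and g: "\<And>k. k \<le> q \<Longrightarrow> \<bar>g k - 1\<bar> \<le> A / (real q)\<^sup>2" "\<And>k. k < q \<Longrightarrow> \<bar>g (Suc k) - g k\<bar> \<le> A / real q ^ 3"
    and x: "\<And>k. k \<le> q \<Longrightarrow> \<bar>x k - 2 * pi * real k / real q\<bar> \<le> A / (real q)\<^sup>2" "\<And>k. k < q \<Longrightarrow> \<bar>x (Suc k) - x k - 2 * pi / real q\<bar> \<le> A / real q ^ 3"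
  defines "m \<equiv> (\<Sum>k<q. g k * cos (real j * x k)) / real q"
  shows "\<bar>m - of_bool (q dvd j)\<bar> \<le> 3" "\<bar>m - of_bool (q dvd j)\<bar> \<le> 20 * A * real j / ((real q)\<^sup>2 * rdist q j)"
proof -
  have q0: "real q > 0" "real q \<ge> 1" using q by auto
  have j1: "real j \<ge> 1" using j by simp
  have Aq: "A / (real q)\<^sup>2 \<le> 1" using A q0 by (simp add: divide_le_eq_1 power2_eq_square mult_ge1_I order_trans[of A 1])
  have g2: "\<bar>g k\<bar> \<le> 2" if "k \<le> q" for k using g(1)[OF that] Aq by linarith
  have "\<bar>\<Sum>k<q. g k * cos (real j * x k)\<bar> \<le> (\<Sum>k<q. 2)"
  proof (rule order_trans[OF sum_abs sum_mono])
    fix k assume "k \<in> {..<q}"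
    then show "\<bar>g k * cos (real j * x k)\<bar> \<le> 2" using g2[of k] mult_mono[of "\<bar>g k\<bar>" 2 "\<bar>cos (real j * x k)\<bar>" 1] by (simp add: abs_mult)
  qed
  then have "\<bar>m\<bar> \<le> 2" unfolding m_def using q0 by (simp add: abs_divide divide_le_eq)
  then show "\<bar>m - of_bool (q dvd j)\<bar> \<le> 3" by (cases "q dvd j") auto
  define e where "e = (\<lambda>k. x k - 2 * pi * real k / real q)"
  define z where "z = cis (2 * pi * real j / real q)"
  have zk: "z ^ k * cis (real j * e k) = cis (real j * x k)" for k
  proof -
    have "real k * (2 * pi * real j / real q) + real j * e k = real j * x k" by (simp add: e_def right_diff_distrib)
    then show ?thesis unfolding z_def Complex.DeMoivre cis_mult by (simp only:)
  qed
  have zq: "z ^ q = 1"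
  proof -
    have "z ^ q = cis (2 * pi * real j)" unfolding z_def Complex.DeMoivre using q0 by simp
    then show ?thesis using cis_multiple_2pi[OF Ints_of_nat[of j]] by simp
  qed
  show "\<bar>m - of_bool (q dvd j)\<bar> \<le> 20 * A * real j / ((real q)\<^sup>2 * rdist q j)"
  proof (cases "q dvd j")
    case True
    then obtain l where l: "j = q * l" unfolding dvd_def by blast
    have "2 * pi * real j / real q = 2 * pi * real l" using q0 by (simp add: l)
    then have z1: "z = 1" unfolding z_def using cis_multiple_2pi[OF Ints_of_nat[of l]] by simp
    have ck: "cos (real j * x k) = cos (real j * e k)" for k using arg_cong[OF zk[of k], of Re] by (simp add: z1)
    have "\<bar>g k * cos (real j * x k) - 1\<bar> \<le> 20 * A * real j / (real q)\<^sup>2" if k: "k < q" for k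
    proof -
      have ek: "\<bar>real j * e k\<bar> \<le> real j * (A / (real q)\<^sup>2)" unfolding abs_mult using x(1)[of k] k by (intro mult_mono) (auto simp: e_def)
      have c1: "\<bar>cos (real j * e k) - 1\<bar> \<le> real j * (A / (real q)\<^sup>2)" using abs_cos_diff_le[of "real j * e k" 0] ek by simp
      have "g k * cos (real j * e k) - 1 = (g k - 1) * cos (real j * e k) + (cos (real j * e k) - 1)" by (simp add: algebra_simps)
      moreover have "\<bar>(g k - 1) * cos (real j * e k)\<bar> \<le> A / (real q)\<^sup>2 * 1" unfolding abs_mult using g(1)[of k] k A by (intro mult_mono) auto
      moreover have "A / (real q)\<^sup>2 \<le> real j * (A / (real q)\<^sup>2)" using mult_right_mono[OF j1, of "A / (real q)\<^sup>2"] A by simp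
      ultimately have "\<bar>g k * cos (real j * e k) - 1\<bar> \<le> 2 * (real j * (A / (real q)\<^sup>2))" using c1 by linarith
      also have "\<dots> \<le> 20 * (real j * (A / (real q)\<^sup>2))" using A by (intro mult_right_mono) auto
      finally show ?thesis unfolding ck by (simp add: mult.commute mult.left_commute)
    qed
    then have "\<bar>\<Sum>k<q. (g k * cos (real j * x k) - 1)\<bar> \<le> (\<Sum>k<q. 20 * A * real j / (real q)\<^sup>2)" by (intro order_trans[OF sum_abs sum_mono]) auto
    then have "\<bar>(\<Sum>k<q. g k * cos (real j * x k)) - real q\<bar> \<le> real q * (20 * A * real j / (real q)\<^sup>2)" by (simp add: sum_subtractf)
    moreover have "m - 1 = ((\<Sum>k<q. g k * cos (real j * x k)) - real q) / real q" using q0 by (simp add: m_def diff_divide_distrib)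
    ultimately have "\<bar>m - 1\<bar> \<le> 20 * A * real j / (real q)\<^sup>2" using q0 by (simp add: abs_divide pos_divide_le_eq mult.commute)
    then show ?thesis using True by (simp add: rdist_def)
  next
    case False
    define i where "i = j mod q"
    have i: "0 < i" "i < q" using False q by (auto simp: i_def dvd_eq_mod_eq_0)
    define d where "d = real (min i (q - i))"
    have dr: "rdist q j = d" using False by (simp add: rdist_def d_def i_def)
    have d1: "d \<ge> 1" using rdist_ge_1[OF q, of j] dr by simp
    have zi: "z = cis (2 * pi * real i / real q)"
    proof -
      have "real j = real i + real q * real (j div q)" unfolding i_def by (metis add.commute mod_mult_div_eq of_nat_add of_nat_mult)
      then have "2 * pi * real j / real q = 2 * pi * real i / real q + 2 * pi * real (j div q)" using q0 by (simp add: field_simps)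
      then show ?thesis unfolding z_def using cis_multiple_2pi[OF Ints_of_nat[of "j div q"]] by (simp add: cis_mult[symmetric])
    qed
    \<comment> \<open>\<open>norm (z - 1)\<close> is the chord \<open>2 * sin (pi * i / q)\<close>,
      and this is governed by the distance \<open>d\<close> from the residue \<open>i\<close> to the
      nearer of 0 and \<open>q\<close>.\<close>
    have zn: "norm (z - 1) \<ge> d / real q"
    proof -
      define t where "t = pi * real i / real q"
      have t: "0 \<le> t" "t \<le> pi" using i q0 by (auto simp: t_def field_simps)
      have zt: "z = cis (2 * t)" unfolding zi t_def by (simp add: mult.assoc)
      have "(norm (z - 1))\<^sup>2 = (cos (2 * t) - 1)\<^sup>2 + (sin (2 * t))\<^sup>2" unfolding cmod_power2 zt by simp
      also have "\<dots> = (2 * sin t)\<^sup>2"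
        unfolding cos_double_sin sin_double using sin_cos_squared_add[of t] by algebra
      finally have "(norm (z - 1))\<^sup>2 = (2 * sin t)\<^sup>2" .
      then have n: "norm (z - 1) = 2 * sin t" by (rule power2_eq_imp_eq) (use sin_ge_zero[OF t] in auto)
      define s where "s = pi * d / real q"
      have ss: "sin t = sin s"
      proof (cases "i \<le> q - i")
        case True then show ?thesis by (simp add: s_def d_def t_def)
      next
        case False
        then have "s = pi - t" using i q0 by (simp add: s_def d_def t_def of_nat_diff field_simps)
        then show ?thesis by simp
      qed
      have "d \<le> real q / 2" using i by (auto simp: d_def min_def of_nat_diff)
      then have "s \<le> pi * (real q / 2) / real q" unfolding s_def using q0 by (intro divide_right_mono mult_left_mono) auto
      then have "s \<le> pi / 2" using q0 by simp
      then have "s \<le> 2 * pi / 3" using pi_gt_zero by linarith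
      moreover have "s \<ge> 0" using d1 q0 by (simp add: s_def)
      ultimately have "s / 4 \<le> sin s" by (intro sin_ge_quarter)
      then have "2 * (s / 4) \<le> norm (z - 1)" using n ss by simp
      moreover have "d / real q \<le> 2 * (s / 4)"
      proof -
        have "2 * d \<le> pi * d" using d1 pi_ge_two by (intro mult_right_mono) auto
        then have "2 * d / real q \<le> pi * d / real q" using q0 by (intro divide_right_mono) auto
        then show ?thesis by (simp add: s_def)
      qed
      ultimately show ?thesis by linarith
    qed
    have zn0: "norm (z - 1) > 0" using zn d1 q0 by (meson divide_pos_pos less_le_trans order_less_le_trans zero_less_one)
    \<comment> \<open>The slowly varying factor: weight and phase deviation. The fast part is the
      geometric sequence \<open>z ^ k\<close>.\<close>
    define G where "G = (\<lambda>k. of_real (g k) * cis (real j * e k))"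
    have Gd: "norm (G (Suc k) - G k) \<le> 5 * A * real j / real q ^ 3" if k: "k < q" for k
    proof -
      have "G (Suc k) - G k = of_real (g (Suc k) - g k) * cis (real j * e (Suc k)) + of_real (g k) * (cis (real j * e (Suc k)) - cis (real j * e k))"
        by (simp add: G_def algebra_simps)
      then have "norm (G (Suc k) - G k) \<le> \<bar>g (Suc k) - g k\<bar> + \<bar>g k\<bar> * norm (cis (real j * e (Suc k)) - cis (real j * e k))"
        by (metis norm_cis norm_mult norm_of_real norm_triangle_ineq mult.right_neutral)
      also have "\<dots> \<le> A / real q ^ 3 + 2 * (2 * (real j * (A / real q ^ 3)))"
      proof (intro add_mono mult_mono)
        show "\<bar>g (Suc k) - g k\<bar> \<le> A / real q ^ 3" using g(2)[OF k] .
        show "\<bar>g k\<bar> \<le> 2" using g2 k by simp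
        have "e (Suc k) - e k = x (Suc k) - x k - 2 * pi / real q" by (simp add: e_def field_simps add_divide_distrib)
        then have de: "\<bar>e (Suc k) - e k\<bar> \<le> A / real q ^ 3" using x(2)[OF k] by simp
        have "\<bar>real j * e (Suc k) - real j * e k\<bar> \<le> real j * (A / real q ^ 3)"
          unfolding right_diff_distrib[symmetric] abs_mult using de by (intro mult_mono) auto
        then show "norm (cis (real j * e (Suc k)) - cis (real j * e k)) \<le> 2 * (real j * (A / real q ^ 3))"
          by (intro order_trans[OF norm_cis_diff_le mult_left_mono]) auto
      qed auto
      also have "\<dots> \<le> real j * (A / real q ^ 3) + 2 * (2 * (real j * (A / real q ^ 3)))"
        using mult_right_mono[OF j1, of "A / real q ^ 3"] A by (intro add_right_mono) simp
      finally show ?thesis by (simp add: mult.commute mult.left_commute)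
    qed
    have "\<bar>\<Sum>k<q. g k * cos (real j * x k)\<bar> \<le> norm (\<Sum>k<q. z ^ k * G k)"
    proof -
      have "z ^ k * G k = of_real (g k) * cis (real j * x k)" for k using zk[of k] by (simp add: G_def mult.left_commute)
      then have "Re (\<Sum>k<q. z ^ k * G k) = (\<Sum>k<q. g k * cos (real j * x k))" by (simp add: Re_sum)
      then show ?thesis by (metis abs_Re_le_cmod)
    qed
    also have "\<dots> \<le> 2 * (\<Sum>k<q. norm (G (Suc k) - G k)) / norm (z - 1)"
      using zn0 zq by (intro abel_unit_circle) (auto simp: z_def)
    also have "\<dots> \<le> 2 * (real q * (5 * A * real j / real q ^ 3)) / (d / real q)"
    proof (rule frac_le)
      have "(\<Sum>k<q. norm (G (Suc k) - G k)) \<le> (\<Sum>k<q. 5 * A * real j / real q ^ 3)" using Gd by (intro sum_mono) auto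
      then show "2 * (\<Sum>k<q. norm (G (Suc k) - G k)) \<le> 2 * (real q * (5 * A * real j / real q ^ 3))" by simp
    qed (use zn d1 q0 A in auto)
    also have "\<dots> = 10 * A * real j / (real q * d)" using q0 by (simp add: eval_nat_numeral)
    finally have "\<bar>\<Sum>k<q. g k * cos (real j * x k)\<bar> / real q \<le> 10 * A * real j / (real q * d) / real q" using q0 by (intro divide_right_mono) auto
    then have "\<bar>m\<bar> \<le> 10 * A * real j / (real q * d) / real q" unfolding m_def abs_divide by simp
    also have "\<dots> = 10 * A * real j / ((real q)\<^sup>2 * d)" by (simp add: power2_eq_square mult.commute mult.left_commute)
    also have "\<dots> \<le> 20 * A * real j / ((real q)\<^sup>2 * d)" using A d1 by (intro divide_right_mono mult_right_mono) auto
    finally show ?thesis using False dr by simp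
  qed
qed

text \<open>Averaging mode \<open>j\<close> over the polygon gives 1 if \<open>q\<close> divides
  \<open>j\<close> and 0 otherwise, up to the mode error; summation over \<open>j\<close> leaves the
  coefficients at multiples of \<open>q\<close>. The factor \<open>m0\<close> is kept separate
  because \<open>a 0\<close> is not covered by the decay bound.\<close>

lemma row_expansion:
  "\<exists>Z>0. \<forall>q A g x a v N. q \<ge> (2::nat) \<longrightarrow> 0 \<le> A \<longrightarrow> A \<le> 1/20 \<longrightarrow>
     (\<forall>k\<le>q. \<bar>g k - 1\<bar> \<le> A / (real q)\<^sup>2) \<longrightarrow> (\<forall>k<q. \<bar>g (Suc k) - g k\<bar> \<le> A / real q ^ 3) \<longrightarrow>
     (\<forall>k\<le>q. \<bar>x k - 2 * pi * real k / real q\<bar> \<le> A / (real q)\<^sup>2) \<longrightarrow> (\<forall>k<q. \<bar>x (Suc k) - x k - 2 * pi / real q\<bar> \<le> A / real q ^ 3) \<longrightarrow>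
     (\<forall>k<q. (\<lambda>j. a j * cos (real j * x k)) sums v k) \<longrightarrow> (\<forall>j\<ge>1. \<bar>a j\<bar> \<le> N / (real j)\<^sup>2) \<longrightarrow>
     (\<exists>m0 P. (\<Sum>k<q. g k * v k) / real q = a 0 * m0 + (\<Sum>n. a (Suc n * q)) + P \<and> \<bar>m0 - 1\<bar> \<le> A / (real q)\<^sup>2 \<and>
        \<bar>P\<bar> \<le> N * Z * sqrt A / (real q)\<^sup>2)"
proof -
  obtain Z0 where Z0: "Z0 > 0" "\<And>E q b. 0 \<le> E \<Longrightarrow> E \<le> 1 \<Longrightarrow> q \<ge> 2 \<Longrightarrow> (\<forall>j\<ge>1. 0 \<le> b j \<and> b j \<le> 3 \<and> b j \<le> E * real j / ((real q)\<^sup>2 * rdist q j)) \<Longrightarrow>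
     summable (\<lambda>j. b j / (real j)\<^sup>2) \<and> (\<Sum>j. b j / (real j)\<^sup>2) \<le> Z0 * sqrt E / (real q)\<^sup>2"
    using row_sum_bound by blast
  have "\<exists>m0 P. (\<Sum>k<q. g k * v k) / real q = a 0 * m0 + (\<Sum>n. a (Suc n * q)) + P \<and> \<bar>m0 - 1\<bar> \<le> A / (real q)\<^sup>2 \<and>
        \<bar>P\<bar> \<le> N * (5 * Z0) * sqrt A / (real q)\<^sup>2"
    if q: "q \<ge> 2" and A: "0 \<le> A" "A \<le> 1/20" and g: "\<forall>k\<le>q. \<bar>g k - 1\<bar> \<le> A / (real q)\<^sup>2" "\<forall>k<q. \<bar>g (Suc k) - g k\<bar> \<le> A / real q ^ 3"
      and x: "\<forall>k\<le>q. \<bar>x k - 2 * pi * real k / real q\<bar> \<le> A / (real q)\<^sup>2" "\<forall>k<q. \<bar>x (Suc k) - x k - 2 * pi / real q\<bar> \<le> A / real q ^ 3"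
      and v: "\<forall>k<q. (\<lambda>j. a j * cos (real j * x k)) sums v k" and a: "\<forall>j\<ge>1. \<bar>a j\<bar> \<le> N / (real j)\<^sup>2"
    for q :: nat and A N :: real and g x a v :: "nat \<Rightarrow> real"
  proof -
    have q0: "real q > 0" using q by simp
    have N0: "N \<ge> 0" using a[rule_format, of 1] by simp
    define m where "m = (\<lambda>j. (\<Sum>k<q. g k * cos (real j * x k)) / real q)"
    have mb: "\<bar>m j - of_bool (q dvd j)\<bar> \<le> 3" "\<bar>m j - of_bool (q dvd j)\<bar> \<le> (20 * A) * real j / ((real q)\<^sup>2 * rdist q j)" if "j \<ge> 1" for j
      unfolding m_def using mode_bound[OF q A(1) _ that, of g x] g x A by auto
    define b where "b = (\<lambda>j. \<bar>m j - of_bool (q dvd j)\<bar>)"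
    \<comment> \<open>The constant 20 of the mode bound explains \<open>A \<le> 1/20\<close>: the
      row sum requires \<open>20 * A \<le> 1\<close>.\<close>
    have bs: "summable (\<lambda>j. b j / (real j)\<^sup>2)" "(\<Sum>j. b j / (real j)\<^sup>2) \<le> Z0 * sqrt (20 * A) / (real q)\<^sup>2"
      using Z0(2)[of "20 * A" q b] mb A q by (auto simp: b_def)
    have tot: "(\<lambda>j. a j * m j) sums ((\<Sum>k<q. g k * v k) / real q)"
    proof -
      have "(\<lambda>j. \<Sum>k<q. g k * (a j * cos (real j * x k))) sums (\<Sum>k<q. g k * v k)"
        using v by (intro sums_sum sums_mult) auto
      then have "(\<lambda>j. (\<Sum>k<q. g k * (a j * cos (real j * x k))) / real q) sums ((\<Sum>k<q. g k * v k) / real q)" by (rule sums_divide)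
      moreover have "(\<Sum>k<q. g k * (a j * cos (real j * x k))) / real q = a j * m j" for j
        by (simp add: m_def sum_distrib_left mult.left_commute)
      ultimately show ?thesis by simp
    qed
    define p where "p = (\<lambda>j. if j = 0 then 0 else a j * (m j - of_bool (q dvd j)))"
    have pb: "\<bar>p j\<bar> \<le> N * (b j / (real j)\<^sup>2)" for j
    proof (cases "j = 0")
      case False
      then have "\<bar>a j\<bar> * b j \<le> N / (real j)\<^sup>2 * b j" using a by (intro mult_right_mono) (auto simp: b_def)
      then show ?thesis using False by (simp add: p_def b_def abs_mult)
    qed (simp add: p_def)
    have Ns: "summable (\<lambda>j. N * (b j / (real j)\<^sup>2))" using bs(1) by (rule summable_mult)
    have ps: "summable (\<lambda>j. \<bar>p j\<bar>)" by (rule summable_comparison_test[OF _ Ns]) (use pb in auto)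
    have "\<bar>suminf p\<bar> \<le> (\<Sum>j. \<bar>p j\<bar>)" by (rule summable_rabs[OF ps])
    also have "\<dots> \<le> (\<Sum>j. N * (b j / (real j)\<^sup>2))" by (rule suminf_le[OF pb ps Ns])
    also have "\<dots> = N * (\<Sum>j. b j / (real j)\<^sup>2)" by (rule suminf_mult[OF bs(1)])
    also have "\<dots> \<le> N * (Z0 * sqrt (20 * A) / (real q)\<^sup>2)" using bs(2) N0 by (rule mult_left_mono)
    also have "\<dots> \<le> N * (5 * Z0) * sqrt A / (real q)\<^sup>2"
    proof -
      have "sqrt (20 * A) \<le> 5 * sqrt A" using A by (intro real_le_lsqrt) (auto simp: power_mult_distrib)
      then have "N * Z0 * sqrt (20 * A) / (real q)\<^sup>2 \<le> N * Z0 * (5 * sqrt A) / (real q)\<^sup>2" using N0 Z0(1) by (intro divide_right_mono mult_left_mono) auto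
      then show ?thesis by (simp add: mult.assoc mult.left_commute)
    qed
    finally have P: "\<bar>suminf p\<bar> \<le> N * (5 * Z0) * sqrt A / (real q)\<^sup>2" .
    have psum: "p sums suminf p" using summable_rabs_cancel[OF ps] by (rule summable_sums)
    define d where "d = (\<lambda>j. if j = 0 then 0 else a j * of_bool (q dvd j))"
    have dsum: "d sums ((\<Sum>k<q. g k * v k) / real q - suminf p - a 0 * m 0)"
    proof -
      have "(\<lambda>j. a j * m j - p j - (if j = 0 then a 0 * m 0 else 0)) sums ((\<Sum>k<q. g k * v k) / real q - suminf p - a 0 * m 0)"
        using sums_diff[OF sums_diff[OF tot psum] sums_single[of 0 "\<lambda>_. a 0 * m 0"]] by simp
      moreover have "(\<lambda>j. a j * m j - p j - (if j = 0 then a 0 * m 0 else 0)) = d"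
        by (auto simp: fun_eq_iff d_def p_def algebra_simps)
      ultimately show ?thesis by simp
    qed
    have "(\<lambda>n. d (Suc n * q)) sums ((\<Sum>k<q. g k * v k) / real q - suminf p - a 0 * m 0)"
    proof (subst sums_mono_reindex)
      show "strict_mono (\<lambda>n. Suc n * q)" using q by (auto simp: strict_mono_Suc_iff)
      show "d n = 0" if "n \<notin> range (\<lambda>n. Suc n * q)" for n
      proof (rule ccontr)
        assume "d n \<noteq> 0"
        then have "n \<noteq> 0" "q dvd n" by (auto simp: d_def split: if_splits)
        then obtain l where l: "n = q * l" "l \<noteq> 0" unfolding dvd_def by auto
        then obtain l' where "l = Suc l'" using not0_implies_Suc by blast
        then have "n = Suc l' * q" using l(1) by (simp only: mult.commute)
        then show False using that by blast
      qed
    qed (rule dsum)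
    moreover have "d (Suc n * q) = a (Suc n * q)" for n using q by (simp add: d_def)
    ultimately have "(\<Sum>n. a (Suc n * q)) = (\<Sum>k<q. g k * v k) / real q - suminf p - a 0 * m 0" by (simp add: sums_iff)
    then have "(\<Sum>k<q. g k * v k) / real q = a 0 * m 0 + (\<Sum>n. a (Suc n * q)) + suminf p" by simp
    moreover have "\<bar>m 0 - 1\<bar> \<le> A / (real q)\<^sup>2"
    proof -
      have "m 0 - 1 = (\<Sum>k<q. g k - 1) / real q" using q0 by (simp add: m_def sum_subtractf diff_divide_distrib)
      moreover have "\<bar>\<Sum>k<q. g k - 1\<bar> \<le> (\<Sum>k<q. A / (real q)\<^sup>2)" using g(1) by (intro order_trans[OF sum_abs sum_mono]) auto
      ultimately show ?thesis using q0 by (simp add: abs_divide pos_divide_le_eq mult.commute)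
    qed
    ultimately show ?thesis using P by blast
  qed
  then show ?thesis using Z0(1) by (intro exI[of _ "5 * Z0"]) auto
qed

text \<open>The last bound is the decisive one: \<open>3/4\<close> is a telescoping bound for
  \<open>\<zeta>(2) - 1\<close>, which is about 0.645, and it is below one. So the terms at the
  proper multiples of \<open>q\<close> amount to a fixed fraction of the decay constant.\<close>

lemma inverse_square_tails:
  assumes "q \<ge> (1::nat)" "\<forall>j\<ge>1. \<bar>a j\<bar> \<le> N / (real j)\<^sup>2"
  shows "summable (\<lambda>n. \<bar>a (Suc n * q)\<bar>)" "\<bar>\<Sum>n. a (Suc n * q)\<bar> \<le> 2 * N / (real q)\<^sup>2"
    "\<bar>(\<Sum>n. a (Suc n * q)) - a q\<bar> \<le> 3/4 * N / (real q)\<^sup>2"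
proof -
  have N0: "N \<ge> 0" using assms(2)[rule_format, of 1] by simp
  have le: "\<bar>a (Suc n * q)\<bar> \<le> N / (real q)\<^sup>2 * (1 / (real (Suc n))\<^sup>2)" for n
  proof -
    have "1 \<le> Suc n * q" using assms(1) by simp
    then have "\<bar>a (Suc n * q)\<bar> \<le> N / (real (Suc n * q))\<^sup>2" using assms(2) by blast
    also have "\<dots> = N / (real q)\<^sup>2 * (1 / (real (Suc n))\<^sup>2)" unfolding of_nat_mult power_mult_distrib by (simp only: times_divide_eq_right divide_divide_eq_left mult_1_right mult.commute)
    finally show ?thesis .
  qed
  have part: "(\<Sum>n<k. 1 / (real (Suc n))\<^sup>2) \<le> 2" for k
    using sum_inverse_squares[of "Suc k"] unfolding sum.lessThan_Suc_shift by simp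
  have sm1: "summable (\<lambda>n. 1 / (real (Suc n))\<^sup>2)" by (rule summableI_nonneg_bounded[OF _ part]) auto
  have s1: "(\<Sum>n. 1 / (real (Suc n))\<^sup>2) \<le> 2" by (rule suminf_le_const[OF sm1 part])
  have sm: "summable (\<lambda>n. N / (real q)\<^sup>2 * (1 / (real (Suc n))\<^sup>2))" using sm1 by (rule summable_mult)
  show sa: "summable (\<lambda>n. \<bar>a (Suc n * q)\<bar>)" by (rule summable_comparison_test[OF _ sm]) (use le in auto)
  have "\<bar>\<Sum>n. a (Suc n * q)\<bar> \<le> (\<Sum>n. \<bar>a (Suc n * q)\<bar>)" by (rule summable_rabs[OF sa])
  also have "\<dots> \<le> (\<Sum>n. N / (real q)\<^sup>2 * (1 / (real (Suc n))\<^sup>2))" by (rule suminf_le[OF le sa sm])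
  also have "\<dots> = N / (real q)\<^sup>2 * (\<Sum>n. 1 / (real (Suc n))\<^sup>2)" by (rule suminf_mult[OF sm1])
  also have "\<dots> \<le> N / (real q)\<^sup>2 * 2" using s1 N0 by (intro mult_left_mono) auto
  finally show "\<bar>\<Sum>n. a (Suc n * q)\<bar> \<le> 2 * N / (real q)\<^sup>2" by (simp add: mult.commute)
  have sa': "summable (\<lambda>n. \<bar>a (Suc (Suc n) * q)\<bar>)" using summable_Suc_iff[of "\<lambda>n. \<bar>a (Suc n * q)\<bar>"] sa by simp
  have part2: "(\<Sum>n<k. 1 / (real (Suc (Suc n)))\<^sup>2) \<le> 3/4" for k
  proof -
    have "(\<Sum>n<Suc k. 1 / (real (Suc (Suc n)))\<^sup>2) \<le> 3/4 - 1 / real (Suc (Suc k))" for k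
    proof (induction k)
      case (Suc k)
      have "1 / (real (Suc (Suc (Suc k))))\<^sup>2 \<le> 1 / real (Suc (Suc k)) - 1 / real (Suc (Suc (Suc k)))"
      proof -
        have "1 / real (Suc (Suc k)) - 1 / real (Suc (Suc (Suc k))) = 1 / (real (Suc (Suc k)) * real (Suc (Suc (Suc k))))" by (simp add: field_simps)
        moreover have "1 / (real (Suc (Suc (Suc k))))\<^sup>2 \<le> 1 / (real (Suc (Suc k)) * real (Suc (Suc (Suc k))))"
          unfolding power2_eq_square by (intro divide_left_mono mult_right_mono) auto
        ultimately show ?thesis by (simp only:)
      qed
      then show ?case using Suc unfolding sum.lessThan_Suc[of _ "Suc k"] by linarith
    qed simp
    then have "(\<Sum>n<Suc k. 1 / (real (Suc (Suc n)))\<^sup>2) \<le> 3/4" by (smt (verit) divide_nonneg_nonneg of_nat_0_le_iff)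
    moreover have "(\<Sum>n<k. 1 / (real (Suc (Suc n)))\<^sup>2) \<le> (\<Sum>n<Suc k. 1 / (real (Suc (Suc n)))\<^sup>2)" by simp
    ultimately show ?thesis by linarith
  qed
  have sm2: "summable (\<lambda>n. 1 / (real (Suc (Suc n)))\<^sup>2)" by (rule summableI_nonneg_bounded[OF _ part2]) auto
  have s2: "(\<Sum>n. 1 / (real (Suc (Suc n)))\<^sup>2) \<le> 3/4" by (rule suminf_le_const[OF sm2 part2])
  have sm2': "summable (\<lambda>n. N / (real q)\<^sup>2 * (1 / (real (Suc (Suc n)))\<^sup>2))" using sm2 by (rule summable_mult)
  have "(\<Sum>n. a (Suc n * q)) - a q = (\<Sum>n. a (Suc (Suc n) * q))"
    using suminf_split_head[OF summable_rabs_cancel[OF sa]] by simp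
  then have "\<bar>(\<Sum>n. a (Suc n * q)) - a q\<bar> \<le> (\<Sum>n. \<bar>a (Suc (Suc n) * q)\<bar>)" using summable_rabs[OF sa'] by simp
  also have "\<dots> \<le> (\<Sum>n. N / (real q)\<^sup>2 * (1 / (real (Suc (Suc n)))\<^sup>2))" by (rule suminf_le[OF le sa' sm2'])
  also have "\<dots> = N / (real q)\<^sup>2 * (\<Sum>n. 1 / (real (Suc (Suc n)))\<^sup>2)" by (rule suminf_mult[OF sm2])
  also have "\<dots> \<le> N / (real q)\<^sup>2 * (3/4)" using s2 N0 by (intro mult_left_mono) auto
  finally show "\<bar>(\<Sum>n. a (Suc n * q)) - a q\<bar> \<le> 3/4 * N / (real q)\<^sup>2" by (simp add: mult.commute)
qed

text \<open>The least constant is the supremum of \<open>j^2 * |a j|\<close>. Its minimality turns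
  an improved decay bound into an inequality between constants, which is how the contraction is
  closed.\<close>

lemma least_decay_constant:
  assumes "\<forall>j\<ge>1. \<bar>a j\<bar> \<le> (N::real) / (real j)\<^sup>2"
  obtains M where "\<forall>j\<ge>1. \<bar>a j\<bar> \<le> M / (real j)\<^sup>2" "\<And>M'. \<forall>j\<ge>1. \<bar>a j\<bar> \<le> M' / (real j)\<^sup>2 \<Longrightarrow> M \<le> M'"
proof -
  define M where "M = (SUP j\<in>{1::nat..}. \<bar>a j\<bar> * (real j)\<^sup>2)"
  have conv: "\<bar>a j\<bar> \<le> M' / (real j)\<^sup>2 \<longleftrightarrow> \<bar>a j\<bar> * (real j)\<^sup>2 \<le> M'" if "j \<ge> 1" for j M' using that by (simp add: pos_le_divide_eq)
  have bdd: "bdd_above ((\<lambda>j. \<bar>a j\<bar> * (real j)\<^sup>2) ` {1..})" using assms conv by (auto intro!: bdd_aboveI[of _ N])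
  have 1: "\<forall>j\<ge>1. \<bar>a j\<bar> \<le> M / (real j)\<^sup>2"
  proof (intro allI impI)
    fix j :: nat assume j: "j \<ge> 1"
    show "\<bar>a j\<bar> \<le> M / (real j)\<^sup>2" unfolding conv[OF j] M_def using j by (intro cSUP_upper bdd) auto
  qed
  have 2: "M \<le> M'" if "\<forall>j\<ge>1. \<bar>a j\<bar> \<le> M' / (real j)\<^sup>2" for M'
    unfolding M_def using that conv by (intro cSUP_least) auto
  show thesis by (rule that[OF 1 2])
qed

lemma nonpos_if_quadratic_decay:
  assumes "\<And>q. q \<ge> (2::nat) \<Longrightarrow> c \<le> K / (real q)\<^sup>2"
  shows "c \<le> (0::real)"
proof (rule ccontr)
  assume "\<not> c \<le> 0" then have c: "c > 0" by simp
  obtain q :: nat where q: "real q > K / c + 2" using reals_Archimedean2 by blast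
  define Q where "Q = q + 2"
  have Q: "Q \<ge> 2" "real Q > K / c" "real Q \<ge> 1" using q by (auto simp: Q_def)
  have "real Q * 1 \<le> real Q * real Q" using Q by (intro mult_left_mono) auto
  then have "K / c < (real Q)\<^sup>2" using Q(2) unfolding power2_eq_square by linarith
  then have "K < c * (real Q)\<^sup>2" using c by (simp add: pos_divide_less_eq mult.commute)
  then have "K / (real Q)\<^sup>2 < c" using Q by (simp add: pos_divide_less_eq)
  then show False using assms[OF Q(1)] by simp
qed

text \<open>Letting \<open>q\<close> tend to infinity gives \<open>a\<^sub>0 = 0\<close>. Then \<open>a\<^sub>q\<close> is bounded by the terms \<open>a\<^sub>n\<^sub>q\<close> with \<open>n \<ge> 2\<close>, the errors and
  \<open>\<Delta>\<close>, and \<open>\<zeta>(2) - 1 < 1\<close> makes this a contraction.\<close>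

lemma two_rows:
  fixes a b R0 R1 :: "nat \<Rightarrow> real"
  assumes z: "b 0 = a 0" "a 0 + (\<Sum>n. a (Suc n)) = 0"
    and N: "\<forall>j\<ge>1. \<bar>a j\<bar> \<le> N / (real j)\<^sup>2" "\<And>N'. \<forall>j\<ge>1. \<bar>a j\<bar> \<le> N' / (real j)\<^sup>2 \<Longrightarrow> N \<le> N'"
    and \<Delta>: "\<forall>j\<ge>1. \<bar>b j - a j\<bar> \<le> \<Delta> / (real j)\<^sup>2" and \<kappa>: "0 \<le> \<kappa>" "\<kappa> \<le> 1/100"
    and R0: "\<And>q. q \<ge> 2 \<Longrightarrow> R0 q \<le> 0" "\<And>q. q \<ge> 2 \<Longrightarrow> \<exists>m P. R0 q = a 0 * m + (\<Sum>n. a (Suc n * q)) + P \<and> \<bar>m - 1\<bar> \<le> 1/2 \<and> \<bar>P\<bar> \<le> \<kappa> * N / (real q)\<^sup>2"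
    and R1: "\<And>q. q \<ge> 2 \<Longrightarrow> 0 \<le> R1 q" "\<And>q. q \<ge> 2 \<Longrightarrow> \<exists>m P. R1 q = b 0 * m + (\<Sum>n. b (Suc n * q)) + P \<and> \<bar>m - 1\<bar> \<le> 1/2 \<and> \<bar>P\<bar> \<le> \<kappa> * (N + \<Delta>) / (real q)\<^sup>2"
  shows "a 0 = 0" "N \<le> 20 * \<Delta>"
proof -
  have N0: "N \<ge> 0" and D0: "\<Delta> \<ge> 0" using N(1)[rule_format, of 1] \<Delta>[rule_format, of 1] by auto
  have Nb: "\<forall>j\<ge>1. \<bar>b j\<bar> \<le> (N + \<Delta>) / (real j)\<^sup>2"
  proof (intro allI impI)
    fix j :: nat assume j: "j \<ge> 1"
    have "\<bar>b j\<bar> \<le> \<bar>a j\<bar> + \<bar>b j - a j\<bar>" by linarith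
    also have "\<dots> \<le> N / (real j)\<^sup>2 + \<Delta> / (real j)\<^sup>2" using N(1) \<Delta> j by (intro add_mono) auto
    finally show "\<bar>b j\<bar> \<le> (N + \<Delta>) / (real j)\<^sup>2" by (simp add: add_divide_distrib)
  qed
  have q1: "q \<ge> 1" if "q \<ge> 2" for q :: nat using that by simp
  have \<kappa>N: "\<kappa> * N \<le> N" "\<kappa> * (N + \<Delta>) \<le> N + \<Delta>" using \<kappa> N0 D0 by (auto intro!: mult_left_le_one_le)
  have half: "\<bar>x\<bar> / 2 \<le> \<bar>x * m\<bar>" if "\<bar>m - 1\<bar> \<le> 1/2" for x m :: real
  proof -
    have "1/2 \<le> \<bar>m\<bar>" using that by linarith
    then have "\<bar>x\<bar> * (1/2) \<le> \<bar>x\<bar> * \<bar>m\<bar>" by (intro mult_left_mono) auto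
    then show ?thesis by (simp add: abs_mult)
  qed
  \<comment> \<open>The two inequalities have opposite signs: \<open>R0 \<le> 0\<close> excludes a
    positive \<open>a 0\<close>, and below \<open>R1 \<ge> 0\<close> a negative one, because all
    other terms are \<open>O(1 / q^2)\<close>.\<close>
  have up: "a 0 \<le> 0"
  proof (rule ccontr)
    assume c: "\<not> a 0 \<le> 0"
    have "a 0 / 2 \<le> 3 * N / (real q)\<^sup>2" if q: "q \<ge> 2" for q
    proof -
      obtain m P where mP: "R0 q = a 0 * m + (\<Sum>n. a (Suc n * q)) + P" "\<bar>m - 1\<bar> \<le> 1/2" "\<bar>P\<bar> \<le> \<kappa> * N / (real q)\<^sup>2" using R0(2)[OF q] by blast
      have "m > 0" using mP(2) by linarith
      then have "a 0 * m > 0" using c by simp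
      then have "a 0 / 2 \<le> a 0 * m" using half[OF mP(2), of "a 0"] c by simp
      moreover have "\<kappa> * N / (real q)\<^sup>2 \<le> N / (real q)\<^sup>2" using \<kappa>N by (intro divide_right_mono) auto
      moreover have "3 * N / (real q)\<^sup>2 = 2 * N / (real q)\<^sup>2 + N / (real q)\<^sup>2" by (simp add: add_divide_distrib[symmetric])
      ultimately show ?thesis using mP(1,3) R0(1)[OF q] inverse_square_tails(2)[OF q1[OF q] N(1)] by linarith
    qed
    from nonpos_if_quadratic_decay[OF this] c show False by simp
  qed
  have lo: "a 0 \<ge> 0"
  proof (rule ccontr)
    assume c: "\<not> a 0 \<ge> 0"
    have "- a 0 / 2 \<le> 3 * (N + \<Delta>) / (real q)\<^sup>2" if q: "q \<ge> 2" for q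
    proof -
      obtain m P where mP: "R1 q = a 0 * m + (\<Sum>n. b (Suc n * q)) + P" "\<bar>m - 1\<bar> \<le> 1/2" "\<bar>P\<bar> \<le> \<kappa> * (N + \<Delta>) / (real q)\<^sup>2" using R1(2)[OF q] z(1) by metis
      have "m > 0" using mP(2) by linarith
      then have "a 0 * m < 0" using c by (simp add: mult_neg_pos)
      then have "- a 0 / 2 \<le> - (a 0 * m)" using half[OF mP(2), of "a 0"] c by simp
      moreover have "\<kappa> * (N + \<Delta>) / (real q)\<^sup>2 \<le> (N + \<Delta>) / (real q)\<^sup>2" using \<kappa>N by (intro divide_right_mono) auto
      moreover have "3 * (N + \<Delta>) / (real q)\<^sup>2 = 2 * (N + \<Delta>) / (real q)\<^sup>2 + (N + \<Delta>) / (real q)\<^sup>2" by (simp add: add_divide_distrib[symmetric])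
      ultimately show ?thesis using mP(1,3) R1(1)[OF q] inverse_square_tails(2)[OF q1[OF q] Nb] by linarith
    qed
    from nonpos_if_quadratic_decay[OF this] c show False by simp
  qed
  show a0: "a 0 = 0" using up lo by simp
  \<comment> \<open>\<open>R0\<close> bounds the tail above by \<open>\<kappa> * N\<close>;
    \<open>R1\<close> bounds it below by \<open>- 3 * \<Delta> - \<kappa> * N\<close>, where
    \<open>2 * \<Delta>\<close> pays for passing from \<open>b\<close> to \<open>a\<close>.
    \<open>B\<close> covers both generously.\<close>
  define B where "B = 3 * \<Delta> + 3 * \<kappa> * N"
  have B0: "B \<ge> 0" using D0 N0 \<kappa> by (simp add: B_def)
  have D: "\<bar>\<Sum>n. a (Suc n * q)\<bar> \<le> B / (real q)\<^sup>2" if q: "q \<ge> 1" for q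
  \<comment> \<open>There is no polygon with one side. The missing equation is the second part of
    \<open>z\<close>, which in the application says that \<open>u\<close> vanishes at the marked
    point.\<close>
  proof (cases "q = 1")
    case True then show ?thesis using z(2) a0 B0 by simp
  next
    case False
    then have q2: "q \<ge> 2" using q by simp
    obtain m P where 0: "R0 q = a 0 * m + (\<Sum>n. a (Suc n * q)) + P" "\<bar>P\<bar> \<le> \<kappa> * N / (real q)\<^sup>2" using R0(2)[OF q2] by blast
    obtain m' P' where 1: "R1 q = b 0 * m' + (\<Sum>n. b (Suc n * q)) + P'" "\<bar>P'\<bar> \<le> \<kappa> * (N + \<Delta>) / (real q)\<^sup>2" using R1(2)[OF q2] by blast
    have "(\<Sum>n. b (Suc n * q)) - (\<Sum>n. a (Suc n * q)) = (\<Sum>n. b (Suc n * q) - a (Suc n * q))"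
      using summable_rabs_cancel[OF inverse_square_tails(1)[OF q Nb]] summable_rabs_cancel[OF inverse_square_tails(1)[OF q N(1)]] by (rule suminf_diff)
    then have d: "\<bar>(\<Sum>n. b (Suc n * q)) - (\<Sum>n. a (Suc n * q))\<bar> \<le> 2 * \<Delta> / (real q)\<^sup>2"
      using inverse_square_tails(2)[OF q \<Delta>] by simp
    have e: "B / (real q)\<^sup>2 = 2 * \<Delta> / (real q)\<^sup>2 + \<kappa> * N / (real q)\<^sup>2 + \<kappa> * N / (real q)\<^sup>2 + (\<kappa> * N + \<Delta>) / (real q)\<^sup>2"
      by (simp add: B_def add_divide_distrib[symmetric])
    have "\<kappa> * (N + \<Delta>) / (real q)\<^sup>2 \<le> (\<kappa> * N + \<Delta>) / (real q)\<^sup>2"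
      using \<kappa> D0 by (intro divide_right_mono) (auto simp: distrib_left intro!: mult_left_le_one_le)
    moreover have "R0 q = (\<Sum>n. a (Suc n * q)) + P" using 0(1) unfolding a0 by (simp only: mult_zero_left add_0)
    moreover have "R1 q = (\<Sum>n. b (Suc n * q)) + P'" using 1(1) unfolding z(1) a0 by (simp only: mult_zero_left add_0)
    ultimately show ?thesis using 0(2) 1(2) R0(1)[OF q2] R1(1)[OF q2] d unfolding e by linarith
  qed
  have "\<forall>j\<ge>1. \<bar>a j\<bar> \<le> (B + 3/4 * N) / (real j)\<^sup>2"
  proof (intro allI impI)
    fix j :: nat assume j: "j \<ge> 1"
    have "\<bar>a j\<bar> \<le> B / (real j)\<^sup>2 + 3/4 * N / (real j)\<^sup>2" using D[OF j] inverse_square_tails(3)[OF j N(1)] by linarith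
    then show "\<bar>a j\<bar> \<le> (B + 3/4 * N) / (real j)\<^sup>2" by (simp add: add_divide_distrib)
  qed
  \<comment> \<open>This leaves \<open>N / 4 \<le> 3 * \<Delta> + 3/100 * N\<close>, so 20 is a
    comfortable constant.\<close>
  then have "N \<le> B + 3/4 * N" by (rule N(2))
  moreover have "\<kappa> * N \<le> 1/100 * N" using \<kappa> N0 by (intro mult_right_mono) auto
  ultimately show "N \<le> 20 * \<Delta>" using D0 by (simp add: B_def)
qed

section \<open>Nearly circular domains\<close>

lemma antiderivative_exists:
  fixes f :: "real \<Rightarrow> real"
  assumes "continuous_on UNIV f"
  obtains F where "\<And>x. (F has_real_derivative f x) (at x)" "F 0 = 0"
proof -
  \<comment> \<open>The interval \<open>{0..x}\<close> is empty for negative \<open>x\<close>; the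
    second integral then supplies the oriented value.\<close>
  define F where "F = (\<lambda>x. integral {0..x} f - integral {x..0} f)"
  have fc: "continuous_on S f" for S using assms continuous_on_subset by blast
  have "(F has_real_derivative f x) (at x)" for x
  proof -
    define n where "n = \<bar>x\<bar> + 1"
    have x: "x \<in> {-n<..<n}" by (auto simp: n_def)
    let ?G = "\<lambda>x. integral {-n..x} f"
    have "(?G has_real_derivative f x) (at x within {-n..n})" using x by (intro integral_has_real_derivative fc) auto
    then have G: "(?G has_real_derivative f x) (at x)"
      using x by (simp add: at_within_interior[of x "{-n..n}"])
    have eq: "F y = ?G y - ?G 0" if y: "y \<in> {-n<..<n}" for y
    proof (cases "y \<ge> 0")
      case True
      have "integral {-n..0} f + integral {0..y} f = integral {-n..y} f"
        using True y by (intro Henstock_Kurzweil_Integration.integral_combine integrable_continuous_interval fc) auto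
      moreover have "integral {y..0} f = 0" using True by (cases "y = 0") auto
      ultimately show ?thesis by (simp add: F_def)
    next
      case False
      have "integral {-n..y} f + integral {y..0} f = integral {-n..0} f"
        using False y by (intro Henstock_Kurzweil_Integration.integral_combine integrable_continuous_interval fc) auto
      moreover have "integral {0..y} f = 0" using False by simp
      ultimately show ?thesis by (simp add: F_def)
    qed
    have "((\<lambda>y. ?G y - ?G 0) has_real_derivative f x) (at x)" using DERIV_diff[OF G DERIV_const] by simp
    then show ?thesis
      by (rule has_field_derivative_transform_within_open[where S = "{-n<..<n}"]) (use x eq in auto)
  qed
  moreover have "F 0 = 0" by (simp add: F_def)
  ultimately show thesis using that by blast
qed

lemma inverse_of_increasing:
  fixes f f' :: "real \<Rightarrow> real"
  assumes d: "\<And>x. (f has_real_derivative f' x) (at x)" and m: "m > 0" "\<And>x. m \<le> f' x"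
  obtains g where "\<And>x. g (f x) = x" "\<And>y. f (g y) = y" "\<And>y. (g has_real_derivative 1 / f' (g y)) (at y)"
proof -
  have ic: "isCont f x" for x using d by (rule DERIV_isCont)
  have mono: "f x < f y" if "x < y" for x y
    by (rule DERIV_pos_imp_increasing[OF that]) (use d m in \<open>meson less_le_trans\<close>)
  have inj: "inj f" using mono by (metis injI linorder_neqE_linordered_idom less_irrefl)
  have grow: "f y - f x \<ge> m * (y - x)" if "x \<le> y" for x y
  proof (cases "x = y")
    case False
    then have xy: "x < y" using that by simp
    obtain t where "f y - f x = (y - x) * f' t" using MVT2[OF xy] d by blast
    then show ?thesis using mult_left_mono[OF m(2)[of t], of "y - x"] that by (simp add: mult.commute)
  qed simp
  have "surj f"
    unfolding surj_def
  proof
    fix y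
    define b where "b = (\<bar>y - f 0\<bar> + 1) / m"
    have b0: "b > 0" "m * b = \<bar>y - f 0\<bar> + 1" using m(1) by (auto simp: b_def)
    have "f b \<ge> y" "f (- b) \<le> y" using grow[of 0 b] grow[of "- b" 0] b0 by auto
    then have "\<exists>x. - b \<le> x \<and> x \<le> b \<and> f x = y" using b0 ic by (intro IVT) auto
    then show "\<exists>x. y = f x" by metis
  qed
  define g where "g = inv f"
  have gf: "g (f x) = x" for x using inj by (simp add: g_def)
  have fg: "f (g y) = y" for y using \<open>surj f\<close> by (simp add: g_def surj_f_inv_f)
  have gd: "(g has_real_derivative inverse (f' (g y))) (at y)" for y
  proof (rule DERIV_inverse_function[where f = f and a = "y - 1" and b = "y + 1"])
    show "f' (g y) \<noteq> 0" using m by (metis less_irrefl less_le_trans)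
    have "isCont g (f (g y))" by (rule isCont_inverse_function[where d = 1]) (use gf ic in auto)
    then show "isCont g y" by (simp add: fg)
  qed (use d fg in auto)
  show thesis by (rule that[OF gf fg]) (use gd in \<open>simp add: divide_inverse\<close>)
qed

section \<open>Curvature of a nearly circular boundary\<close>

lemma bC_of_chain:
  assumes "\<And>i t. i < k \<Longrightarrow> (D i has_vector_derivative D (Suc i) t) (at t)" "\<And>i t. i \<le> k \<Longrightarrow> norm (D i t) \<le> B" "norm c \<le> 1"
  shows "bC k B (\<lambda>t. D 0 t \<bullet> (c::real^2))"
  using assms(1,2)
proof (induction k arbitrary: D)
  case 0
  have "\<bar>D 0 t \<bullet> c\<bar> \<le> B" for t
    by (rule order_trans[OF Cauchy_Schwarz_ineq2 order_trans[OF mult_left_le[OF assms(3) norm_ge_zero] 0(2)]]) simp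
  then show ?case by simp
next
  case (Suc k)
  show ?case
  proof (rule bC_SucI)
    show "\<bar>D 0 t \<bullet> c\<bar> \<le> B" for t
      by (rule order_trans[OF Cauchy_Schwarz_ineq2 order_trans[OF mult_left_le[OF assms(3) norm_ge_zero] Suc(3)]]) simp
    show "((\<lambda>t. D 0 t \<bullet> c) has_real_derivative D (Suc 0) t \<bullet> c) (at t)" for t
      by (rule vector_derivative_inner_const[OF Suc(2)]) simp
    show "bC k B (\<lambda>t. D (Suc 0) t \<bullet> c)" using Suc(1)[of "\<lambda>i. D (Suc i)"] Suc(2,3) by simp
  qed
qed

lemma bC_trig: "\<exists>K. bC m K (\<lambda>t. cos (2 * pi * t)) \<and> bC m K (\<lambda>t. sin (2 * pi * t))"
proof (induction m)
  case 0 then show ?case by (intro exI[of _ 1]) auto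
next
  case (Suc m)
  then obtain K where K: "bC m K (\<lambda>t. cos (2 * pi * t))" "bC m K (\<lambda>t. sin (2 * pi * t))" by blast
  define L where "L = max 1 (2 * pi * K)"
  have "bC m (\<bar>2 * pi\<bar> * K) (\<lambda>t. (2 * pi) * cos (2 * pi * t))" "bC m (\<bar>- (2 * pi)\<bar> * K) (\<lambda>t. (- (2 * pi)) * sin (2 * pi * t))"
    by (intro bC_cmult K)+
  then have b: "bC m L (\<lambda>t. (2 * pi) * cos (2 * pi * t))" "bC m L (\<lambda>t. (- (2 * pi)) * sin (2 * pi * t))"
    by (auto elim!: bC_mono simp: L_def)
  have "bC (Suc m) L (\<lambda>t. cos (2 * pi * t))"
  proof (rule bC_SucI[OF _ _ b(2)])
    show "\<bar>cos (2 * pi * t)\<bar> \<le> L" for t using abs_cos_le_one[of "2 * pi * t"] by (simp add: L_def le_max_iff_disj)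
    show "((\<lambda>t. cos (2 * pi * t)) has_real_derivative (- (2 * pi)) * sin (2 * pi * t)) (at t)" for t by (auto intro!: derivative_eq_intros)
  qed
  moreover have "bC (Suc m) L (\<lambda>t. sin (2 * pi * t))"
  proof (rule bC_SucI[OF _ _ b(1)])
    show "\<bar>sin (2 * pi * t)\<bar> \<le> L" for t using abs_sin_le_one[of "2 * pi * t"] by (simp add: L_def le_max_iff_disj)
    show "((\<lambda>t. sin (2 * pi * t)) has_real_derivative (2 * pi) * cos (2 * pi * t)) (at t)" for t by (auto intro!: derivative_eq_intros)
  qed
  ultimately show ?case by blast
qed

text \<open>Writing the unit tangent in the frame at \<open>s = 0\<close> as \<open>(p, r)\<close>, the curvature is \<open>p r' - r p'\<close>; closeness to the
  circle means that \<open>p\<close> and \<open>r\<close> are close to the cosine and the sine.\<close>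

lemma curvature_near_circle:
  "\<exists>K>0. \<forall>\<delta> \<alpha> \<beta> \<alpha>' \<beta>'. \<delta> \<le> 1 \<longrightarrow> bC 8 \<delta> \<alpha> \<longrightarrow> bC 8 \<delta> \<beta> \<longrightarrow> (\<forall>t. (\<alpha> has_real_derivative \<alpha>' t) (at t)) \<longrightarrow> (\<forall>t. (\<beta> has_real_derivative \<beta>' t) (at t)) \<longrightarrow>
    bC 7 (K * \<delta>) (\<lambda>t. ((cos (2*pi*t) + \<alpha> t) * (2*pi * cos (2*pi*t) + \<beta>' t) - (sin (2*pi*t) + \<beta> t) * (- (2*pi) * sin (2*pi*t) + \<alpha>' t)) / (2 * pi) - 1)"
proof -
  obtain K where K: "bC 7 K (\<lambda>t. cos (2 * pi * t))" "bC 7 K (\<lambda>t. sin (2 * pi * t))" using bC_trig by blast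
  have K0: "K \<ge> 0" using bC_nonneg[OF K(1)] .
  define L where "L = 2 ^ 7 * K + 2 * pi * (2 ^ 7 * K) + 2 ^ 7 + 2 ^ 7 * K + 2 * pi * (2 ^ 7 * K) + 2 ^ 7"
  have L0: "L > 0" unfolding L_def using K0 by (intro add_nonneg_pos add_nonneg_nonneg) auto
  have "bC 7 (L * \<delta>) (\<lambda>t. ((cos (2*pi*t) + \<alpha> t) * (2*pi * cos (2*pi*t) + \<beta>' t) - (sin (2*pi*t) + \<beta> t) * (- (2*pi) * sin (2*pi*t) + \<alpha>' t)) / (2 * pi) - 1)"
    if \<delta>: "\<delta> \<le> 1" and a: "bC 8 \<delta> \<alpha>" and b: "bC 8 \<delta> \<beta>" and a': "\<forall>t. (\<alpha> has_real_derivative \<alpha>' t) (at t)" and b': "\<forall>t. (\<beta> has_real_derivative \<beta>' t) (at t)" for \<delta> \<alpha> \<beta> \<alpha>' \<beta>'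
  proof -
    have d0: "\<delta> \<ge> 0" using bC_nonneg[OF a] .
    have S: "(8::nat) = Suc 7" by simp
    have a7: "bC 7 \<delta> \<alpha>" "bC 7 \<delta> \<beta>" using a b unfolding S by (blast intro: bC_Suc_imp)+
    have a7': "bC 7 \<delta> \<alpha>'" "bC 7 \<delta> \<beta>'" using bC_deriv[OF a[unfolded S]] bC_deriv[OF b[unfolded S]] a' b' by blast+
    let ?c = "\<lambda>t. cos (2*pi*t)" and ?s = "\<lambda>t. sin (2*pi*t)"
    have 1: "bC 7 (2 ^ 7 * K * \<delta>) (\<lambda>t. ?c t * \<beta>' t)" by (intro bC_mult K a7')
    have 2: "bC 7 (\<bar>2 * pi\<bar> * (2 ^ 7 * K * \<delta>)) (\<lambda>t. 2 * pi * (?c t * \<alpha> t))" by (intro bC_cmult bC_mult K a7)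
    have 3: "bC 7 (2 ^ 7 * \<delta> * \<delta>) (\<lambda>t. \<alpha> t * \<beta>' t)" by (intro bC_mult a7 a7')
    have 4: "bC 7 (2 ^ 7 * K * \<delta>) (\<lambda>t. ?s t * \<alpha>' t)" by (intro bC_mult K a7')
    have 5: "bC 7 (\<bar>2 * pi\<bar> * (2 ^ 7 * K * \<delta>)) (\<lambda>t. 2 * pi * (?s t * \<beta> t))" by (intro bC_cmult bC_mult K a7)
    have 6: "bC 7 (2 ^ 7 * \<delta> * \<delta>) (\<lambda>t. \<beta> t * \<alpha>' t)" by (intro bC_mult a7 a7')
    have dd: "\<delta> * \<delta> \<le> \<delta>" using \<delta> d0 by (simp add: mult_left_le)
    let ?B = "2 ^ 7 * K * \<delta> + \<bar>2 * pi\<bar> * (2 ^ 7 * K * \<delta>) + 2 ^ 7 * \<delta> * \<delta> + 2 ^ 7 * K * \<delta> + \<bar>2 * pi\<bar> * (2 ^ 7 * K * \<delta>) + 2 ^ 7 * \<delta> * \<delta>"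
    have "bC 7 ?B (\<lambda>t. ?c t * \<beta>' t + 2 * pi * (?c t * \<alpha> t) + \<alpha> t * \<beta>' t - ?s t * \<alpha>' t + 2 * pi * (?s t * \<beta> t) - \<beta> t * \<alpha>' t)"
      by (intro bC_add bC_diff 1 2 3 4 5 6)
    from bC_cmult[OF this, of "1 / (2 * pi)"]
    have b: "bC 7 (\<bar>1 / (2 * pi)\<bar> * ?B) (\<lambda>t. 1 / (2 * pi) * (?c t * \<beta>' t + 2 * pi * (?c t * \<alpha> t) + \<alpha> t * \<beta>' t - ?s t * \<alpha>' t + 2 * pi * (?s t * \<beta> t) - \<beta> t * \<alpha>' t))" .
    have B0: "?B \<ge> 0" using K0 d0 by (intro add_nonneg_nonneg mult_nonneg_nonneg) auto
    have "\<bar>1 / (2 * pi)\<bar> * ?B \<le> 1 * ?B" using B0 pi_gt3 by (intro mult_right_mono) auto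
    also have "\<dots> \<le> L * \<delta>" using dd by (simp add: L_def algebra_simps)
    finally have le: "\<bar>1 / (2 * pi)\<bar> * ?B \<le> L * \<delta>" .
    \<comment> \<open>The terms free of the perturbation combine to \<open>2 * pi\<close> and cancel
      the 1; every other term is linear or quadratic in the perturbation.\<close>
    have eq: "1 / (2 * pi) * (?c t * \<beta>' t + 2 * pi * (?c t * \<alpha> t) + \<alpha> t * \<beta>' t - ?s t * \<alpha>' t + 2 * pi * (?s t * \<beta> t) - \<beta> t * \<alpha>' t) =
      ((?c t + \<alpha> t) * (2*pi * ?c t + \<beta>' t) - (?s t + \<beta> t) * (- (2*pi) * ?s t + \<alpha>' t)) / (2 * pi) - 1" for t
    proof -
      have gen: "1 / P * (c * y + P * (c * a) + a * y - s * x + P * (s * b) - b * x) = ((c + a) * (P * c + y) - (s + b) * (- P * s + x)) / P - 1"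
        if "P \<noteq> 0" "s * s + c * c = 1" for P c s a b x y :: real
      proof -
        have "(c + a) * (P * c + y) - (s + b) * (- P * s + x) = P * (s * s + c * c) + (c * y + P * (c * a) + a * y - s * x + P * (s * b) - b * x)"
          by (simp add: algebra_simps)
        then show ?thesis using that by (simp add: add_divide_distrib)
      qed
      show ?thesis by (rule gen) (use sin_cos_squared_add[of "2 * pi * t"] in \<open>auto simp: power2_eq_square\<close>)
    qed
    show ?thesis using bC_mono[OF b le] unfolding eq .
  qed
  then show ?thesis using L0 by blast
qed

text \<open>The inner product of \<open>(p, r)\<close> with \<open>(cos \<psi>, sin \<psi>)\<close>
  is constant, because both unit vectors turn at the same rate. It is 1 at 0, and two unit vectors
  with inner product 1 are equal.\<close>

lemma unit_speed_angle:
  fixes p r p' r' \<psi> :: "real \<Rightarrow> real"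
  assumes pd: "\<And>t. (p has_real_derivative p' t) (at t)" and rd: "\<And>t. (r has_real_derivative r' t) (at t)"
    and one: "\<And>t. p t * p t + r t * r t = 1" and \<psi>: "\<And>t. (\<psi> has_real_derivative p t * r' t - r t * p' t) (at t)"
    and init: "\<psi> 0 = 0" "p 0 = 1" "r 0 = 0"
  shows "p t = cos (\<psi> t)" "r t = sin (\<psi> t)"
proof -
  have z: "p t * p' t + r t * r' t = 0" for t
  proof -
    have "((\<lambda>t. p t * p t + r t * r t) has_real_derivative 2 * (p t * p' t + r t * r' t)) (at t)"
      by (auto intro!: derivative_eq_intros pd rd simp: algebra_simps)
    moreover have "((\<lambda>t. p t * p t + r t * r t) has_real_derivative 0) (at t)" unfolding one by simp
    ultimately show ?thesis using DERIV_unique by fastforce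
  qed
  have p': "p' t = - (p t * r' t - r t * p' t) * r t" and r': "r' t = (p t * r' t - r t * p' t) * p t" for t
    using z[of t] one[of t] by algebra+
  define F where "F = (\<lambda>t. p t * cos (\<psi> t) + r t * sin (\<psi> t))"
  have "(F has_real_derivative 0) (at t)" for t
  proof -
    have "(F has_real_derivative p' t * cos (\<psi> t) - p t * (sin (\<psi> t) * (p t * r' t - r t * p' t)) + (r' t * sin (\<psi> t) + r t * (cos (\<psi> t) * (p t * r' t - r t * p' t)))) (at t)"
      unfolding F_def by (auto intro!: derivative_eq_intros pd rd \<psi> simp: algebra_simps)
    moreover have "p' t * cos (\<psi> t) - p t * (sin (\<psi> t) * (p t * r' t - r t * p' t)) + (r' t * sin (\<psi> t) + r t * (cos (\<psi> t) * (p t * r' t - r t * p' t))) = 0"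
      using p'[of t] r'[of t] by algebra
    ultimately show ?thesis by simp
  qed
  then have "F t = F 0" using DERIV_isconst_all by blast
  then have F: "p t * cos (\<psi> t) + r t * sin (\<psi> t) = 1" using init by (simp add: F_def)
  have "(p t - cos (\<psi> t))\<^sup>2 + (r t - sin (\<psi> t))\<^sup>2 = 0"
    using F one[of t] sin_cos_squared_add[of "\<psi> t"] by algebra
  then show "p t = cos (\<psi> t)" "r t = sin (\<psi> t)" by (simp_all add: sum_power2_eq_zero_iff)
qed

lemma rot90_frame:
  assumes "norm T = 1"
  shows "T \<bullet> T = 1" "rot90 T \<bullet> rot90 T = 1" "T \<bullet> rot90 T = 0" "rot90 T \<bullet> T = 0" "norm (rot90 T) = 1"
    "x = (x \<bullet> T) *\<^sub>R T + (x \<bullet> rot90 T) *\<^sub>R rot90 T" "x \<bullet> x = (x \<bullet> T) * (x \<bullet> T) + (x \<bullet> rot90 T) * (x \<bullet> rot90 T)"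
proof -
  show TT: "T \<bullet> T = 1" using assms by (simp add: norm_eq_1)
  have r: "rot90 T $ 1 = - (T $ 2)" "rot90 T $ 2 = T $ 1" by (simp_all add: rot90_def)
  show rr: "rot90 T \<bullet> rot90 T = 1" "T \<bullet> rot90 T = 0" "rot90 T \<bullet> T = 0" using TT by (simp_all add: inner_vec2 r)
  then show "norm (rot90 T) = 1" by (simp add: norm_eq_1)
  have T1: "T$1 * T$1 + T$2 * T$2 = 1" using TT by (simp add: inner_vec2)
  show e: "x = (x \<bullet> T) *\<^sub>R T + (x \<bullet> rot90 T) *\<^sub>R rot90 T"
    unfolding vec2_eq_iff inner_vec2 vector_add_component vector_scaleR_component r real_scaleR_def
    using T1 by (intro conjI; algebra)
  show "x \<bullet> x = (x \<bullet> T) * (x \<bullet> T) + (x \<bullet> rot90 T) * (x \<bullet> rot90 T)"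
    unfolding inner_vec2 r using T1 by algebra
qed

lemma periodic_range:
  fixes f :: "real \<Rightarrow> 'a"
  assumes "\<And>t. f (t + 1) = f t"
  shows "range f = f ` {0..<1}"
proof -
  have "f t \<in> f ` {0..<1}" for t
  proof -
    define h where "h = (\<lambda>t. f (t / (2 * pi)))"
    have "h (t + 2 * pi) = h t" for t using assms[of "t / (2 * pi)"] by (simp add: h_def add_divide_distrib)
    from periodic_int[of h "2 * pi * frac t" "\<lfloor>t\<rfloor>", OF this]
    have "f t = f (frac t)" by (simp add: h_def add_divide_distrib frac_def)
    moreover have "frac t \<in> {0..<1}" by (simp add: frac_ge_0 frac_lt_1)
    ultimately show ?thesis by blast
  qed
  then show ?thesis by blast
qed

text \<open>The tangent angle is the integral \<open>\<psi>\<close> of the curvature, and its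
  inverse \<open>s\<close> satisfies \<open>s' = 1 / \<kappa> (s)\<close>, the autonomous form in
  which \<open>bC_reparam\<close> applies to the radius of curvature. Two derivatives are lost from
  \<open>\<gamma>\<close> to its curvature, which is why 9 becomes 7.\<close>

lemma near_circle_angle_param:
  "\<exists>C>0. \<exists>\<delta>0>0. \<forall>\<delta> \<gamma>. \<delta> \<le> \<delta>0 \<longrightarrow> (\<forall>s. \<gamma> (s + 1) = \<gamma> s) \<longrightarrow> (\<forall>s. norm (vector_derivative \<gamma> (at s)) = 1) \<longrightarrow>
     Ck_dist_le 9 \<gamma> (circle_param (\<gamma> 0) (vector_derivative \<gamma> (at 0))) \<delta> \<longrightarrow>
     (\<exists>\<zeta> R. (\<forall>t. (\<zeta> has_vector_derivative R t *\<^sub>R (cos t *\<^sub>R vector_derivative \<gamma> (at 0) + sin t *\<^sub>R rot90 (vector_derivative \<gamma> (at 0)))) (at t)) \<and>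
        range \<zeta> = range \<gamma> \<and> (\<forall>t. \<zeta> (t + 2 * pi) = \<zeta> t) \<and> (\<forall>t. R (t + 2 * pi) = R t) \<and> (\<forall>t. R t > 0) \<and> bC 7 (C * \<delta>) (\<lambda>t. 2 * pi * R t - 1))"
proof -
  obtain K where K0: "K > 0" and K: "\<And>\<delta> \<alpha> \<beta> \<alpha>' \<beta>'. \<delta> \<le> 1 \<Longrightarrow> bC 8 \<delta> \<alpha> \<Longrightarrow> bC 8 \<delta> \<beta> \<Longrightarrow> (\<And>t. (\<alpha> has_real_derivative \<alpha>' t) (at t)) \<Longrightarrow> (\<And>t. (\<beta> has_real_derivative \<beta>' t) (at t)) \<Longrightarrow>
    bC 7 (K * \<delta>) (\<lambda>t. ((cos (2*pi*t) + \<alpha> t) * (2*pi * cos (2*pi*t) + \<beta>' t) - (sin (2*pi*t) + \<beta> t) * (- (2*pi) * sin (2*pi*t) + \<alpha>' t)) / (2 * pi) - 1)"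
    using curvature_near_circle by blast
  obtain C1 where C1: "C1 \<ge> 0" "\<And>f \<epsilon>. \<epsilon> \<le> 1/2 \<Longrightarrow> bC 7 \<epsilon> (\<lambda>x. f x - 1) \<Longrightarrow> bC 7 (C1 * \<epsilon>) (\<lambda>x. f x powr (-1) - 1)"
    using bC_powr[of 7 "-1"] by blast
  obtain C2 where C2: "C2 \<ge> 0" "\<And>f g s B. bC 7 B f \<Longrightarrow> bC 7 2 g \<Longrightarrow> (\<And>x. (s has_real_derivative g (s x)) (at x)) \<Longrightarrow> bC 7 (C2 * B) (\<lambda>x. f (s x))"
    using bC_reparam[of 7] by blast
  \<comment> \<open>Makes \<open>\<delta> \<le> 1\<close>, \<open>K * \<delta> \<le> 1/4\<close> and
    \<open>C1 * (K * \<delta>) \<le> 1\<close> hold together.\<close>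
  define \<delta>0 where "\<delta>0 = 1 / (1 + 4 * K + C1 * K)"
  have den: "1 + 4 * K + C1 * K > 0" using K0 C1(1) by (simp add: add_pos_nonneg)
  define C where "C = C2 * (C1 * K) + 1"
  have C0: "C > 0" unfolding C_def using C2(1) C1(1) K0 by (intro add_nonneg_pos mult_nonneg_nonneg) auto
  have main: "\<exists>\<zeta> R. (\<forall>t. (\<zeta> has_vector_derivative R t *\<^sub>R (cos t *\<^sub>R T + sin t *\<^sub>R rot90 T)) (at t)) \<and>
        range \<zeta> = range \<gamma> \<and> (\<forall>t. \<zeta> (t + 2 * pi) = \<zeta> t) \<and> (\<forall>t. R (t + 2 * pi) = R t) \<and> (\<forall>t. R t > 0) \<and> bC 7 (C * \<delta>) (\<lambda>t. 2 * pi * R t - 1)"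
    if \<delta>: "\<delta> \<le> \<delta>0" and per: "\<And>s. \<gamma> (s + 1) = \<gamma> s" and unit: "\<And>s. norm (vector_derivative \<gamma> (at s)) = 1"
      and T_def: "T = vector_derivative \<gamma> (at 0)" and near: "Ck_dist_le 9 \<gamma> (circle_param (\<gamma> 0) T) \<delta>" for \<delta> \<gamma> T
  proof -
    obtain D E where DE0: "D 0 = \<gamma>" "E 0 = circle_param (\<gamma> 0) T"
      and D: "\<And>i t. i < 9 \<Longrightarrow> (D i has_vector_derivative D (Suc i) t) (at t)"
      and E: "\<And>i t. i < 9 \<Longrightarrow> (E i has_vector_derivative E (Suc i) t) (at t)"
      and le: "\<And>i t. i \<le> 9 \<Longrightarrow> norm (D i t - E i t) \<le> \<delta>"
      using near unfolding Ck_dist_le_def by blast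
    have d0: "\<delta> \<ge> 0" using le[of 0 0] norm_ge_zero order_trans by blast
    have "\<delta> * (1 + 4 * K + C1 * K) \<le> 1" using \<delta> den unfolding \<delta>0_def by (simp add: pos_le_divide_eq)
    then have sm: "\<delta> + 4 * (K * \<delta>) + C1 * (K * \<delta>) \<le> 1" by (simp add: algebra_simps)
    have nn: "K * \<delta> \<ge> 0" "C1 * (K * \<delta>) \<ge> 0" using K0 C1(1) d0 by auto
    have d1: "\<delta> \<le> 1" and Kd: "K * \<delta> \<le> 1/4" and CKd: "C1 * (K * \<delta>) \<le> 1" using sm nn d0 by linarith+
    have \<gamma>D: "(\<gamma> has_vector_derivative D 1 t) (at t)" for t using D[of 0 t] DE0 by simp
    then have vd: "vector_derivative \<gamma> (at t) = D 1 t" for t by (rule vector_derivative_at)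
    have T: "T = D 1 0" using T_def vd by simp
    have nT: "norm T = 1" using unit T_def by simp
    note fr = rot90_frame[OF nT]
    have E1: "E 1 t = cos (2*pi*t) *\<^sub>R T + sin (2*pi*t) *\<^sub>R rot90 T" for t
    proof -
      have "(circle_param (\<gamma> 0) T has_vector_derivative (1 / (2*pi)) *\<^sub>R ((2*pi * cos (2*pi*t)) *\<^sub>R T + (2 * pi * sin (2*pi*t)) *\<^sub>R rot90 T)) (at t)"
        unfolding circle_param_def[abs_def]
        by (auto intro!: derivative_eq_intros simp: has_real_derivative_iff_has_vector_derivative[symmetric] mult.commute)
      moreover have "(circle_param (\<gamma> 0) T has_vector_derivative E 1 t) (at t)" using E[of 0 t] DE0 by simp
      ultimately have "E 1 t = (1 / (2*pi)) *\<^sub>R ((2*pi * cos (2*pi*t)) *\<^sub>R T + (2 * pi * sin (2*pi*t)) *\<^sub>R rot90 T)"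
        by (metis vector_derivative_unique_at)
      then show ?thesis by (simp add: scaleR_add_right)
    qed
    define p where "p = (\<lambda>t. D 1 t \<bullet> T)"
    define r where "r = (\<lambda>t. D 1 t \<bullet> rot90 T)"
    define p' where "p' = (\<lambda>t. D 2 t \<bullet> T)"
    define r' where "r' = (\<lambda>t. D 2 t \<bullet> rot90 T)"
    have D1: "(D 1 has_vector_derivative D 2 t) (at t)" for t using D[of 1 t] by (simp add: numeral_2_eq_2)
    have pd: "(p has_real_derivative p' t) (at t)" for t unfolding p_def p'_def by (rule vector_derivative_inner_const[OF D1])
    have rd: "(r has_real_derivative r' t) (at t)" for t unfolding r_def r'_def by (rule vector_derivative_inner_const[OF D1])
    have one: "p t * p t + r t * r t = 1" for t
      using fr(7)[of "D 1 t"] unit[of t] vd[of t] unfolding p_def r_def by (simp add: norm_eq_1)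
    have ch: "bC 8 \<delta> (\<lambda>t. (D 1 t - E 1 t) \<bullet> c)" if "norm c \<le> 1" for c
    proof -
      have "bC 8 \<delta> (\<lambda>t. (\<lambda>i t. D (Suc i) t - E (Suc i) t) 0 t \<bullet> c)"
        using that D E le by (intro bC_of_chain) (auto intro!: has_vector_derivative_diff)
      then show ?thesis by simp
    qed
    have ba: "bC 8 \<delta> (\<lambda>t. p t - cos (2*pi*t))" using ch[of T] nT by (simp add: E1 p_def inner_diff_left inner_add_left fr(1-4) del: One_nat_def)
    have bb: "bC 8 \<delta> (\<lambda>t. r t - sin (2*pi*t))" using ch[of "rot90 T"] fr(5) by (simp add: E1 r_def inner_diff_left inner_add_left fr(1-4) del: One_nat_def)
    have ad: "((\<lambda>t. p t - cos (2*pi*t)) has_real_derivative p' t + 2 * pi * sin (2*pi*t)) (at t)" for t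
      by (auto intro!: derivative_eq_intros pd)
    have bd: "((\<lambda>t. r t - sin (2*pi*t)) has_real_derivative r' t - 2 * pi * cos (2*pi*t)) (at t)" for t
      by (auto intro!: derivative_eq_intros rd)
    define \<kappa> where "\<kappa> = (\<lambda>t. p t * r' t - r t * p' t)"
    have b\<kappa>: "bC 7 (K * \<delta>) (\<lambda>t. \<kappa> t / (2 * pi) - 1)"
      using K[OF d1 ba bb ad bd] by (simp add: \<kappa>_def)
    have \<kappa>b: "\<bar>\<kappa> t / (2*pi) - 1\<bar> \<le> 1/4" for t using bC_abs[OF b\<kappa>, of t] Kd by linarith
    have \<kappa>lo: "3/2 * pi \<le> \<kappa> t" and \<kappa>hi: "\<kappa> t \<le> 5/2 * pi" for t
    proof -
      have "3/4 \<le> \<kappa> t / (2*pi)" "\<kappa> t / (2*pi) \<le> 5/4" using \<kappa>b[of t] by linarith+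
      then show "3/2 * pi \<le> \<kappa> t" "\<kappa> t \<le> 5/2 * pi" by (simp_all add: field_simps)
    qed
    have \<kappa>pos: "\<kappa> t > 0" for t using \<kappa>lo[of t] pi_gt_zero by linarith
    have \<kappa>c: "continuous_on UNIV \<kappa>"
    proof -
      have S: "(7::nat) = Suc 6" by simp
      obtain f' where "\<And>x. ((\<lambda>t. \<kappa> t / (2 * pi) - 1) has_real_derivative f' x) (at x)" using bC_SucE[OF b\<kappa>[unfolded S]] by blast
      then have "continuous_on UNIV (\<lambda>t. \<kappa> t / (2 * pi) - 1)" by (intro DERIV_continuous_on) (auto intro: DERIV_subset)
      then have "continuous_on UNIV (\<lambda>t. ((\<kappa> t / (2 * pi) - 1) + 1) * (2 * pi))" by (intro continuous_on_mult continuous_on_add continuous_on_const)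
      then show ?thesis by simp
    qed
    obtain \<psi> where \<psi>: "\<And>x. (\<psi> has_real_derivative \<kappa> x) (at x)" "\<psi> 0 = 0" using antiderivative_exists[OF \<kappa>c] by blast
    have init: "p 0 = 1" "r 0 = 0" by (simp_all add: p_def r_def T[symmetric] fr(1-4) del: One_nat_def)
    have cs: "p t = cos (\<psi> t)" "r t = sin (\<psi> t)" for t
      using unit_speed_angle[OF pd rd one \<psi>(1)[unfolded \<kappa>_def] \<psi>(2) init] by auto
    have perD: "D 1 (t + 1) = D 1 t" for t
    proof -
      have "((\<lambda>s. \<gamma> (s + 1)) has_vector_derivative 1 *\<^sub>R D 1 (t + 1)) (at t)"
        using vector_diff_chain_at[of "\<lambda>s. s + 1" 1 t \<gamma> "D 1 (t + 1)"] \<gamma>D[of "t + 1"]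
        by (simp add: o_def has_vector_derivative_add_const has_vector_derivative_id)
      then show ?thesis using \<gamma>D[of t] unfolding per by (metis scaleR_one vector_derivative_unique_at)
    qed
    have perp: "p (t + 1) = p t" "r (t + 1) = r t" for t by (simp_all add: p_def r_def perD del: One_nat_def)
    have "p' (t + 1) = p' t" "r' (t + 1) = r' t" for t
      using periodic_deriv[OF pd perp(1)] periodic_deriv[OF rd perp(2)] by auto
    then have per\<kappa>: "\<kappa> (t + 1) = \<kappa> t" for t by (simp add: \<kappa>_def perp)
    \<comment> \<open>The total turning is a multiple of a full turn, because the tangent is
      periodic; the curvature is within a quarter of \<open>2 * pi\<close>, which leaves exactly one
      turn.\<close>
    have shift: "\<psi> (t + 1) = \<psi> t + 2 * pi" for t
    proof -
      have "((\<lambda>t. \<psi> (t + 1) - \<psi> t) has_real_derivative 0) (at t)" for t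
      proof -
        have "((\<lambda>t. \<psi> (t + 1)) has_real_derivative \<kappa> (t + 1)) (at t)" using \<psi>(1)[of "t + 1"] by (simp add: DERIV_shift)
        from DERIV_diff[OF this \<psi>(1)[of t]] show ?thesis by (simp add: per\<kappa>)
      qed
      then have c: "\<psi> (t + 1) - \<psi> t = \<psi> (0 + 1) - \<psi> 0" using DERIV_isconst_all[of "\<lambda>t. \<psi> (t + 1) - \<psi> t" t 0] by blast
      obtain \<xi> where "\<psi> 1 - \<psi> 0 = (1 - 0) * \<kappa> \<xi>" using MVT2[of 0 1 \<psi> \<kappa>] \<psi>(1) by auto
      then have rng: "3/2 * pi \<le> \<psi> 1" "\<psi> 1 \<le> 5/2 * pi" using \<kappa>lo[of \<xi>] \<kappa>hi[of \<xi>] \<psi>(2) by auto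
      have "cos (\<psi> 1) = 1" using cs(1)[of 1] perp(1)[of 0] init by simp
      then obtain n :: int where n: "\<psi> 1 = real_of_int n * 2 * pi" using cos_one_2pi_int by auto
      have "3/4 \<le> real_of_int n" "real_of_int n \<le> 5/4" using rng pi_gt_zero unfolding n by (simp_all add: field_simps)
      then have "n = 1" by linarith
      then show ?thesis using c n \<psi>(2) by simp
    qed
    obtain s where s: "\<And>x. s (\<psi> x) = x" "\<And>y. \<psi> (s y) = y" "\<And>y. (s has_real_derivative 1 / \<kappa> (s y)) (at y)"
      using inverse_of_increasing[OF \<psi>(1), of "3/2 * pi"] \<kappa>lo by auto
    have sshift: "s (t + 2 * pi) = s t + 1" for t by (metis s(1,2) shift)
    define R where "R = (\<lambda>t. 1 / \<kappa> (s t))"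
    define \<zeta> where "\<zeta> = (\<lambda>t. \<gamma> (s t))"
    have "(\<zeta> has_vector_derivative R t *\<^sub>R (cos t *\<^sub>R T + sin t *\<^sub>R rot90 T)) (at t)" for t
    proof -
      have "D 1 (s t) = cos t *\<^sub>R T + sin t *\<^sub>R rot90 T"
        using fr(6)[of "D 1 (s t)"] cs[of "s t"] s(2)[of t] by (simp add: p_def r_def)
      then show ?thesis
        using vector_diff_chain_at[OF s(3)[unfolded has_real_derivative_iff_has_vector_derivative] \<gamma>D, of t]
        by (simp add: \<zeta>_def o_def R_def)
    qed
    moreover have "range \<zeta> = range \<gamma>"
    proof -
      have "\<gamma> x \<in> range \<zeta>" for x using s(1)[of x] unfolding \<zeta>_def by (metis rangeI)
      then show ?thesis by (auto simp: \<zeta>_def)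
    qed
    moreover have "\<forall>t. \<zeta> (t + 2 * pi) = \<zeta> t" by (simp add: \<zeta>_def sshift per)
    moreover have "\<forall>t. R (t + 2 * pi) = R t" by (simp add: R_def sshift per\<kappa>)
    moreover have "\<forall>t. R t > 0" by (simp add: R_def \<kappa>pos)
    moreover have "bC 7 (C * \<delta>) (\<lambda>t. 2 * pi * R t - 1)"
    proof -
      have "bC 7 (C1 * (K * \<delta>)) (\<lambda>x. (\<kappa> x / (2*pi)) powr (-1) - 1)" using C1(2)[OF _ b\<kappa>] Kd by simp
      moreover have "(\<kappa> x / (2*pi)) powr (-1) = 2 * pi * (1 / \<kappa> x)" for x
        using \<kappa>pos[of x] by (simp add: powr_neg_one)
      ultimately have b1: "bC 7 (C1 * (K * \<delta>)) (\<lambda>x. 2 * pi * (1 / \<kappa> x) - 1)" by simp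
      have "bC 7 (\<bar>1 / (2*pi)\<bar> * (C1 * (K * \<delta>) + \<bar>1\<bar>)) (\<lambda>x. 1 / (2*pi) * ((2 * pi * (1 / \<kappa> x) - 1) + 1))"
        by (intro bC_cmult bC_add b1 bC_const)
      moreover have "\<bar>1 / (2*pi)\<bar> * (C1 * (K * \<delta>) + \<bar>1\<bar>) \<le> 2"
      proof -
        have "\<bar>1 / (2*pi)\<bar> * (C1 * (K * \<delta>) + \<bar>1\<bar>) \<le> 1 * 2" using CKd nn pi_gt3 by (intro mult_mono) auto
        then show ?thesis by simp
      qed
      ultimately have "bC 7 2 (\<lambda>x. 1 / (2*pi) * ((2 * pi * (1 / \<kappa> x) - 1) + 1))" by (rule bC_mono)
      then have b2: "bC 7 2 (\<lambda>x. 1 / \<kappa> x)" by simp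
      have "bC 7 (C2 * (C1 * (K * \<delta>))) (\<lambda>x. 2 * pi * (1 / \<kappa> (s x)) - 1)" using C2(2)[OF b1 b2] s(3) by simp
      moreover have "C2 * (C1 * (K * \<delta>)) \<le> C * \<delta>" using d0 by (simp add: C_def algebra_simps)
      ultimately have "bC 7 (C * \<delta>) (\<lambda>x. 2 * pi * (1 / \<kappa> (s x)) - 1)" by (rule bC_mono)
      then show ?thesis by (simp add: R_def)
    qed
    ultimately show ?thesis by blast
  qed
  show ?thesis
    using C0 main den by (intro exI[of _ C] conjI exI[of _ \<delta>0] allI impI) (auto simp: \<delta>0_def)
qed

text \<open>The boundary point with outward normal \<open>Nv t\<close> is the unique maximiser of
  the component along \<open>Nv t\<close>. This characterises \<open>z t\<close> by the point set
  alone, with no reference to a parametrisation.\<close>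

lemma (in curve) normal_max:
  assumes "y \<in> range z" "y \<noteq> z t"
  shows "y \<bullet> Nv t < z t \<bullet> Nv t"
proof -
  obtain b where b: "y = z b" using assms(1) by blast
  define n where "n = \<lfloor>(b - t) / (2 * pi)\<rfloor>"
  define g where "g = b - t - real_of_int n * (2 * pi)"
  have "real_of_int n \<le> (b - t) / (2 * pi)" "(b - t) / (2 * pi) < real_of_int n + 1" unfolding n_def by linarith+
  then have g: "0 \<le> g" "g < 2 * pi" unfolding g_def by (simp_all add: field_simps)
  have "z (t + g + 2 * pi * of_int n) = z (t + g)" by (rule periodic_int[of z, OF z_per])
  moreover have "t + g + 2 * pi * of_int n = b" by (simp add: g_def)
  ultimately have y: "y = z (t + g)" using b by simp
  then have "g \<noteq> 0" using assms(2) by auto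
  then have "(z (t + g) - z t) \<bullet> Nv t < 0" using g by (intro chord_normal_neg) auto
  then show ?thesis by (simp add: y inner_diff_left)
qed

section \<open>From symmetric domains to symmetric curves\<close>

lemma frontier_linear_image:
  fixes f :: "real^2 \<Rightarrow> real^2"
  assumes "linear f" "inj f"
  shows "frontier (f ` S) = f ` frontier S"
  unfolding frontier_def using assms
  by (simp add: closure_injective_linear_image interior_injective_linear_image image_set_diff)

text \<open>A reflection maps maximisers in the direction \<open>Nv t\<close> to maximisers in the
  direction \<open>Nv (- t)\<close>, so uniqueness transfers the symmetry of the set to the
  parametrisation.\<close>

lemma sym_curve_of_normalized:
  assumes "curve z \<rho>" "range z = frontier \<Omega>" "normalized \<Omega> m a"
  shows "sym_curve z \<rho>"
proof -
  interpret curve z \<rho> by fact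
  have m: "m = 0" and a: "a$2 = 0" "a$1 > 0" and ax: "symmetry_axis_points \<Omega> m a" using assms(3) by (auto simp: normalized_def)
  have na: "norm a = a$1" using a by (simp add: norm_eq_sqrt_inner inner_vec2)
  have lr: "line_reflection m (rot90 ((1 / norm (a - m)) *\<^sub>R (a - m))) = Rf"
    by (rule ext) (use a in \<open>simp add: m na line_reflection_def vec2_eq_iff rot90_def inner_vec2\<close>)
  have "Rf ` \<Omega> = \<Omega>" using ax lr by (simp add: symmetry_axis_points_def)
  moreover have "linear Rf" by (rule linearI) (simp_all add: vec2_eq_iff)
  moreover have "inj Rf" by (rule injI) (metis Rf_simps(3))
  ultimately have Rr: "Rf ` range z = range z" using frontier_linear_image[of Rf \<Omega>] assms(2) by simp
  then have Rz: "Rf (z t) \<in> range z" for t by blast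
  have adj: "Rf x \<bullet> y = x \<bullet> Rf y" for x y by (simp add: inner_vec2)
  have sym: "z (- t) = Rf (z t)" for t
  proof (rule ccontr)
    assume "z (- t) \<noteq> Rf (z t)"
    then have "Rf (z t) \<bullet> Nv (- t) < z (- t) \<bullet> Nv (- t)" using normal_max[OF Rz] by metis
    then have lt: "z t \<bullet> Nv t < Rf (z (- t)) \<bullet> Nv t" using Rf_Nv[of t] by (metis adj Rf_simps(3))
    moreover have "Rf (z (- t)) \<noteq> z t" using lt by auto
    ultimately show False using normal_max[OF Rz, of "- t" t] by simp
  qed
  \<comment> \<open>By symmetry \<open>z 0\<close> lies on the axis, so it is one of the two axis
    points; it is the leftmost boundary point, which excludes the auxiliary point on the positive
    side.\<close>
  have z0: "z 0 = 0"
  proof -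
    have z2: "z 0 $ 2 = 0" using sym[of 0] by (simp add: vec2_eq_iff)
    have "z 0 = m + (z 0 $ 1 / a $ 1) *\<^sub>R (a - m)" using z2 a by (simp add: m vec2_eq_iff)
    then have "z 0 \<in> frontier \<Omega> \<inter> {m + t *\<^sub>R (a - m) | t. True}" using assms(2) by blast
    then have c: "z 0 = 0 \<or> z 0 = a" using ax m by (auto simp: symmetry_axis_points_def)
    have "m \<in> frontier \<Omega>" using ax unfolding symmetry_axis_points_def by blast
    then have "0 \<in> range z" using m assms(2) by simp
    then have "z 0 \<noteq> a" using normal_max[of 0 0] a by (force simp: inner_vec2)
    with c show ?thesis by blast
  qed
  \<comment> \<open>The component of \<open>z (- s)\<close> along \<open>Tv (- t)\<close> is
    differentiated in two ways, by the chain rule and through the symmetry.\<close>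
  have \<rho>s: "\<rho> (- t) = \<rho> t" for t
  proof -
    have "((\<lambda>s. z s \<bullet> Tv (- t)) has_real_derivative (\<rho> (- t) *\<^sub>R Tv (- t)) \<bullet> Tv (- t)) (at (- t))"
      by (rule vector_derivative_inner_const[OF z_deriv])
    then have "((\<lambda>s. z (- s) \<bullet> Tv (- t)) has_real_derivative - \<rho> (- t)) (at t)"
      by (simp add: DERIV_mirror inner_Tv_Tv)
    moreover have "((\<lambda>s. z s \<bullet> Rf (Tv (- t))) has_real_derivative (\<rho> t *\<^sub>R Tv t) \<bullet> Rf (Tv (- t))) (at t)"
      by (rule vector_derivative_inner_const[OF z_deriv])
    then have "((\<lambda>s. z (- s) \<bullet> Tv (- t)) has_real_derivative - \<rho> t) (at t)"
      by (simp add: sym adj Rf_Tv inner_Tv_Tv)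
    ultimately show ?thesis using DERIV_unique by fastforce
  qed
  show ?thesis by unfold_locales (use sym z0 \<rho>s in auto)
qed

text \<open>Undoes the scaling to perimeter 1 and rotates the angle so that it is measured in the
  fixed frame \<open>Tv\<close>. The constant \<open>c\<close> is the radius of the comparison
  circle before scaling.\<close>

lemma near_circle_curve:
  "\<exists>C>0. \<exists>\<delta>0>0. \<forall>\<delta> \<Omega> m a. \<delta> \<le> \<delta>0 \<longrightarrow> domain_S_delta 8 \<delta> \<Omega> \<longrightarrow> normalized \<Omega> m a \<longrightarrow>
     (\<exists>z \<rho> c. sym_curve z \<rho> \<and> range z = frontier \<Omega> \<and> c > 0 \<and> bC 7 (C * \<delta>) (\<lambda>t. \<rho> t / c - 1))"
proof -
  obtain C \<delta>0 where C: "C > 0" "\<delta>0 > 0" and P: "\<And>\<delta> \<gamma>. \<delta> \<le> \<delta>0 \<Longrightarrow> (\<forall>s. \<gamma> (s + 1) = \<gamma> s) \<Longrightarrow> (\<forall>s. norm (vector_derivative \<gamma> (at s)) = 1) \<Longrightarrow>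
     Ck_dist_le 9 \<gamma> (circle_param (\<gamma> 0) (vector_derivative \<gamma> (at 0))) \<delta> \<Longrightarrow>
     (\<exists>\<zeta> R. (\<forall>t. (\<zeta> has_vector_derivative R t *\<^sub>R (cos t *\<^sub>R vector_derivative \<gamma> (at 0) + sin t *\<^sub>R rot90 (vector_derivative \<gamma> (at 0)))) (at t)) \<and>
        range \<zeta> = range \<gamma> \<and> (\<forall>t. \<zeta> (t + 2 * pi) = \<zeta> t) \<and> (\<forall>t. R (t + 2 * pi) = R t) \<and> (\<forall>t. R t > 0) \<and> bC 7 (C * \<delta>) (\<lambda>t. 2 * pi * R t - 1))"
    using near_circle_angle_param by blast
  have "\<exists>z \<rho> c. sym_curve z \<rho> \<and> range z = frontier \<Omega> \<and> c > 0 \<and> bC 7 (C * \<delta>) (\<lambda>t. \<rho> t / c - 1)"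
    if \<delta>: "\<delta> \<le> \<delta>0" and dom: "domain_S_delta 8 \<delta> \<Omega>" and nrm: "normalized \<Omega> m a" for \<delta> \<Omega> m a
  proof -
    define l where "l = 1 / perimeter \<Omega>"
    obtain \<gamma> where bp: "boundary_param 9 ((\<lambda>x. l *\<^sub>R x) ` \<Omega>) \<gamma>" and unit: "\<forall>s. norm (vector_derivative \<gamma> (at s)) = 1"
      and near: "Ck_dist_le 9 \<gamma> (circle_param (\<gamma> 0) (vector_derivative \<gamma> (at 0))) \<delta>"
      using dom unfolding domain_S_delta_def close_to_circle_def Let_def l_def by auto
    have per: "\<forall>s. \<gamma> (s + 1) = \<gamma> s" and inj: "inj_on \<gamma> {0..<1}" and im: "\<gamma> ` {0..<1} = frontier ((\<lambda>x. l *\<^sub>R x) ` \<Omega>)"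
      using bp by (auto simp: boundary_param_def)
    \<comment> \<open>A zero scale would shrink the boundary to one point, against the injectivity
      of \<open>\<gamma>\<close>.\<close>
    have l: "l \<noteq> 0"
    proof
      assume "l = 0"
      then have "(\<lambda>x. l *\<^sub>R x) ` \<Omega> \<subseteq> {0}" by auto
      then have "frontier ((\<lambda>x. l *\<^sub>R x) ` \<Omega>) \<subseteq> {0}" unfolding frontier_def by (meson Diff_subset closed_singleton closure_minimal subset_trans)
      moreover have "\<gamma> 0 \<in> \<gamma> ` {0..<1}" "\<gamma> (1/2) \<in> \<gamma> ` {0..<1}" by auto
      ultimately have "\<gamma> 0 = 0" "\<gamma> (1/2) = 0" unfolding im by auto
      then have "\<gamma> 0 = \<gamma> (1/2)" by simp
      then have "(0::real) = 1/2" by (rule inj_onD[OF inj]) auto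
      then show False by simp
    qed
    have rg: "range \<gamma> = (\<lambda>x. l *\<^sub>R x) ` frontier \<Omega>"
      using periodic_range[of \<gamma>] per im frontier_linear_image[of "\<lambda>x. l *\<^sub>R x" \<Omega>] l by (simp add: linear_scaleR inj_on_def)
    define T where "T = vector_derivative \<gamma> (at 0)"
    have nT: "norm T = 1" using unit by (simp add: T_def)
    obtain \<zeta> R where \<zeta>: "\<And>t. (\<zeta> has_vector_derivative R t *\<^sub>R (cos t *\<^sub>R T + sin t *\<^sub>R rot90 T)) (at t)" "range \<zeta> = range \<gamma>"
      "\<And>t. \<zeta> (t + 2 * pi) = \<zeta> t" "\<And>t. R (t + 2 * pi) = R t" "\<And>t. R t > 0" "bC 7 (C * \<delta>) (\<lambda>t. 2 * pi * R t - 1)"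
      using P[OF \<delta> per unit near] unfolding T_def by blast
    \<comment> \<open>A negative factor would act as a half turn on the tangent direction; the sign
      lets the angle \<open>b\<close> absorb it.\<close>
    define U where "U = sgn l *\<^sub>R T"
    have "U$1 * U$1 + U$2 * U$2 = 1"
      using rot90_frame(1)[OF nT] l by (simp add: U_def inner_vec2 sgn_if)
    then have "(- (U$2))\<^sup>2 + (U$1)\<^sup>2 = 1" by (simp add: power2_eq_square)
    then obtain b where b: "- (U$2) = cos b" "U$1 = sin b" using sincos_total_2pi by metis
    have Ub: "U = Tv b" using b by (simp add: vec2_eq_iff)
    have TU: "T = sgn l *\<^sub>R Tv b" using Ub[symmetric] l by (simp add: U_def sgn_if)
    have frame: "cos t *\<^sub>R T + sin t *\<^sub>R rot90 T = sgn l *\<^sub>R Tv (t + b)" for t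
      by (simp add: TU vec2_eq_iff rot90_def sin_add cos_add algebra_simps)
    define z where "z = (\<lambda>t. (1 / l) *\<^sub>R \<zeta> (t - b))"
    define \<rho> where "\<rho> = (\<lambda>t. R (t - b) / \<bar>l\<bar>)"
    have rgz: "range z = frontier \<Omega>"
    proof -
      have "range z = (\<lambda>x. (1 / l) *\<^sub>R x) ` range \<zeta>"
      proof -
        have "(1 / l) *\<^sub>R \<zeta> t \<in> range z" for t unfolding z_def by (rule range_eqI[of _ _ "t + b"]) simp
        then show ?thesis unfolding z_def by auto
      qed
      also have "\<dots> = frontier \<Omega>" unfolding \<zeta>(2) rg using l by (simp add: image_image)
      finally show ?thesis .
    qed
    have cur: "curve z \<rho>"
    proof
      fix t
      have "((\<lambda>t. \<zeta> (t - b)) has_vector_derivative 1 *\<^sub>R (R (t - b) *\<^sub>R (cos (t - b) *\<^sub>R T + sin (t - b) *\<^sub>R rot90 T))) (at t)"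
        using vector_diff_chain_at[of "\<lambda>t. t - b" 1 t \<zeta>, OF _ \<zeta>(1)]
        by (simp add: o_def has_vector_derivative_diff_const has_vector_derivative_id)
      from has_vector_derivative_scaleR[OF DERIV_const[of "1 / l"] this]
      have "(z has_vector_derivative (1 / l) *\<^sub>R R (t - b) *\<^sub>R sgn l *\<^sub>R Tv t) (at t)"
        unfolding z_def frame by simp
      moreover have "(1 / l) *\<^sub>R R (t - b) *\<^sub>R sgn l *\<^sub>R Tv t = \<rho> t *\<^sub>R Tv t"
        unfolding \<rho>_def using l by (simp add: sgn_if)
      ultimately show "(z has_vector_derivative \<rho> t *\<^sub>R Tv t) (at t)" by (simp only:)
      show "\<rho> t > 0" using l \<zeta>(5) by (simp add: \<rho>_def)
      show "\<rho> (t + 2 * pi) = \<rho> t" using \<zeta>(4)[of "t - b"] by (simp add: \<rho>_def algebra_simps)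
      show "z (t + 2 * pi) = z t" using \<zeta>(3)[of "t - b"] by (simp add: z_def algebra_simps)
    next
      have S: "(7::nat) = Suc 6" by simp
      obtain f' where "\<And>x. ((\<lambda>t. 2 * pi * R t - 1) has_real_derivative f' x) (at x)" using bC_SucE[OF \<zeta>(6)[unfolded S]] by blast
      then have "continuous_on UNIV (\<lambda>t. 2 * pi * R t - 1)" by (intro DERIV_continuous_on) (auto intro: DERIV_subset)
      then have "continuous_on UNIV (\<lambda>t. ((2 * pi * R t - 1) + 1) * (1 / (2 * pi)))" by (intro continuous_on_mult continuous_on_add continuous_on_const)
      then have "continuous_on UNIV R" by simp
      then have "continuous_on UNIV (\<lambda>t. R (t - b))"
        by (rule continuous_on_compose2) (auto intro!: continuous_on_diff continuous_on_id continuous_on_const)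
      then show "continuous_on UNIV \<rho>" unfolding \<rho>_def using l
        by (intro continuous_on_divide continuous_on_const) auto
    qed
    define c where "c = 1 / (2 * pi * \<bar>l\<bar>)"
    have c: "c > 0" using l by (simp add: c_def)
    have "bC 7 (C * \<delta>) (\<lambda>t. \<rho> t / c - 1)"
    proof -
      have "bC m B (\<lambda>t. f (t - b))" if "bC m B f" for m B f
        using that
      proof (induction m arbitrary: f)
        case (Suc m)
        obtain f' where f': "\<And>x. (f has_real_derivative f' x) (at x)" "bC m B f'" using bC_SucE[OF Suc.prems] by blast
        show ?case
        proof (rule bC_SucI[OF _ _ Suc.IH[OF f'(2)]])
          show "\<bar>f (x - b)\<bar> \<le> B" for x by (rule bC_abs[OF Suc.prems])
          show "((\<lambda>x. f (x - b)) has_real_derivative f' (x - b)) (at x)" for x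
            using f'(1)[of "x + - b"] DERIV_shift[of f "f' (x - b)" x "- b"] by simp
        qed
      qed simp
      from this[OF \<zeta>(6)] show ?thesis using l by (simp add: \<rho>_def c_def mult.commute)
    qed
    then show ?thesis using sym_curve_of_normalized[OF cur rgz nrm] rgz c by blast
  qed
  then show ?thesis using C by blast
qed

section \<open>Interpolation and the density\<close>

lemma bC_chain:
  assumes "bC m B f"
  obtains D where "D 0 = f" "\<And>i x. i < m \<Longrightarrow> (D i has_real_derivative D (Suc i) x) (at x)" "\<And>i x. i \<le> m \<Longrightarrow> \<bar>D i x\<bar> \<le> B"
proof -
  have "\<exists>D. D 0 = f \<and> (\<forall>i<m. \<forall>x. (D i has_real_derivative D (Suc i) x) (at x)) \<and> (\<forall>i\<le>m. \<forall>x. \<bar>D i x\<bar> \<le> B)"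
    using assms
  proof (induction m arbitrary: f)
    case 0 then show ?case by (intro exI[of _ "\<lambda>_. f"]) auto
  next
    case (Suc m)
    obtain f' where f': "\<And>x. (f has_real_derivative f' x) (at x)" "bC m B f'" using bC_SucE[OF Suc.prems] by blast
    obtain D where D: "D 0 = f'" "\<forall>i<m. \<forall>x. (D i has_real_derivative D (Suc i) x) (at x)" "\<forall>i\<le>m. \<forall>x. \<bar>D i x\<bar> \<le> B"
      using Suc.IH[OF f'(2)] by blast
    have 1: "(case_nat f D i has_real_derivative case_nat f D (Suc i) x) (at x)" if "i < Suc m" for i x
      using that f' D by (cases i) auto
    have 2: "\<bar>case_nat f D i x\<bar> \<le> B" if "i \<le> Suc m" for i x
      using that bC_abs[OF Suc.prems, of x] D(3) by (cases i) auto
    show ?case by (intro exI[of _ "case_nat f D"]) (use 1 2 in auto)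
  qed
  then show thesis using that by blast
qed

text \<open>The five-point difference for the second derivative, with weights -1, 16, -30, 16, -1
  over 12. Its remainder is of size \<open>E * h^6\<close>, and \<open>h = root 6 (A / E)\<close>
  makes this comparable with \<open>A\<close>. The cubed form avoids fractional powers.\<close>

lemma second_derivative_interpolation:
  assumes b: "bC 6 E f" and d: "\<And>x. (f has_real_derivative f' x) (at x)" "\<And>x. (f' has_real_derivative f'' x) (at x)"
    and A: "\<And>x. \<bar>f x\<bar> \<le> A" and pos: "0 < A" "0 < E"
  shows "\<bar>f'' x\<bar> ^ 3 \<le> 216 * A ^ 2 * E"
proof -
  obtain D where D0: "D 0 = f" and D: "\<And>i x. i < 6 \<Longrightarrow> (D i has_real_derivative D (Suc i) x) (at x)" "\<And>i x. i \<le> 6 \<Longrightarrow> \<bar>D i x\<bar> \<le> E"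
    using bC_chain[OF b] by blast
  have "D 1 y = f' y" for y using D(1)[of 0 y] D0 d(1)[of y] DERIV_unique by force
  then have "D 1 = f'" by (rule ext)
  then have D2: "D 2 x = f'' x" using D(1)[of 1 x] d(2)[of x] DERIV_unique by (force simp: numeral_2_eq_2)
  define h where "h = root 6 (A / E)"
  have h6: "h ^ 6 = A / E" using pos by (simp add: h_def)
  define Y where "Y = (\<lambda>i. D i x * h ^ i)"
  define e where "e = E * h ^ 6 / 720"
  have tay: "\<bar>f (x + s * h) - (Y 0 + Y 1 * s + Y 2 * s ^ 2 / 2 + Y 3 * s ^ 3 / 6 + Y 4 * s ^ 4 / 24 + Y 5 * s ^ 5 / 120)\<bar> \<le> e * s ^ 6" for s
  proof -
    have "\<exists>t. \<bar>t\<bar> \<le> \<bar>s * h\<bar> \<and> f (x + s * h) = (\<Sum>m\<in>{..<6::nat}. D m (x + 0) / fact m * (s * h) ^ m) + D 6 (x + t) / fact 6 * (s * h) ^ (6::nat)"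
    proof (rule Maclaurin_bi_le[where f = "\<lambda>t. f (x + t)" and diff = "\<lambda>m t. D m (x + t)"])
      show "(\<lambda>t. D 0 (x + t)) = (\<lambda>t. f (x + t))" by (simp add: D0)
      show "\<forall>m t. m < 6 \<and> \<bar>t\<bar> \<le> \<bar>s * h\<bar> \<longrightarrow> ((\<lambda>t. D m (x + t)) has_real_derivative D (Suc m) (x + t)) (at t)"
      proof (intro allI impI)
        fix m :: nat and t :: real assume "m < 6 \<and> \<bar>t\<bar> \<le> \<bar>s * h\<bar>"
        then have "(D m has_real_derivative D (Suc m) (t + x)) (at (t + x))" using D(1) by blast
        then show "((\<lambda>t. D m (x + t)) has_real_derivative D (Suc m) (x + t)) (at t)" by (simp add: DERIV_shift add.commute)
      qed
    qed
    then obtain t where t: "f (x + s * h) = (\<Sum>m\<in>{..<6::nat}. D m x / fact m * (s * h) ^ m) + D 6 (x + t) / fact 6 * (s * h) ^ (6::nat)" by auto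
    have sum: "(\<Sum>m\<in>{..<6::nat}. D m x / fact m * (s * h) ^ m) = Y 0 + Y 1 * s + Y 2 * s ^ 2 / 2 + Y 3 * s ^ 3 / 6 + Y 4 * s ^ 4 / 24 + Y 5 * s ^ 5 / 120"
      by (simp add: Y_def power_mult_distrib eval_nat_numeral lessThan_Suc ac_simps)
    have "\<bar>D 6 (x + t) / fact 6 * (s * h) ^ (6::nat)\<bar> = \<bar>D 6 (x + t)\<bar> * ((s * h) ^ 6 / 720)" by (simp add: abs_mult fact_numeral)
    also have "\<dots> \<le> E * ((s * h) ^ 6 / 720)" using D(2)[of 6 "x + t"] by (intro mult_right_mono) auto
    also have "\<dots> = e * s ^ 6" by (simp add: e_def power_mult_distrib)
    finally show ?thesis unfolding t sum by simp
  qed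
  have 1: "\<bar>f (x + h) - (Y 0 + Y 1 + Y 2 / 2 + Y 3 / 6 + Y 4 / 24 + Y 5 / 120)\<bar> \<le> e" using tay[of 1] by simp
  have 2: "\<bar>f (x - h) - (Y 0 - Y 1 + Y 2 / 2 - Y 3 / 6 + Y 4 / 24 - Y 5 / 120)\<bar> \<le> e" using tay[of "-1"] by simp
  have 3: "\<bar>f (x + 2 * h) - (Y 0 + 2 * Y 1 + 2 * Y 2 + 4/3 * Y 3 + 2/3 * Y 4 + 4/15 * Y 5)\<bar> \<le> 64 * e" using tay[of 2] by simp
  have 4: "\<bar>f (x - 2 * h) - (Y 0 - 2 * Y 1 + 2 * Y 2 - 4/3 * Y 3 + 2/3 * Y 4 - 4/15 * Y 5)\<bar> \<le> 64 * e" using tay[of "-2"] by simp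
  have 5: "Y 0 = f x" by (simp add: Y_def D0)
  have e: "720 * e = A" using pos h6 by (simp add: e_def)
  note ab = 1[unfolded abs_le_iff] 2[unfolded abs_le_iff] 3[unfolded abs_le_iff] 4[unfolded abs_le_iff]
    A[of x, unfolded abs_le_iff] A[of "x + h", unfolded abs_le_iff] A[of "x - h", unfolded abs_le_iff] A[of "x + 2 * h", unfolded abs_le_iff] A[of "x - 2 * h", unfolded abs_le_iff]
  \<comment> \<open>The weights have absolute sum 64, and the remainders contribute
    \<open>160 * e\<close>, which is less than \<open>A\<close>.\<close>
  have "12 * Y 2 \<le> 65 * A" using ab 5 e pos by linarith
  moreover have "- (12 * Y 2) \<le> 65 * A" using ab 5 e pos by linarith
  ultimately have "\<bar>Y 2\<bar> \<le> 6 * A" using pos by linarith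
  then have "\<bar>f'' x\<bar> * h ^ 2 \<le> 6 * A" by (simp add: Y_def D2 abs_mult)
  then have "(\<bar>f'' x\<bar> * h ^ 2) ^ 3 \<le> (6 * A) ^ 3" by (intro power_mono) auto
  then have "\<bar>f'' x\<bar> ^ 3 * (A / E) \<le> 216 * A ^ 3" by (simp add: power_mult_distrib h6 flip: power_mult)
  then show ?thesis using pos by (simp add: field_simps power3_eq_cube power2_eq_square)
qed

text \<open>Lazutkin's density: in the coordinate \<open>X\<close> with \<open>X' = density \<rho>\<close> the vertices of a maximal polygon are almost
  equidistributed.\<close>

definition mean_cbrt :: "(real \<Rightarrow> real) \<Rightarrow> real" where
  "mean_cbrt \<rho> = integral {0..2*pi} (\<lambda>t. \<rho> t powr (1/3)) / (2 * pi)"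

definition density :: "(real \<Rightarrow> real) \<Rightarrow> real \<Rightarrow> real" where
  "density \<rho> t = \<rho> t powr (1/3) / mean_cbrt \<rho>"

lemma bC_imp_continuous: "bC (Suc m) B f \<Longrightarrow> continuous_on S f"
  by (elim bC_SucE) (meson DERIV_isCont continuous_at_imp_continuous_on)

lemma cbrt_cube: "0 < x \<Longrightarrow> (x powr (1/3)) ^ 3 = (x::real)"
  by (simp add: powr_power)

text \<open>\<open>density\<close> does not see a constant factor of \<open>\<rho>\<close>, so the
  size of the domain drops out and closeness to 1 is inherited with a linear constant. The
  normalisation by the mean makes \<open>X\<close> map a full turn to a full turn.\<close>

lemma density_near_one:
  "\<exists>C\<ge>1. \<forall>\<rho> c \<epsilon>. c > 0 \<longrightarrow> 0 \<le> \<epsilon> \<longrightarrow> C * \<epsilon> \<le> 1/2 \<longrightarrow> bC 7 \<epsilon> (\<lambda>t. \<rho> t / c - 1) \<longrightarrow> (\<forall>t. \<rho> (t + 2 * pi) = \<rho> t) \<longrightarrow> (\<forall>t. \<rho> (- t) = \<rho> t) \<longrightarrow>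
    (\<exists>X c'. c' > 0 \<and> (\<forall>t. \<rho> t = c' * density \<rho> t ^ 3) \<and> bC 7 (C * \<epsilon>) (\<lambda>t. density \<rho> t - 1) \<and> bC 7 (C * \<epsilon>) (\<lambda>t. density \<rho> t ^ 3 - 1) \<and>
      bC 7 2 (\<lambda>t. 1 / density \<rho> t) \<and> phase (density \<rho>) (\<lambda>t. 1 / density \<rho> t) X \<and> circle_phase (density \<rho>) X \<and> (\<forall>t. density \<rho> (2 * pi - t) = density \<rho> t))"
proof -
  obtain C1 where C1: "C1 \<ge> 0" "\<And>f \<epsilon>. \<epsilon> \<le> 1/2 \<Longrightarrow> bC 7 \<epsilon> (\<lambda>x. f x - 1) \<Longrightarrow> bC 7 (C1 * \<epsilon>) (\<lambda>x. f x powr (1/3) - 1)"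
    using bC_powr[of 7 "1/3"] by blast
  obtain C3 where C3: "C3 \<ge> 0" "\<And>f \<epsilon>. \<epsilon> \<le> 1/2 \<Longrightarrow> bC 7 \<epsilon> (\<lambda>x. f x - 1) \<Longrightarrow> bC 7 (C3 * \<epsilon>) (\<lambda>x. f x powr 3 - 1)"
    using bC_powr[of 7 "3"] by blast
  obtain C4 where C4: "C4 \<ge> 0" "\<And>f \<epsilon>. \<epsilon> \<le> 1/2 \<Longrightarrow> bC 7 \<epsilon> (\<lambda>x. f x - 1) \<Longrightarrow> bC 7 (C4 * \<epsilon>) (\<lambda>x. f x powr (-1) - 1)"
    using bC_powr[of 7 "-1"] by blast
  define C where "C = 1 + 4 * C1 + C3 * (4 * C1) + C4 * (4 * C1)"
  have C: "C \<ge> 1" using C1(1) C3(1) C4(1) by (simp add: C_def add_nonneg_nonneg)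
  have "\<exists>X c'. c' > 0 \<and> (\<forall>t. \<rho> t = c' * density \<rho> t ^ 3) \<and> bC 7 (C * \<epsilon>) (\<lambda>t. density \<rho> t - 1) \<and> bC 7 (C * \<epsilon>) (\<lambda>t. density \<rho> t ^ 3 - 1) \<and>
      bC 7 2 (\<lambda>t. 1 / density \<rho> t) \<and> phase (density \<rho>) (\<lambda>t. 1 / density \<rho> t) X \<and> circle_phase (density \<rho>) X \<and> (\<forall>t. density \<rho> (2 * pi - t) = density \<rho> t)"
    if c: "c > 0" and \<epsilon>: "0 \<le> \<epsilon>" "C * \<epsilon> \<le> 1/2" and b: "bC 7 \<epsilon> (\<lambda>t. \<rho> t / c - 1)" and per: "\<And>t. \<rho> (t + 2 * pi) = \<rho> t" and ev: "\<And>t. \<rho> (- t) = \<rho> t" for \<rho> c \<epsilon>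
  proof -
    have ex: "\<epsilon> + 4 * (C1 * \<epsilon>) + C3 * (4 * (C1 * \<epsilon>)) + C4 * (4 * (C1 * \<epsilon>)) \<le> 1/2" using \<epsilon>(2) by (simp add: C_def algebra_simps)
    have nn: "C1 * \<epsilon> \<ge> 0" "C3 * (4 * (C1 * \<epsilon>)) \<ge> 0" "C4 * (4 * (C1 * \<epsilon>)) \<ge> 0" using C1(1) C3(1) C4(1) \<epsilon>(1) by auto
    have e1: "\<epsilon> \<le> 1/2" and e2: "4 * (C1 * \<epsilon>) \<le> 1/2" and e4: "C4 * (4 * (C1 * \<epsilon>)) \<le> 1/2" using ex nn \<epsilon>(1) by linarith+
    define s where "s = (\<lambda>t. (\<rho> t / c) powr (1/3))"
    have bs: "bC 7 (C1 * \<epsilon>) (\<lambda>t. s t - 1)" unfolding s_def by (rule C1(2)[OF e1 b])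
    have S7: "(7::nat) = Suc 6" by simp
    have f0: "\<rho> t / c > 0" for t using bC_abs[OF b, of t] e1 by linarith
    have s0: "s t > 0" for t unfolding s_def using f0[of t] by (metis powr_gt_zero less_irrefl)
    have s3: "s t ^ 3 = \<rho> t / c" for t unfolding s_def by (rule cbrt_cube[OF f0])
    have sb: "\<bar>s t - 1\<bar> \<le> C1 * \<epsilon>" for t by (rule bC_abs[OF bs])
    have "continuous_on UNIV (\<lambda>t. s t - 1)" using bs unfolding S7 by (rule bC_imp_continuous)
    then have "continuous_on UNIV (\<lambda>t. (s t - 1) + 1)" by (intro continuous_on_add continuous_on_const)
    then have sc: "continuous_on S s" for S by (simp add: continuous_on_subset[of UNIV])
    define m where "m = integral {0..2*pi} s / (2 * pi)"
    have sint: "s integrable_on {0..2*pi}" by (intro integrable_continuous_interval sc)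
    have mb: "\<bar>m - 1\<bar> \<le> C1 * \<epsilon>"
    proof -
      have "integral {0..2*pi} (\<lambda>t. s t - 1) = integral {0..2*pi} s - 2 * pi"
        using Henstock_Kurzweil_Integration.integral_diff[OF sint integrable_const_ivl[of 1]] by simp
      moreover have "\<bar>integral {0..2*pi} (\<lambda>t. s t - 1)\<bar> \<le> C1 * \<epsilon> * (2 * pi - 0)" using sb nn by (intro abs_integral_le) auto
      ultimately have "\<bar>integral {0..2*pi} s - 2 * pi\<bar> \<le> C1 * \<epsilon> * (2 * pi)" by simp
      moreover have "integral {0..2*pi} s - 2 * pi = (m - 1) * (2 * pi)" by (simp add: m_def field_simps)
      ultimately have "\<bar>m - 1\<bar> * (2 * pi) \<le> C1 * \<epsilon> * (2 * pi)" by (simp add: abs_mult)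
      then show ?thesis by simp
    qed
    have m: "1/2 \<le> m" "m > 0" using mb e2 by linarith+
    have powr: "\<rho> t powr (1/3) = c powr (1/3) * s t" for t
    proof -
      have "\<rho> t = c * (\<rho> t / c)" using c by simp
      then show ?thesis unfolding s_def using c f0[of t] by (metis powr_mult less_imp_le)
    qed
    have mc: "mean_cbrt \<rho> = c powr (1/3) * m" unfolding mean_cbrt_def powr m_def by simp
    have den: "density \<rho> t = s t / m" for t unfolding density_def powr mc using c by simp
    define \<sigma> where "\<sigma> = density \<rho>"
    have \<sigma>: "\<sigma> t = s t / m" for t by (simp add: \<sigma>_def den)
    have \<sigma>0: "\<sigma> t > 0" for t using s0[of t] m by (simp add: \<sigma>)
    have cube: "\<rho> t = (c * m ^ 3) * \<sigma> t ^ 3" for t using m c by (simp add: \<sigma> power_divide s3)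
    have im: "\<bar>1 / m\<bar> \<le> 2" using m by (simp add: field_simps)
    have b\<sigma>: "bC 7 (4 * (C1 * \<epsilon>)) (\<lambda>t. \<sigma> t - 1)"
    proof -
      have "bC 7 (\<bar>1 / m\<bar> * (C1 * \<epsilon>) + \<bar>1 / m - 1\<bar>) (\<lambda>t. 1 / m * (s t - 1) + (1 / m - 1))"
        by (intro bC_add bC_cmult bs bC_const)
      moreover have "\<bar>1 / m - 1\<bar> \<le> 2 * (C1 * \<epsilon>)"
      proof -
        have "1 / m - 1 = - (1 / m * (m - 1))" using m by (simp add: field_simps)
        then have "\<bar>1 / m - 1\<bar> = \<bar>1 / m\<bar> * \<bar>m - 1\<bar>" by (simp add: abs_mult)
        also have "\<dots> \<le> 2 * (C1 * \<epsilon>)" using im mb by (intro mult_mono) auto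
        finally show ?thesis .
      qed
      ultimately have "bC 7 (4 * (C1 * \<epsilon>)) (\<lambda>t. 1 / m * (s t - 1) + (1 / m - 1))"
        by (elim bC_mono) (use mult_right_mono[OF im nn(1)] in linarith)
      moreover have "1 / m * (s t - 1) + (1 / m - 1) = \<sigma> t - 1" for t using m(2) by (simp add: \<sigma> diff_divide_distrib)
      ultimately show ?thesis by (simp only:)
    qed
    have Ce: "C * \<epsilon> = \<epsilon> + 4 * (C1 * \<epsilon>) + C3 * (4 * (C1 * \<epsilon>)) + C4 * (4 * (C1 * \<epsilon>))" by (simp add: C_def algebra_simps)
    have b1: "bC 7 (C * \<epsilon>) (\<lambda>t. \<sigma> t - 1)" by (rule bC_mono[OF b\<sigma>]) (use nn \<epsilon>(1) Ce in linarith)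
    have "bC 7 (C3 * (4 * (C1 * \<epsilon>))) (\<lambda>t. \<sigma> t powr 3 - 1)" by (rule C3(2)[OF e2 b\<sigma>])
    then have "bC 7 (C3 * (4 * (C1 * \<epsilon>))) (\<lambda>t. \<sigma> t ^ 3 - 1)" using \<sigma>0 powr_realpow[of "\<sigma> _" 3] by simp
    then have b3: "bC 7 (C * \<epsilon>) (\<lambda>t. \<sigma> t ^ 3 - 1)" by (rule bC_mono) (use nn \<epsilon>(1) Ce in linarith)
    have "bC 7 (C4 * (4 * (C1 * \<epsilon>))) (\<lambda>t. \<sigma> t powr (-1) - 1)" by (rule C4(2)[OF e2 b\<sigma>])
    moreover have "\<sigma> t powr (-1) = 1 / \<sigma> t" for t using \<sigma>0[of t] by (simp add: powr_neg_one)
    ultimately have "bC 7 (C4 * (4 * (C1 * \<epsilon>))) (\<lambda>t. 1 / \<sigma> t - 1)" by simp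
    from bC_add[OF this bC_const[of _ 1]] have "bC 7 (C4 * (4 * (C1 * \<epsilon>)) + \<bar>1\<bar>) (\<lambda>t. 1 / \<sigma> t)" by simp
    then have b4: "bC 7 2 (\<lambda>t. 1 / \<sigma> t)" by (rule bC_mono) (use e4 in simp)
    have \<sigma>c: "continuous_on S \<sigma>" for S unfolding \<sigma>[abs_def] using m by (intro continuous_on_divide sc continuous_on_const) auto
    have \<sigma>per: "\<sigma> (t + 2 * pi) = \<sigma> t" and \<sigma>ev: "\<sigma> (- t) = \<sigma> t" for t by (simp_all add: \<sigma> s_def per ev)
    have \<sigma>sym: "\<sigma> (2 * pi - t) = \<sigma> t" for t using \<sigma>per[of "- t"] \<sigma>ev[of t] by (simp add: add.commute)
    obtain X where X: "\<And>x. (X has_real_derivative \<sigma> x) (at x)" "X 0 = 0" using antiderivative_exists[OF \<sigma>c] by blast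
    have "(\<sigma> has_integral (X (2*pi) - X 0)) {0..2*pi}"
      using X(1) by (intro fundamental_theorem_of_calculus) (auto simp: has_real_derivative_iff_has_vector_derivative[symmetric] intro: DERIV_subset)
    then have "X (2*pi) = integral {0..2*pi} \<sigma>" using X(2) by (simp add: integral_unique)
    also have "\<dots> = integral {0..2*pi} s / m" unfolding \<sigma>[abs_def] by simp
    also have "\<dots> = (m * (2 * pi)) / m" by (simp add: m_def)
    also have "\<dots> = 2 * pi" using m by simp
    finally have X2: "X (2 * pi) = 2 * pi" .
    have Xs: "X (2 * pi - t) = 2 * pi - X t" for t
    proof -
      have "((\<lambda>t. X (2 * pi - t) + X t) has_real_derivative 0) (at t)" for t
      proof -
        have "((\<lambda>t. X (2 * pi - t)) has_real_derivative \<sigma> (2 * pi - t) * (0 - 1)) (at t)"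
          by (rule DERIV_chain2[where f = X and g = "\<lambda>t. 2 * pi - t"]) (auto intro!: X derivative_eq_intros)
        from DERIV_add[OF this X(1)] show ?thesis by (simp add: \<sigma>sym)
      qed
      then have "X (2 * pi - t) + X t = X (2 * pi - 0) + X 0" using DERIV_isconst_all[of "\<lambda>t. X (2 * pi - t) + X t" t 0] by blast
      then show ?thesis using X(2) X2 by simp
    qed
    have ph: "phase \<sigma> (\<lambda>t. 1 / \<sigma> t) X" unfolding phase_def using \<sigma>per X X2 \<sigma>0 by (auto simp: less_imp_neq[symmetric])
    have cp: "circle_phase \<sigma> X" by unfold_locales (use \<sigma>c \<sigma>0 X X2 Xs in auto)
    have "c * m ^ 3 > 0" using c m by simp
    then show ?thesis using cube b1 b3 b4 ph cp \<sigma>sym unfolding \<sigma>_def[symmetric] by blast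
  qed
  then show ?thesis using C by blast
qed

text \<open>Cube root and mean are Lipschitz for values in \<open>[1/2, 2]\<close>, in the sup norm
  and without derivatives; so the distance of the phases is controlled by the difference of the
  radii of curvature alone.\<close>

lemma phase_lipschitz:
  fixes r0 r1 :: "real \<Rightarrow> real"
  assumes c: "continuous_on {0..2*pi} r0" "continuous_on {0..2*pi} r1" and r: "\<And>t. 1/2 \<le> r0 t" "\<And>t. r0 t \<le> 2" "\<And>t. 1/2 \<le> r1 t" "\<And>t. r1 t \<le> 2"
    and d: "\<And>t. \<bar>r1 t - r0 t\<bar> \<le> d"
    and X0: "\<And>t. (X0 has_real_derivative density r0 t) (at t)" "X0 0 = 0" and X1: "\<And>t. (X1 has_real_derivative density r1 t) (at t)" "X1 0 = 0"
    and t: "t \<in> {0..2*pi}"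
  shows "\<bar>X1 t - X0 t\<bar> \<le> 300 * d"
proof -
  define s0 s1 where "s0 = (\<lambda>t. r0 t powr (1/3))" and "s1 = (\<lambda>t. r1 t powr (1/3))"
  have d0: "d \<ge> 0" using d[of 0] by linarith
  have cub: "(1/2 \<le> x powr (1/3) \<and> x powr (1/3) \<le> 2) \<and> (x powr (1/3)) ^ 3 = x" if "1/2 \<le> x" "x \<le> 2" for x :: real
  proof -
    have x3: "(x powr (1/3)) ^ 3 = x" using that by (simp add: powr_power)
    have "1/2 \<le> x powr (1/3)"
    proof (rule ccontr)
      assume "\<not> 1/2 \<le> x powr (1/3)"
      then have "(x powr (1/3)) ^ 3 \<le> (1/2) ^ 3" by (intro power_mono) auto
      then show False using x3 that by (simp add: power3_eq_cube)
    qed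
    moreover have "x powr (1/3) \<le> 2"
    proof (rule ccontr)
      assume "\<not> x powr (1/3) \<le> 2"
      then have "2 ^ 3 \<le> (x powr (1/3)) ^ 3" by (intro power_mono) auto
      then show False using x3 that by (simp add: power3_eq_cube)
    qed
    ultimately show ?thesis using x3 by blast
  qed
  have s0: "1/2 \<le> s0 t" "s0 t \<le> 2" "s0 t ^ 3 = r0 t" and s1: "1/2 \<le> s1 t" "s1 t \<le> 2" "s1 t ^ 3 = r1 t" for t
    unfolding s0_def s1_def using cub[OF r(1,2)] cub[OF r(3,4)] by blast+
  have sd: "\<bar>s1 t - s0 t\<bar> \<le> 2 * d" for t
  proof -
    have "r1 t - r0 t = (s1 t - s0 t) * (s1 t * s1 t + s1 t * s0 t + s0 t * s0 t)"
      unfolding s0(3)[symmetric] s1(3)[symmetric] by (simp add: power3_eq_cube algebra_simps)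
    then have e: "\<bar>r1 t - r0 t\<bar> = \<bar>s1 t - s0 t\<bar> * \<bar>s1 t * s1 t + s1 t * s0 t + s0 t * s0 t\<bar>" by (simp add: abs_mult)
    have "1/2 * (1/2) \<le> s1 t * s1 t" "1/2 * (1/2) \<le> s1 t * s0 t" "1/2 * (1/2) \<le> s0 t * s0 t" using s0[of t] s1[of t] by (intro mult_mono; simp)+
    then have "1/2 \<le> \<bar>s1 t * s1 t + s1 t * s0 t + s0 t * s0 t\<bar>" by linarith
    then have "\<bar>s1 t - s0 t\<bar> * (1/2) \<le> \<bar>r1 t - r0 t\<bar>" unfolding e by (intro mult_left_mono) auto
    then show ?thesis using d[of t] by argo
  qed
  have sc: "continuous_on {0..2*pi} s0" "continuous_on {0..2*pi} s1" unfolding s0_def s1_def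
    by (intro continuous_on_powr' c continuous_on_const ballI; insert r(1)[of _] r(3)[of _]; smt (verit) divide_pos_pos)+
  then have si: "s0 integrable_on {0..2*pi}" "s1 integrable_on {0..2*pi}" by (intro integrable_continuous_interval; simp)+
  define m0 m1 where "m0 = mean_cbrt r0" and "m1 = mean_cbrt r1"
  have mb: "1/2 \<le> m \<and> m \<le> 2" if "m = integral {0..2*pi} s / (2*pi)" "s integrable_on {0..2*pi}" "\<And>t. 1/2 \<le> s t" "\<And>t. s t \<le> 2" for m :: real and s
  proof -
    have "integral {0..2*pi} (\<lambda>_. 1/2 :: real) \<le> integral {0..2*pi} s" "integral {0..2*pi} s \<le> integral {0..2*pi} (\<lambda>_. 2 :: real)"
      using that by (intro integral_le integrable_const_ivl; simp)+
    then show ?thesis unfolding that(1) by (simp add: field_simps)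
  qed
  have m0e: "m0 = integral {0..2*pi} s0 / (2*pi)" and m1e: "m1 = integral {0..2*pi} s1 / (2*pi)" by (simp_all add: m0_def m1_def s0_def s1_def mean_cbrt_def)
  have m0: "1/2 \<le> m0" "m0 \<le> 2" and m1: "1/2 \<le> m1" "m1 \<le> 2" using mb[OF m0e si(1) s0(1,2)] mb[OF m1e si(2) s1(1,2)] by auto
  have md: "\<bar>m1 - m0\<bar> \<le> 2 * d"
  proof -
    have "\<bar>integral {0..2*pi} (\<lambda>t. s1 t - s0 t)\<bar> \<le> 2 * d * (2 * pi - 0)" using sd d0 by (intro abs_integral_le) auto
    then have "\<bar>integral {0..2*pi} s1 - integral {0..2*pi} s0\<bar> \<le> 2 * d * (2 * pi)"
      using Henstock_Kurzweil_Integration.integral_diff[OF si(2,1)] by simp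
    moreover have "integral {0..2*pi} s1 - integral {0..2*pi} s0 = (m1 - m0) * (2 * pi)" by (simp add: m0e m1e left_diff_distrib)
    ultimately have "\<bar>m1 - m0\<bar> * (2 * pi) \<le> 2 * d * (2 * pi)" by (simp add: abs_mult)
    then show ?thesis by simp
  qed
  have dd: "\<bar>density r1 t - density r0 t\<bar> \<le> 32 * d" for t
  proof -
    have e: "density r1 t - density r0 t = (s1 t * m0 - s0 t * m1) / (m0 * m1)"
      using m0 m1 unfolding density_def m0_def[symmetric] m1_def[symmetric] s0_def[symmetric] s1_def[symmetric]
      by (simp add: s0_def s1_def field_simps)
    have "s1 t * m0 - s0 t * m1 = (s1 t - s0 t) * m0 - s0 t * (m1 - m0)" by (simp add: algebra_simps)
    then have "\<bar>s1 t * m0 - s0 t * m1\<bar> \<le> \<bar>s1 t - s0 t\<bar> * m0 + s0 t * \<bar>m1 - m0\<bar>"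
      using m0 s0[of t] abs_triangle_ineq4[of "(s1 t - s0 t) * m0" "s0 t * (m1 - m0)"] by (simp add: abs_mult)
    also have "\<dots> \<le> (2 * d) * 2 + 2 * (2 * d)" using sd[of t] md m0 s0[of t] d0 by (intro add_mono mult_mono) auto
    finally have n: "\<bar>s1 t * m0 - s0 t * m1\<bar> \<le> 8 * d" by simp
    have "1/2 * (1/2) \<le> m0 * m1" using m0 m1 by (intro mult_mono) auto
    then have "\<bar>s1 t * m0 - s0 t * m1\<bar> / (m0 * m1) \<le> 8 * d / (1/4)" using n d0 by (intro frac_le) auto
    then show ?thesis using m0 m1 unfolding e by (simp add: abs_divide abs_mult)
  qed
  have der: "((\<lambda>t. X1 t - X0 t) has_vector_derivative density r1 t - density r0 t) (at t)" for t
    unfolding has_real_derivative_iff_has_vector_derivative[symmetric] by (rule DERIV_diff[OF X1(1) X0(1)])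
  have "norm ((X1 t - X0 t) - (X1 0 - X0 0)) \<le> 32 * d * \<bar>t - 0\<bar>"
    by (rule lipschitz_of_vector_derivative[where f = "\<lambda>t. X1 t - X0 t", OF der]) (use dd in simp)
  then have "\<bar>X1 t - X0 t\<bar> \<le> 32 * d * t" using X0 X1 t by simp
  also have "\<dots> \<le> 32 * d * 8" using t pi_less_4 d0 by (intro mult_left_mono) auto
  finally show ?thesis using d0 by simp
qed

section \<open>Rigidity for two curves\<close>

lemma orbit_angle_range:
  assumes "orbit z q \<theta> \<phi>" "k \<le> q"
  shows "\<theta> k \<in> {0..2*pi}"
proof -
  have st: "\<theta> k \<le> \<theta> (Suc k)" if "k < q" for k
  proof -
    have "\<theta> (Suc k) = \<theta> k + \<phi> k + \<phi> (Suc k)" "0 < \<phi> k" "0 < \<phi> (Suc k)" using assms(1) that unfolding orbit_def by auto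
    then show ?thesis by linarith
  qed
  have "\<theta> k \<le> \<theta> q" using assms(2)
  proof (induction k rule: inc_induct)
    case (step n) then show ?case using st[of n] by linarith
  qed simp
  moreover have "\<theta> 0 \<le> \<theta> k" using assms(2)
  proof (induction k)
    case (Suc k) then show ?case using st[of k] by simp
  qed simp
  ultimately show ?thesis using assms(1) by (auto simp: orbit_def)
qed

text \<open>Dividing by \<open>q * sin (pi / q)\<close>, the total weight on a circle, turns
  \<open>sin \<phi> * u\<close> into \<open>g * v\<close> with \<open>g\<close> close to 1 and
  \<open>v = u / \<sigma>\<close>, to which the Fourier expansion applies.\<close>

lemma orbit_row:
  "\<exists>E>0. \<forall>z \<rho> c \<sigma> X \<epsilon> q \<theta> \<phi> u N. curve z \<rho> \<longrightarrow> c > 0 \<longrightarrow> (\<forall>t. \<rho> t = c * \<sigma> t ^ 3) \<longrightarrow> 0 \<le> \<epsilon> \<longrightarrow> \<epsilon> \<le> E \<longrightarrow>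
     bC 7 \<epsilon> (\<lambda>t. \<sigma> t - 1) \<longrightarrow> bC 7 \<epsilon> (\<lambda>t. \<sigma> t ^ 3 - 1) \<longrightarrow> circle_phase \<sigma> X \<longrightarrow> (\<forall>t. \<sigma> (2 * pi - t) = \<sigma> t) \<longrightarrow> q \<ge> 2 \<longrightarrow> orbit z q \<theta> \<phi> \<longrightarrow>
     continuous_on UNIV u \<longrightarrow> (\<forall>t. u (2 * pi - t) = u t) \<longrightarrow> (\<forall>j\<ge>1. \<bar>circle_phase.coef X u j\<bar> \<le> N / (real j)\<^sup>2) \<longrightarrow>
     (\<exists>m P. (\<Sum>k<q. sin (\<phi> k) * u (\<theta> k)) / (real q * sin (pi / real q)) = circle_phase.coef X u 0 * m + (\<Sum>n. circle_phase.coef X u (Suc n * q)) + P \<and>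
        \<bar>m - 1\<bar> \<le> 1/2 \<and> \<bar>P\<bar> \<le> 1/100 * N / (real q)\<^sup>2)"
proof -
  obtain Z where Z: "Z > 0" and row: "\<And>q A g x a v N. q \<ge> (2::nat) \<Longrightarrow> 0 \<le> A \<Longrightarrow> A \<le> 1/20 \<Longrightarrow>
     (\<forall>k\<le>q. \<bar>g k - 1\<bar> \<le> A / (real q)\<^sup>2) \<Longrightarrow> (\<forall>k<q. \<bar>g (Suc k) - g k\<bar> \<le> A / real q ^ 3) \<Longrightarrow>
     (\<forall>k\<le>q. \<bar>x k - 2 * pi * real k / real q\<bar> \<le> A / (real q)\<^sup>2) \<Longrightarrow> (\<forall>k<q. \<bar>x (Suc k) - x k - 2 * pi / real q\<bar> \<le> A / real q ^ 3) \<Longrightarrow>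
     (\<forall>k<q. (\<lambda>j. a j * cos (real j * x k)) sums v k) \<Longrightarrow> (\<forall>j\<ge>1. \<bar>a j\<bar> \<le> N / (real j)\<^sup>2) \<Longrightarrow>
     (\<exists>m0 P. (\<Sum>k<q. g k * v k) / real q = a 0 * m0 + (\<Sum>n. a (Suc n * q)) + P \<and> \<bar>m0 - 1\<bar> \<le> A / (real q)\<^sup>2 \<and>
        \<bar>P\<bar> \<le> N * Z * sqrt A / (real q)\<^sup>2)"
    using row_expansion by blast
  \<comment> \<open>The three entries serve the orbit asymptotics, the bound
    \<open>A \<le> 1/20\<close>, and \<open>Z * sqrt A \<le> 1/100\<close>.\<close>
  define E where "E = min (1 / 100000) (min (1 / (40 * 10 ^ 11)) (1 / (2 * 10 ^ 11 * (100 * Z)\<^sup>2)))"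
  have E0: "E > 0" using Z by (simp add: E_def)
  have "\<exists>m P. (\<Sum>k<q. sin (\<phi> k) * u (\<theta> k)) / (real q * sin (pi / real q)) = circle_phase.coef X u 0 * m + (\<Sum>n. circle_phase.coef X u (Suc n * q)) + P \<and>
        \<bar>m - 1\<bar> \<le> 1/2 \<and> \<bar>P\<bar> \<le> 1/100 * N / (real q)\<^sup>2"
    if cur: "curve z \<rho>" and c: "c > 0" and \<rho>: "\<And>t. \<rho> t = c * \<sigma> t ^ 3" and \<epsilon>: "0 \<le> \<epsilon>" "\<epsilon> \<le> E"
      and b1: "bC 7 \<epsilon> (\<lambda>t. \<sigma> t - 1)" and b3: "bC 7 \<epsilon> (\<lambda>t. \<sigma> t ^ 3 - 1)" and cp: "circle_phase \<sigma> X" and \<sigma>s: "\<And>t. \<sigma> (2 * pi - t) = \<sigma> t"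
      and q: "q \<ge> 2" and orb: "orbit z q \<theta> \<phi>" and u: "continuous_on UNIV u" "\<And>t. u (2 * pi - t) = u t"
      and N: "\<forall>j\<ge>1. \<bar>circle_phase.coef X u j\<bar> \<le> N / (real j)\<^sup>2" for z \<rho> c \<sigma> X \<epsilon> q \<theta> \<phi> u N
  proof -
    interpret circle_phase \<sigma> X by fact
    have N0: "N \<ge> 0" using N[rule_format, of 1] by simp
    obtain D where D: "D 0 = (\<lambda>t. \<sigma> t - 1)" "\<And>i x. i < 3 \<Longrightarrow> (D i has_real_derivative D (Suc i) x) (at x)" "\<And>i x. i \<le> 3 \<Longrightarrow> \<bar>D i x\<bar> \<le> \<epsilon>"
      using bC_chain[OF bC_le[OF b1, of 3]] by auto
    obtain F where F: "F 0 = (\<lambda>t. \<sigma> t ^ 3 - 1)" "\<And>i x. i < 3 \<Longrightarrow> (F i has_real_derivative F (Suc i) x) (at x)" "\<And>i x. i \<le> 3 \<Longrightarrow> \<bar>F i x\<bar> \<le> \<epsilon>"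
      using bC_chain[OF bC_le[OF b3, of 3]] by auto
    have D0: "(\<sigma> has_real_derivative D 1 x) (at x)" for x
      using DERIV_add[OF D(2)[of 0 x] DERIV_const[of 1]] by (simp add: D(1))
    have F0: "((\<lambda>t. \<sigma> t ^ 3) has_real_derivative F 1 x) (at x)" for x
      using DERIV_add[OF F(2)[of 0 x] DERIV_const[of 1]] by (simp add: F(1))
    have D1: "(D 1 has_real_derivative D 2 x) (at x)" "(D 2 has_real_derivative D 3 x) (at x)" for x using D(2)[of 1 x] D(2)[of 2 x] by (simp_all add: eval_nat_numeral)
    have F1: "(F 1 has_real_derivative F 2 x) (at x)" "(F 2 has_real_derivative F 3 x) (at x)" for x using F(2)[of 1 x] F(2)[of 2 x] by (simp_all add: eval_nat_numeral)
    have Db: "\<bar>\<sigma> x - 1\<bar> \<le> \<epsilon>" "\<bar>D 1 x\<bar> \<le> \<epsilon>" "\<bar>D 2 x\<bar> \<le> \<epsilon>" "\<bar>D 3 x\<bar> \<le> \<epsilon>" for x using D(3)[of 0 x] D(3)[of 1 x] D(3)[of 2 x] D(3)[of 3 x] D(1) by simp_all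
    have Fb: "\<bar>\<sigma> x ^ 3 - 1\<bar> \<le> \<epsilon>" "\<bar>F 1 x\<bar> \<le> \<epsilon>" "\<bar>F 2 x\<bar> \<le> \<epsilon>" "\<bar>F 3 x\<bar> \<le> \<epsilon>" for x using F(3)[of 0 x] F(3)[of 1 x] F(3)[of 2 x] F(3)[of 3 x] F(1) by simp_all
    have e5: "\<epsilon> \<le> 1 / 100000" using \<epsilon>(2) by (simp add: E_def)
    note asy = orbit_asymptotics[OF cur \<rho> c refl \<epsilon>(1) e5 D0 D1 Db F0 F1 Fb X_deriv X_0 X_2pi q orb]
    define A where "A = 2 * 10 ^ 11 * \<epsilon>"
    have A: "0 \<le> A" "A \<le> 1/20"
    proof -
      show "0 \<le> A" using \<epsilon>(1) by (simp add: A_def)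
      have "\<epsilon> \<le> 1 / (40 * 10 ^ 11)" using \<epsilon>(2) by (simp add: E_def)
      then show "A \<le> 1/20" by (simp add: A_def)
    qed
    have ZA: "Z * sqrt A \<le> 1/100"
    proof -
      have "\<epsilon> \<le> 1 / (2 * 10 ^ 11 * (100 * Z)\<^sup>2)" using \<epsilon>(2) by (simp add: E_def)
      then have "A \<le> 2 * 10 ^ 11 * (1 / (2 * 10 ^ 11 * (100 * Z)\<^sup>2))" unfolding A_def by (intro mult_left_mono) auto
      also have "\<dots> = (1 / (100 * Z))\<^sup>2" by (simp add: power_divide)
      finally have "sqrt A \<le> 1 / (100 * Z)" using Z by (intro real_le_lsqrt) auto
      then have "Z * sqrt A \<le> Z * (1 / (100 * Z))" using Z by (intro mult_left_mono) auto
      then show ?thesis using Z by simp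
    qed
    define s where "s = sin (pi / real q)"
    have q0: "real q > 0" "real q \<ge> 2" using q by auto
    have "pi / real q / 4 \<le> s" unfolding s_def using q0 by (intro sin_ge_quarter) (auto simp: field_simps)
    moreover have "1 / (2 * real q) \<le> pi / real q / 4" using q0 pi_gt3 by (simp add: field_simps)
    ultimately have s1: "1 / (2 * real q) \<le> s" by linarith
    then have s0: "s > 0" using q0 by (smt (verit) divide_pos_pos zero_less_mult_iff)
    \<comment> \<open>Since \<open>sin (pi / q)\<close> is at least \<open>1 / (2 * q)\<close>, the
      division costs one power of \<open>q\<close>; the asymptotics of the weights carry one more
      power for this reason.\<close>
    have dv: "\<bar>y\<bar> / s \<le> 2 * B / real q ^ n" if "\<bar>y\<bar> \<le> B / real q ^ Suc n" for y B n
    proof -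
      have B0: "0 \<le> B / real q ^ Suc n" using that by (meson abs_ge_zero order_trans)
      have "\<bar>y\<bar> / s \<le> (B / real q ^ Suc n) / (1 / (2 * real q))" using that s1 q0 B0 by (intro frac_le) auto
      also have "\<dots> = 2 * B / real q ^ n" using q0 by (simp add: field_simps)
      finally show ?thesis .
    qed
    define g where "g = (\<lambda>k. sin (\<phi> k) * \<sigma> (\<theta> k) / s)"
    define v where "v = (\<lambda>k. u (\<theta> k) / \<sigma> (\<theta> k))"
    have g1: "\<forall>k\<le>q. \<bar>g k - 1\<bar> \<le> A / (real q)\<^sup>2"
    proof (intro allI impI)
      fix k assume "k \<le> q"
      then have "\<bar>sin (\<phi> k) * \<sigma> (\<theta> k) - s\<bar> \<le> 10 ^ 11 * \<epsilon> / real q ^ Suc 2" using asy(4)[of k] by (simp add: s_def)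
      from dv[OF this] have "\<bar>sin (\<phi> k) * \<sigma> (\<theta> k) - s\<bar> / s \<le> A / (real q)\<^sup>2" by (simp add: A_def)
      moreover have "\<bar>g k - 1\<bar> = \<bar>sin (\<phi> k) * \<sigma> (\<theta> k) - s\<bar> / s"
      proof -
        have "g k - 1 = (sin (\<phi> k) * \<sigma> (\<theta> k) - s) / s" using s0 by (simp add: g_def diff_divide_distrib)
        then show ?thesis using s0 by (simp add: abs_divide)
      qed
      ultimately show "\<bar>g k - 1\<bar> \<le> A / (real q)\<^sup>2" by simp
    qed
    have g2: "\<forall>k<q. \<bar>g (Suc k) - g k\<bar> \<le> A / real q ^ 3"
    proof (intro allI impI)
      fix k assume "k < q"
      then have "\<bar>sin (\<phi> (Suc k)) * \<sigma> (\<theta> (Suc k)) - sin (\<phi> k) * \<sigma> (\<theta> k)\<bar> \<le> 10 ^ 11 * \<epsilon> / real q ^ Suc 3" using asy(3)[of k] by simp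
      from dv[OF this] have "\<bar>sin (\<phi> (Suc k)) * \<sigma> (\<theta> (Suc k)) - sin (\<phi> k) * \<sigma> (\<theta> k)\<bar> / s \<le> A / real q ^ 3" by (simp add: A_def)
      moreover have "\<bar>g (Suc k) - g k\<bar> = \<bar>sin (\<phi> (Suc k)) * \<sigma> (\<theta> (Suc k)) - sin (\<phi> k) * \<sigma> (\<theta> k)\<bar> / s"
      proof -
        have "g (Suc k) - g k = (sin (\<phi> (Suc k)) * \<sigma> (\<theta> (Suc k)) - sin (\<phi> k) * \<sigma> (\<theta> k)) / s" by (simp add: g_def diff_divide_distrib)
        then show ?thesis using s0 by (simp add: abs_divide)
      qed
      ultimately show "\<bar>g (Suc k) - g k\<bar> \<le> A / real q ^ 3" by simp
    qed
    have CA: "10 ^ 11 * \<epsilon> \<le> A" using \<epsilon>(1) by (simp add: A_def)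
    have x1: "\<forall>k\<le>q. \<bar>X (\<theta> k) - 2 * pi * real k / real q\<bar> \<le> A / (real q)\<^sup>2"
    proof (intro allI impI)
      fix k assume "k \<le> q"
      then have "\<bar>X (\<theta> k) - 2 * pi * real k / real q\<bar> \<le> 10 ^ 11 * \<epsilon> / (real q)\<^sup>2" using asy(2)[of k] by simp
      also have "\<dots> \<le> A / (real q)\<^sup>2" using CA by (intro divide_right_mono) auto
      finally show "\<bar>X (\<theta> k) - 2 * pi * real k / real q\<bar> \<le> A / (real q)\<^sup>2" .
    qed
    have x2: "\<forall>k<q. \<bar>X (\<theta> (Suc k)) - X (\<theta> k) - 2 * pi / real q\<bar> \<le> A / real q ^ 3"
    proof (intro allI impI)
      fix k assume "k < q"
      then have "\<bar>X (\<theta> (Suc k)) - X (\<theta> k) - 2 * pi / real q\<bar> \<le> 10 ^ 11 * \<epsilon> / real q ^ 3" using asy(1)[of k] by simp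
      also have "\<dots> \<le> A / real q ^ 3" using CA by (intro divide_right_mono) auto
      finally show "\<bar>X (\<theta> (Suc k)) - X (\<theta> k) - 2 * pi / real q\<bar> \<le> A / real q ^ 3" .
    qed
    have "summable (\<lambda>n. \<bar>coef u (Suc n)\<bar>)" using inverse_square_tails(1)[of 1 "coef u" N] N by simp
    then have sm: "summable (\<lambda>j. \<bar>coef u j\<bar>)" using summable_Suc_iff[of "\<lambda>j. \<bar>coef u j\<bar>"] by simp
    have vs: "\<forall>k<q. (\<lambda>j. coef u j * cos (real j * X (\<theta> k))) sums v k"
      unfolding v_def using orbit_angle_range[OF orb] by (intro allI impI fourier_repr u \<sigma>s sm) auto
    obtain m P where mP: "(\<Sum>k<q. g k * v k) / real q = coef u 0 * m + (\<Sum>n. coef u (Suc n * q)) + P" "\<bar>m - 1\<bar> \<le> A / (real q)\<^sup>2"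
        "\<bar>P\<bar> \<le> N * Z * sqrt A / (real q)\<^sup>2"
      using row[OF q A g1 g2 x1 x2 vs N] by blast
    have "(\<Sum>k<q. g k * v k) = (\<Sum>k<q. sin (\<phi> k) * u (\<theta> k)) / s"
      unfolding sum_divide_distrib
    proof (rule sum.cong[OF refl])
      show "g k * v k = sin (\<phi> k) * u (\<theta> k) / s" for k using \<sigma>_pos[of "\<theta> k"] by (simp add: g_def v_def)
    qed
    then have "(\<Sum>k<q. sin (\<phi> k) * u (\<theta> k)) / (real q * s) = coef u 0 * m + (\<Sum>n. coef u (Suc n * q)) + P"
      using mP(1) by (simp add: mult.commute)
    moreover have "\<bar>m - 1\<bar> \<le> 1/2"
    proof -
      have "1 \<le> (real q)\<^sup>2" using q0 by (simp add: one_le_power)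
      then have "A / (real q)\<^sup>2 \<le> A / 1" using A q0 by (intro divide_left_mono) auto
      then show ?thesis using mP(2) A by linarith
    qed
    moreover have "\<bar>P\<bar> \<le> 1/100 * N / (real q)\<^sup>2"
    proof -
      have "N * (Z * sqrt A) \<le> N * (1/100)" by (rule mult_left_mono[OF ZA N0])
      then have "N * Z * sqrt A / (real q)\<^sup>2 \<le> 1/100 * N / (real q)\<^sup>2" by (intro divide_right_mono) auto
      then show ?thesis using mP(3) by linarith
    qed
    ultimately show ?thesis unfolding s_def by blast
  qed
  then show ?thesis using E0 by blast
qed

section \<open>Comparison of the maximal lengths of two curves\<close>

definition max_length :: "(real \<Rightarrow> real^2) \<Rightarrow> nat \<Rightarrow> real" where
  "max_length z q = Sup (poly_length z q ` sym_polys q)"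

lemma (in sym_curve) max_length_attained:
  assumes "q \<ge> 2"
  obtains \<theta> where "\<theta> \<in> sym_polys q" "poly_length z q \<theta> = max_length z q" "\<And>\<theta>'. \<theta>' \<in> sym_polys q \<Longrightarrow> poly_length z q \<theta>' \<le> poly_length z q \<theta>"
proof -
  obtain \<theta> where \<theta>: "\<theta> \<in> sym_polys q" "\<And>\<theta>'. \<theta>' \<in> sym_polys q \<Longrightarrow> poly_length z q \<theta>' \<le> poly_length z q \<theta>" using ex_max_poly[OF assms] by blast
  then have "max_length z q = poly_length z q \<theta>" unfolding max_length_def by (intro cSup_eq_maximum) auto
  with \<theta> show thesis using that by metis
qed

text \<open>Polygons are given by tangent angles, so the maximal polygon of one curve is a
  competitor on the other; \<open>poly_length_compare\<close> then bounds its length there from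
  below by first-order terms.\<close>

lemma max_length_compare:
  assumes "sym_curve z \<rho>" "sym_curve z' \<rho>'" "q \<ge> 2"
  obtains \<theta> \<phi> where "orbit z q \<theta> \<phi>" "max_length z q + 2 * (\<Sum>k<q. sin (\<phi> k) * ((z' (\<theta> k) - z (\<theta> k)) \<bullet> Nv (\<theta> k))) \<le> max_length z' q"
proof -
  interpret A: sym_curve z \<rho> by fact
  interpret B: sym_curve z' \<rho>' by fact
  obtain \<theta> where \<theta>: "\<theta> \<in> sym_polys q" "poly_length z q \<theta> = max_length z q" "\<And>\<theta>'. \<theta>' \<in> sym_polys q \<Longrightarrow> poly_length z q \<theta>' \<le> poly_length z q \<theta>"
    using A.max_length_attained[OF assms(3)] by blast
  obtain \<theta>' where \<theta>': "poly_length z' q \<theta>' = max_length z' q" "\<And>\<theta>''. \<theta>'' \<in> sym_polys q \<Longrightarrow> poly_length z' q \<theta>'' \<le> poly_length z' q \<theta>'"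
    using B.max_length_attained[OF assms(3)] by metis
  obtain \<phi> where orb: "orbit z q \<theta> \<phi>" using A.max_poly_orbit[OF assms(3) \<theta>(1,3)] by blast
  have z0: "z 0 = 0" "z (2*pi) = 0" "z' 0 = 0" "z' (2*pi) = 0" using A.z_0 B.z_0 A.z_per[of 0] B.z_per[of 0] by auto
  have "poly_length z q \<theta> + (\<Sum>k\<in>{1..<q}. 2 * sin (\<phi> k) * ((z' (\<theta> k) - z (\<theta> k)) \<bullet> Nv (\<theta> k))) \<le> poly_length z' q \<theta>"
    using poly_length_compare[OF _ orb z0] assms(3) by simp
  also have "\<dots> \<le> max_length z' q" using \<theta>'(1) \<theta>'(2)[OF \<theta>(1)] by simp
  finally have "max_length z q + (\<Sum>k\<in>{1..<q}. 2 * sin (\<phi> k) * ((z' (\<theta> k) - z (\<theta> k)) \<bullet> Nv (\<theta> k))) \<le> max_length z' q" unfolding \<theta>(2) .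
  \<comment> \<open>The term \<open>k = 0\<close> vanishes because both curves pass through the
    origin at angle 0.\<close>
  moreover have "(\<Sum>k\<in>{1..<q}. 2 * sin (\<phi> k) * ((z' (\<theta> k) - z (\<theta> k)) \<bullet> Nv (\<theta> k))) = 2 * (\<Sum>k<q. sin (\<phi> k) * ((z' (\<theta> k) - z (\<theta> k)) \<bullet> Nv (\<theta> k)))"
    unfolding sum_distrib_left
  proof (rule sum.mono_neutral_cong_left)
    have "\<theta> 0 = 0" using orb by (simp add: orbit_def)
    then show "\<forall>k\<in>{..<q} - {1..<q}. 2 * (sin (\<phi> k) * ((z' (\<theta> k) - z (\<theta> k)) \<bullet> Nv (\<theta> k))) = 0" using z0 by (auto simp: not_le)
  qed auto
  ultimately show thesis using that[OF orb] by simp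
qed

lemma inner_has_derivative:
  fixes f g :: "real \<Rightarrow> real^2"
  assumes "(f has_vector_derivative f') (at t)" "(g has_vector_derivative g') (at t)"
  shows "((\<lambda>t. f t \<bullet> g t) has_real_derivative f t \<bullet> g' + f' \<bullet> g t) (at t)"
  unfolding has_real_derivative_iff_has_vector_derivative
  by (rule bounded_bilinear.has_vector_derivative[OF bounded_bilinear_inner assms])

text \<open>\<open>z \<bullet> Nv\<close> is the support function, so \<open>u\<close> is a
  difference of support functions and satisfies \<open>u'' + u = \<rho>1 - \<rho>0\<close>. The
  constant 7 exceeds a full turn \<open>2 * pi\<close>.\<close>

lemma support_difference:
  assumes "sym_curve z0 \<rho>0" "sym_curve z1 \<rho>1"
    and u_def: "u = (\<lambda>t. (z1 t - z0 t) \<bullet> Nv t)" and u1_def: "u1 = (\<lambda>t. (z1 t - z0 t) \<bullet> Tv t)"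
  shows "\<And>t. (u has_real_derivative u1 t) (at t)" "\<And>t. (u1 has_real_derivative \<rho>1 t - \<rho>0 t - u t) (at t)"
    "\<And>t. u (t + 2 * pi) = u t" "\<And>t. u (2 * pi - t) = u t" "u 0 = 0" "u1 0 = 0" "u1 (2 * pi) = 0"
    "\<And>B t. (\<And>t. \<bar>\<rho>1 t - \<rho>0 t\<bar> \<le> B) \<Longrightarrow> \<bar>u t\<bar> \<le> 7 * B \<and> \<bar>u1 t\<bar> \<le> 7 * B"
proof -
  interpret A: sym_curve z0 \<rho>0 by fact
  interpret B: sym_curve z1 \<rho>1 by fact
  have w: "((\<lambda>t. z1 t - z0 t) has_vector_derivative (\<rho>1 t - \<rho>0 t) *\<^sub>R Tv t) (at t)" for t
    using has_vector_derivative_diff[OF B.z_deriv A.z_deriv] by (simp add: scaleR_diff_left)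
  show "(u has_real_derivative u1 t) (at t)" for t
    using inner_has_derivative[OF w Nv_has_vector_derivative] unfolding u_def u1_def by (simp add: inner_Tv_Nv)
  show "(u1 has_real_derivative \<rho>1 t - \<rho>0 t - u t) (at t)" for t
    using inner_has_derivative[OF w Tv_has_vector_derivative] unfolding u_def u1_def by (simp add: inner_Tv_Tv)
  have Nper: "Nv (t + 2 * pi) = Nv t" for t by (simp add: vec2_eq_iff)
  show per: "u (t + 2 * pi) = u t" for t by (simp add: u_def Nper A.z_per B.z_per)
  have per1: "u1 (t + 2 * pi) = u1 t" for t by (simp add: u1_def A.z_per B.z_per)
  have ev: "u (- t) = u t" for t unfolding u_def A.z_sym B.z_sym Rf_Nv[symmetric] Rf_simps(1)[symmetric] by (rule Rf_simps(7))
  show "u (2 * pi - t) = u t" for t using per[of "- t"] ev[of t] by (simp add: add.commute)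
  show "u 0 = 0" "u1 0 = 0" by (simp_all add: u_def u1_def A.z_0 B.z_0)
  then show "u1 (2 * pi) = 0" using per1[of 0] by simp
  show "\<bar>u t\<bar> \<le> 7 * B \<and> \<bar>u1 t\<bar> \<le> 7 * B" if B: "\<And>t. \<bar>\<rho>1 t - \<rho>0 t\<bar> \<le> B" for B t
  proof -
    obtain m :: int where m: "0 \<le> t + 2 * pi * of_int m" "t + 2 * pi * of_int m < 0 + 2 * pi" using reduce_2pi[of 0 t] by blast
    define s where "s = t + 2 * pi * of_int m"
    have us: "u t = u s" "u1 t = u1 s" unfolding s_def by (simp_all add: periodic_int[of u, OF per] periodic_int[of u1, OF per1])
    have B0: "B \<ge> 0" using B[of 0] by linarith
    have "norm ((z1 s - z0 s) - (z1 0 - z0 0)) \<le> B * \<bar>s - 0\<bar>"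
      by (rule lipschitz_of_vector_derivative[where f = "\<lambda>t. z1 t - z0 t", OF w]) (use B in simp)
    then have "norm (z1 s - z0 s) \<le> B * s" using m by (simp add: A.z_0 B.z_0 s_def)
    also have "\<dots> \<le> B * 7" using m B0 pi_approx unfolding s_def[symmetric] by (intro mult_left_mono) auto
    finally have n: "norm (z1 s - z0 s) \<le> 7 * B" by simp
    have "\<bar>u s\<bar> \<le> norm (z1 s - z0 s)" "\<bar>u1 s\<bar> \<le> norm (z1 s - z0 s)"
      using Cauchy_Schwarz_ineq2[of "z1 s - z0 s" "Nv s"] Cauchy_Schwarz_ineq2[of "z1 s - z0 s" "Tv s"] by (simp_all add: u_def u1_def)
    then show ?thesis using n us by simp
  qed
qed

text \<open>The equation \<open>u'' = f - u\<close> expresses each further derivative through lower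
  ones, at the cost of one \<open>B\<close> per order; \<open>u\<close> and \<open>u1\<close> are
  carried together.\<close>

lemma bC_oscillator:
  assumes "bC m B f" "\<And>x. (u has_real_derivative u1 x) (at x)" "\<And>x. (u1 has_real_derivative f x - u x) (at x)"
    "\<And>x. \<bar>u x\<bar> \<le> B'" "\<And>x. \<bar>u1 x\<bar> \<le> B'"
  shows "bC m (real m * B + B') u"
proof -
  have "bC m (real m * B + B') u \<and> bC m (real m * B + B') u1"
    using assms(1)
  proof (induction m)
    case 0 then show ?case using assms(4,5) by simp
  next
    case (Suc m)
    have B: "B \<ge> 0" using bC_nonneg[OF Suc.prems] .
    have f: "bC m B f" using Suc.prems by (rule bC_Suc_imp)
    have u: "bC m (real m * B + B') u" "bC m (real m * B + B') u1" using Suc.IH[OF f] by auto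
    have eq: "real (Suc m) * B + B' = B + (real m * B + B')" by (simp add: algebra_simps)
    have le: "B' \<le> real (Suc m) * B + B'" "real m * B + B' \<le> real (Suc m) * B + B'" using B by (auto simp: algebra_simps)
    have d: "bC m (real (Suc m) * B + B') (\<lambda>x. f x - u x)" unfolding eq by (rule bC_diff[OF f u(1)])
    have u1: "bC m (real (Suc m) * B + B') u1" by (rule bC_mono[OF u(2) le(2)])
    have "bC (Suc m) (real (Suc m) * B + B') u" by (rule bC_SucI[OF order_trans[OF assms(4) le(1)] assms(2) u1])
    moreover have "bC (Suc m) (real (Suc m) * B + B') u1" by (rule bC_SucI[OF order_trans[OF assms(5) le(1)] assms(3) d])
    ultimately show ?case by blast
  qed
  then show ?thesis by blast
qed

text \<open>Weights 15 and 9 in the geometric mean of the two bounds for \<open>x\<close> cancel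
  \<open>J\<close>, as \<open>3 * 15 = 5 * 9\<close>. What remains is the power 25 of
  \<open>S\<close> against \<open>x ^ 24\<close>, and the surplus factor
  \<open>\<Delta> \<le> K3 * e\<close> supplies the smallness. Integer powers replace the exponent
  25/24.\<close>

lemma superlinear_gain:
  fixes x S y e \<Delta> J K2 K3 :: real
  assumes x: "0 \<le> x" "x \<le> K2 * J ^ 3 * S * y" "x \<le> K3 * e / J ^ 5" and y: "y ^ 3 = S ^ 2 * e" and S: "S = 80 * \<Delta>" "\<Delta> \<le> K3 * e"
    and pos: "J > 0" "\<Delta> > 0" "e > 0" "K2 > 0" "K3 > 0" and small: "K2 ^ 15 * K3 ^ 10 * 80 ^ 25 * e ^ 15 \<le> (1/2) ^ 24"
  shows "x \<le> \<Delta> / 2"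
proof -
  have "x ^ 24 = x ^ 15 * x ^ 9" by (simp flip: power_add)
  also have "\<dots> \<le> (K2 * J ^ 3 * S * y) ^ 15 * (K3 * e / J ^ 5) ^ 9"
    using x by (intro mult_mono power_mono zero_le_power) auto
  also have "\<dots> = K2 ^ 15 * K3 ^ 9 * e ^ 9 * S ^ 15 * y ^ 15 * (J ^ 45 / J ^ 45)"
    by (simp add: power_mult_distrib power_divide flip: power_mult)
  also have "\<dots> = K2 ^ 15 * K3 ^ 9 * e ^ 9 * S ^ 15 * (y ^ 3) ^ 5" using pos by (simp flip: power_mult)
  also have "\<dots> = K2 ^ 15 * K3 ^ 9 * (e ^ 9 * e ^ 5) * (S ^ 15 * S ^ 10)" by (simp add: y power_mult_distrib flip: power_mult)
  also have "\<dots> = K2 ^ 15 * K3 ^ 9 * e ^ 14 * S ^ 25" by (simp flip: power_add)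
  also have "\<dots> = K2 ^ 15 * K3 ^ 9 * e ^ 14 * 80 ^ 25 * \<Delta> ^ 24 * \<Delta>" by (simp add: S power_mult_distrib eval_nat_numeral)
  also have "\<dots> \<le> K2 ^ 15 * K3 ^ 9 * e ^ 14 * 80 ^ 25 * \<Delta> ^ 24 * (K3 * e)" using S pos by (intro mult_left_mono) auto
  also have "\<dots> = (K2 ^ 15 * (K3 ^ 9 * K3) * 80 ^ 25 * (e ^ 14 * e)) * \<Delta> ^ 24" by (simp only: ac_simps)
  also have "\<dots> = (K2 ^ 15 * K3 ^ 10 * 80 ^ 25 * e ^ 15) * \<Delta> ^ 24"
    using power_Suc2[of K3 9, symmetric] power_Suc2[of e 14, symmetric] by simp
  also have "\<dots> \<le> (1/2) ^ 24 * \<Delta> ^ 24" using small pos by (intro mult_right_mono) auto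
  also have "\<dots> = (\<Delta> / 2) ^ 24" by (simp add: power_divide)
  finally have "x ^ Suc 23 \<le> (\<Delta> / 2) ^ Suc 23" by simp
  then show ?thesis by (rule power_le_imp_le_base) (use pos in simp)
qed

text \<open>By contradiction at the least constant \<open>\<Delta>\<close>: if it were positive, the
  coefficient differences would satisfy the same decay with \<open>\<Delta> / 2\<close>. All
  quantities are divided by \<open>c0\<close>, so the first curve has radius near 1 and the second
  near \<open>k = c1 / c0\<close>, a ratio that is controlled only after \<open>a 0 = 0\<close> is
  known.\<close>

lemma curves_equal_of_max_lengths:
  "\<exists>E>0. \<forall>\<epsilon> z0 \<rho>0 c0 z1 \<rho>1 c1. 0 < \<epsilon> \<longrightarrow> \<epsilon> \<le> E \<longrightarrow> sym_curve z0 \<rho>0 \<longrightarrow> sym_curve z1 \<rho>1 \<longrightarrow> c0 > 0 \<longrightarrow> c1 > 0 \<longrightarrow>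
     bC 7 \<epsilon> (\<lambda>t. \<rho>0 t / c0 - 1) \<longrightarrow> bC 7 \<epsilon> (\<lambda>t. \<rho>1 t / c1 - 1) \<longrightarrow> (\<forall>q\<ge>2. max_length z0 q = max_length z1 q) \<longrightarrow> z0 = z1"
proof -
  obtain C where C: "C \<ge> 1" and dens: "\<And>\<rho> c \<epsilon>. c > 0 \<Longrightarrow> 0 \<le> \<epsilon> \<Longrightarrow> C * \<epsilon> \<le> 1/2 \<Longrightarrow> bC 7 \<epsilon> (\<lambda>t. \<rho> t / c - 1) \<Longrightarrow> (\<forall>t. \<rho> (t + 2 * pi) = \<rho> t) \<Longrightarrow> (\<forall>t. \<rho> (- t) = \<rho> t) \<Longrightarrow>
    (\<exists>X c'. c' > 0 \<and> (\<forall>t. \<rho> t = c' * density \<rho> t ^ 3) \<and> bC 7 (C * \<epsilon>) (\<lambda>t. density \<rho> t - 1) \<and> bC 7 (C * \<epsilon>) (\<lambda>t. density \<rho> t ^ 3 - 1) \<and>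
      bC 7 2 (\<lambda>t. 1 / density \<rho> t) \<and> phase (density \<rho>) (\<lambda>t. 1 / density \<rho> t) X \<and> circle_phase (density \<rho>) X \<and> (\<forall>t. density \<rho> (2 * pi - t) = density \<rho> t))"
    using density_near_one by blast
  obtain E1 where E1r: "E1 > 0 \<and> (\<forall>z \<rho> c \<sigma> X \<epsilon> q \<theta> \<phi> u N. curve z \<rho> \<longrightarrow> c > 0 \<longrightarrow> (\<forall>t. \<rho> t = c * \<sigma> t ^ 3) \<longrightarrow> 0 \<le> \<epsilon> \<longrightarrow> \<epsilon> \<le> E1 \<longrightarrow>
     bC 7 \<epsilon> (\<lambda>t. \<sigma> t - 1) \<longrightarrow> bC 7 \<epsilon> (\<lambda>t. \<sigma> t ^ 3 - 1) \<longrightarrow> circle_phase \<sigma> X \<longrightarrow> (\<forall>t. \<sigma> (2 * pi - t) = \<sigma> t) \<longrightarrow> q \<ge> 2 \<longrightarrow> orbit z q \<theta> \<phi> \<longrightarrow>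
     continuous_on UNIV u \<longrightarrow> (\<forall>t. u (2 * pi - t) = u t) \<longrightarrow> (\<forall>j\<ge>1. \<bar>circle_phase.coef X u j\<bar> \<le> N / (real j)\<^sup>2) \<longrightarrow>
     (\<exists>m P. (\<Sum>k<q. sin (\<phi> k) * u (\<theta> k)) / (real q * sin (pi / real q)) = circle_phase.coef X u 0 * m + (\<Sum>n. circle_phase.coef X u (Suc n * q)) + P \<and>
        \<bar>m - 1\<bar> \<le> 1/2 \<and> \<bar>P\<bar> \<le> 1/100 * N / (real q)\<^sup>2))"
    using orbit_row ..
  note E1 = conjunct1[OF E1r]
  note row = conjunct2[OF E1r, rule_format (no_asm)]
  obtain Cd where Cdo: "Cd \<ge> 0 \<and> (\<forall>f g \<sigma> X B j. bC 7 B f \<longrightarrow> (\<forall>x. f (x + 2 * pi) = f x) \<longrightarrow> bC 7 2 g \<longrightarrow> phase \<sigma> g X \<longrightarrow> 1 \<le> j \<longrightarrow>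
     \<bar>integral {0..2*pi} (\<lambda>x. f x * cos (real j * X x))\<bar> \<le> Cd * B / real j ^ 7 \<and> \<bar>integral {0..2*pi} (\<lambda>x. f x * sin (real j * X x))\<bar> \<le> Cd * B / real j ^ 7)"
    using oscillatory_decay[of 7] ..
  note Cd = conjunct1[OF Cdo]
  note osc = conjunct1[OF conjunct2[OF Cdo, rule_format (no_asm)]]
  \<comment> \<open>Chosen so that \<open>80 * K3 \<le> K1\<close>, which later bounds
    \<open>S\<close> by \<open>K1 * y\<close>.\<close>
  define K1 where "K1 = 1 + 80 * (2 * Cd + 1)"
  define K2 where "K2 = 600 * (6 + K1)"
  define K3 where "K3 = 2 * Cd + 1"
  have K: "K1 \<ge> 1" "K2 > 0" "K3 > 0" using Cd by (simp_all add: K1_def K2_def K3_def)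
  define K4 where "K4 = K2 ^ 15 * K3 ^ 10 * 80 ^ 25"
  have K4: "K4 > 0" using K by (simp add: K4_def)
  \<comment> \<open>The 84 is \<open>14 * 6\<close>: the bound \<open>6 * \<epsilon>\<close> for
    \<open>f\<close>, multiplied by the factor 14 in passing to \<open>u\<close>.\<close>
  define E where "E = min (1 / (2 * C)) (min (E1 / C) (min (1/100) ((1/2) ^ 24 / K4 / 84)))"
  have E0: "E > 0" using C E1 K4 by (simp add: E_def)
  have "z0 = z1"
    if \<epsilon>: "0 < \<epsilon>" "\<epsilon> \<le> E" and sc0: "sym_curve z0 \<rho>0" and sc1: "sym_curve z1 \<rho>1" and c0: "c0 > 0" and c1: "c1 > 0"
      and b0: "bC 7 \<epsilon> (\<lambda>t. \<rho>0 t / c0 - 1)" and b1: "bC 7 \<epsilon> (\<lambda>t. \<rho>1 t / c1 - 1)" and ml: "\<forall>q\<ge>2. max_length z0 q = max_length z1 q"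
    for \<epsilon> z0 \<rho>0 c0 z1 \<rho>1 c1
  proof -
    interpret Z0: sym_curve z0 \<rho>0 by fact
    interpret Z1: sym_curve z1 \<rho>1 by fact
    have Ce: "C * \<epsilon> \<le> 1/2" and CeE: "C * \<epsilon> \<le> E1" and e100: "\<epsilon> \<le> 1/100" and e4: "84 * \<epsilon> \<le> (1/2) ^ 24 / K4"
    proof -
      have "\<epsilon> \<le> 1 / (2 * C)" "\<epsilon> \<le> E1 / C" using \<epsilon>(2) by (simp_all add: E_def)
      then show "C * \<epsilon> \<le> 1/2" "C * \<epsilon> \<le> E1" using C by (simp_all add: field_simps)
      have "\<epsilon> \<le> (1/2) ^ 24 / K4 / 84" using \<epsilon>(2) unfolding E_def by (meson min.boundedE)
      moreover have "84 * x \<le> Q" if "x \<le> Q / 84" for x Q :: real using that by simp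
      ultimately show "84 * \<epsilon> \<le> (1/2) ^ 24 / K4" by blast
      show "\<epsilon> \<le> 1/100" using \<epsilon>(2) by (simp add: E_def)
    qed
    have Cn: "0 \<le> C * \<epsilon>" using C \<epsilon> by simp
    define r0 where "r0 = (\<lambda>t. \<rho>0 t / c0)"
    define r1 where "r1 = (\<lambda>t. \<rho>1 t / c0)"
    define k where "k = c1 / c0"
    have k0: "k > 0" using c0 c1 by (simp add: k_def)
    have rk: "r1 t / k = \<rho>1 t / c1" for t using c0 by (simp add: r1_def k_def)
    have br0: "bC 7 \<epsilon> (\<lambda>t. r0 t / 1 - 1)" using b0 by (simp add: r0_def)
    have br1: "bC 7 \<epsilon> (\<lambda>t. r1 t / k - 1)" using b1 by (simp add: rk)
    have per: "\<forall>t. r0 (t + 2 * pi) = r0 t" "\<forall>t. r1 (t + 2 * pi) = r1 t" and ev: "\<forall>t. r0 (- t) = r0 t" "\<forall>t. r1 (- t) = r1 t"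
      by (simp_all add: r0_def r1_def Z0.\<rho>_per Z1.\<rho>_per Z0.\<rho>_sym Z1.\<rho>_sym)
    define \<sigma>0 \<sigma>1 where "\<sigma>0 = density r0" and "\<sigma>1 = density r1"
    obtain X0 d0 where N0: "d0 > 0" "\<forall>t. r0 t = d0 * \<sigma>0 t ^ 3" "bC 7 (C * \<epsilon>) (\<lambda>t. \<sigma>0 t - 1)" "bC 7 (C * \<epsilon>) (\<lambda>t. \<sigma>0 t ^ 3 - 1)"
      "bC 7 2 (\<lambda>t. 1 / \<sigma>0 t)" "phase \<sigma>0 (\<lambda>t. 1 / \<sigma>0 t) X0" "circle_phase \<sigma>0 X0" "\<forall>t. \<sigma>0 (2 * pi - t) = \<sigma>0 t"
      using dens[OF _ _ Ce br0 per(1) ev(1)] \<epsilon>(1) unfolding \<sigma>0_def by auto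
    obtain X1 d1 where N1: "d1 > 0" "\<forall>t. r1 t = d1 * \<sigma>1 t ^ 3" "bC 7 (C * \<epsilon>) (\<lambda>t. \<sigma>1 t - 1)" "bC 7 (C * \<epsilon>) (\<lambda>t. \<sigma>1 t ^ 3 - 1)"
      "bC 7 2 (\<lambda>t. 1 / \<sigma>1 t)" "phase \<sigma>1 (\<lambda>t. 1 / \<sigma>1 t) X1" "circle_phase \<sigma>1 X1" "\<forall>t. \<sigma>1 (2 * pi - t) = \<sigma>1 t"
      using dens[OF k0 _ Ce br1 per(2) ev(2)] \<epsilon>(1) unfolding \<sigma>1_def by auto
    interpret P0: circle_phase \<sigma>0 X0 by fact
    interpret P1: circle_phase \<sigma>1 X1 by fact
    define w where "w = (\<lambda>t. (z1 t - z0 t) \<bullet> Nv t)"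
    define w1 where "w1 = (\<lambda>t. (z1 t - z0 t) \<bullet> Tv t)"
    note sd = support_difference[OF sc0 sc1 w_def w1_def]
    define u where "u = (\<lambda>t. w t / c0)"
    define u1 where "u1 = (\<lambda>t. w1 t / c0)"
    define f where "f = (\<lambda>t. r1 t - r0 t)"
    have ud: "(u has_real_derivative u1 t) (at t)" for t unfolding u_def u1_def by (rule DERIV_cdivide[OF sd(1)])
    have u1d: "(u1 has_real_derivative f t - u t) (at t)" for t
      using DERIV_cdivide[OF sd(2)[of t], of c0] by (simp add: u1_def u_def f_def r0_def r1_def diff_divide_distrib)
    have uper: "\<forall>t. u (t + 2 * pi) = u t" and usym: "\<forall>t. u (2 * pi - t) = u t" and u0: "u 0 = 0" "u1 0 = 0" "u1 (2 * pi) = 0"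
      by (simp_all add: u_def u1_def sd(3-7))
    have uc: "continuous_on S u" for S using ud by (meson DERIV_isCont continuous_at_imp_continuous_on)
    have ub: "\<bar>u t\<bar> \<le> 7 * B \<and> \<bar>u1 t\<bar> \<le> 7 * B" if "\<And>t. \<bar>f t\<bar> \<le> B" for B t
    proof -
      have "\<bar>\<rho>1 t - \<rho>0 t\<bar> \<le> B * c0" for t
        using that[of t] c0 by (simp add: f_def r0_def r1_def abs_divide pos_divide_le_eq flip: diff_divide_distrib)
      from sd(8)[OF this, of t] show ?thesis using c0 by (simp add: u_def u1_def abs_divide pos_divide_le_eq algebra_simps)
    qed
    have ubC: "bC 7 (14 * B) u" if "bC 7 B f" for B
    proof -
      have "bC 7 (real 7 * B + 7 * B) u" using ub[OF bC_abs[OF that]] by (intro bC_oscillator[OF that ud u1d]) auto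
      then show ?thesis by (rule bC_mono) (use bC_nonneg[OF that] in simp)
    qed
    define a b where "a = P0.coef u" and "b = P1.coef u"
    have adec: "\<bar>a j\<bar> \<le> Cd * B / real j ^ 7" "\<bar>b j\<bar> \<le> Cd * B / real j ^ 7" if B: "bC 7 B u" and j: "j \<ge> 1" for B j
    proof -
      have nr: "P0.nrm j = pi" using j by (simp add: P0.nrm_def)
      have le: "\<bar>I / pi\<bar> \<le> Q" if "\<bar>I\<bar> \<le> Q" for I Q :: real
      proof -
        have "\<bar>I\<bar> * 1 \<le> \<bar>I\<bar> * pi" using pi_gt3 by (intro mult_left_mono) auto
        also have "\<dots> \<le> Q * pi" using that by (intro mult_right_mono) auto
        finally show ?thesis by (simp add: abs_divide pos_divide_le_eq)
      qed
      show "\<bar>a j\<bar> \<le> Cd * B / real j ^ 7" unfolding a_def P0.coef_def nr by (rule le[OF osc[OF B uper N0(5,6) j]])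
      show "\<bar>b j\<bar> \<le> Cd * B / real j ^ 7" unfolding b_def P1.coef_def nr by (rule le[OF osc[OF B uper N1(5,6) j]])
    qed
    have sq: "Q / real j ^ 7 \<le> Q / (real j)\<^sup>2" if "j \<ge> 1" "Q \<ge> 0" for j :: nat and Q :: real
    proof -
      have "(real j)\<^sup>2 \<le> real j ^ 7" using that by (intro power_increasing) auto
      then show ?thesis using that by (intro divide_left_mono) auto
    qed
    \<comment> \<open>A crude bound that depends on \<open>k\<close>; it guarantees that the least
      decay constants \<open>N\<close> and \<open>\<Delta>\<close> exist.\<close>
    obtain B where B: "bC 7 B u"
    proof -
      have "bC 7 ((\<bar>k\<bar> * \<epsilon> + \<bar>k\<bar>) + (\<epsilon> + \<bar>1\<bar>)) (\<lambda>t. (k * (r1 t / k - 1) + k) - ((r0 t / 1 - 1) + 1))"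
        by (intro bC_diff bC_add bC_cmult br0 br1 bC_const)
      moreover have "(k * (r1 t / k - 1) + k) - ((r0 t / 1 - 1) + 1) = f t" for t using k0 by (simp add: f_def right_diff_distrib)
      ultimately have "bC 7 ((\<bar>k\<bar> * \<epsilon> + \<bar>k\<bar>) + (\<epsilon> + \<bar>1\<bar>)) f" by (simp only:)
      from ubC[OF this] show thesis by (rule that)
    qed
    have CB: "Cd * B \<ge> 0" using Cd bC_nonneg[OF B] by simp
    have "\<forall>j\<ge>1. \<bar>a j\<bar> \<le> (Cd * B) / (real j)\<^sup>2" using adec(1)[OF B] sq[OF _ CB] by (meson order_trans)
    then obtain N where N: "\<forall>j\<ge>1. \<bar>a j\<bar> \<le> N / (real j)\<^sup>2" "\<And>N'. \<forall>j\<ge>1. \<bar>a j\<bar> \<le> N' / (real j)\<^sup>2 \<Longrightarrow> N \<le> N'"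
      using least_decay_constant[of a] by metis
    have diffdec: "\<bar>b j - a j\<bar> \<le> (2 * Cd * B) / real j ^ 7" if B: "bC 7 B u" and j: "j \<ge> 1" for B j
    proof -
      have "2 * Cd * B / real j ^ 7 = Cd * B / real j ^ 7 + Cd * B / real j ^ 7" by (simp flip: add_divide_distrib)
      then show ?thesis using adec[OF B j] by linarith
    qed
    have "\<forall>j\<ge>1. \<bar>b j - a j\<bar> \<le> (2 * Cd * B) / (real j)\<^sup>2"
      using CB by (intro allI impI order_trans[OF diffdec[OF B] sq]) (auto simp: mult.commute)
    then obtain \<Delta> where \<Delta>: "\<forall>j\<ge>1. \<bar>b j - a j\<bar> \<le> \<Delta> / (real j)\<^sup>2" "\<And>M. \<forall>j\<ge>1. \<bar>b j - a j\<bar> \<le> M / (real j)\<^sup>2 \<Longrightarrow> \<Delta> \<le> M"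
      using least_decay_constant[of "\<lambda>j. b j - a j"] by metis
    have bN: "\<forall>j\<ge>1. \<bar>b j\<bar> \<le> (N + \<Delta>) / (real j)\<^sup>2"
    proof (intro allI impI)
      fix j :: nat assume "j \<ge> 1"
      then have "\<bar>a j\<bar> \<le> N / (real j)\<^sup>2" "\<bar>b j - a j\<bar> \<le> \<Delta> / (real j)\<^sup>2" using N(1) \<Delta>(1) by auto
      then show "\<bar>b j\<bar> \<le> (N + \<Delta>) / (real j)\<^sup>2" unfolding add_divide_distrib by linarith
    qed
    have sm: "summable (\<lambda>j. \<bar>a j\<bar>)"
      using inverse_square_tails(1)[of 1 a N] N(1) summable_Suc_iff[of "\<lambda>j. \<bar>a j\<bar>"] by simp
    have four: "(\<lambda>j. a j * cos (real j * X0 t)) sums (u t / \<sigma>0 t)" if "t \<in> {0..2*pi}" for t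
      unfolding a_def by (rule P0.fourier_repr[OF uc _ _ _ that]) (use usym N0(8) sm in \<open>auto simp: a_def\<close>)
    \<comment> \<open>The expansion at angle 0, where \<open>u\<close> vanishes; it stands in for
      the equation missing at \<open>q = 1\<close>.\<close>
    have asum: "a 0 + (\<Sum>n. a (Suc n)) = 0"
    proof -
      have s: "a sums 0" using four[of 0] by (simp add: P0.X_0 u0)
      then have "(\<lambda>n. a (Suc n)) sums (0 - a 0)" using sums_Suc_iff[of a] by simp
      then show ?thesis by (simp add: sums_iff)
    qed
    \<comment> \<open>The zeroth coefficient is the plain mean of \<open>u\<close>, the same for
      both phases.\<close>
    have b0a0: "b 0 = a 0" by (simp add: a_def b_def P0.coef_def P1.coef_def P0.nrm_def)
    have ex0: "\<exists>R. R \<le> 0 \<and> (\<exists>m P. R = a 0 * m + (\<Sum>n. a (Suc n * q)) + P \<and> \<bar>m - 1\<bar> \<le> 1/2 \<and> \<bar>P\<bar> \<le> 1/100 * N / (real q)\<^sup>2)"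
      if q: "q \<ge> 2" for q
    proof -
      obtain \<theta> \<phi> where o: "orbit z0 q \<theta> \<phi>" and le: "max_length z0 q + 2 * (\<Sum>k<q. sin (\<phi> k) * ((z1 (\<theta> k) - z0 (\<theta> k)) \<bullet> Nv (\<theta> k))) \<le> max_length z1 q"
        using max_length_compare[OF sc0 sc1 q] by blast
      have "(\<Sum>k<q. sin (\<phi> k) * u (\<theta> k)) = (\<Sum>k<q. sin (\<phi> k) * ((z1 (\<theta> k) - z0 (\<theta> k)) \<bullet> Nv (\<theta> k))) / c0"
        by (simp add: u_def w_def sum_divide_distrib)
      moreover have "(\<Sum>k<q. sin (\<phi> k) * ((z1 (\<theta> k) - z0 (\<theta> k)) \<bullet> Nv (\<theta> k))) \<le> 0" using le ml q by simp
      ultimately have "(\<Sum>k<q. sin (\<phi> k) * u (\<theta> k)) \<le> 0" using c0 by (simp add: divide_nonpos_pos)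
      moreover have "real q * sin (pi / real q) > 0" using q by (intro mult_pos_pos sin_gt_zero) (auto simp: field_simps)
      ultimately have "(\<Sum>k<q. sin (\<phi> k) * u (\<theta> k)) / (real q * sin (pi / real q)) \<le> 0" by (simp add: divide_nonpos_pos)
      moreover have rr: "\<forall>t. \<rho>0 t = (c0 * d0) * \<sigma>0 t ^ 3" using N0(2) c0 by (simp add: r0_def divide_eq_eq mult.commute mult.assoc)
      have "\<exists>m P. (\<Sum>k<q. sin (\<phi> k) * u (\<theta> k)) / (real q * sin (pi / real q)) = a 0 * m + (\<Sum>n. a (Suc n * q)) + P \<and> \<bar>m - 1\<bar> \<le> 1/2 \<and> \<bar>P\<bar> \<le> 1/100 * N / (real q)\<^sup>2"
        unfolding a_def by (rule row[OF Z0.curve_axioms mult_pos_pos[OF c0 N0(1)] rr Cn CeE N0(3,4,7,8) q o uc usym N(1)[unfolded a_def]])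
      ultimately show ?thesis by blast
    qed
    \<comment> \<open>The roles are exchanged: the orbits are those of the second curve, and
      \<open>u\<close> enters with the opposite sign.\<close>
    have ex1: "\<exists>R. 0 \<le> R \<and> (\<exists>m P. R = b 0 * m + (\<Sum>n. b (Suc n * q)) + P \<and> \<bar>m - 1\<bar> \<le> 1/2 \<and> \<bar>P\<bar> \<le> 1/100 * (N + \<Delta>) / (real q)\<^sup>2)"
      if q: "q \<ge> 2" for q
    proof -
      obtain \<theta> \<phi> where o: "orbit z1 q \<theta> \<phi>" and le: "max_length z1 q + 2 * (\<Sum>k<q. sin (\<phi> k) * ((z0 (\<theta> k) - z1 (\<theta> k)) \<bullet> Nv (\<theta> k))) \<le> max_length z0 q"
        using max_length_compare[OF sc1 sc0 q] by blast
      have "(\<Sum>k<q. sin (\<phi> k) * ((z0 (\<theta> k) - z1 (\<theta> k)) \<bullet> Nv (\<theta> k))) = - (\<Sum>k<q. sin (\<phi> k) * ((z1 (\<theta> k) - z0 (\<theta> k)) \<bullet> Nv (\<theta> k)))"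
        unfolding sum_negf[symmetric] by (intro sum.cong) (auto simp: inner_diff_left algebra_simps)
      moreover have "(\<Sum>k<q. sin (\<phi> k) * u (\<theta> k)) = (\<Sum>k<q. sin (\<phi> k) * ((z1 (\<theta> k) - z0 (\<theta> k)) \<bullet> Nv (\<theta> k))) / c0"
        by (simp add: u_def w_def sum_divide_distrib)
      moreover have "(\<Sum>k<q. sin (\<phi> k) * ((z0 (\<theta> k) - z1 (\<theta> k)) \<bullet> Nv (\<theta> k))) \<le> 0" using le ml q by simp
      ultimately have "0 \<le> (\<Sum>k<q. sin (\<phi> k) * u (\<theta> k))" using c0 by simp
      moreover have "real q * sin (pi / real q) > 0" using q by (intro mult_pos_pos sin_gt_zero) (auto simp: field_simps)
      ultimately have "0 \<le> (\<Sum>k<q. sin (\<phi> k) * u (\<theta> k)) / (real q * sin (pi / real q))" by simp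
      moreover have rr: "\<forall>t. \<rho>1 t = (c0 * d1) * \<sigma>1 t ^ 3" using N1(2) c0 by (simp add: r1_def divide_eq_eq mult.commute mult.assoc)
      have "\<exists>m P. (\<Sum>k<q. sin (\<phi> k) * u (\<theta> k)) / (real q * sin (pi / real q)) = b 0 * m + (\<Sum>n. b (Suc n * q)) + P \<and> \<bar>m - 1\<bar> \<le> 1/2 \<and> \<bar>P\<bar> \<le> 1/100 * (N + \<Delta>) / (real q)\<^sup>2"
        unfolding b_def by (rule row[OF Z1.curve_axioms mult_pos_pos[OF c0 N1(1)] rr Cn CeE N1(3,4,7,8) q o uc usym bN[unfolded b_def]])
      ultimately show ?thesis by blast
    qed
    obtain R0 where R0: "\<And>q. q \<ge> 2 \<Longrightarrow> R0 q \<le> 0" "\<And>q. q \<ge> 2 \<Longrightarrow> \<exists>m P. R0 q = a 0 * m + (\<Sum>n. a (Suc n * q)) + P \<and> \<bar>m - 1\<bar> \<le> 1/2 \<and> \<bar>P\<bar> \<le> 1/100 * N / (real q)\<^sup>2"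
      using ex0 by metis
    obtain R1 where R1: "\<And>q. q \<ge> 2 \<Longrightarrow> 0 \<le> R1 q" "\<And>q. q \<ge> 2 \<Longrightarrow> \<exists>m P. R1 q = b 0 * m + (\<Sum>n. b (Suc n * q)) + P \<and> \<bar>m - 1\<bar> \<le> 1/2 \<and> \<bar>P\<bar> \<le> 1/100 * (N + \<Delta>) / (real q)\<^sup>2"
      using ex1 by metis
    have k100: "0 \<le> (1/100::real)" "(1/100::real) \<le> 1/100" by auto
    have a00: "a 0 = 0" and N\<Delta>: "N \<le> 20 * \<Delta>"
      using two_rows[OF b0a0 asum N \<Delta>(1) k100 R0 R1] by auto
    \<comment> \<open>With \<open>a 0 = 0\<close> the series gives
      \<open>|u| \<le> 2 * N * \<sigma>0 \<le> 4 * N\<close>, and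
      \<open>N \<le> 20 * \<Delta>\<close>; so the whole of \<open>u\<close> is controlled by
      \<open>\<Delta>\<close>.\<close>
    have uS: "\<bar>u t\<bar> \<le> 80 * \<Delta>" for t
    proof -
      obtain m :: int where m: "0 \<le> t + 2 * pi * of_int m" "t + 2 * pi * of_int m < 0 + 2 * pi" using reduce_2pi[of 0 t] by blast
      define s where "s = t + 2 * pi * of_int m"
      have s: "s \<in> {0..2*pi}" using m by (simp add: s_def)
      have us: "u t = u s" unfolding s_def using periodic_int[of u] uper by metis
      define a' where "a' = (\<lambda>j. a j * cos (real j * X0 s))"
      have a': "\<forall>j\<ge>1. \<bar>a' j\<bar> \<le> N / (real j)\<^sup>2"
      proof (intro allI impI)
        fix j :: nat assume j: "j \<ge> 1"
        have "\<bar>a' j\<bar> \<le> \<bar>a j\<bar> * 1" unfolding a'_def abs_mult by (intro mult_left_mono) auto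
        then show "\<bar>a' j\<bar> \<le> N / (real j)\<^sup>2" using N(1) j by fastforce
      qed
      have "a' sums (u s / \<sigma>0 s)" unfolding a'_def by (rule four[OF s])
      then have "(\<lambda>n. a' (Suc n)) sums (u s / \<sigma>0 s - a' 0)" using sums_Suc_iff[of a'] by simp
      then have "u s / \<sigma>0 s = (\<Sum>n. a' (Suc n * 1))" by (simp add: sums_iff a'_def a00)
      then have "\<bar>u s / \<sigma>0 s\<bar> \<le> 2 * N" using inverse_square_tails(2)[OF _ a', of 1] by simp
      then have "\<bar>u s\<bar> \<le> 2 * N * \<sigma>0 s" using P0.\<sigma>_pos[of s] by (simp add: abs_divide pos_divide_le_eq)
      moreover have "\<sigma>0 s \<le> 2" using bC_abs[OF N0(3), of s] Ce by linarith
      moreover have "N \<ge> 0" using N(1)[rule_format, of 1] by simp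
      ultimately have "\<bar>u s\<bar> \<le> 2 * N * 2" using mult_left_mono[of "\<sigma>0 s" 2 "2 * N"] by linarith
      then show ?thesis using N\<Delta> us by simp
    qed
    have "\<Delta> \<le> 0"
    proof (rule ccontr)
      assume "\<not> \<Delta> \<le> 0" then have \<Delta>0: "\<Delta> > 0" by simp
      have r0c: "continuous_on S r0" and r1c: "continuous_on S r1" for S
        unfolding r0_def r1_def using c0 Z0.\<rho>_cont Z1.\<rho>_cont by (auto intro!: continuous_on_divide intro: continuous_on_subset)
      have ri: "r0 integrable_on {0..2*pi}" "r1 integrable_on {0..2*pi}" by (intro integrable_continuous_interval r0c r1c)+
      \<comment> \<open>Integrating \<open>u'' + u = f\<close> over a period gives equal integrals
        of \<open>r0\<close> and \<open>r1\<close>, hence \<open>k\<close> close to 1. From here on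
        \<open>f\<close> and \<open>u\<close> are small with \<open>\<epsilon>\<close>.\<close>
      have "integral {0..2*pi} u = 0" using a00 by (simp add: a_def P0.coef_def P0.nrm_def)
      moreover have "((\<lambda>t. f t - u t) has_integral (u1 (2*pi) - u1 0)) {0..2*pi}"
        using u1d by (intro fundamental_theorem_of_calculus) (auto simp: has_real_derivative_iff_has_vector_derivative[symmetric] intro: DERIV_subset)
      then have "integral {0..2*pi} (\<lambda>t. f t - u t) = 0" using u0 by (simp add: integral_unique)
      moreover have "integral {0..2*pi} (\<lambda>t. f t - u t) = (integral {0..2*pi} r1 - integral {0..2*pi} r0) - integral {0..2*pi} u"
        unfolding f_def using ri by (simp add: Henstock_Kurzweil_Integration.integral_diff integrable_diff integrable_continuous_interval uc)
      ultimately have req: "integral {0..2*pi} r1 = integral {0..2*pi} r0" by simp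
      have r0b: "\<bar>r0 t - 1\<bar> \<le> \<epsilon>" and r1b: "\<bar>r1 t - k\<bar> \<le> k * \<epsilon>" for t
      proof -
        show "\<bar>r0 t - 1\<bar> \<le> \<epsilon>" using bC_abs[OF br0, of t] by simp
        have "r1 t - k = k * (r1 t / k - 1)" using k0 by (simp add: right_diff_distrib)
        then show "\<bar>r1 t - k\<bar> \<le> k * \<epsilon>" using bC_abs[OF br1, of t] k0 by (simp add: abs_mult)
      qed
      have near: "\<bar>integral {0..2*pi} r - c * (2 * pi)\<bar> \<le> B * (2 * pi)" if "r integrable_on {0..2*pi}" "\<And>t. \<bar>r t - c\<bar> \<le> B" for r and c B :: real
      proof -
        have "B \<ge> 0" using that(2)[of 0] by linarith
        then have "\<bar>integral {0..2*pi} (\<lambda>t. r t - c)\<bar> \<le> B * (2 * pi - 0)" using that by (intro abs_integral_le) auto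
        moreover have "integral {0..2*pi} (\<lambda>t. r t - c) = integral {0..2*pi} r - c * (2 * pi)"
          using Henstock_Kurzweil_Integration.integral_diff[OF that(1) integrable_const_ivl[of c]] by simp
        ultimately show ?thesis by simp
      qed
      have "\<bar>k - 1\<bar> * (2 * pi) \<le> (k * \<epsilon> + \<epsilon>) * (2 * pi)"
      proof -
        have "\<bar>(k - 1) * (2 * pi)\<bar> \<le> (k * \<epsilon> + \<epsilon>) * (2 * pi)"
          using near[OF ri(1) r0b] near[OF ri(2) r1b] req unfolding left_diff_distrib distrib_right by linarith
        then show ?thesis by (simp add: abs_mult)
      qed
      then have kb: "\<bar>k - 1\<bar> \<le> k * \<epsilon> + \<epsilon>" by simp
      have "k * \<epsilon> \<le> k * (1/100)" using e100 k0 by (intro mult_left_mono) auto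
      then have "k \<le> 2" using kb e100 by linarith
      then have k2: "k * \<epsilon> \<le> 2 * \<epsilon>" using \<epsilon>(1) by (intro mult_right_mono) auto
      then have k3: "\<bar>k - 1\<bar> \<le> 3 * \<epsilon>" using kb by linarith
      define e where "e = 84 * \<epsilon>"
      have e0: "e > 0" "e \<le> 1" using \<epsilon>(1) e100 by (simp_all add: e_def)
      have fb: "bC 7 (6 * \<epsilon>) f"
      proof -
        have "bC 7 ((\<bar>k\<bar> * \<epsilon> + \<bar>k - 1\<bar>) + \<epsilon>) (\<lambda>t. (k * (r1 t / k - 1) + (k - 1)) - (r0 t / 1 - 1))"
          by (intro bC_diff bC_add bC_cmult br0 br1 bC_const)
        moreover have "(k * (r1 t / k - 1) + (k - 1)) - (r0 t / 1 - 1) = f t" for t using k0 by (simp add: f_def right_diff_distrib)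
        ultimately have "bC 7 ((\<bar>k\<bar> * \<epsilon> + \<bar>k - 1\<bar>) + \<epsilon>) f" by (simp only:)
        then show ?thesis by (rule bC_mono) (use k2 k3 k0 in simp)
      qed
      have ue: "bC 7 e u" using ubC[OF fb] by (simp add: e_def)
      have \<Delta>e: "\<Delta> \<le> K3 * e"
      proof -
        have "\<forall>j\<ge>1. \<bar>b j - a j\<bar> \<le> (2 * Cd * e) / (real j)\<^sup>2"
          using Cd e0 by (intro allI impI order_trans[OF diffdec[OF ue] sq]) auto
        then have "\<Delta> \<le> 2 * Cd * e" by (rule \<Delta>(2))
        then show ?thesis using e0 by (simp add: K3_def algebra_simps)
      qed
      define S where "S = 80 * \<Delta>"
      have S0: "S > 0" using \<Delta>0 by (simp add: S_def)
      define y where "y = root 3 (S ^ 2 * e)"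
      have y3: "y ^ 3 = S ^ 2 * e" and y0: "y > 0" using S0 e0 by (simp_all add: y_def)
      have u6: "bC 6 e u" by (rule bC_le[OF ue]) simp
      have cube_le: "p \<le> q" if "p ^ 3 \<le> q ^ 3" "0 \<le> q" for p q :: real
        using that power_le_imp_le_base[of p 2 q] by (simp add: numeral_3_eq_3 numeral_2_eq_2)
      have u2: "\<bar>f t - u t\<bar> \<le> 6 * y" for t
      proof (rule cube_le)
        have "\<bar>f t - u t\<bar> ^ 3 \<le> 216 * S ^ 2 * e"
          using second_derivative_interpolation[OF u6 ud u1d _ S0 e0(1), of t] uS by (simp add: S_def)
        then show "\<bar>f t - u t\<bar> ^ 3 \<le> (6 * y) ^ 3" by (simp add: power_mult_distrib y3)
      qed (use y0 in simp)
      \<comment> \<open>\<open>S\<close> is also \<open>O(e)\<close>, so it is below a multiple of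
        \<open>y\<close>, the cube root of \<open>S^2 * e\<close>; thus \<open>f = u'' + u\<close>
        is controlled by \<open>y\<close> alone.\<close>
      have Sy: "S \<le> K1 * y"
      proof (rule cube_le)
        have "S \<le> 80 * (K3 * e)" using \<Delta>e by (simp add: S_def)
        also have "\<dots> \<le> K1 * e" using e0 by (simp add: K1_def K3_def algebra_simps)
        also have "\<dots> \<le> K1 ^ 3 * e" using K(1) e0 power_increasing[of 1 3 K1] by (intro mult_right_mono) auto
        finally have "S ^ 2 * S \<le> S ^ 2 * (K1 ^ 3 * e)" by (intro mult_left_mono) auto
        moreover have "(K1 * y) ^ 3 = S ^ 2 * (K1 ^ 3 * e)" by (simp add: power_mult_distrib y3)
        moreover have "S ^ 3 = S ^ 2 * S" by (simp add: power3_eq_cube power2_eq_square)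
        ultimately show "S ^ 3 \<le> (K1 * y) ^ 3" by simp
      qed (use y0 K in simp)
      define d where "d = (6 + K1) * y"
      have fd: "\<bar>r1 t - r0 t\<bar> \<le> d" for t
      proof -
        have "\<bar>f t\<bar> \<le> 6 * y + S" using u2[of t] uS[of t] unfolding S_def by linarith
        then show ?thesis using Sy by (simp add: f_def d_def distrib_right)
      qed
      have r0r: "1/2 \<le> r0 t" "r0 t \<le> 2" and r1r: "1/2 \<le> r1 t" "r1 t \<le> 2" for t
        using r0b[of t] r1b[of t] k3 k2 e100 by linarith+
      have Xd: "\<bar>X1 t - X0 t\<bar> \<le> 300 * d" if "t \<in> {0..2*pi}" for t
        by (rule phase_lipschitz[where ?r0.0 = r0 and ?r1.0 = r1])
          (use r0c r1c r0r r1r fd P0.X_0 P1.X_0 P0.X_deriv P1.X_deriv that in \<open>simp_all add: \<sigma>0_def \<sigma>1_def\<close>)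
      \<comment> \<open>Only the phases differ, and the cosine turns their distance into a factor
        \<open>j\<close>. The phase distance \<open>d\<close> and the factor \<open>u\<close> are
        both small, so the bound is superlinear in \<open>u\<close>.\<close>
      have bad: "\<bar>b j - a j\<bar> \<le> 600 * real j * S * d" if j: "j \<ge> 1" for j
      proof -
        have i: "(\<lambda>t. u t * cos (real j * X0 t)) integrable_on {0..2*pi}" "(\<lambda>t. u t * cos (real j * X1 t)) integrable_on {0..2*pi}"
          by (intro integrable_continuous_interval continuous_intros uc P0.X_cont P1.X_cont)+
        have "b j - a j = integral {0..2*pi} (\<lambda>t. u t * cos (real j * X1 t) - u t * cos (real j * X0 t)) / pi"
          using j Henstock_Kurzweil_Integration.integral_diff[OF i(2,1)] by (simp add: a_def b_def P0.coef_def P1.coef_def P0.nrm_def diff_divide_distrib)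
        moreover have "\<bar>integral {0..2*pi} (\<lambda>t. u t * cos (real j * X1 t) - u t * cos (real j * X0 t))\<bar> \<le> (S * (real j * (300 * d))) * (2 * pi - 0)"
        proof (rule abs_integral_le)
          have d0: "d \<ge> 0" using fd[of 0] by linarith
          show "0 \<le> S * (real j * (300 * d))" using S0 d0 by simp
          fix t :: real assume t: "t \<in> {0..2*pi}"
          have "\<bar>u t * cos (real j * X1 t) - u t * cos (real j * X0 t)\<bar> = \<bar>u t\<bar> * \<bar>cos (real j * X1 t) - cos (real j * X0 t)\<bar>"
            by (simp flip: abs_mult right_diff_distrib)
          also have "\<dots> \<le> S * (real j * (300 * d))"
          proof (rule mult_mono)
            show "\<bar>u t\<bar> \<le> S" using uS by (simp add: S_def)
            have "\<bar>cos (real j * X1 t) - cos (real j * X0 t)\<bar> \<le> \<bar>real j * X1 t - real j * X0 t\<bar>" by (rule abs_cos_diff_le)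
            also have "\<dots> = real j * \<bar>X1 t - X0 t\<bar>" by (simp add: abs_mult flip: right_diff_distrib)
            also have "\<dots> \<le> real j * (300 * d)" using Xd[OF t] by (intro mult_left_mono) auto
            finally show "\<bar>cos (real j * X1 t) - cos (real j * X0 t)\<bar> \<le> real j * (300 * d)" .
          qed (use S0 in auto)
          finally show "\<bar>u t * cos (real j * X1 t) - u t * cos (real j * X0 t)\<bar> \<le> S * (real j * (300 * d))" .
        qed simp
        ultimately show ?thesis by (simp add: abs_divide pos_divide_le_eq ac_simps)
      qed
      have small: "K2 ^ 15 * K3 ^ 10 * 80 ^ 25 * e ^ 15 \<le> (1/2) ^ 24"
      proof -
        have "e ^ 15 \<le> e ^ 1" using e0 by (intro power_decreasing) auto
        also have "\<dots> \<le> (1/2) ^ 24 / K4" using e4 by (simp only: e_def power_one_right)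
        finally have "K4 * e ^ 15 \<le> K4 * ((1/2) ^ 24 / K4)" using K4 by (intro mult_left_mono) auto
        then show ?thesis using K4 unfolding K4_def[symmetric] by simp
      qed
      \<comment> \<open>After multiplication by \<open>J^2\<close> the phase bound grows like
        \<open>J^3\<close> and the smoothness bound falls like \<open>1 / J^5\<close>;
        \<open>superlinear_gain\<close> combines them uniformly in \<open>J\<close>.\<close>
      have "\<forall>j\<ge>1. \<bar>b j - a j\<bar> \<le> (\<Delta> / 2) / (real j)\<^sup>2"
      proof (intro allI impI)
        fix j :: nat assume j: "j \<ge> 1"
        define J where "J = real j"
        have J: "J > 0" using j by (simp add: J_def)
        have "\<bar>b j - a j\<bar> * J\<^sup>2 \<le> \<Delta> / 2"
        proof (rule superlinear_gain[OF _ _ _ y3 S_def \<Delta>e J \<Delta>0 e0(1) K(2,3) small])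
          show "0 \<le> \<bar>b j - a j\<bar> * J\<^sup>2" by simp
          have "\<bar>b j - a j\<bar> * J\<^sup>2 \<le> (600 * J * S * d) * J\<^sup>2" using bad[OF j] by (intro mult_right_mono) (auto simp: J_def)
          also have "\<dots> = K2 * J ^ 3 * S * y" by (simp add: d_def K2_def power2_eq_square power3_eq_cube)
          finally show "\<bar>b j - a j\<bar> * J\<^sup>2 \<le> K2 * J ^ 3 * S * y" .
          have "\<bar>b j - a j\<bar> * J\<^sup>2 \<le> ((2 * Cd * e) / J ^ 7) * J\<^sup>2" using diffdec[OF ue j] by (intro mult_right_mono) (auto simp: J_def)
          also have "\<dots> = (2 * Cd * e) / J ^ 5" using J by (simp add: field_simps eval_nat_numeral)
          also have "\<dots> \<le> K3 * e / J ^ 5" using J e0 by (intro divide_right_mono) (auto simp: K3_def)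
          finally show "\<bar>b j - a j\<bar> * J\<^sup>2 \<le> K3 * e / J ^ 5" .
        qed
        then show "\<bar>b j - a j\<bar> \<le> (\<Delta> / 2) / (real j)\<^sup>2" using J by (simp add: J_def pos_le_divide_eq)
      qed
      from \<Delta>(2)[OF this] show False using \<Delta>0 by simp
    qed
    then have uz: "u t = 0" for t using uS[of t] by linarith
    then have "u = (\<lambda>_. 0)" by (rule ext)
    then have u1z: "u1 t = 0" for t using ud[of t] DERIV_unique[of u "u1 t" t 0] by simp
    show "z0 = z1"
    proof
      fix t
      have "(z1 t - z0 t) \<bullet> Nv t = 0" "(z1 t - z0 t) \<bullet> Tv t = 0" using uz[of t] u1z[of t] c0 by (simp_all add: u_def u1_def w_def w1_def)
      then have "z1 t - z0 t = 0" using frame_expand[of "z1 t - z0 t" t] by simp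
      then show "z0 t = z1 t" by simp
    qed
  qed
  then show ?thesis using E0 by blast
qed

section \<open>Isospectral families\<close>

text \<open>A compact convex set is the convex hull of its frontier, and an open convex set is the
  interior of its closure.\<close>

lemma frontier_determines_convex:
  fixes S T :: "(real^2) set"
  assumes "bounded S" "open S" "convex S" "bounded T" "open T" "convex T" "frontier S = frontier T"
  shows "S = T"
proof -
  have *: "U = interior (convex hull (frontier U))" if "bounded U" "open U" "convex U" for U :: "(real^2) set"
  proof -
    have i: "interior (closure U) = U" using that by (simp add: convex_interior_closure interior_open)
    have "frontier (closure U) = frontier U" unfolding frontier_def using i that by (simp add: interior_open)
    moreover have "closure U = convex hull (frontier (closure U))"
      using that by (intro Krein_Milman_frontier convex_closure) (auto simp: compact_closure)
    ultimately show ?thesis using i by simp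
  qed
  show ?thesis using *[OF assms(1-3)] *[OF assms(4-6)] assms(7) by simp
qed

section \<open>Closed geodesics in terms of the tangent angle\<close>

lemma (in curve) normal_max_le: "y \<in> range z \<Longrightarrow> y \<bullet> Nv t \<le> z t \<bullet> Nv t"
  using normal_max[of y t] by (cases "y = z t") auto

lemma (in curve) boundary_param_scaled:
  assumes "range z = frontier \<Omega>"
  shows "boundary_param 1 \<Omega> (\<lambda>s. z (2 * pi * s))"
    and "((\<lambda>s. z (2 * pi * s)) has_vector_derivative (2 * pi * \<rho> (2 * pi * s)) *\<^sub>R Tv (2 * pi * s)) (at s)"
proof -
  have d: "((\<lambda>s. z (2 * pi * s)) has_vector_derivative (2 * pi * \<rho> (2 * pi * s)) *\<^sub>R Tv (2 * pi * s)) (at s)" for s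
  proof -
    have "((\<lambda>s. 2 * pi * s) has_vector_derivative 2 * pi) (at s)"
      unfolding has_real_derivative_iff_has_vector_derivative[symmetric] by (auto intro!: derivative_eq_intros)
    from vector_diff_chain_at[OF this z_deriv] show ?thesis by (simp add: o_def)
  qed
  then show "((\<lambda>s. z (2 * pi * s)) has_vector_derivative (2 * pi * \<rho> (2 * pi * s)) *\<^sub>R Tv (2 * pi * s)) (at s)" .
  have per: "z (2 * pi * (s + 1)) = z (2 * pi * s)" for s using z_per[of "2 * pi * s"] by (simp add: distrib_left)
  have Tc: "continuous_on UNIV Tv" by (auto intro!: continuous_at_imp_continuous_on has_vector_derivative_continuous[OF Tv_has_vector_derivative])
  have c: "continuous_on UNIV (\<lambda>s. (2 * pi * \<rho> (2 * pi * s)) *\<^sub>R Tv (2 * pi * s))"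
    by (intro continuous_on_scaleR continuous_on_mult continuous_on_const continuous_on_compose2[OF \<rho>_cont] continuous_on_compose2[OF Tc] continuous_on_id) auto
  have "Ck 1 (\<lambda>s. z (2 * pi * s))" unfolding Ck_def
    by (rule exI[of _ "\<lambda>i. if i = 0 then (\<lambda>s. z (2 * pi * s)) else (\<lambda>s. (2 * pi * \<rho> (2 * pi * s)) *\<^sub>R Tv (2 * pi * s))"]) (use d c in auto)
  moreover have "vector_derivative (\<lambda>s. z (2 * pi * s)) (at s) \<noteq> 0" for s
    using vector_derivative_at[OF d[of s]] \<rho>_pos[of "2 * pi * s"] norm_Tv[of "2 * pi * s"] by fastforce
  moreover have "inj_on (\<lambda>s. z (2 * pi * s)) {0..<1}"
  proof (rule linorder_inj_onI)
    fix x y :: real assume xy: "x < y" "x \<in> {0..<1}" "y \<in> {0..<1}"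
    have "z (2 * pi * y) \<noteq> z (2 * pi * x)"
    proof (rule z_neq)
      show "2 * pi * x < 2 * pi * y" using xy by simp
      have "2 * pi * y < 2 * pi * (x + 1)" using xy by (intro mult_strict_left_mono) auto
      then show "2 * pi * y < 2 * pi * x + 2 * pi" by (simp add: distrib_left)
    qed
    then show "z (2 * pi * x) \<noteq> z (2 * pi * y)" by simp
  qed auto
  moreover have "(\<lambda>s. z (2 * pi * s)) ` {0..<1} = frontier \<Omega>"
  proof -
    have "range (\<lambda>s. z (2 * pi * s)) = range z"
    proof -
      have "z t \<in> range (\<lambda>s. z (2 * pi * s))" for t by (rule range_eqI[of _ _ "t / (2 * pi)"]) simp
      then show ?thesis by auto
    qed
    then show ?thesis using periodic_range[of "\<lambda>s. z (2 * pi * s)", OF per] assms by simp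
  qed
  ultimately show "boundary_param 1 \<Omega> (\<lambda>s. z (2 * pi * s))" unfolding boundary_param_def using per by blast
qed

text \<open>\<open>tangent_at\<close> admits any regular parametrisation of the boundary. Along each
  of them the component in the direction \<open>Nv t\<close> is maximal at \<open>z t\<close>, so
  the velocity has no normal component there.\<close>

lemma (in curve) tangent_at_parallel:
  assumes "range z = frontier \<Omega>" "tangent_at \<Omega> (z t) v"
  obtains c where "c \<noteq> 0" "v = c *\<^sub>R Tv t"
proof -
  obtain \<gamma> s where g: "boundary_param 1 \<Omega> \<gamma>" "\<gamma> s = z t" "(\<gamma> has_vector_derivative v) (at s)" using assms(2) unfolding tangent_at_def by blast
  have rg: "range \<gamma> = range z" using g(1) periodic_range[of \<gamma>] assms(1) by (simp add: boundary_param_def)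
  have "vector_derivative \<gamma> (at s) \<noteq> 0" using g(1) by (simp add: boundary_param_def)
  then have v0: "v \<noteq> 0" using vector_derivative_at[OF g(3)] by simp
  have "((\<lambda>x. \<gamma> x \<bullet> Nv t) has_real_derivative v \<bullet> Nv t) (at s)" by (rule vector_derivative_inner_const[OF g(3)])
  then have vN: "v \<bullet> Nv t = 0"
    by (rule DERIV_local_max[where d = 1]) (use rg g(2) normal_max_le in auto)
  then have "v = (v \<bullet> Tv t) *\<^sub>R Tv t" using frame_expand[of v t] by simp
  moreover from this have "v \<bullet> Tv t \<noteq> 0" using v0 by force
  ultimately show thesis using that by blast
qed

text \<open>All tangent vectors at a boundary point are parallel, so the law for the vector that the
  definition supplies gives the law for \<open>Tv t\<close>; the integer indexing is cut down to the
  natural numbers.\<close>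

lemma (in curve) negligible_geodesic_lengths:
  assumes "range z = frontier \<Omega>"
  shows "negligible {l. \<exists>q p. closed_geodesic \<Omega> q p \<and> l = geod_length q p}"
proof (rule negligible_subset[OF negligible_closed_lengths], safe)
  fix q and p :: "int \<Rightarrow> real^2" assume g: "closed_geodesic \<Omega> q p"
  define p' where "p' = (\<lambda>k. p (int k))"
  have "q \<ge> 1" using g by (simp add: closed_geodesic_def)
  moreover have "\<forall>k. p' k \<in> range z" using g assms by (simp add: closed_geodesic_def p'_def)
  moreover have "\<forall>k. p' (k + q) = p' k" using g by (simp add: closed_geodesic_def p'_def)
  moreover have "\<forall>k. p' (Suc k) \<noteq> p' k"
  proof
    fix k
    have "p (int k + 1) \<noteq> p (int k)" using g by (simp add: closed_geodesic_def)
    then show "p' (Suc k) \<noteq> p' k" by (simp add: p'_def add.commute)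
  qed
  moreover have "\<forall>k t. z t = p' (Suc k) \<longrightarrow> Tv t \<bullet> sgn (p' (Suc k) - p' k) = Tv t \<bullet> sgn (p' (Suc (Suc k)) - p' (Suc k))"
  proof (intro allI impI)
    fix k t assume t: "z t = p' (Suc k)"
    define i where "i = int k + 1"
    have pi: "p' (Suc k) = p i" "p' k = p (i - 1)" "p' (Suc (Suc k)) = p (i + 1)" by (simp_all add: p'_def i_def add.commute)
    obtain v where v: "tangent_at \<Omega> (p i) v" "((1 / norm (p i - p (i - 1))) *\<^sub>R (p i - p (i - 1))) \<bullet> v = ((1 / norm (p (i + 1) - p i)) *\<^sub>R (p (i + 1) - p i)) \<bullet> v"
      using g unfolding closed_geodesic_def by blast
    obtain c where c: "c \<noteq> 0" "v = c *\<^sub>R Tv t" using tangent_at_parallel[OF assms, of t v] v(1) t pi by metis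
    have "sgn (p i - p (i - 1)) \<bullet> v = sgn (p (i + 1) - p i) \<bullet> v" using v(2) by (simp add: sgn_div_norm divide_inverse)
    then show "Tv t \<bullet> sgn (p' (Suc k) - p' k) = Tv t \<bullet> sgn (p' (Suc (Suc k)) - p' (Suc k))"
      unfolding pi c(2) using c(1) by (simp add: inner_commute)
  qed
  moreover have "geod_length q p = (\<Sum>k<q. norm (p' (Suc k) - p' k))"
    unfolding geod_length_def
    by (rule sum.reindex_bij_witness[of _ int nat]) (auto simp: p'_def dist_norm norm_minus_commute add.commute)
  ultimately show "\<exists>qa pa. 1 \<le> qa \<and> (\<forall>k. pa k \<in> range z) \<and> (\<forall>k. pa (k + qa) = pa k) \<and> (\<forall>k. pa (Suc k) \<noteq> pa k) \<and>
      (\<forall>k t. z t = pa (Suc k) \<longrightarrow> Tv t \<bullet> sgn (pa (Suc k) - pa k) = Tv t \<bullet> sgn (pa (Suc (Suc k)) - pa (Suc k))) \<and>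
      geod_length q p = (\<Sum>k<qa. norm (pa (Suc k) - pa k))" by blast
qed

lemma (in curve) negligible_length_spectrum:
  assumes "range z = frontier \<Omega>"
  shows "negligible (length_spectrum \<Omega>)"
proof -
  let ?G = "{l. \<exists>q p. closed_geodesic \<Omega> q p \<and> l = geod_length q p}"
  have "negligible ((\<lambda>l. real n * l) ` ?G)" for n
    by (rule negligible_differentiable_image_negligible[OF _ negligible_geodesic_lengths[OF assms]]) (auto intro!: derivative_intros simp: differentiable_on_def)
  then have "negligible (\<Union>n. (\<lambda>l. real n * l) ` ?G)" by (rule negligible_Union_nat)
  moreover have "negligible (\<Union>n. {real n * perimeter \<Omega>})" by (rule negligible_Union_nat) simp
  ultimately have "negligible ((\<Union>n. (\<lambda>l. real n * l) ` ?G) \<union> (\<Union>n. {real n * perimeter \<Omega>}))" by (rule negligible_Un)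
  then show ?thesis by (rule negligible_subset) (auto simp: length_spectrum_def)
qed

text \<open>The maximal polygon, given on indices up to \<open>q\<close>, is extended to all
  integers by residues modulo \<open>q\<close>; its reflection law at the seam is
  \<open>\<phi> q = \<phi> 0\<close>.\<close>

lemma (in sym_curve) max_length_in_spectrum:
  assumes rg: "range z = frontier \<Omega>" and q: "q \<ge> 2"
  shows "max_length z q \<in> length_spectrum \<Omega>"
proof -
  obtain \<theta> where \<theta>: "\<theta> \<in> sym_polys q" "poly_length z q \<theta> = max_length z q" "\<And>\<theta>'. \<theta>' \<in> sym_polys q \<Longrightarrow> poly_length z q \<theta>' \<le> poly_length z q \<theta>"
    using max_length_attained[OF q] by blast
  obtain \<phi> where orb: "orbit z q \<theta> \<phi>" using max_poly_orbit[OF q \<theta>(1,3)] by blast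
  have th: "\<theta> 0 = 0" "\<theta> q = 2 * pi" "\<phi> q = \<phi> 0"
    and st: "\<And>k. k < q \<Longrightarrow> \<theta> (Suc k) = \<theta> k + \<phi> k + \<phi> (Suc k)" "\<And>k. k < q \<Longrightarrow> z (\<theta> (Suc k)) \<noteq> z (\<theta> k)"
    "\<And>k. k < q \<Longrightarrow> sgn (z (\<theta> (Suc k)) - z (\<theta> k)) = Tv (\<theta> k + \<phi> k)"
    using orb unfolding orbit_def by auto
  have z2: "z (2 * pi) = z 0" using z_per[of 0] by simp
  define e where "e = (\<lambda>i::int. nat (i mod int q))"
  define p where "p = (\<lambda>i. z (\<theta> (e i)))"
  have eq: "e i < q" for i using q by (simp add: e_def nat_less_iff)
  have esuc: "e (i + 1) = (if Suc (e i) = q then 0 else Suc (e i))" for i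
  proof -
    have "int (e i) = i mod int q" using q by (simp add: e_def)
    moreover have "(i + 1) mod int q = (i mod int q + 1) mod int q" by (simp add: mod_add_left_eq)
    ultimately have "(i + 1) mod int q = int (Suc (e i)) mod int q" by (simp add: add.commute)
    then have "e (i + 1) = Suc (e i) mod q" unfolding e_def by (metis nat_int of_nat_mod)
    then show ?thesis using eq[of i] by (auto simp: mod_less)
  qed
  have ps: "p (i + 1) = z (\<theta> (Suc (e i)))" for i using esuc[of i] th z2 by (auto simp: p_def split: if_splits)
  have "closed_geodesic \<Omega> q p" unfolding closed_geodesic_def
  proof (intro conjI allI)
    show "2 \<le> q" by fact
    show "p (i + int q) = p i" for i by (simp add: p_def e_def)
    show "p i \<in> frontier \<Omega>" for i using rg by (auto simp: p_def)
    show "p (i + 1) \<noteq> p i" for i unfolding ps unfolding p_def using st(2)[OF eq] .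
    fix i
    define t where "t = \<theta> (e i)"
    define v where "v = (2 * pi * \<rho> t) *\<^sub>R Tv t"
    \<comment> \<open>Tangency is witnessed by the angle parametrisation rescaled to period
      1.\<close>
    have tv: "tangent_at \<Omega> (p i) v"
      unfolding tangent_at_def v_def p_def t_def[symmetric] using boundary_param_scaled[OF rg]
      by (intro exI[of _ "\<lambda>s. z (2 * pi * s)"] exI[of _ "t / (2 * pi)"]) (auto dest: meta_spec[of _ "t / (2 * pi)"])
    have sg: "(1 / norm x) *\<^sub>R x = sgn x" for x :: "real^2" by (simp add: sgn_div_norm divide_inverse)
    have out: "sgn (p (i + 1) - p i) \<bullet> Tv t = cos (\<phi> (e i))"
      unfolding ps unfolding p_def using st(3)[OF eq[of i]] by (simp add: t_def inner_Tv_Tv)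
    define j where "j = e (i - 1)"
    have pj: "p i = z (\<theta> (Suc j))" "p (i - 1) = z (\<theta> j)" using ps[of "i - 1"] by (simp_all add: j_def p_def)
    have ej: "e i = (if Suc j = q then 0 else Suc j)" using esuc[of "i - 1"] by (simp add: j_def)
    have jq: "j < q" unfolding j_def by (rule eq)
    have "sgn (p i - p (i - 1)) = Tv (\<theta> (Suc j) - \<phi> (Suc j))" unfolding pj using st(3)[OF jq] st(1)[OF jq] by simp
    moreover have "Tv t = Tv (\<theta> (Suc j))" "\<phi> (e i) = \<phi> (Suc j)" using ej th by (auto simp: t_def split: if_splits)
    ultimately have inn: "sgn (p i - p (i - 1)) \<bullet> Tv t = cos (\<phi> (e i))" by (simp add: inner_Tv_Tv)
    show "\<exists>v. tangent_at \<Omega> (p i) v \<and> ((1 / norm (p i - p (i - 1))) *\<^sub>R (p i - p (i - 1))) \<bullet> v = ((1 / norm (p (i + 1) - p i)) *\<^sub>R (p (i + 1) - p i)) \<bullet> v"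
      unfolding sg using tv inn out by (intro exI[of _ v]) (simp add: v_def)
  qed
  moreover have "geod_length q p = max_length z q"
  proof -
    have "geod_length q p = (\<Sum>k<q. norm (z (\<theta> (Suc k)) - z (\<theta> k)))"
      unfolding geod_length_def
    proof (rule sum.reindex_bij_witness[of _ int nat])
      fix i assume i: "i \<in> {0..<int q}"
      then have "e i = nat i" by (simp add: e_def)
      then show "norm (z (\<theta> (Suc (nat i))) - z (\<theta> (nat i))) = dist (p i) (p (i + 1))"
        unfolding ps by (simp add: p_def dist_norm norm_minus_commute)
    qed auto
    then show ?thesis using \<theta>(2) by (simp add: poly_length_def)
  qed
  ultimately have "max_length z q = real 1 * geod_length q p \<and> 1 \<ge> (1::nat) \<and> closed_geodesic \<Omega> q p" by simp
  then show ?thesis unfolding length_spectrum_def by blast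
qed

section \<open>Dependence on the family parameter\<close>

lemma max_length_lipschitz:
  assumes "sym_curve z0 \<rho>0" "sym_curve z1 \<rho>1" "q \<ge> 2" "\<And>t. \<bar>(z1 t - z0 t) \<bullet> Nv t\<bar> \<le> D"
  shows "\<bar>max_length z1 q - max_length z0 q\<bar> \<le> 2 * real q * D"
proof -
  have *: "max_length z q - 2 * real q * D \<le> max_length z' q"
    if h: "sym_curve z \<rho>" "sym_curve z' \<rho>'" "\<And>t. \<bar>(z' t - z t) \<bullet> Nv t\<bar> \<le> D" for z \<rho> z' \<rho>'
  proof -
    obtain \<theta> \<phi> where le: "max_length z q + 2 * (\<Sum>k<q. sin (\<phi> k) * ((z' (\<theta> k) - z (\<theta> k)) \<bullet> Nv (\<theta> k))) \<le> max_length z' q"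
      using max_length_compare[OF h(1,2) assms(3)] by blast
    have D0: "D \<ge> 0" using h(3)[of 0] by linarith
    have "\<bar>\<Sum>k<q. sin (\<phi> k) * ((z' (\<theta> k) - z (\<theta> k)) \<bullet> Nv (\<theta> k))\<bar> \<le> (\<Sum>k<q. \<bar>sin (\<phi> k) * ((z' (\<theta> k) - z (\<theta> k)) \<bullet> Nv (\<theta> k))\<bar>)" by (rule sum_abs)
    also have "\<dots> \<le> (\<Sum>k<q. 1 * D)" unfolding abs_mult using h(3) D0 by (intro sum_mono mult_mono) auto
    finally have "- (real q * D) \<le> (\<Sum>k<q. sin (\<phi> k) * ((z' (\<theta> k) - z (\<theta> k)) \<bullet> Nv (\<theta> k)))" by (simp add: abs_le_iff)
    then show ?thesis using le by (simp add: mult.assoc)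
  qed
  have "\<bar>(z0 t - z1 t) \<bullet> Nv t\<bar> \<le> D" for t using assms(4)[of t] by (simp add: inner_diff_left abs_minus_commute)
  then show ?thesis using *[OF assms(1,2,4)] *[OF assms(2,1)] by (simp add: abs_le_iff)
qed

text \<open>By the intermediate value theorem a nonconstant continuous function would fill an
  interval, which is not negligible.\<close>

lemma constant_of_negligible_range:
  fixes f :: "real \<Rightarrow> real"
  assumes "continuous_on {a..b} f" "f ` {a..b} \<subseteq> S" "negligible S" "x \<in> {a..b}" "y \<in> {a..b}"
  shows "f x = f y"
proof -
  have *: "\<not> f s < f t" if "s \<in> {a..b}" "t \<in> {a..b}" for s t
  proof
    assume lt: "f s < f t"
    have "connected (f ` {a..b})" using assms(1) by (intro connected_continuous_image) auto
    then have "{f s..f t} \<subseteq> f ` {a..b}" using that by (intro connected_contains_Icc) auto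
    then have "negligible {f s..f t}" using assms(2,3) by (meson negligible_subset order_trans)
    then have "box (f s) (f t) = {}" using negligible_interval(1)[of "f s" "f t"] by simp
    then show False using lt by (simp add: box_eq_empty)
  qed
  then show ?thesis using assms(4,5) by (meson linorder_neqE)
qed

text \<open>The velocity of the family is bounded because the parameter interval times one period of
  \<open>s\<close> is compact.\<close>

lemma family_lipschitz:
  assumes fam: "C1_family r \<Omega> \<gamma>"
  obtains L where "\<And>\<tau> \<tau>' s. \<tau> \<in> {-1..1} \<Longrightarrow> \<tau>' \<in> {-1..1} \<Longrightarrow> s \<in> {0..1} \<Longrightarrow> norm (\<gamma> \<tau>' s - \<gamma> \<tau> s) \<le> L * \<bar>\<tau>' - \<tau>\<bar>"
proof -
  obtain \<gamma>' where d: "\<And>\<tau> s. \<tau> \<in> {-1..1} \<Longrightarrow> ((\<lambda>t. \<gamma> t s) has_vector_derivative \<gamma>' \<tau> s) (at \<tau> within {-1..1})"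
    and c: "continuous_on ({-1..1} \<times> UNIV) (\<lambda>(\<tau>, s). \<gamma>' \<tau> s)" using fam unfolding C1_family_def by blast
  have "compact ((\<lambda>(\<tau>, s). \<gamma>' \<tau> s) ` ({-1..1} \<times> {0..1}))"
    by (intro compact_continuous_image continuous_on_subset[OF c] compact_Times) auto
  then obtain L where L: "\<And>y. y \<in> (\<lambda>(\<tau>, s). \<gamma>' \<tau> s) ` ({-1..1} \<times> {0..1}) \<Longrightarrow> norm y \<le> L"
    using compact_imp_bounded bounded_iff by metis
  show thesis
  proof (rule that)
    fix \<tau> \<tau>' s :: real assume t: "\<tau> \<in> {-1..1}" "\<tau>' \<in> {-1..1}" and s: "s \<in> {0..1}"
    have "norm (\<gamma> \<tau>' s - \<gamma> \<tau> s) \<le> L * norm (\<tau>' - \<tau>)"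
    proof (rule differentiable_bound[where S = "{-1..1}" and f = "\<lambda>t. \<gamma> t s" and f' = "\<lambda>x h. h *\<^sub>R \<gamma>' x s"])
      show "((\<lambda>t. \<gamma> t s) has_derivative (\<lambda>h. h *\<^sub>R \<gamma>' x s)) (at x within {-1..1})" if "x \<in> {-1..1}" for x
        using d[OF that] by (simp add: has_vector_derivative_def)
      show "onorm (\<lambda>h. h *\<^sub>R \<gamma>' x s) \<le> L" if "x \<in> {-1..1}" for x
      proof (rule onorm_le)
        have "\<gamma>' x s \<in> (\<lambda>(\<tau>, s). \<gamma>' \<tau> s) ` ({-1..1} \<times> {0..1})" by (rule image_eqI[of _ _ "(x, s)"]) (use that s in auto)
        from mult_right_mono[OF L[OF this], of "\<bar>h\<bar>" for h]
        show "norm (h *\<^sub>R \<gamma>' x s) \<le> L * norm h" for h by (simp add: mult.commute)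
      qed
    qed (use t in auto)
    then show "norm (\<gamma> \<tau>' s - \<gamma> \<tau> s) \<le> L * \<bar>\<tau>' - \<tau>\<bar>" by simp
  qed
qed

text \<open>The family moves points at a fixed parameter, while the comparison needs points with a
  fixed normal. The support function is a maximum over the boundary, and a maximum moves no more
  than the points do.\<close>

lemma support_lipschitz:
  fixes g g' :: "real \<Rightarrow> real^2"
  assumes "curve z \<rho>" "curve z' \<rho>'" "range z = frontier \<Omega>" "range z' = frontier \<Omega>'"
    and "g ` {0..<1} = frontier \<Omega>" "g' ` {0..<1} = frontier \<Omega>'" "\<And>s. s \<in> {0..1} \<Longrightarrow> norm (g' s - g s) \<le> D"
  shows "\<bar>(z' t - z t) \<bullet> Nv t\<bar> \<le> D"
proof -
  have *: "w' t \<bullet> Nv t - w t \<bullet> Nv t \<le> D"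
    if h: "curve w \<eta>" "range w = g ` {0..<1}" "range w' = g' ` {0..<1}" "\<And>s. s \<in> {0..1} \<Longrightarrow> norm (g' s - g s) \<le> D" for w w' g g' :: "real \<Rightarrow> real^2" and \<eta>
  proof -
    interpret curve w \<eta> by fact
    obtain s where s: "s \<in> {0..<1}" "w' t = g' s" using h(3) by blast
    have "g s \<bullet> Nv t \<le> w t \<bullet> Nv t" using s h(2) by (intro normal_max_le) auto
    moreover have "(g' s - g s) \<bullet> Nv t \<le> D"
    proof -
      have "norm (g' s - g s) \<le> D" using s by (intro h(4)) auto
      then show ?thesis using Cauchy_Schwarz_ineq2[of "g' s - g s" "Nv t"] by simp
    qed
    ultimately show ?thesis unfolding s(2) by (simp add: inner_diff_left)
  qed
  have 1: "z' t \<bullet> Nv t - z t \<bullet> Nv t \<le> D" using assms by (intro *[where w = z and w' = z' and g = g and g' = g']) auto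
  have 2: "z t \<bullet> Nv t - z' t \<bullet> Nv t \<le> D" using assms by (intro *[where w = z' and w' = z and g = g' and g' = g]) (auto simp: norm_minus_commute)
  show ?thesis using 1 2 by (simp add: inner_diff_left abs_le_iff)
qed

theorem theorem3p1:
  shows "\<exists>\<delta>>0. \<forall>(\<Omega> :: real \<Rightarrow> (real^2) set) (\<gamma> :: real \<Rightarrow> real \<Rightarrow> real^2).
     C1_family 8 \<Omega> \<gamma> \<and> (\<forall>\<tau>\<in>{-1..1}. domain_S_delta 8 \<delta> (\<Omega> \<tau>)) \<and>
     normalized_family \<Omega> \<gamma> \<and> dyn_isospectral \<Omega>
     \<longrightarrow> (\<forall>\<tau>\<in>{-1..1}. \<Omega> \<tau> = \<Omega> 0)"
proof -
  obtain C \<delta>0 where C: "C > 0" "\<delta>0 > 0" and near: "\<And>\<delta> \<Omega> m a. \<delta> \<le> \<delta>0 \<Longrightarrow> domain_S_delta 8 \<delta> \<Omega> \<Longrightarrow> normalized \<Omega> m a \<Longrightarrow>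
     (\<exists>z \<rho> c. sym_curve z \<rho> \<and> range z = frontier \<Omega> \<and> c > 0 \<and> bC 7 (C * \<delta>) (\<lambda>t. \<rho> t / c - 1))"
    using near_circle_curve by blast
  obtain E where E: "E > 0" and rigid: "\<And>\<epsilon> z0 \<rho>0 c0 z1 \<rho>1 c1. 0 < \<epsilon> \<Longrightarrow> \<epsilon> \<le> E \<Longrightarrow> sym_curve z0 \<rho>0 \<Longrightarrow> sym_curve z1 \<rho>1 \<Longrightarrow> c0 > 0 \<Longrightarrow> c1 > 0 \<Longrightarrow>
     bC 7 \<epsilon> (\<lambda>t. \<rho>0 t / c0 - 1) \<Longrightarrow> bC 7 \<epsilon> (\<lambda>t. \<rho>1 t / c1 - 1) \<Longrightarrow> (\<forall>q\<ge>2. max_length z0 q = max_length z1 q) \<Longrightarrow> z0 = z1"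
    using curves_equal_of_max_lengths by blast
  \<comment> \<open>Small enough that the bound \<open>C * \<delta>\<close> for the radius of
    curvature is admissible in \<open>rigid\<close>.\<close>
  define \<delta> where "\<delta> = min \<delta>0 (E / C)"
  have \<delta>: "\<delta> > 0" "\<delta> \<le> \<delta>0" using C E by (simp_all add: \<delta>_def)
  have C\<delta>: "0 < C * \<delta>" "C * \<delta> \<le> E"
  proof -
    show "0 < C * \<delta>" using C \<delta> by simp
    have "C * \<delta> \<le> C * (E / C)" using C by (intro mult_left_mono) (auto simp: \<delta>_def)
    then show "C * \<delta> \<le> E" using C by simp
  qed
  have main: "\<Omega> \<tau> = \<Omega> 0"
    if fam: "C1_family 8 \<Omega> \<gamma>" and dom: "\<And>\<tau>. \<tau> \<in> {-1..1} \<Longrightarrow> domain_S_delta 8 \<delta> (\<Omega> \<tau>)" and nf: "normalized_family \<Omega> \<gamma>" and iso: "dyn_isospectral \<Omega>"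
      and \<tau>: "\<tau> \<in> {-1..1}" for \<Omega> \<gamma> \<tau>
  proof -
    \<comment> \<open>One angle parametrisation per domain, chosen separately for each
      \<open>\<tau>\<close>; continuity of the maximal lengths in \<open>\<tau>\<close> is recovered
      from the support functions.\<close>
    have "\<forall>\<tau>\<in>{-1..1}. \<exists>Q. sym_curve (fst Q) (fst (snd Q)) \<and> range (fst Q) = frontier (\<Omega> \<tau>) \<and> snd (snd Q) > 0 \<and> bC 7 (C * \<delta>) (\<lambda>t. fst (snd Q) t / snd (snd Q) - 1)"
    proof
      fix \<tau> :: real assume t: "\<tau> \<in> {-1..1}"
      obtain a where a: "normalized (\<Omega> \<tau>) (\<gamma> \<tau> 0) a" using nf t unfolding normalized_family_def by blast
      obtain z \<rho> c where "sym_curve z \<rho>" "range z = frontier (\<Omega> \<tau>)" "c > 0" "bC 7 (C * \<delta>) (\<lambda>t. \<rho> t / c - 1)"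
        using near[OF \<delta>(2) dom[OF t] a] by blast
      then show "\<exists>Q. sym_curve (fst Q) (fst (snd Q)) \<and> range (fst Q) = frontier (\<Omega> \<tau>) \<and> snd (snd Q) > 0 \<and> bC 7 (C * \<delta>) (\<lambda>t. fst (snd Q) t / snd (snd Q) - 1)"
        by (intro exI[of _ "(z, \<rho>, c)"]) simp
    qed
    from bchoice[OF this] obtain Q where Q: "\<forall>\<tau>\<in>{-1..1}. sym_curve (fst (Q \<tau>)) (fst (snd (Q \<tau>))) \<and> range (fst (Q \<tau>)) = frontier (\<Omega> \<tau>) \<and> snd (snd (Q \<tau>)) > 0 \<and> bC 7 (C * \<delta>) (\<lambda>t. fst (snd (Q \<tau>)) t / snd (snd (Q \<tau>)) - 1)" ..
    define z \<rho> c where "z = (\<lambda>\<tau>. fst (Q \<tau>))" and "\<rho> = (\<lambda>\<tau>. fst (snd (Q \<tau>)))" and "c = (\<lambda>\<tau>. snd (snd (Q \<tau>)))"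
    have sc: "sym_curve (z \<tau>) (\<rho> \<tau>)" and rg: "range (z \<tau>) = frontier (\<Omega> \<tau>)" and c: "c \<tau> > 0" and b: "bC 7 (C * \<delta>) (\<lambda>t. \<rho> \<tau> t / c \<tau> - 1)"
      if "\<tau> \<in> {-1..1}" for \<tau> using Q that unfolding z_def \<rho>_def c_def by blast+
    have cu: "curve (z \<tau>) (\<rho> \<tau>)" if "\<tau> \<in> {-1..1}" for \<tau> using sc[OF that] by (simp add: sym_curve_def)
    have im: "\<gamma> \<tau> ` {0..<1} = frontier (\<Omega> \<tau>)" if "\<tau> \<in> {-1..1}" for \<tau>
      using fam that unfolding C1_family_def boundary_param_def by blast
    obtain L where L: "\<And>\<tau> \<tau>' s. \<tau> \<in> {-1..1} \<Longrightarrow> \<tau>' \<in> {-1..1} \<Longrightarrow> s \<in> {0..1} \<Longrightarrow> norm (\<gamma> \<tau>' s - \<gamma> \<tau> s) \<le> L * \<bar>\<tau>' - \<tau>\<bar>"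
      using family_lipschitz[OF fam] by blast
    have zero: "(0::real) \<in> {-1..1}" by simp
    have "max_length (z 0) q = max_length (z \<tau>) q" if q: "q \<ge> 2" for q
    proof (rule constant_of_negligible_range[where f = "\<lambda>\<tau>. max_length (z \<tau>) q", OF _ _ _ zero \<tau>])
      show "negligible (length_spectrum (\<Omega> 0))" by (rule curve.negligible_length_spectrum[OF cu rg]) simp_all
      show "(\<lambda>\<tau>. max_length (z \<tau>) q) ` {-1..1} \<subseteq> length_spectrum (\<Omega> 0)"
      proof (rule image_subsetI)
        fix s :: real assume s: "s \<in> {-1..1}"
        have "max_length (z s) q \<in> length_spectrum (\<Omega> s)" by (rule sym_curve.max_length_in_spectrum[OF sc[OF s] rg[OF s] q])
        then show "max_length (z s) q \<in> length_spectrum (\<Omega> 0)" using iso s unfolding dyn_isospectral_def by blast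
      qed
      have "lipschitz_on (\<bar>2 * real q * L\<bar>) {-1..1} (\<lambda>\<tau>. max_length (z \<tau>) q)"
      proof (rule lipschitz_onI)
        fix s' s :: real assume s': "s' \<in> {-1..1}" and s: "s \<in> {-1..1}"
        have "\<bar>max_length (z s') q - max_length (z s) q\<bar> \<le> 2 * real q * (L * \<bar>s' - s\<bar>)"
          by (rule max_length_lipschitz[OF sc[OF s] sc[OF s'] q support_lipschitz[OF cu[OF s] cu[OF s'] rg[OF s] rg[OF s'] im[OF s] im[OF s'] L[OF s s']]])
        also have "\<dots> = 2 * real q * L * \<bar>s' - s\<bar>" by (simp only: mult.assoc)
        also have "\<dots> \<le> \<bar>2 * real q * L\<bar> * \<bar>s' - s\<bar>" by (intro mult_right_mono) auto
        finally show "dist (max_length (z s') q) (max_length (z s) q) \<le> \<bar>2 * real q * L\<bar> * dist s' s" by (simp only: dist_real_def)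
      qed simp
      then show "continuous_on {-1..1} (\<lambda>\<tau>. max_length (z \<tau>) q)" by (rule lipschitz_on_continuous_on)
    qed
    then have "z 0 = z \<tau>"
      by (intro rigid[OF C\<delta> sc[OF zero] sc[OF \<tau>] c[OF zero] c[OF \<tau>] b[OF zero] b[OF \<tau>]]) simp
    then have fr: "frontier (\<Omega> \<tau>) = frontier (\<Omega> 0)" using rg[OF zero] rg[OF \<tau>] by simp
    have d: "bounded (\<Omega> s) \<and> open (\<Omega> s) \<and> convex (\<Omega> s)" if "s \<in> {-1..1}" for s
      using dom[OF that] by (simp add: domain_S_delta_def domain_S_def domain_D_def strictly_convex_def)
    show ?thesis using frontier_determines_convex[OF _ _ _ _ _ _ fr] d[OF \<tau>] d[OF zero] by simp
  qed
  show ?thesis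
  proof (intro exI[of _ \<delta>] conjI allI impI ballI)
    fix \<Omega> \<gamma> and \<tau> :: real
    assume "C1_family 8 \<Omega> \<gamma> \<and> (\<forall>\<tau>\<in>{-1..1}. domain_S_delta 8 \<delta> (\<Omega> \<tau>)) \<and> normalized_family \<Omega> \<gamma> \<and> dyn_isospectral \<Omega>" "\<tau> \<in> {-1..1}"
    then show "\<Omega> \<tau> = \<Omega> 0" by (intro main[of \<Omega> \<gamma> \<tau>]) blast+
  qed (rule \<delta>(1))
qed

end
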